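(* Let $M$ be a smooth manifold (possibly with boundary). If $g_1$ and $g_2$ are two rough Riemannian metrics on $M$ that are mutually bounded, then the pairs $(\mu_{g_1},g_1)$ and $(\mu_{g_2},g_2)$ are also mutually bounded and yield equivalent $L^2$-spaces of differential forms which are equal as sets: $L^2(M;\Lambda M):=L^2(M;\Lambda M,\mu_{g_1},g_1)=L^2(M;\Lambda M,\mu_{g_2},g_2)$. Let $d_e$ be a closed and nilpotent extension of $d_{cc}$ in this space (which remains fixed with respect to $(\mu_{g_i},g_i)$, $i=1,2$). Define the Hodge-Dirac operator with respect to $g_i$ by $\mathbb D_{e,i}:=d_e+d_e^{*,g_i}$, with domain $\mathrm{dom}(d_e)\cap\mathrm{dom}(d_e^{*,g_i})$. Then: (i) $\mathbb D_{e,i}$ is self-adjoint with respect to the inner product $\langle\cdot,\cdot\rangle_{g_i}$ of $L^2(M;\Lambda M,\mu_{g_i},g_i)$; in particular it is densely-defined and closed. More generally, $\mathbb D_{e,i}$ is bi-sectorial with respect to either norm. (ii) For all integers $k,l,k',l'\ge1$, $\ker(\mathbb D_{e,i}^k)=\ker(\mathbb D_{e,i})$ and $\overline{\mathrm{ran}(\mathbb D_{e,i}^l)}=\overline{\mathrm{ran}(\mathbb D_{e,i})}$, and moreover $$L^2(M;\Lambda M)=\ker(\mathbb D_{e,1}^k)\oplus\overline{\mathrm{ran}(\mathbb D_{e,1}^l)}=\ker(\mathbb D_{e,2}^{k'})\oplus\overline{\mathrm{ran}(\mathbb D_{e,1}^{l'})},$$ where the splitting is not in general orthogonal. (iii) $\ker(\mathbb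 D_{e,1})\cong\ker(\mathbb D_{e,2})$, where an isomorphism is given by $$\Phi:=\mathcal P_{\ker(\mathbb D_{e,1}),\overline{\mathrm{ran}(\mathbb D_{e,1})}}\big|_{\ker(\mathbb D_{e,2})}:\ker(\mathbb D_{e,2})\to\ker(\mathbb D_{e,1}),$$ with inverse $\Phi^{-1}=\mathcal P_{\ker(\mathbb D_{e,2}),\overline{\mathrm{ran}(\mathbb D_{e,1})}}\big|_{\ker(\mathbb D_{e,1})}:\ker(\mathbb D_{e,1})\to\ker(\mathbb D_{e,2})$. (iv) For each degree $k$, $\ker(\mathbb D_{e,1}|_{\Lambda^kM})\cong\ker(\mathbb D_{e,2}|_{\Lambda^kM})$, where an isomorphism is given by $$\Phi_k:=\mathcal P_{\ker(\mathbb D_{e,1}),\overline{\mathrm{ran}(\mathbb D_{e,1})}}\big|_{\ker(\mathbb D_{e,2}|_{\Lambda^kM})}:\ker(\mathbb D_{e,2}|_{\Lambda^kM})\to\ker(\mathbb D_{e,1}|_{\Lambda^kM}).$$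
   Context: $M$ is a smooth manifold of dimension $n$, possibly with boundary and possibly non-compact. Null sets and measurable sections are intrinsic: a set is measurable (null) if its image in every chart is Lebesgue measurable (Lebesgue null), and a section is measurable if its coefficients in every local trivialisation are; "a.e." refers to these null sets. A rough Riemannian metric (RRM) is a measurable section $g$ of $\mathrm{Sym}_{\mathbb R}T^*M\otimes T^*M$ such that each $x\in M$ lies in a chart $(U,\psi)$ (a local comparability chart) with a constant $C(U)\ge1$ satisfying $C(U)^{-1}|\psi_*(y)u|_{\mathbb R^n}\le|u|_{g(y)}\le C(U)|\psi_*(y)u|_{\mathbb R^n}$ for a.e. $y\in U$ and all $u\in T_yM$. Its volume measure $\mu_g$ is given in a local comparability chart $(U,\psi)$ by $d\mu_g=\sqrt{\det g}\;d(\psi^*\mathscr L)$, $\mathscr L$ being Lebesgue measure. $g$ extends canonically to the complexified exterior bundle $\Lambda M=\bigoplus_{k=0}^n\Lambda^kM$, again denoted $g$. $L^2(M;\Lambda M,\mu_g,g)$ is the Hilbert space of measurable sections with $\int_M|u|_g^2\,d\mu_g<\infty$, with inner product $\langle\cdot,\cdot\rangle_g$. Two metrics (on a bundle) are mutually bounded if for some $C\ge1$, $C^{-1}|u|_{g_1(x)}\le|u|_{g_2(x)}\le C|u|_{g_1(x)}$ for a.e. $x\in M$ and all $u$ in the fibre at $x$; two measures are mutually bounded if both Radon-Nikodym derivatives $d\mu_1/d\mu_2$ and $d\mu_2/d\mu_1$ lie in $L^\infty(M)$; pairs (measure, metric) are mutually bounded if the measures and the metrics (on $\Lambda M$) are.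 $d_{cc}$ is the exterior derivative with domain $C^\infty_{cc}(M;\Lambda M)$, the smooth forms compactly supported in the interior of $M$. An operator $T$ is nilpotent if $\mathrm{ran}(T)\subset\ker(T)$. $d_e^{*,g_i}$ is the adjoint of $d_e$ with respect to $\langle\cdot,\cdot\rangle_{g_i}$. $\mathcal P_{A,B}$ is the projection onto $A$ along $B$. $\ker(\mathbb D_{e,i}|_{\Lambda^kM})$ is the set of elements of $\ker(\mathbb D_{e,i})$ that are $k$-forms a.e. A closed operator $T$ is bi-sectorial if for some $\omega\in[0,\pi/2)$ its spectrum lies in $S_\omega=\{0\}\cup\{\zeta:|\arg\zeta|\le\omega\text{ or }|\arg(-\zeta)|\le\omega\}$ and for each $\theta\in(\omega,\pi/2)$ there is $C_\theta$ with $|\zeta|\,\|(\zeta-T)^{-1}\|\le C_\theta$ for all $\zeta\notin S_\theta$.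
   Formalization: Part (iv) is false for arbitrary closed nilpotent extensions d_e, which may mix degrees; it is proved when d_e maps the degree-k part of each form in its domain to the degree-(k+1) part of its image. Dimension n ≥ 1; the remark that the splitting need not be orthogonal is not formalized. *)

theory Defs
  imports "HOL-Analysis.Analysis"
begin

section \<open>Operators in complex Hilbert spaces with an explicit carrier\<close>

text \<open>Operators are represented by their graphs, so that dom, ran, composition powers and
  extension of operators are Domain, Range, relpow and set inclusion.\<close>

record 'v hilb =
  hcar :: "'v set"
  hadd :: "'v \<Rightarrow> 'v \<Rightarrow> 'v"
  hzero :: "'v"
  hscale :: "complex \<Rightarrow> 'v \<Rightarrow> 'v"
  hinner :: "'v \<Rightarrow> 'v \<Rightarrow> complex"

type_synonym 'v graph = "('v \<times> 'v) set"

definition hminus :: "'v hilb \<Rightarrow> 'v \<Rightarrow> 'v \<Rightarrow> 'v" where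
  "hminus H u v = hadd H u (hscale H (-1) v)"

definition hnorm :: "'v hilb \<Rightarrow> 'v \<Rightarrow> real" where
  "hnorm H u = sqrt (Re (hinner H u u))"

definition hconv :: "'v hilb \<Rightarrow> (nat \<Rightarrow> 'v) \<Rightarrow> 'v \<Rightarrow> bool" where
  "hconv H xs u \<longleftrightarrow> (\<lambda>n. hnorm H (hminus H (xs n) u)) \<longlonglongrightarrow> 0"

definition hclosure :: "'v hilb \<Rightarrow> 'v set \<Rightarrow> 'v set" where
  "hclosure H S = {u \<in> hcar H. \<exists>xs. (\<forall>n. xs n \<in> S) \<and> hconv H xs u}"

definition hsubspace :: "'v hilb \<Rightarrow> 'v set \<Rightarrow> bool" where
  "hsubspace H S \<longleftrightarrow> S \<subseteq> hcar H \<and> hzero H \<in> S \<and>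
     (\<forall>u\<in>S. \<forall>v\<in>S. hadd H u v \<in> S) \<and> (\<forall>c. \<forall>u\<in>S. hscale H c u \<in> S)"

definition linear_operator :: "'v hilb \<Rightarrow> 'v graph \<Rightarrow> bool" where
  "linear_operator H T \<longleftrightarrow> T \<subseteq> hcar H \<times> hcar H \<and> single_valued T \<and> (hzero H, hzero H) \<in> T \<and>
     (\<forall>(u, v) \<in> T. \<forall>(x, y) \<in> T. (hadd H u x, hadd H v y) \<in> T) \<and>
     (\<forall>c. \<forall>(u, v) \<in> T. (hscale H c u, hscale H c v) \<in> T)"

definition closed_operator :: "'v hilb \<Rightarrow> 'v graph \<Rightarrow> bool" where
  "closed_operator H T \<longleftrightarrow> linear_operator H T \<and>
     (\<forall>xs ys u v. (\<forall>n. (xs n, ys n) \<in> T) \<and> u \<in> hcar H \<and> v \<in> hcar H \<and>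
        hconv H xs u \<and> hconv H ys v \<longrightarrow> (u, v) \<in> T)"

definition densely_defined :: "'v hilb \<Rightarrow> 'v graph \<Rightarrow> bool" where
  "densely_defined H T \<longleftrightarrow> hclosure H (Domain T) = hcar H"

definition hker :: "'v hilb \<Rightarrow> 'v graph \<Rightarrow> 'v set" where
  "hker H T = {u. (u, hzero H) \<in> T}"

definition nilpotent_operator :: "'v hilb \<Rightarrow> 'v graph \<Rightarrow> bool" where
  "nilpotent_operator H T \<longleftrightarrow> Range T \<subseteq> hker H T"

definition hadjoint :: "'v hilb \<Rightarrow> 'v graph \<Rightarrow> 'v graph" where
  "hadjoint H T = {(v, w). v \<in> hcar H \<and> w \<in> hcar H \<and>
     (\<forall>(x, y) \<in> T. hinner H y v = hinner H x w)}"

definition hsum :: "'v hilb \<Rightarrow> 'v graph \<Rightarrow> 'v graph \<Rightarrow> 'v graph" where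
  "hsum H S T = {(u, hadd H v w) | u v w. (u, v) \<in> S \<and> (u, w) \<in> T}"

definition self_adjoint :: "'v hilb \<Rightarrow> 'v graph \<Rightarrow> bool" where
  "self_adjoint H T \<longleftrightarrow> linear_operator H T \<and> densely_defined H T \<and> hadjoint H T = T"

text \<open>The graph of the (possibly multivalued) inverse of \<open>\<zeta> - T\<close>.\<close>

definition resolvent :: "'v hilb \<Rightarrow> 'v graph \<Rightarrow> complex \<Rightarrow> 'v graph" where
  "resolvent H T \<zeta> = {(hminus H (hscale H \<zeta> u) v, u) | u v. (u, v) \<in> T}"

definition hspectrum :: "'v hilb \<Rightarrow> 'v graph \<Rightarrow> complex set" where
  "hspectrum H T = - {\<zeta>. single_valued (resolvent H T \<zeta>) \<and> Domain (resolvent H T \<zeta>) = hcar H \<and>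
     (\<exists>C. \<forall>(w, u) \<in> resolvent H T \<zeta>. hnorm H u \<le> C * hnorm H w)}"

definition bisector :: "real \<Rightarrow> complex set" where
  "bisector \<omega> = {0} \<union> {\<zeta>. \<bar>Arg \<zeta>\<bar> \<le> \<omega> \<or> \<bar>Arg (-\<zeta>)\<bar> \<le> \<omega>}"

definition bisectorial :: "'v hilb \<Rightarrow> 'v graph \<Rightarrow> bool" where
  "bisectorial H T \<longleftrightarrow> closed_operator H T \<and>
     (\<exists>\<omega>. 0 \<le> \<omega> \<and> \<omega> < pi / 2 \<and> hspectrum H T \<subseteq> bisector \<omega> \<and>
       (\<forall>\<theta>. \<omega> < \<theta> \<and> \<theta> < pi / 2 \<longrightarrow>
         (\<exists>C. \<forall>\<zeta>. \<zeta> \<notin> bisector \<theta> \<longrightarrow>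
           (\<forall>(w, u) \<in> resolvent H T \<zeta>. cmod \<zeta> * hnorm H u \<le> C * hnorm H w))))"

definition direct_sum :: "'v hilb \<Rightarrow> 'v set \<Rightarrow> 'v set \<Rightarrow> bool" where
  "direct_sum H A B \<longleftrightarrow> hsubspace H A \<and> hsubspace H B \<and> A \<inter> B = {hzero H} \<and>
     (\<forall>v\<in>hcar H. \<exists>a\<in>A. \<exists>b\<in>B. v = hadd H a b)"

text \<open>The projection onto \<open>A\<close> along \<open>B\<close>; meaningful if \<open>direct_sum H A B\<close>.\<close>

definition proj_along :: "'v hilb \<Rightarrow> 'v set \<Rightarrow> 'v set \<Rightarrow> 'v \<Rightarrow> 'v" where
  "proj_along H A B v = (THE a. a \<in> A \<and> (\<exists>b\<in>B. v = hadd H a b))"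

text \<open>Isomorphisms of normed spaces: linear bijections, bounded with bounded inverse.\<close>

definition hilb_iso :: "'v hilb \<Rightarrow> 'v set \<Rightarrow> 'v hilb \<Rightarrow> 'v set \<Rightarrow> ('v \<Rightarrow> 'v) \<Rightarrow> bool" where
  "hilb_iso H A K B \<Phi> \<longleftrightarrow> bij_betw \<Phi> A B \<and>
     (\<forall>u\<in>A. \<forall>v\<in>A. \<Phi> (hadd H u v) = hadd K (\<Phi> u) (\<Phi> v)) \<and>
     (\<forall>c. \<forall>u\<in>A. \<Phi> (hscale H c u) = hscale K c (\<Phi> u)) \<and>
     (\<exists>C\<ge>1. \<forall>u\<in>A. hnorm H u / C \<le> hnorm K (\<Phi> u) \<and> hnorm K (\<Phi> u) \<le> C * hnorm H u)"

definition equivalent_norms :: "'v hilb \<Rightarrow> 'v hilb \<Rightarrow> bool" where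
  "equivalent_norms H K \<longleftrightarrow>
     (\<exists>C\<ge>1. \<forall>u\<in>hcar H. hnorm H u / C \<le> hnorm K u \<and> hnorm K u \<le> C * hnorm H u)"

definition hodge_dirac :: "'v hilb \<Rightarrow> 'v graph \<Rightarrow> 'v graph" where
  "hodge_dirac H d = hsum H d (hadjoint H d)"


section \<open>Smooth functions and smooth manifolds with boundary\<close>

primrec C_k_on ::
  "nat \<Rightarrow> 'a::real_normed_vector set \<Rightarrow> ('a \<Rightarrow> 'b::real_normed_vector) \<Rightarrow> bool" where
  "C_k_on 0 W f \<longleftrightarrow> continuous_on W f"
| "C_k_on (Suc k) W f \<longleftrightarrow> (\<forall>x\<in>W. f differentiable (at x)) \<and>
     (\<forall>v. C_k_on k W (\<lambda>x. frechet_derivative f (at x) v))"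

text \<open>On a set \<open>S\<close> that need not be open, smooth means: locally the restriction of a smooth
  function on an open set.\<close>

definition smooth_on ::
  "'a::real_normed_vector set \<Rightarrow> ('a \<Rightarrow> 'b::real_normed_vector) \<Rightarrow> bool" where
  "smooth_on S f \<longleftrightarrow> (\<forall>x\<in>S. \<exists>W F. open W \<and> x \<in> W \<and> (\<forall>k. C_k_on k W F) \<and> (\<forall>y\<in>W \<inter> S. F y = f y))"

type_synonym 'n rvec = "real^'n"

type_synonym 'n rmat = "real^'n^'n"

type_synonym ('a, 'n) chart = "'a set \<times> ('a \<Rightarrow> 'n rvec)"

text \<open>The linear order on the index type serves to single out the last coordinate (for the
  half-space) and to fix the standard basis of the exterior algebra; every finite index type
  carries one.\<close>

definition half_space :: "'n::{finite,linorder} rvec set" where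
  "half_space = {x. 0 \<le> x $ Max UNIV}"

abbreviation chart_inv :: "('a, 'n) chart \<Rightarrow> 'n rvec \<Rightarrow> 'a" where
  "chart_inv c \<equiv> inv_into (fst c) (snd c)"

abbreviation chart_image :: "('a, 'n) chart \<Rightarrow> 'n rvec set" where
  "chart_image c \<equiv> snd c ` fst c"

definition is_chart :: "('a::topological_space, 'n::{finite,linorder}) chart \<Rightarrow> bool" where
  "is_chart c \<longleftrightarrow> open (fst c) \<and>
     homeomorphism (fst c) (chart_image c) (snd c) (chart_inv c) \<and>
     (open (chart_image c) \<or> openin (top_of_set half_space) (chart_image c))"

definition compatible :: "('a, 'n::finite) chart \<Rightarrow> ('a, 'n) chart \<Rightarrow> bool" where
  "compatible c c' \<longleftrightarrow>
     smooth_on (snd c ` (fst c \<inter> fst c')) (snd c' \<circ> chart_inv c) \<and>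
     smooth_on (snd c' ` (fst c \<inter> fst c')) (snd c \<circ> chart_inv c')"

text \<open>A smooth structure on the whole (Hausdorff, second countable) space: a maximal smooth atlas.
  Charts take values in open subsets of \<open>\<real>\<^sup>n\<close> or relatively open subsets of the half-space.\<close>

definition smooth_manifold ::
  "('a::{t2_space,second_countable_topology}, 'n::{finite,linorder}) chart set \<Rightarrow> bool" where
  "smooth_manifold M \<longleftrightarrow> (\<Union>c\<in>M. fst c) = UNIV \<and> (\<forall>c\<in>M. is_chart c) \<and>
     (\<forall>c\<in>M. \<forall>c'\<in>M. compatible c c') \<and>
     (\<forall>c. is_chart c \<and> (\<forall>c'\<in>M. compatible c c') \<longrightarrow> c \<in> M)"

definition manifold_interior :: "('a, 'n::finite) chart set \<Rightarrow> 'a set" where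
  "manifold_interior M = {p. \<exists>c\<in>M. p \<in> fst c \<and> snd c p \<in> interior (chart_image c)}"

definition manifold_measurable :: "('a, 'n::finite) chart set \<Rightarrow> 'a set \<Rightarrow> bool" where
  "manifold_measurable M A \<longleftrightarrow> (\<forall>c\<in>M. snd c ` (A \<inter> fst c) \<in> sets lebesgue)"

definition manifold_null :: "('a, 'n::finite) chart set \<Rightarrow> 'a set \<Rightarrow> bool" where
  "manifold_null M A \<longleftrightarrow> (\<forall>c\<in>M. snd c ` (A \<inter> fst c) \<in> null_sets lebesgue)"

definition ae :: "('a, 'n::finite) chart set \<Rightarrow> ('a \<Rightarrow> bool) \<Rightarrow> bool" where
  "ae M P \<longleftrightarrow> manifold_null M {x. \<not> P x}"


section \<open>Tangent vectors, metrics and forms\<close>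

text \<open>The fibres of \<open>TM\<close> and \<open>\<Lambda>M\<close> at \<open>p\<close> are identified with \<open>\<real>\<^sup>n\<close> and with the complexified
  exterior algebra of its dual by means of one chosen chart \<open>pref_chart M p\<close> around \<open>p\<close>. No
  regularity of this choice in \<open>p\<close> is implied: regularity of sections is always tested on their
  coefficients in charts, obtained with the differentials of the transition maps.\<close>

definition pref_chart :: "('a, 'n::finite) chart set \<Rightarrow> 'a \<Rightarrow> ('a, 'n) chart" where
  "pref_chart M p = (SOME c. c \<in> M \<and> p \<in> fst c)"

definition transition_jacobian ::
  "('a, 'n::finite) chart \<Rightarrow> ('a, 'n) chart \<Rightarrow> 'a \<Rightarrow> 'n rmat" where
  "transition_jacobian c c' p =
     jacobian (snd c' \<circ> chart_inv c) (at (snd c p) within snd c ` (fst c \<inter> fst c'))"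

text \<open>For \<open>c = (U, \<psi>)\<close>: the map \<open>\<psi>\<^sub>*(p) : T\<^sub>pM \<rightarrow> \<real>\<^sup>n\<close> and its inverse.\<close>

definition chart_push :: "('a, 'n::finite) chart set \<Rightarrow> ('a, 'n) chart \<Rightarrow> 'a \<Rightarrow> 'n rmat" where
  "chart_push M c p = transition_jacobian (pref_chart M p) c p"

definition chart_pull :: "('a, 'n::finite) chart set \<Rightarrow> ('a, 'n) chart \<Rightarrow> 'a \<Rightarrow> 'n rmat" where
  "chart_pull M c p = transition_jacobian c (pref_chart M p) p"

text \<open>A form has a complex coefficient for every subset \<open>I = {i\<^sub>1 < \<dots> < i\<^sub>k}\<close> of the index set,
  namely that of \<open>dx\<^sub>I = dx\<^bsub>i1\<^esub> \<and> \<dots> \<and> dx\<^bsub>ik\<^esub>\<close>; its degree is \<open>card I\<close>.\<close>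

type_synonym 'n form = "complex^('n set)"

text \<open>The minor of \<open>A\<close> with rows \<open>I\<close> and columns \<open>J\<close> in increasing order (Leibniz formula).\<close>

definition mat_minor ::
  "'n::{finite,linorder} rmat \<Rightarrow> 'n set \<Rightarrow> 'n set \<Rightarrow> real" where
  "mat_minor A I J = (if card I = card J then
     (\<Sum>\<pi> | \<pi> permutes {..<card I}. of_int (sign \<pi>) *
        (\<Prod>a<card I. A $ (sorted_list_of_set I ! a) $ (sorted_list_of_set J ! \<pi> a)))
     else 0)"

text \<open>Pullback by the linear map with matrix \<open>A\<close>: the \<open>dx\<^sub>J\<close>-coefficient of \<open>A\<^sup>* dx\<^sub>I\<close> is the minor
  with rows \<open>I\<close> and columns \<open>J\<close>.\<close>

definition form_pullback :: "'n::{finite,linorder} rmat \<Rightarrow> 'n form \<Rightarrow> 'n form" where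
  "form_pullback A \<omega> = (\<chi> J. \<Sum>I\<in>UNIV. of_real (mat_minor A I J) * \<omega> $ I)"

definition form_in_chart ::
  "('a, 'n::{finite,linorder}) chart set \<Rightarrow> ('a, 'n) chart \<Rightarrow> ('a \<Rightarrow> 'n form) \<Rightarrow> 'n rvec \<Rightarrow> 'n form" where
  "form_in_chart M c \<omega> y = (let p = chart_inv c y in form_pullback (chart_pull M c p) (\<omega> p))"

definition metric_in_chart ::
  "('a, 'n::finite) chart set \<Rightarrow> ('a, 'n) chart \<Rightarrow> ('a \<Rightarrow> 'n rmat) \<Rightarrow> 'n rvec \<Rightarrow> 'n rmat" where
  "metric_in_chart M c g y = (let p = chart_inv c y; A = chart_pull M c p
     in transpose A ** g p ** A)"

definition measurable_form ::
  "('a, 'n::{finite,linorder}) chart set \<Rightarrow> ('a \<Rightarrow> 'n form) \<Rightarrow> bool" where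
  "measurable_form M \<omega> \<longleftrightarrow>
     (\<forall>c\<in>M. form_in_chart M c \<omega> \<in> borel_measurable (lebesgue_on (chart_image c)))"

definition measurable_metric :: "('a, 'n::finite) chart set \<Rightarrow> ('a \<Rightarrow> 'n rmat) \<Rightarrow> bool" where
  "measurable_metric M g \<longleftrightarrow>
     (\<forall>c\<in>M. metric_in_chart M c g \<in> borel_measurable (lebesgue_on (chart_image c)))"

definition metric_norm :: "'n::finite rmat \<Rightarrow> 'n rvec \<Rightarrow> real" where
  "metric_norm G u = sqrt (u \<bullet> (G *v u))"

definition comparability_chart ::
  "('a, 'n::finite) chart set \<Rightarrow> ('a \<Rightarrow> 'n rmat) \<Rightarrow> ('a, 'n) chart \<Rightarrow> bool" where
  "comparability_chart M g c \<longleftrightarrow> c \<in> M \<and>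
     (\<exists>C\<ge>1. ae M (\<lambda>y. y \<in> fst c \<longrightarrow>
        (\<forall>u. norm (chart_push M c y *v u) / C \<le> metric_norm (g y) u \<and>
             metric_norm (g y) u \<le> C * norm (chart_push M c y *v u))))"

definition rough_metric :: "('a, 'n::finite) chart set \<Rightarrow> ('a \<Rightarrow> 'n rmat) \<Rightarrow> bool" where
  "rough_metric M g \<longleftrightarrow> (\<forall>p. transpose (g p) = g p) \<and> measurable_metric M g \<and>
     (\<forall>x. \<exists>c. comparability_chart M g c \<and> x \<in> fst c)"

text \<open>The extension of \<open>G\<close> to complex forms: \<open>\<langle>dx\<^sub>I, dx\<^sub>J\<rangle>\<close> is the Gram determinant of the dual
  metric, whose matrix is the inverse of \<open>G\<close>.\<close>

definition form_inner :: "'n::{finite,linorder} rmat \<Rightarrow> 'n form \<Rightarrow> 'n form \<Rightarrow> complex" where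
  "form_inner G \<omega> \<eta> =
     (\<Sum>I\<in>UNIV. \<Sum>J\<in>UNIV. of_real (mat_minor (matrix_inv G) I J) * \<omega> $ I * cnj (\<eta> $ J))"

definition form_norm :: "'n::{finite,linorder} rmat \<Rightarrow> 'n form \<Rightarrow> real" where
  "form_norm G \<omega> = sqrt (Re (form_inner G \<omega> \<omega>))"

definition is_volume_measure ::
  "('a, 'n::finite) chart set \<Rightarrow> ('a \<Rightarrow> 'n rmat) \<Rightarrow> 'a measure \<Rightarrow> bool" where
  "is_volume_measure M g \<mu> \<longleftrightarrow> space \<mu> = UNIV \<and> sets \<mu> = {A. manifold_measurable M A} \<and>
     (\<forall>c A. comparability_chart M g c \<and> A \<in> sets \<mu> \<and> A \<subseteq> fst c \<longrightarrow>
        emeasure \<mu> A = (\<integral>\<^sup>+y\<in>snd c ` A. ennreal (sqrt (det (metric_in_chart M c g y))) \<partial>lebesgue))"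

definition volume_measure ::
  "('a, 'n::finite) chart set \<Rightarrow> ('a \<Rightarrow> 'n rmat) \<Rightarrow> 'a measure" where
  "volume_measure M g = (THE \<mu>. is_volume_measure M g \<mu>)"


section \<open>Mutual boundedness\<close>

definition mutually_bounded_metrics ::
  "('a, 'n::finite) chart set \<Rightarrow> ('a \<Rightarrow> 'n rmat) \<Rightarrow> ('a \<Rightarrow> 'n rmat) \<Rightarrow> bool" where
  "mutually_bounded_metrics M g1 g2 \<longleftrightarrow>
     (\<exists>C\<ge>1. ae M (\<lambda>x. \<forall>u. metric_norm (g1 x) u / C \<le> metric_norm (g2 x) u \<and>
                           metric_norm (g2 x) u \<le> C * metric_norm (g1 x) u))"

definition mutually_bounded_on_forms ::
  "('a, 'n::{finite,linorder}) chart set \<Rightarrow> ('a \<Rightarrow> 'n rmat) \<Rightarrow> ('a \<Rightarrow> 'n rmat) \<Rightarrow> bool" where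
  "mutually_bounded_on_forms M g1 g2 \<longleftrightarrow>
     (\<exists>C\<ge>1. ae M (\<lambda>x. \<forall>\<omega>. form_norm (g1 x) \<omega> / C \<le> form_norm (g2 x) \<omega> \<and>
                           form_norm (g2 x) \<omega> \<le> C * form_norm (g1 x) \<omega>))"

text \<open>The density equation states that the derivative exists: \<open>RN_deriv\<close> is 0 by convention
  otherwise.\<close>

definition bounded_RN_deriv ::
  "('a, 'n::finite) chart set \<Rightarrow> 'a measure \<Rightarrow> 'a measure \<Rightarrow> bool" where
  "bounded_RN_deriv M \<mu> \<nu> \<longleftrightarrow> density \<mu> (RN_deriv \<mu> \<nu>) = \<nu> \<and>
     (\<exists>C::real. ae M (\<lambda>x. RN_deriv \<mu> \<nu> x \<le> ennreal C))"

definition mutually_bounded_measures ::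
  "('a, 'n::finite) chart set \<Rightarrow> 'a measure \<Rightarrow> 'a measure \<Rightarrow> bool" where
  "mutually_bounded_measures M \<mu> \<nu> \<longleftrightarrow> bounded_RN_deriv M \<mu> \<nu> \<and> bounded_RN_deriv M \<nu> \<mu>"

definition mutually_bounded_pairs ::
  "('a, 'n::{finite,linorder}) chart set \<Rightarrow> 'a measure \<times> ('a \<Rightarrow> 'n rmat) \<Rightarrow>
     'a measure \<times> ('a \<Rightarrow> 'n rmat) \<Rightarrow> bool" where
  "mutually_bounded_pairs M P Q \<longleftrightarrow>
     mutually_bounded_measures M (fst P) (fst Q) \<and> mutually_bounded_on_forms M (snd P) (snd Q)"


section \<open>The space of square integrable forms\<close>

text \<open>Vectors are classes of measurable forms modulo equality a.e.; the linear structure does not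
  involve the metric.\<close>

type_synonym ('a, 'n) form_class = "('a \<Rightarrow> 'n form) set"

definition form_class ::
  "('a, 'n::{finite,linorder}) chart set \<Rightarrow> ('a \<Rightarrow> 'n form) \<Rightarrow> ('a, 'n) form_class" where
  "form_class M \<omega> = {\<eta>. measurable_form M \<eta> \<and> ae M (\<lambda>x. \<eta> x = \<omega> x)}"

definition rep :: "('a, 'n::finite) form_class \<Rightarrow> 'a \<Rightarrow> 'n form" where
  "rep u = (SOME \<omega>. \<omega> \<in> u)"

definition L2_forms ::
  "('a, 'n::{finite,linorder}) chart set \<Rightarrow> ('a \<Rightarrow> 'n rmat) \<Rightarrow> ('a, 'n) form_class hilb" where
  "L2_forms M g = \<lparr>
     hcar = {form_class M \<omega> | \<omega>. measurable_form M \<omega> \<and>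
       (\<integral>\<^sup>+x. ennreal ((form_norm (g x) (\<omega> x))\<^sup>2) \<partial>volume_measure M g) < \<infinity>},
     hadd = (\<lambda>u v. form_class M (\<lambda>x. rep u x + rep v x)),
     hzero = form_class M (\<lambda>x. 0),
     hscale = (\<lambda>c u. form_class M (\<lambda>x. c *s rep u x)),
     hinner = (\<lambda>u v. \<integral>x. form_inner (g x) (rep u x) (rep v x) \<partial>volume_measure M g) \<rparr>"

definition degree_part ::
  "('a, 'n::{finite,linorder}) chart set \<Rightarrow> nat \<Rightarrow> ('a, 'n) form_class \<Rightarrow> ('a, 'n) form_class" where
  "degree_part M k u = form_class M (\<lambda>x. \<chi> I. if card I = k then rep u x $ I else 0)"

definition k_forms ::
  "('a, 'n::{finite,linorder}) chart set \<Rightarrow> nat \<Rightarrow> ('a, 'n) form_class set" where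
  "k_forms M k = {u. \<forall>\<omega>\<in>u. ae M (\<lambda>x. \<forall>I. card I \<noteq> k \<longrightarrow> \<omega> x $ I = 0)}"

text \<open>Homogeneity of degree one: the operator maps the degree-\<open>k\<close> part of every form in its
  domain to the degree-\<open>(k + 1)\<close> part of the image, as the exterior derivative does. Closed
  nilpotent extensions of \<open>d_cc\<close> need not have this property.\<close>

definition raises_degree ::
  "('a, 'n::{finite,linorder}) chart set \<Rightarrow> ('a, 'n) form_class graph \<Rightarrow> bool" where
  "raises_degree M d \<longleftrightarrow>
     (\<forall>k. \<forall>(u, v) \<in> d. (degree_part M k u, degree_part M (Suc k) v) \<in> d)"


section \<open>The exterior derivative on smooth compactly supported forms\<close>

definition smooth_form ::
  "('a, 'n::{finite,linorder}) chart set \<Rightarrow> ('a \<Rightarrow> 'n form) \<Rightarrow> bool" where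
  "smooth_form M \<omega> \<longleftrightarrow> (\<forall>c\<in>M. smooth_on (chart_image c) (form_in_chart M c \<omega>))"

definition Ccc_forms ::
  "('a::topological_space, 'n::{finite,linorder}) chart set \<Rightarrow> ('a \<Rightarrow> 'n form) set" where
  "Ccc_forms M = {\<omega>. smooth_form M \<omega> \<and>
     compact (closure {x. \<omega> x \<noteq> 0}) \<and> closure {x. \<omega> x \<noteq> 0} \<subseteq> manifold_interior M}"

text \<open>\<open>d (\<Sum>\<^sub>I f\<^sub>I dx\<^sub>I) = \<Sum>\<^sub>I \<Sum>\<^sub>j \<partial>\<^sub>jf\<^sub>I dx\<^sub>j \<and> dx\<^sub>I\<close>; the sign comes from moving \<open>dx\<^sub>j\<close> to its place.\<close>

definition euclidean_d ::
  "'n::{finite,linorder} rvec set \<Rightarrow> ('n rvec \<Rightarrow> 'n form) \<Rightarrow> 'n rvec \<Rightarrow> 'n form" where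
  "euclidean_d S f y = (\<chi> J. \<Sum>j\<in>J. (-1) ^ card {i \<in> J. i < j} *
     frechet_derivative f (at y within S) (axis j 1) $ (J - {j}))"

text \<open>At \<open>p\<close> the derivative is computed in the chart that identifies the fibre at \<open>p\<close>.\<close>

definition exterior_d ::
  "('a, 'n::{finite,linorder}) chart set \<Rightarrow> ('a \<Rightarrow> 'n form) \<Rightarrow> 'a \<Rightarrow> 'n form" where
  "exterior_d M \<omega> p = (let c = pref_chart M p in
     euclidean_d (chart_image c) (form_in_chart M c \<omega>) (snd c p))"

definition d_cc ::
  "('a::topological_space, 'n::{finite,linorder}) chart set \<Rightarrow> ('a, 'n) form_class graph" where
  "d_cc M = {(form_class M \<omega>, form_class M (exterior_d M \<omega>)) | \<omega>. \<omega> \<in> Ccc_forms M}"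

end

theory Submission
  imports Defs "HOL-Computational_Algebra.Polynomial"
begin

text \<open>Since \<open>d\<close> is closed, nilpotent and densely defined, the space splits orthogonally into
  \<open>ker d\<close> and its complement, and \<open>D = d + d\<^sup>*\<close> respects this splitting; from it one reads off that
  \<open>D\<close> is self-adjoint, that \<open>ker D = ker d \<inter> ker d\<^sup>*\<close> and that \<open>closure (ran D)\<close> meets \<open>ker d\<close> in
  \<open>closure (ran d)\<close>. Neither \<open>ker d\<close> nor \<open>closure (ran d)\<close> depends on the inner product, and
  for each of the two inner products \<open>ker d = ker D \<oplus> closure (ran d)\<close>. Hence both kernels are
  complements of \<open>closure (ran D\<^sub>1)\<close>, and the projection along it is an isomorphism between them.
  It commutes with the degree projections, which are self-adjoint for both inner products.

  That the two \<open>L\<^sup>2\<close> spaces coincide reduces to a comparison of positive definite matrices: in a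
  frame that is orthonormal for \<open>g\<^sub>1\<close>, a frame that is orthonormal for \<open>g\<^sub>2\<close> has bounded entries,
  hence bounded minors. That \<open>d\<close> is densely defined follows by testing a form orthogonal to
  \<open>C\<^sub>c\<^sub>c\<^sup>\<infinity>\<close> against bump functions supported in coordinate boxes.\<close>

subsection \<open>Hilbert spaces with an explicit carrier\<close>

text \<open>The two spaces share a carrier and a linear structure and differ only in the inner
  product; Hilbert spaces are therefore records, so that both can be compared inside one type. The
  mixed splitting rests on the fact that the closure of \<open>ran D1\<close> is the sum of the
  closure of \<open>ran d\<close>, which both metrics agree on, and the complement of
  \<open>ker d\<close>, which they do not. A vector is first split along \<open>ker d\<close> by the
  first inner product, and only its component in \<open>ker d\<close> is split again, by the second.
  Density of \<open>dom d\<close> is what makes the adjoint single-valued. Bisectoriality in the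
  other norm costs only constants, because the resolvent graph does not see the inner product. In
  (iv), raising degrees says nothing directly about the degree 0 part of an image, which needs its
  own argument. On the analytic side, \<open>volume_measure\<close> is a definite description, so
  existence and uniqueness come first, by gluing chart densities; its null sets turn out to be the
  manifold null sets. A rough metric is positive definite only almost everywhere, so pointwise
  arguments run off a null set, and completeness of the measure absorbs the exceptions.\<close>

locale hilbert_space =
  fixes H :: "'v hilb"
  assumes add_closed [simp]: "u \<in> hcar H \<Longrightarrow> v \<in> hcar H \<Longrightarrow> hadd H u v \<in> hcar H"
    and scale_closed [simp]: "u \<in> hcar H \<Longrightarrow> hscale H c u \<in> hcar H"
    and zero_closed [simp]: "hzero H \<in> hcar H"
    and inner_add_left [simp]: "u \<in> hcar H \<Longrightarrow> v \<in> hcar H \<Longrightarrow> w \<in> hcar H \<Longrightarrow>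
      hinner H (hadd H u v) w = hinner H u w + hinner H v w"
    and inner_scale_left [simp]: "u \<in> hcar H \<Longrightarrow> w \<in> hcar H \<Longrightarrow>
      hinner H (hscale H c u) w = c * hinner H u w"
    and inner_zero_left [simp]: "w \<in> hcar H \<Longrightarrow> hinner H (hzero H) w = 0"
    and inner_commute: "u \<in> hcar H \<Longrightarrow> v \<in> hcar H \<Longrightarrow> hinner H u v = cnj (hinner H v u)"
    and inner_self_nonneg: "u \<in> hcar H \<Longrightarrow> 0 \<le> Re (hinner H u u)"
    and minus_null_imp_eq: "u \<in> hcar H \<Longrightarrow> v \<in> hcar H \<Longrightarrow>
      hinner H (hminus H u v) (hminus H u v) = 0 \<Longrightarrow> u = v"
    and complete: "(\<And>n. xs n \<in> hcar H) \<Longrightarrow>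
      (\<And>e. 0 < e \<Longrightarrow> \<exists>N. \<forall>m\<ge>N. \<forall>n\<ge>N. hnorm H (hminus H (xs m) (xs n)) < e) \<Longrightarrow>
      \<exists>u\<in>hcar H. hconv H xs u"
begin

lemma inner_add_right [simp]: "u \<in> hcar H \<Longrightarrow> v \<in> hcar H \<Longrightarrow> w \<in> hcar H \<Longrightarrow>
    hinner H w (hadd H u v) = hinner H w u + hinner H w v"
  by (metis inner_add_left inner_commute add_closed complex_cnj_add)

lemma inner_scale_right [simp]: "u \<in> hcar H \<Longrightarrow> w \<in> hcar H \<Longrightarrow>
    hinner H w (hscale H c u) = cnj c * hinner H w u"
  by (metis inner_scale_left inner_commute scale_closed complex_cnj_mult)

lemma inner_zero_right [simp]: "w \<in> hcar H \<Longrightarrow> hinner H w (hzero H) = 0"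
  by (metis inner_zero_left inner_commute zero_closed complex_cnj_zero)

lemma minus_closed [simp]: "u \<in> hcar H \<Longrightarrow> v \<in> hcar H \<Longrightarrow> hminus H u v \<in> hcar H"
  by (simp add: hminus_def)

lemma inner_minus_left [simp]: "u \<in> hcar H \<Longrightarrow> v \<in> hcar H \<Longrightarrow> w \<in> hcar H \<Longrightarrow>
    hinner H (hminus H u v) w = hinner H u w - hinner H v w"
  by (simp add: hminus_def)

lemma inner_minus_right [simp]: "u \<in> hcar H \<Longrightarrow> v \<in> hcar H \<Longrightarrow> w \<in> hcar H \<Longrightarrow>
    hinner H w (hminus H u v) = hinner H w u - hinner H w v"
  by (simp add: hminus_def)

text \<open>Stands in for the vector space axioms: an algebraic identity between vectors is checked
  by testing both sides against every \<open>w\<close>, where linearity of the inner product turns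
  it into an identity of complex numbers.\<close>

lemma vec_eqI:
  assumes "u \<in> hcar H" "v \<in> hcar H" "\<And>w. w \<in> hcar H \<Longrightarrow> hinner H u w = hinner H v w"
  shows "u = v"
  by (rule minus_null_imp_eq) (use assms in auto)

lemma norm_nonneg [simp]: "u \<in> hcar H \<Longrightarrow> 0 \<le> hnorm H u"
  by (simp add: hnorm_def inner_self_nonneg)

lemma norm_power2: "u \<in> hcar H \<Longrightarrow> (hnorm H u)\<^sup>2 = Re (hinner H u u)"
  by (simp add: hnorm_def inner_self_nonneg)

lemma Im_inner_self [simp]: "u \<in> hcar H \<Longrightarrow> Im (hinner H u u) = 0"
  by (metis inner_commute complex_cnj complex.sel(2) Reals_cnj_iff complex_is_Real_iff)

lemma inner_self: "u \<in> hcar H \<Longrightarrow> hinner H u u = of_real ((hnorm H u)\<^sup>2)"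
  by (simp add: complex_eq_iff norm_power2)

lemma norm_zero [simp]: "hnorm H (hzero H) = 0"
  by (simp add: hnorm_def)

lemma norm_eq_0: "u \<in> hcar H \<Longrightarrow> hnorm H u = 0 \<longleftrightarrow> u = hzero H"
proof
  assume u: "u \<in> hcar H" "hnorm H u = 0"
  then have "hinner H u u = 0" by (simp add: inner_self)
  then show "u = hzero H" using u by (intro minus_null_imp_eq) auto
qed simp

lemma norm_minus_eq_0: "u \<in> hcar H \<Longrightarrow> v \<in> hcar H \<Longrightarrow> hnorm H (hminus H u v) = 0 \<longleftrightarrow> u = v"
proof
  assume u: "u \<in> hcar H" "v \<in> hcar H" "hnorm H (hminus H u v) = 0"
  then have "hinner H (hminus H u v) (hminus H u v) = 0"
    using inner_self[of "hminus H u v"] by simp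
  then show "u = v" using u minus_null_imp_eq by blast
qed (simp add: hnorm_def)

lemma norm_scale [simp]: "u \<in> hcar H \<Longrightarrow> hnorm H (hscale H c u) = cmod c * hnorm H u"
proof -
  assume u: "u \<in> hcar H"
  have "(hnorm H (hscale H c u))\<^sup>2 = Re (c * cnj c * hinner H u u)"
    using u by (simp add: norm_power2 mult.assoc)
  also have "\<dots> = (cmod c * hnorm H u)\<^sup>2"
    using u by (simp only: complex_norm_square[symmetric] inner_self)
      (simp add: power_mult_distrib flip: of_real_mult of_real_power)
  finally show ?thesis using u by (simp add: power2_eq_iff_nonneg)
qed

lemma norm_minus_commute: "u \<in> hcar H \<Longrightarrow> v \<in> hcar H \<Longrightarrow> hnorm H (hminus H u v) = hnorm H (hminus H v u)"
  by (simp add: hnorm_def algebra_simps)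

text \<open>Pythagoras for removing from \<open>u\<close> its component along \<open>v\<close>.
  Nonnegativity of the left side is Cauchy-Schwarz; strict decrease for non-orthogonal vectors
  drives the projection theorem.\<close>

lemma norm_project_le:
  assumes u: "u \<in> hcar H" and v: "v \<in> hcar H" and v0: "hnorm H v \<noteq> 0"
  shows "(hnorm H (hminus H u (hscale H (hinner H u v / of_real ((hnorm H v)\<^sup>2)) v)))\<^sup>2 =
    (hnorm H u)\<^sup>2 - (cmod (hinner H u v))\<^sup>2 / (hnorm H v)\<^sup>2"
proof -
  define c where "c = hinner H u v"
  define r where "r = (hnorm H v)\<^sup>2"
  have r: "r \<noteq> 0" "hinner H v v = of_real r" "hinner H v u = cnj c"
    using v0 v u by (auto simp: r_def c_def inner_self inner_commute[of v u])
  have "hinner H (hminus H u (hscale H (c / of_real r) v)) (hminus H u (hscale H (c / of_real r) v))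
     = hinner H u u - c * cnj c / of_real r"
    using u v r by (simp add: algebra_simps) (simp add: c_def[symmetric])
  also have "\<dots> = of_real ((hnorm H u)\<^sup>2 - (cmod c)\<^sup>2 / r)"
    using u complex_norm_square[of c] by (simp add: inner_self)
  finally show ?thesis
    using u v by (simp add: norm_power2 c_def[symmetric] r_def[symmetric] del: inner_minus_left inner_minus_right)
qed

lemma cauchy_schwarz:
  assumes u: "u \<in> hcar H" and v: "v \<in> hcar H"
  shows "cmod (hinner H u v) \<le> hnorm H u * hnorm H v"
proof (cases "hnorm H v = 0")
  case True
  then show ?thesis using u v norm_eq_0 by auto
next
  case False
  then have p: "0 < hnorm H v" using norm_nonneg[OF v] by linarith
  have "0 \<le> (hnorm H u)\<^sup>2 - (cmod (hinner H u v))\<^sup>2 / (hnorm H v)\<^sup>2"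
    using norm_project_le[OF u v False] by (metis zero_le_power2)
  then have "(cmod (hinner H u v))\<^sup>2 \<le> (hnorm H u * hnorm H v)\<^sup>2"
    using p by (simp add: field_simps)
  then show ?thesis by (rule power2_le_imp_le) (use u v in simp)
qed

lemma norm_triangle:
  assumes u: "u \<in> hcar H" and v: "v \<in> hcar H"
  shows "hnorm H (hadd H u v) \<le> hnorm H u + hnorm H v"
proof -
  have "Re (hinner H u v) \<le> hnorm H u * hnorm H v"
    using cauchy_schwarz[OF u v] complex_Re_le_cmod[of "hinner H u v"] by linarith
  moreover have "Re (hinner H v u) = Re (hinner H u v)"
    using inner_commute[OF v u] by simp
  ultimately have "(hnorm H (hadd H u v))\<^sup>2 \<le> (hnorm H u + hnorm H v)\<^sup>2"
    using u v by (simp add: norm_power2 power2_sum)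
  then show ?thesis by (rule power2_le_imp_le) (use u v in auto)
qed

lemma norm_triangle_minus:
  assumes "u \<in> hcar H" "v \<in> hcar H" "w \<in> hcar H"
  shows "hnorm H (hminus H u w) \<le> hnorm H (hminus H u v) + hnorm H (hminus H v w)"
proof -
  have "hminus H u w = hadd H (hminus H u v) (hminus H v w)"
    by (rule vec_eqI) (use assms in auto)
  then show ?thesis using norm_triangle assms by simp
qed

lemma parallelogram:
  assumes "u \<in> hcar H" "v \<in> hcar H"
  shows "(hnorm H (hminus H u v))\<^sup>2 + (hnorm H (hadd H u v))\<^sup>2 = 2 * (hnorm H u)\<^sup>2 + 2 * (hnorm H v)\<^sup>2"
  using assms by (simp add: norm_power2)

lemma pythagoras:
  assumes "u \<in> hcar H" "v \<in> hcar H" "hinner H u v = 0"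
  shows "(hnorm H (hadd H u v))\<^sup>2 = (hnorm H u)\<^sup>2 + (hnorm H v)\<^sup>2"
  using assms inner_commute[of v u] by (simp add: norm_power2)

lemma conv_inner_left:
  assumes "hconv H xs u" "\<And>n. xs n \<in> hcar H" "u \<in> hcar H" "w \<in> hcar H"
  shows "(\<lambda>n. hinner H (xs n) w) \<longlonglongrightarrow> hinner H u w"
proof (rule LIM_zero_cancel, rule Lim_null_comparison)
  show "\<forall>\<^sub>F n in sequentially. norm (hinner H (xs n) w - hinner H u w) \<le> hnorm H (hminus H (xs n) u) * hnorm H w"
    using cauchy_schwarz[of "hminus H (xs _) u" w] assms by simp
  show "(\<lambda>n. hnorm H (hminus H (xs n) u) * hnorm H w) \<longlonglongrightarrow> 0"
    using assms(1) tendsto_mult_left_zero unfolding hconv_def by blast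
qed

lemma conv_inner_right:
  assumes "hconv H xs u" "\<And>n. xs n \<in> hcar H" "u \<in> hcar H" "w \<in> hcar H"
  shows "(\<lambda>n. hinner H w (xs n)) \<longlonglongrightarrow> hinner H w u"
proof -
  have "(\<lambda>n. cnj (hinner H (xs n) w)) \<longlonglongrightarrow> cnj (hinner H u w)"
    by (intro tendsto_cnj conv_inner_left assms)
  then show ?thesis using assms by (simp flip: inner_commute)
qed

lemma conv_const: "u \<in> hcar H \<Longrightarrow> hconv H (\<lambda>_. u) u"
  by (simp add: hconv_def hnorm_def)

lemma conv_norm:
  assumes "hconv H xs u" "\<And>n. xs n \<in> hcar H" "u \<in> hcar H" "w \<in> hcar H"
  shows "(\<lambda>n. hnorm H (hminus H w (xs n))) \<longlonglongrightarrow> hnorm H (hminus H w u)"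
proof (rule LIM_zero_cancel, rule Lim_null_comparison)
  have "\<bar>hnorm H (hminus H w (xs n)) - hnorm H (hminus H w u)\<bar> \<le> hnorm H (hminus H (xs n) u)" for n
    using norm_triangle_minus[of w u "xs n"] norm_triangle_minus[of w "xs n" u] assms
      norm_minus_commute[of u "xs n"] by force
  then show "\<forall>\<^sub>F n in sequentially. norm (hnorm H (hminus H w (xs n)) - hnorm H (hminus H w u)) \<le> hnorm H (hminus H (xs n) u)"
    by simp
qed (use assms(1) in \<open>simp add: hconv_def\<close>)

lemma conv_add:
  assumes "hconv H xs u" "\<And>n. xs n \<in> hcar H" "u \<in> hcar H"
    and "hconv H ys v" "\<And>n. ys n \<in> hcar H" "v \<in> hcar H"
  shows "hconv H (\<lambda>n. hadd H (xs n) (ys n)) (hadd H u v)"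
  unfolding hconv_def
proof (rule Lim_null_comparison)
  have "hminus H (hadd H (xs n) (ys n)) (hadd H u v) = hadd H (hminus H (xs n) u) (hminus H (ys n) v)" for n
    by (rule vec_eqI) (use assms in auto)
  then show "\<forall>\<^sub>F n in sequentially. norm (hnorm H (hminus H (hadd H (xs n) (ys n)) (hadd H u v)))
      \<le> hnorm H (hminus H (xs n) u) + hnorm H (hminus H (ys n) v)"
    using norm_triangle assms by auto
  show "(\<lambda>n. hnorm H (hminus H (xs n) u) + hnorm H (hminus H (ys n) v)) \<longlonglongrightarrow> 0"
    using assms(1,4) tendsto_add_zero unfolding hconv_def by blast
qed

lemma conv_scale:
  assumes "hconv H xs u" "\<And>n. xs n \<in> hcar H" "u \<in> hcar H"
  shows "hconv H (\<lambda>n. hscale H c (xs n)) (hscale H c u)"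
proof -
  have "hminus H (hscale H c (xs n)) (hscale H c u) = hscale H c (hminus H (xs n) u)" for n
    by (rule vec_eqI) (use assms in \<open>auto simp: algebra_simps\<close>)
  then have "hnorm H (hminus H (hscale H c (xs n)) (hscale H c u)) = cmod c * hnorm H (hminus H (xs n) u)" for n
    using assms by simp
  then show ?thesis using assms(1) unfolding hconv_def by (simp add: tendsto_mult_right_zero)
qed

lemma closureI: "u \<in> hcar H \<Longrightarrow> (\<And>n. xs n \<in> S) \<Longrightarrow> hconv H xs u \<Longrightarrow> u \<in> hclosure H S"
  by (auto simp: hclosure_def)

lemma closure_iff:
  assumes "S \<subseteq> hcar H"
  shows "u \<in> hclosure H S \<longleftrightarrow> u \<in> hcar H \<and> (\<forall>e>0. \<exists>s\<in>S. hnorm H (hminus H s u) < e)"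
proof
  assume "u \<in> hclosure H S"
  then obtain xs where xs: "u \<in> hcar H" "\<And>n. xs n \<in> S" "hconv H xs u" by (auto simp: hclosure_def)
  have "\<exists>s\<in>S. hnorm H (hminus H s u) < e" if "0 < e" for e
    using xs(3) that xs(2) eventually_happens'[OF sequentially_bot] order_tendstoD(2)
    unfolding hconv_def by (metis (mono_tags, lifting))
  then show "u \<in> hcar H \<and> (\<forall>e>0. \<exists>s\<in>S. hnorm H (hminus H s u) < e)" using xs by blast
next
  assume A: "u \<in> hcar H \<and> (\<forall>e>0. \<exists>s\<in>S. hnorm H (hminus H s u) < e)"
  then have "\<exists>s\<in>S. hnorm H (hminus H s u) < inverse (real (Suc n))" for n by simp
  then obtain xs where xs: "\<And>n. xs n \<in> S" "\<And>n. hnorm H (hminus H (xs n) u) < inverse (real (Suc n))"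
    by metis
  have "(\<lambda>n. hnorm H (hminus H (xs n) u)) \<longlonglongrightarrow> 0"
  proof (rule Lim_null_comparison[OF _ LIMSEQ_inverse_real_of_nat])
    show "\<forall>\<^sub>F n in sequentially. norm (hnorm H (hminus H (xs n) u)) \<le> inverse (real (Suc n))"
      using A xs assms by (intro always_eventually allI) (auto simp: less_imp_le subset_iff)
  qed
  then show "u \<in> hclosure H S" using A xs(1) closureI hconv_def by metis
qed

lemma closure_subset: "S \<subseteq> hcar H \<Longrightarrow> S \<subseteq> hclosure H S"
  using conv_const by (fastforce simp: hclosure_def)

lemma closure_carrier: "hclosure H S \<subseteq> hcar H"
  by (auto simp: hclosure_def)

lemma closure_mono: "S \<subseteq> T \<Longrightarrow> hclosure H S \<subseteq> hclosure H T"
  unfolding hclosure_def by blast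

lemma closure_closure: assumes "S \<subseteq> hcar H" shows "hclosure H (hclosure H S) = hclosure H S"
proof
  show "hclosure H (hclosure H S) \<subseteq> hclosure H S"
  proof
    fix u assume u: "u \<in> hclosure H (hclosure H S)"
    have "\<exists>s\<in>S. hnorm H (hminus H s u) < e" if e: "0 < e" for e
    proof -
      obtain t where t: "t \<in> hclosure H S" "hnorm H (hminus H t u) < e/2"
        using u half_gt_zero[OF e] unfolding closure_iff[OF closure_carrier] by blast
      then obtain s where s: "s \<in> S" "hnorm H (hminus H s t) < e/2"
        using half_gt_zero[OF e] unfolding closure_iff[OF assms] by blast
      have "hnorm H (hminus H s u) < e"
        using s t norm_triangle_minus[of s t u] u assms closure_carrier by fastforce
      then show ?thesis using s by blast
    qed
    then show "u \<in> hclosure H S" using u closure_iff[OF assms] closure_carrier by blast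
  qed
qed (use closure_subset closure_carrier in blast)

lemma closure_minimal: "S \<subseteq> T \<Longrightarrow> hclosure H T \<subseteq> T \<Longrightarrow> hclosure H S \<subseteq> T"
  using closure_mono by blast

lemma subspace_closure:
  assumes "hsubspace H S" shows "hsubspace H (hclosure H S)"
  unfolding hsubspace_def
proof (intro conjI ballI allI)
  have S: "S \<subseteq> hcar H" "hzero H \<in> S" using assms by (auto simp: hsubspace_def)
  show "hclosure H S \<subseteq> hcar H" by (rule closure_carrier)
  show "hzero H \<in> hclosure H S" using closure_subset S by blast
  fix u assume u: "u \<in> hclosure H S"
  then obtain xs where xs: "u \<in> hcar H" "\<And>n. xs n \<in> S" "hconv H xs u" by (auto simp: hclosure_def)
  then have xc: "\<And>n. xs n \<in> hcar H" using S by blast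
  { fix v assume v: "v \<in> hclosure H S"
    then obtain ys where ys: "v \<in> hcar H" "\<And>n. ys n \<in> S" "hconv H ys v" by (auto simp: hclosure_def)
    then have yc: "\<And>n. ys n \<in> hcar H" using S by blast
    show "hadd H u v \<in> hclosure H S"
      by (rule closureI[OF _ _ conv_add[OF xs(3) xc xs(1) ys(3) yc ys(1)]])
        (use xs ys assms in \<open>auto simp: hsubspace_def\<close>) }
  { fix c show "hscale H c u \<in> hclosure H S"
      by (rule closureI[OF _ _ conv_scale[OF xs(3) xc xs(1)]])
        (use xs assms in \<open>auto simp: hsubspace_def\<close>) }
qed

lemma subspace_minus: "hsubspace H S \<Longrightarrow> u \<in> S \<Longrightarrow> v \<in> S \<Longrightarrow> hminus H u v \<in> S"
  by (auto simp: hsubspace_def hminus_def)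

text \<open>Variational proof: a minimising sequence for the distance from \<open>v\<close> to
  \<open>S\<close> is Cauchy by the parallelogram law, and the residual at the minimiser is
  orthogonal to \<open>S\<close>, since otherwise a step along some \<open>s\<close> would shorten
  it.\<close>

lemma closed_projection_exists:
  assumes S: "hsubspace H S" and cl: "hclosure H S \<subseteq> S" and v: "v \<in> hcar H"
  shows "\<exists>a\<in>S. \<forall>s\<in>S. hinner H (hminus H v a) s = 0"
proof -
  have Sc: "\<And>s. s \<in> S \<Longrightarrow> s \<in> hcar H" and S0: "hzero H \<in> S" using S by (auto simp: hsubspace_def)
  define f where "f s = hnorm H (hminus H v s)" for s
  define \<delta> where "\<delta> = (INF s\<in>S. f s)"
  have bdd: "bdd_below (f ` S)"
    using v Sc by (intro bdd_belowI[of _ 0]) (auto simp: f_def)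
  have \<delta>_le: "\<delta> \<le> f s" if "s \<in> S" for s
    unfolding \<delta>_def by (rule cINF_lower[OF bdd that])
  have \<delta>0: "0 \<le> \<delta>"
    unfolding \<delta>_def using S0 v Sc by (intro cINF_greatest) (auto simp: f_def)
  have "\<exists>s\<in>S. f s < \<delta> + inverse (real (Suc n))" for n
  proof -
    have "\<delta> < \<delta> + inverse (real (Suc n))" by simp
    then show ?thesis
      unfolding \<delta>_def using cINF_less_iff[OF _ bdd] S0 by (metis empty_iff)
  qed
  then obtain xs where xs: "\<And>n. xs n \<in> S" "\<And>n. f (xs n) < \<delta> + inverse (real (Suc n))" by metis
  have xc: "\<And>n. xs n \<in> hcar H" using xs Sc by blast
  have lim: "(\<lambda>n. f (xs n)) \<longlonglongrightarrow> \<delta>"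
  proof (rule tendsto_sandwich)
    show "\<forall>\<^sub>F n in sequentially. \<delta> \<le> f (xs n)" using \<delta>_le xs by simp
    show "\<forall>\<^sub>F n in sequentially. f (xs n) \<le> \<delta> + inverse (real (Suc n))" by (intro always_eventually allI less_imp_le xs)
    show "(\<lambda>n. \<delta> + inverse (real (Suc n))) \<longlonglongrightarrow> \<delta>" using LIMSEQ_inverse_real_of_nat_add by simp
  qed simp
  \<comment> \<open>The midpoint of \<open>s\<close> and \<open>t\<close> lies in \<open>S\<close>,
    so its distance from \<open>v\<close> is at least \<open>\<delta>\<close>; the parallelogram law
    then bounds the distance between \<open>s\<close> and \<open>t\<close>.\<close>
  have para: "(hnorm H (hminus H s t))\<^sup>2 \<le> 2 * (f s)\<^sup>2 + 2 * (f t)\<^sup>2 - 4 * \<delta>\<^sup>2" if st: "s \<in> S" "t \<in> S" for s t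
  proof -
    define m where "m = hscale H (1/2) (hadd H s t)"
    have m: "m \<in> S" using st S by (auto simp: m_def hsubspace_def)
    have "(hnorm H (hminus H s t))\<^sup>2 + (2 * f m)\<^sup>2 = 2 * (f s)\<^sup>2 + 2 * (f t)\<^sup>2"
    proof -
      have 1: "hminus H (hminus H v t) (hminus H v s) = hminus H s t"
        by (rule vec_eqI) (use st Sc v in auto)
      have "hadd H (hminus H v t) (hminus H v s) = hscale H 2 (hminus H v m)"
        by (rule vec_eqI) (use st Sc v in \<open>auto simp: m_def algebra_simps\<close>)
      then have 2: "hnorm H (hadd H (hminus H v t) (hminus H v s)) = 2 * f m"
        using m Sc v by (simp add: f_def)
      show ?thesis
        using parallelogram[of "hminus H v t" "hminus H v s"] 1 2 st Sc v by (simp add: f_def)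
    qed
    moreover have "\<delta>\<^sup>2 \<le> (f m)\<^sup>2" using \<delta>_le[OF m] \<delta>0 by (simp add: power_mono)
    ultimately show ?thesis by (simp add: power_mult_distrib)
  qed
  have "\<exists>u\<in>hcar H. hconv H xs u"
  proof (rule complete[OF xc])
    fix e :: real assume e: "0 < e"
    have "(\<lambda>n. (f (xs n))\<^sup>2) \<longlonglongrightarrow> \<delta>\<^sup>2" by (intro tendsto_power lim)
    then have "\<forall>\<^sub>F n in sequentially. (f (xs n))\<^sup>2 < \<delta>\<^sup>2 + e\<^sup>2/4"
      by (rule order_tendstoD) (use e in simp)
    \<comment> \<open>The margin \<open>e^2 / 4\<close> enters \<open>para\<close> twice with factor
      2, which makes exactly \<open>e^2\<close>.\<close>
    then obtain N where N: "\<And>n. n \<ge> N \<Longrightarrow> (f (xs n))\<^sup>2 < \<delta>\<^sup>2 + e\<^sup>2/4"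
      by (auto simp: eventually_sequentially)
    have "hnorm H (hminus H (xs m) (xs n)) < e" if "m \<ge> N" "n \<ge> N" for m n
    proof (rule power2_less_imp_less)
      show "(hnorm H (hminus H (xs m) (xs n)))\<^sup>2 < e\<^sup>2"
        using para[OF xs(1)[of m] xs(1)[of n]] N[OF that(1)] N[OF that(2)] by linarith
    qed (use e in simp)
    then show "\<exists>N. \<forall>m\<ge>N. \<forall>n\<ge>N. hnorm H (hminus H (xs m) (xs n)) < e" by blast
  qed
  then obtain a where a: "a \<in> hcar H" "hconv H xs a" by blast
  have aS: "a \<in> S" using closureI[OF a(1) xs(1) a(2)] cl by blast
  have fa: "f a = \<delta>"
    using conv_norm[OF a(2) xc a(1) v] lim LIMSEQ_unique unfolding f_def by blast
  have "hinner H (hminus H v a) s = 0" if s: "s \<in> S" for s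
  proof (cases "hnorm H s = 0")
    case True then show ?thesis using norm_eq_0 s Sc v a by auto
  next
    case False
    \<comment> \<open>The component of the residual along \<open>s\<close>; moving from
      \<open>a\<close> to \<open>a + t\<close> would lower the distance below the minimum unless
      this component vanishes.\<close>
    define t where "t = hscale H (hinner H (hminus H v a) s / of_real ((hnorm H s)\<^sup>2)) s"
    have t: "t \<in> S" using s S by (auto simp: t_def hsubspace_def)
    have at: "hadd H a t \<in> S" using aS t S by (auto simp: hsubspace_def)
    have "hminus H (hminus H v a) t = hminus H v (hadd H a t)"
      by (rule vec_eqI) (use t Sc v a in auto)
    then have "(f (hadd H a t))\<^sup>2 = (f a)\<^sup>2 - (cmod (hinner H (hminus H v a) s))\<^sup>2 / (hnorm H s)\<^sup>2"
      using norm_project_le[of "hminus H v a" s] False s Sc v a by (simp add: f_def t_def)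
    moreover have "(f a)\<^sup>2 \<le> (f (hadd H a t))\<^sup>2"
      using \<delta>_le[OF at] fa \<delta>0 by (simp add: power_mono)
    ultimately have "(cmod (hinner H (hminus H v a) s))\<^sup>2 / (hnorm H s)\<^sup>2 \<le> 0" by linarith
    then have "(cmod (hinner H (hminus H v a) s))\<^sup>2 \<le> 0"
      using False by (simp add: divide_le_0_iff)
    then show ?thesis by simp
  qed
  then show ?thesis using aS by blast
qed

definition perp :: "'v set \<Rightarrow> 'v set" where
  "perp S = {w \<in> hcar H. \<forall>s\<in>S. hinner H s w = 0}"

lemma perpD: "w \<in> perp S \<Longrightarrow> s \<in> S \<Longrightarrow> s \<in> hcar H \<Longrightarrow> hinner H s w = 0 \<and> hinner H w s = 0"
  by (auto simp: perp_def inner_commute[of w s])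

lemma perp_carrier: "perp S \<subseteq> hcar H" by (auto simp: perp_def)

lemma closure_perp: assumes "S \<subseteq> hcar H" shows "hclosure H (perp S) = perp S"
proof
  show "hclosure H (perp S) \<subseteq> perp S"
  proof
    fix u assume "u \<in> hclosure H (perp S)"
    then obtain xs where xs: "u \<in> hcar H" "\<And>n. xs n \<in> perp S" "hconv H xs u" by (auto simp: hclosure_def)
    have "hinner H s u = 0" if "s \<in> S" for s
    proof -
      have "(\<lambda>n. hinner H s (xs n)) \<longlonglongrightarrow> hinner H s u"
        using xs that assms perp_carrier by (intro conv_inner_right) auto
      moreover have "\<And>n. hinner H s (xs n) = 0" using xs(2) that by (auto simp: perp_def)
      ultimately show ?thesis by (simp add: LIMSEQ_const_iff)
    qed
    then show "u \<in> perp S" using xs by (auto simp: perp_def)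
  qed
qed (use closure_subset perp_carrier in blast)

text \<open>Orthogonality to a fixed \<open>w\<close> is a closed condition: \<open>S\<close> lies
  in the closed set \<open>perp {w}\<close>, hence so does its closure.\<close>

lemma perp_closure: assumes "S \<subseteq> hcar H" shows "perp (hclosure H S) = perp S"
proof
  show "perp (hclosure H S) \<subseteq> perp S" using closure_subset[OF assms] by (auto simp: perp_def)
  show "perp S \<subseteq> perp (hclosure H S)"
  proof
    fix w assume w: "w \<in> perp S"
    have "S \<subseteq> perp {w}"
    proof
      fix s assume "s \<in> S"
      then show "s \<in> perp {w}" using perpD[OF w, of s] assms by (auto simp: perp_def)
    qed
    then have "hclosure H S \<subseteq> hclosure H (perp {w})" by (rule closure_mono)
    then have "hclosure H S \<subseteq> perp {w}" using closure_perp[of "{w}"] w perp_carrier by auto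
    have "hinner H s w = 0" if "s \<in> hclosure H S" for s
      using that \<open>hclosure H S \<subseteq> perp {w}\<close> perpD[of s "{w}" w] w by (auto simp: perp_def)
    then show "w \<in> perp (hclosure H S)"
      using w by (auto simp: perp_def)
  qed
qed

lemma orthogonal_decomposition:
  assumes S: "hsubspace H S" and v: "v \<in> hcar H"
  obtains a b where "a \<in> hclosure H S" "b \<in> perp S" "v = hadd H a b"
proof -
  have Sc: "S \<subseteq> hcar H" using S by (auto simp: hsubspace_def)
  obtain a where a: "a \<in> hclosure H S" "\<forall>s\<in>hclosure H S. hinner H (hminus H v a) s = 0"
    using closed_projection_exists[OF subspace_closure[OF S] _ v] closure_closure[OF Sc] by blast
  have ac: "a \<in> hcar H" using a closure_carrier by blast
  have "hminus H v a \<in> perp S"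
    unfolding perp_def
  proof (intro CollectI conjI ballI)
    fix s assume s: "s \<in> S"
    then have "hinner H (hminus H v a) s = 0" using a(2) closure_subset[OF Sc] by blast
    then show "hinner H s (hminus H v a) = 0"
      using inner_commute[of s "hminus H v a"] s Sc v ac by (metis complex_cnj_zero minus_closed subsetD)
  qed (use v ac in simp)
  moreover have "v = hadd H a (hminus H v a)" by (rule vec_eqI) (use v ac in auto)
  ultimately show ?thesis using that a by blast
qed

text \<open>If \<open>v = a + b\<close> with \<open>a\<close> in the closure and \<open>b\<close> in
  \<open>perp S\<close>, then \<open>b\<close> is orthogonal to both \<open>v\<close> and
  \<open>a\<close>, hence to itself.\<close>

lemma perp_perp: assumes S: "hsubspace H S" shows "perp (perp S) = hclosure H S"
proof
  have Sc: "S \<subseteq> hcar H" using S by (auto simp: hsubspace_def)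
  show "perp (perp S) \<subseteq> hclosure H S"
  proof
    fix v assume v: "v \<in> perp (perp S)"
    then have vc: "v \<in> hcar H" using perp_carrier by blast
    obtain a b where ab: "a \<in> hclosure H S" "b \<in> perp S" "v = hadd H a b"
      using orthogonal_decomposition[OF S vc] .
    have c: "a \<in> hcar H" "b \<in> hcar H" using ab closure_carrier perp_carrier by blast+
    have "hinner H b a = 0" using ab perp_closure[OF Sc] perpD c by blast
    moreover have "hinner H b v = 0" using v ab c perpD by blast
    ultimately have "hinner H b b = 0" using ab c by simp
    then have "b = hzero H" using c inner_self norm_eq_0 by simp
    then have "v = a" using ab(3) c by (intro vec_eqI) auto
    then show "v \<in> hclosure H S" using ab by simp
  qed
  show "hclosure H S \<subseteq> perp (perp S)"
    unfolding perp_closure[OF Sc, symmetric] using closure_carrier perpD unfolding perp_def by blast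
qed

lemma dense_iff: assumes "hsubspace H S" shows "hclosure H S = hcar H \<longleftrightarrow> perp S \<subseteq> {hzero H}"
proof
  assume "perp S \<subseteq> {hzero H}"
  then have "hcar H \<subseteq> perp (perp S)" by (auto simp: perp_def)
  then show "hclosure H S = hcar H" using perp_perp[OF assms] perp_carrier by blast
next
  assume d: "hclosure H S = hcar H"
  have "S \<subseteq> hcar H" using assms by (auto simp: hsubspace_def)
  then have "perp S = perp (hcar H)" using perp_closure d by metis
  moreover have "perp (hcar H) \<subseteq> {hzero H}"
    using inner_self norm_eq_0 by (auto simp: perp_def)
  ultimately show "perp S \<subseteq> {hzero H}" by blast
qed

end

subsection \<open>Operators and adjoints\<close>

lemma linear_operator_carrier:
  "linear_operator H T \<Longrightarrow> (u, v) \<in> T \<Longrightarrow> u \<in> hcar H \<and> v \<in> hcar H"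
  by (auto simp: linear_operator_def)

lemma linear_operator_fun:
  "linear_operator H T \<Longrightarrow> (u, v) \<in> T \<Longrightarrow> (u, w) \<in> T \<Longrightarrow> v = w"
  unfolding linear_operator_def single_valued_def by blast

lemma linear_operator_zero: "linear_operator H T \<Longrightarrow> (hzero H, hzero H) \<in> T"
  by (simp add: linear_operator_def)

lemma linear_operator_add:
  "linear_operator H T \<Longrightarrow> (u, v) \<in> T \<Longrightarrow> (x, y) \<in> T \<Longrightarrow> (hadd H u x, hadd H v y) \<in> T"
  unfolding linear_operator_def by blast

lemma linear_operator_scale:
  "linear_operator H T \<Longrightarrow> (u, v) \<in> T \<Longrightarrow> (hscale H c u, hscale H c v) \<in> T"
  unfolding linear_operator_def by blast

lemma linear_operator_minus:
  "linear_operator H T \<Longrightarrow> (u, v) \<in> T \<Longrightarrow> (x, y) \<in> T \<Longrightarrow> (hminus H u x, hminus H v y) \<in> T"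
  unfolding hminus_def by (intro linear_operator_add linear_operator_scale)

lemma subspace_Domain: assumes T: "linear_operator H T" shows "hsubspace H (Domain T)"
  unfolding hsubspace_def
proof (intro conjI subsetI ballI allI)
  show "hzero H \<in> Domain T" using linear_operator_zero[OF T] by blast
  fix u assume u: "u \<in> Domain T"
  then show "u \<in> hcar H" using linear_operator_carrier[OF T] by blast
  show "hscale H c u \<in> Domain T" for c using linear_operator_scale[OF T] u by blast
  fix v assume "v \<in> Domain T"
  then show "hadd H u v \<in> Domain T" using linear_operator_add[OF T] u by blast
qed

lemma subspace_Range: assumes T: "linear_operator H T" shows "hsubspace H (Range T)"
  unfolding hsubspace_def
proof (intro conjI subsetI ballI allI)
  show "hzero H \<in> Range T" using linear_operator_zero[OF T] by blast
  fix u assume u: "u \<in> Range T"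
  then show "u \<in> hcar H" using linear_operator_carrier[OF T] by blast
  show "hscale H c u \<in> Range T" for c using linear_operator_scale[OF T] u by blast
  fix v assume "v \<in> Range T"
  then show "hadd H u v \<in> Range T" using linear_operator_add[OF T] u by blast
qed

lemma adjointD: "(v, w) \<in> hadjoint H T \<Longrightarrow> (x, y) \<in> T \<Longrightarrow> hinner H y v = hinner H x w"
  unfolding hadjoint_def by blast

lemma adjoint_carrier: "(v, w) \<in> hadjoint H T \<Longrightarrow> v \<in> hcar H \<and> w \<in> hcar H"
  unfolding hadjoint_def by blast

lemma adjointI:
  "v \<in> hcar H \<Longrightarrow> w \<in> hcar H \<Longrightarrow> (\<And>x y. (x, y) \<in> T \<Longrightarrow> hinner H y v = hinner H x w) \<Longrightarrow>
    (v, w) \<in> hadjoint H T"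
  unfolding hadjoint_def by blast

context hilbert_space
begin

lemma add_zero_left [simp]: "u \<in> hcar H \<Longrightarrow> hadd H (hzero H) u = u"
  by (rule vec_eqI) auto

lemma add_zero_right [simp]: "u \<in> hcar H \<Longrightarrow> hadd H u (hzero H) = u"
  by (rule vec_eqI) auto

lemma minus_zero_right [simp]: "u \<in> hcar H \<Longrightarrow> hminus H u (hzero H) = u"
  by (rule vec_eqI) auto

lemma minus_self [simp]: "u \<in> hcar H \<Longrightarrow> hminus H u u = hzero H"
  by (rule vec_eqI) auto

lemma scale_zero [simp]: "hscale H c (hzero H) = hzero H"
  by (rule vec_eqI) auto

lemma add_minus_cancel_left [simp]:
  "u \<in> hcar H \<Longrightarrow> v \<in> hcar H \<Longrightarrow> hminus H (hadd H u v) u = v"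
  by (rule vec_eqI) auto

lemma add_minus_cancel_right [simp]:
  "u \<in> hcar H \<Longrightarrow> v \<in> hcar H \<Longrightarrow> hminus H (hadd H u v) v = u"
  by (rule vec_eqI) auto

lemma add_minus_inverse [simp]:
  "u \<in> hcar H \<Longrightarrow> v \<in> hcar H \<Longrightarrow> hadd H u (hminus H v u) = v"
  by (rule vec_eqI) auto

lemma inner_self_eq_0: "u \<in> hcar H \<Longrightarrow> hinner H u u = 0 \<longleftrightarrow> u = hzero H"
  using inner_self norm_eq_0 by auto

lemma subspace_ker: assumes "linear_operator H T" shows "hsubspace H (hker H T)"
  unfolding hsubspace_def hker_def
proof (intro conjI subsetI ballI allI CollectI; (elim CollectE)?)
  show "(hzero H, hzero H) \<in> T" using linear_operator_zero[OF assms] .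
  fix u assume u: "(u, hzero H) \<in> T"
  then show "u \<in> hcar H" using linear_operator_carrier[OF assms] by blast
  show "(hscale H c u, hzero H) \<in> T" for c using linear_operator_scale[OF assms u, of c] by simp
  fix v assume "(v, hzero H) \<in> T"
  then show "(hadd H u v, hzero H) \<in> T" using linear_operator_add[OF assms u] by fastforce
qed

lemma closed_operator_ker: assumes "closed_operator H T" shows "hclosure H (hker H T) = hker H T"
proof
  have lin: "linear_operator H T" using assms by (simp add: closed_operator_def)
  show "hker H T \<subseteq> hclosure H (hker H T)"
    using closure_subset subspace_ker[OF lin] by (simp add: hsubspace_def)
  show "hclosure H (hker H T) \<subseteq> hker H T"
    using assms conv_const[of "hzero H"] unfolding closed_operator_def hclosure_def hker_def
    by (clarsimp simp del: all_simps)
qed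

lemma perp_dense:
  assumes "densely_defined H T" "Domain T \<subseteq> hcar H" "x \<in> perp (Domain T)"
  shows "x = hzero H"
proof -
  have x: "x \<in> hcar H" using assms perp_carrier by blast
  have "x \<in> perp (hclosure H (Domain T))" using assms perp_closure by simp
  then have "hinner H x x = 0" using assms x by (auto simp: densely_defined_def perp_def)
  then show ?thesis using inner_self_eq_0 x by blast
qed

text \<open>Two values of the adjoint at the same vector differ by an element orthogonal to
  \<open>Domain T\<close>, so density gives single-valuedness; closedness is continuity of the inner
  product.\<close>

lemma closed_operator_adjoint:
  assumes T: "T \<subseteq> hcar H \<times> hcar H" and dense: "densely_defined H T"
  shows "closed_operator H (hadjoint H T)"
  unfolding closed_operator_def linear_operator_def
proof (intro conjI allI impI)
  have Tc: "\<And>x y. (x, y) \<in> T \<Longrightarrow> x \<in> hcar H \<and> y \<in> hcar H" using T by blast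
  show "hadjoint H T \<subseteq> hcar H \<times> hcar H" unfolding hadjoint_def by blast
  show "single_valued (hadjoint H T)"
  proof (rule single_valuedI)
    fix v w w' assume a: "(v, w) \<in> hadjoint H T" "(v, w') \<in> hadjoint H T"
    have c: "w \<in> hcar H" "w' \<in> hcar H" using a adjoint_carrier by metis+
    have "hminus H w w' \<in> perp (Domain T)"
      using a[THEN adjointD] c Tc by (auto simp: perp_def)
    then have "hminus H w w' = hzero H" using perp_dense[OF dense] T by blast
    then show "w = w'" using c norm_minus_eq_0 by (metis norm_zero)
  qed
  show "(hzero H, hzero H) \<in> hadjoint H T" using Tc by (intro adjointI) auto
  show "\<forall>(u, v)\<in>hadjoint H T. \<forall>(x, y)\<in>hadjoint H T. (hadd H u x, hadd H v y) \<in> hadjoint H T"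
  proof clarify
    fix u v x y assume a: "(u, v) \<in> hadjoint H T" "(x, y) \<in> hadjoint H T"
    then show "(hadd H u x, hadd H v y) \<in> hadjoint H T"
      using adjoint_carrier[OF a(1)] adjoint_carrier[OF a(2)] Tc adjointD[OF a(1)] adjointD[OF a(2)]
      by (intro adjointI) auto
  qed
  show "\<forall>(u, v)\<in>hadjoint H T. (hscale H c u, hscale H c v) \<in> hadjoint H T" for c
  proof clarify
    fix u v assume a: "(u, v) \<in> hadjoint H T"
    then show "(hscale H c u, hscale H c v) \<in> hadjoint H T"
      using adjoint_carrier[OF a(1)] Tc adjointD[OF a(1)]
      by (intro adjointI) auto
  qed
  fix xs ys u v
  assume A: "(\<forall>n. (xs n, ys n) \<in> hadjoint H T) \<and> u \<in> hcar H \<and> v \<in> hcar H \<and> hconv H xs u \<and> hconv H ys v"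
  have c: "\<And>n. xs n \<in> hcar H" "\<And>n. ys n \<in> hcar H" using A adjoint_carrier by metis+
  show "(u, v) \<in> hadjoint H T"
  proof (intro adjointI)
    fix x y assume xy: "(x, y) \<in> T"
    have "(\<lambda>n. hinner H y (xs n)) \<longlonglongrightarrow> hinner H y u"
      using A c Tc[OF xy] by (intro conv_inner_right) auto
    moreover have "(\<lambda>n. hinner H x (ys n)) \<longlonglongrightarrow> hinner H x v"
      using A c Tc[OF xy] by (intro conv_inner_right) auto
    moreover have "hinner H y (xs n) = hinner H x (ys n)" for n using adjointD A xy by metis
    ultimately show "hinner H y u = hinner H x v" using LIMSEQ_unique by auto
  qed (use A in auto)
qed

lemma ker_adjoint:
  assumes T: "T \<subseteq> hcar H \<times> hcar H" shows "hker H (hadjoint H T) = perp (Range T)"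
  using T unfolding hker_def hadjoint_def perp_def by fastforce

end

section \<open>Graphs as subspaces of the product space, and the double adjoint\<close>

definition product_hilb :: "'v hilb \<Rightarrow> ('v \<times> 'v) hilb" where
  "product_hilb H = \<lparr>
     hcar = hcar H \<times> hcar H,
     hadd = (\<lambda>p q. (hadd H (fst p) (fst q), hadd H (snd p) (snd q))),
     hzero = (hzero H, hzero H),
     hscale = (\<lambda>c p. (hscale H c (fst p), hscale H c (snd p))),
     hinner = (\<lambda>p q. hinner H (fst p) (fst q) + hinner H (snd p) (snd q)) \<rparr>"

context hilbert_space
begin

lemma product_minus:
  "hminus (product_hilb H) p q = (hminus H (fst p) (fst q), hminus H (snd p) (snd q))"
  by (simp add: hminus_def product_hilb_def)

lemma product_norm:
  "p \<in> hcar H \<times> hcar H \<Longrightarrow> hnorm (product_hilb H) p = sqrt ((hnorm H (fst p))\<^sup>2 + (hnorm H (snd p))\<^sup>2)"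
  by (auto simp: hnorm_def product_hilb_def inner_self_nonneg)

lemma product_conv:
  assumes "\<And>n. xs n \<in> hcar H \<times> hcar H" "u \<in> hcar H \<times> hcar H"
  shows "hconv (product_hilb H) xs u \<longleftrightarrow> hconv H (\<lambda>n. fst (xs n)) (fst u) \<and> hconv H (\<lambda>n. snd (xs n)) (snd u)"
proof -
  have c: "fst (xs n) \<in> hcar H" "snd (xs n) \<in> hcar H" "fst u \<in> hcar H" "snd u \<in> hcar H" for n
    using assms(1)[of n] assms(2) by (auto simp: mem_Times_iff)
  define a where "a n = hnorm H (hminus H (fst (xs n)) (fst u))" for n
  define b where "b n = hnorm H (hminus H (snd (xs n)) (snd u))" for n
  have ab: "0 \<le> a n" "0 \<le> b n" for n using c by (auto simp: a_def b_def)
  have n: "hnorm (product_hilb H) (hminus (product_hilb H) (xs n) u) = sqrt ((a n)\<^sup>2 + (b n)\<^sup>2)" for n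
    using c by (simp add: product_norm product_minus a_def b_def)
  have "(\<lambda>n. sqrt ((a n)\<^sup>2 + (b n)\<^sup>2)) \<longlonglongrightarrow> 0 \<longleftrightarrow> a \<longlonglongrightarrow> 0 \<and> b \<longlonglongrightarrow> 0"
  proof (intro iffI conjI)
    assume L: "(\<lambda>n. sqrt ((a n)\<^sup>2 + (b n)\<^sup>2)) \<longlonglongrightarrow> 0"
    show "a \<longlonglongrightarrow> 0" "b \<longlonglongrightarrow> 0"
      by (rule Lim_null_comparison[OF _ L]; use ab in \<open>simp add: real_le_rsqrt\<close>)+
  next
    assume "a \<longlonglongrightarrow> 0 \<and> b \<longlonglongrightarrow> 0"
    then have "(\<lambda>n. sqrt ((a n)\<^sup>2 + (b n)\<^sup>2)) \<longlonglongrightarrow> sqrt (0\<^sup>2 + 0\<^sup>2)"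
      by (intro tendsto_intros) auto
    then show "(\<lambda>n. sqrt ((a n)\<^sup>2 + (b n)\<^sup>2)) \<longlonglongrightarrow> 0" by simp
  qed
  then show ?thesis unfolding hconv_def n a_def b_def by simp
qed

lemma product_hilbert_space: "hilbert_space (product_hilb H)"
proof
  fix xs :: "nat \<Rightarrow> 'v \<times> 'v"
  let ?P = "product_hilb H"
  assume xs: "\<And>n. xs n \<in> hcar ?P"
    and cauchy: "\<And>e. 0 < e \<Longrightarrow> \<exists>N. \<forall>m\<ge>N. \<forall>n\<ge>N. hnorm ?P (hminus ?P (xs m) (xs n)) < e"
  have c: "fst (xs n) \<in> hcar H" "snd (xs n) \<in> hcar H" for n
    using xs[of n] by (auto simp: product_hilb_def)
  have le: "hnorm H (hminus H (fst (xs m)) (fst (xs n))) \<le> hnorm ?P (hminus ?P (xs m) (xs n))"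
    "hnorm H (hminus H (snd (xs m)) (snd (xs n))) \<le> hnorm ?P (hminus ?P (xs m) (xs n))" for m n
    using c by (simp_all add: product_norm product_minus real_le_rsqrt)
  have "\<exists>u\<in>hcar H. hconv H (\<lambda>n. fst (xs n)) u"
  proof (rule complete[OF c(1)])
    fix e :: real assume "0 < e"
    then show "\<exists>N. \<forall>m\<ge>N. \<forall>n\<ge>N. hnorm H (hminus H (fst (xs m)) (fst (xs n))) < e"
      using cauchy le(1) le_less_trans by meson
  qed
  moreover have "\<exists>u\<in>hcar H. hconv H (\<lambda>n. snd (xs n)) u"
  proof (rule complete[OF c(2)])
    fix e :: real assume "0 < e"
    then show "\<exists>N. \<forall>m\<ge>N. \<forall>n\<ge>N. hnorm H (hminus H (snd (xs m)) (snd (xs n))) < e"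
      using cauchy le(2) le_less_trans by meson
  qed
  ultimately obtain u v where uv: "u \<in> hcar H" "v \<in> hcar H" "hconv H (\<lambda>n. fst (xs n)) u" "hconv H (\<lambda>n. snd (xs n)) v"
    by blast
  have "hconv ?P xs (u, v)"
    by (subst product_conv) (use uv xs in \<open>auto simp: product_hilb_def\<close>)
  then show "\<exists>u\<in>hcar ?P. hconv ?P xs u"
    using uv by (intro bexI[of _ "(u, v)"]) (auto simp: product_hilb_def)
next
  let ?P = "product_hilb H"
  fix u v assume u: "u \<in> hcar ?P" "v \<in> hcar ?P" and e: "hinner ?P (hminus ?P u v) (hminus ?P u v) = 0"
  have c: "fst u \<in> hcar H" "snd u \<in> hcar H" "fst v \<in> hcar H" "snd v \<in> hcar H"
    using u by (auto simp: product_hilb_def)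
  have "(hnorm H (hminus H (fst u) (fst v)))\<^sup>2 + (hnorm H (hminus H (snd u) (snd v)))\<^sup>2 = 0"
    using e product_norm[of "hminus ?P u v"] c
    by (simp add: product_minus hnorm_def[of ?P] real_sqrt_eq_zero_cancel_iff)
  then have "hnorm H (hminus H (fst u) (fst v)) = 0" "hnorm H (hminus H (snd u) (snd v)) = 0"
    by (auto simp: sum_power2_eq_zero_iff)
  then show "u = v" using c norm_minus_eq_0 by (auto simp: prod_eq_iff)
next
  let ?P = "product_hilb H"
  fix u v assume u: "u \<in> hcar ?P" "v \<in> hcar ?P"
  then have c: "fst u \<in> hcar H" "snd u \<in> hcar H" "fst v \<in> hcar H" "snd v \<in> hcar H"
    by (auto simp: product_hilb_def)
  show "hinner ?P u v = cnj (hinner ?P v u)"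
    using inner_commute[OF c(1,3)] inner_commute[OF c(2,4)] by (simp add: product_hilb_def)
qed (auto simp: product_hilb_def inner_self_nonneg algebra_simps)

text \<open>Von Neumann's graph argument: a closed operator is a closed subspace of the product, so
  a pair \<open>(a, b)\<close> of the double adjoint can be projected onto it. The residual
  \<open>(p, q)\<close>, rotated, belongs to the adjoint, and this forces it to be zero.\<close>

lemma biadjoint_subset:
  assumes T: "closed_operator H T"
  shows "hadjoint H (hadjoint H T) \<subseteq> T"
proof clarify
  interpret P: hilbert_space "product_hilb H" by (rule product_hilbert_space)
  have lin: "linear_operator H T" using T by (simp add: closed_operator_def)
  have Tc: "T \<subseteq> hcar H \<times> hcar H" using lin by (simp add: linear_operator_def)
  have S: "hsubspace (product_hilb H) T"
    unfolding hsubspace_def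
    using linear_operator_zero[OF lin] linear_operator_add[OF lin] linear_operator_scale[OF lin] Tc
    by (auto simp: product_hilb_def)
  have cl: "hclosure (product_hilb H) T \<subseteq> T"
  proof
    fix p assume "p \<in> hclosure (product_hilb H) T"
    then obtain xs where xs: "p \<in> hcar (product_hilb H)" "\<And>n. xs n \<in> T" "hconv (product_hilb H) xs p"
      by (auto simp: hclosure_def)
    then have "hconv H (\<lambda>n. fst (xs n)) (fst p)" "hconv H (\<lambda>n. snd (xs n)) (snd p)"
      using product_conv[of xs p] Tc by (auto simp: product_hilb_def)
    moreover have "\<forall>n. (fst (xs n), snd (xs n)) \<in> T" using xs by simp
    moreover have "fst p \<in> hcar H" "snd p \<in> hcar H" using xs(1) by (auto simp: product_hilb_def)
    ultimately have "(fst p, snd p) \<in> T"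
      using T unfolding closed_operator_def by meson
    then show "p \<in> T" by simp
  qed
  fix a b assume ab: "(a, b) \<in> hadjoint H (hadjoint H T)"
  have abc: "a \<in> hcar H" "b \<in> hcar H" using adjoint_carrier[OF ab] by auto
  obtain z where z: "z \<in> T" "\<forall>s\<in>T. hinner (product_hilb H) (hminus (product_hilb H) (a, b) z) s = 0"
    using P.closed_projection_exists[OF S cl, of "(a, b)"] abc by (auto simp: product_hilb_def)
  obtain x y where xy: "z = (x, y)" by (cases z)
  define p where "p = hminus H a x"
  define q where "q = hminus H b y"
  have xyc: "x \<in> hcar H" "y \<in> hcar H" using z xy Tc by auto
  have pq: "p \<in> hcar H" "q \<in> hcar H" using abc xyc by (auto simp: p_def q_def)
  have orth: "hinner H s p + hinner H t q = 0" if st: "(s, t) \<in> T" for s t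
  proof -
    have c: "s \<in> hcar H" "t \<in> hcar H" using st Tc by auto
    have "hinner H p s + hinner H q t = 0"
      using z(2) st by (auto simp: product_minus xy p_def q_def) (auto simp: product_hilb_def)
    then show ?thesis
      using inner_commute[OF c(1) pq(1)] inner_commute[OF c(2) pq(2)] by (metis complex_cnj_add complex_cnj_zero)
  qed
  \<comment> \<open>Orthogonality of \<open>(p, q)\<close> to the graph, read as an equation between
    the two inner products, is the defining property of the adjoint at \<open>q\<close> with value
    \<open>-p\<close>.\<close>
  have "(q, hscale H (-1) p) \<in> hadjoint H T"
  proof (rule adjointI)
    fix s t assume st: "(s, t) \<in> T"
    have c: "s \<in> hcar H" "t \<in> hcar H" using st Tc by auto
    show "hinner H t q = hinner H s (hscale H (-1) p)"
      using orth[OF st] c pq by (simp add: eq_neg_iff_add_eq_0 add.commute)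
  qed (use pq in auto)
  then have "hinner H (hscale H (-1) p) a = hinner H q b" by (rule adjointD[OF ab])
  then have 1: "hinner H p a + hinner H q b = 0" using pq abc by (simp add: add_eq_0_iff)
  have "hinner H x p + hinner H y q = 0" using orth z xy by blast
  then have 2: "hinner H p x + hinner H q y = 0"
    using inner_commute[OF pq(1) xyc(1)] inner_commute[OF pq(2) xyc(2)] by (metis complex_cnj_add complex_cnj_zero)
  have "hinner H p p + hinner H q q = (hinner H p a + hinner H q b) - (hinner H p x + hinner H q y)"
    using pq abc xyc by (simp add: p_def q_def)
  then have "hinner H p p + hinner H q q = 0" using 1 2 by simp
  then have "(hnorm H p)\<^sup>2 + (hnorm H q)\<^sup>2 = 0"
    using pq by (simp only: inner_self flip: of_real_add) (metis of_real_eq_0_iff)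
  then have "hnorm H p = 0" "hnorm H q = 0" by (auto simp: sum_power2_eq_zero_iff)
  then have "a = x" "b = y" using norm_minus_eq_0 abc xyc by (auto simp: p_def q_def)
  then show "(a, b) \<in> T" using z xy by simp
qed

end

section \<open>Self-adjoint operators: resolvents, kernels and ranges of powers\<close>

context hilbert_space
begin

lemma subspace_subset: "hsubspace H S \<Longrightarrow> S \<subseteq> hcar H"
  by (simp add: hsubspace_def)

lemma self_adjoint_closed:
  assumes "self_adjoint H T" shows "closed_operator H T"
proof -
  have "closed_operator H (hadjoint H T)"
    using assms by (intro closed_operator_adjoint) (auto simp: self_adjoint_def linear_operator_def)
  then show ?thesis using assms by (simp add: self_adjoint_def)
qed

lemma self_adjoint_symmetric:
  assumes "self_adjoint H T" "(u, v) \<in> T" "(x, y) \<in> T"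
  shows "hinner H v x = hinner H u y"
  using assms adjointD[of x y H T u v] by (simp add: self_adjoint_def)

text \<open>\<open>hinner H v u\<close> is real, so pairing \<open>\<zeta> u - v\<close> with
  \<open>u\<close> has imaginary part \<open>Im \<zeta>\<close> times the squared norm of
  \<open>u\<close>; Cauchy-Schwarz and cancelling one factor \<open>hnorm H u\<close> give the
  bound.\<close>

lemma self_adjoint_Im_bound:
  assumes T: "self_adjoint H T" and uv: "(u, v) \<in> T"
  shows "\<bar>Im \<zeta>\<bar> * hnorm H u \<le> hnorm H (hminus H (hscale H \<zeta> u) v)"
proof -
  have lin: "linear_operator H T" using T by (simp add: self_adjoint_def)
  have c: "u \<in> hcar H" "v \<in> hcar H" using linear_operator_carrier[OF lin uv] by auto
  have "hinner H v u = cnj (hinner H v u)"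
    using self_adjoint_symmetric[OF T uv uv] inner_commute[OF c] by simp
  then have "Im (hinner H v u) = 0" by (metis Reals_cnj_iff complex_is_Real_iff)
  then have "Im (hinner H (hminus H (hscale H \<zeta> u) v) u) = Im \<zeta> * (hnorm H u)\<^sup>2"
    using c by (simp add: inner_self)
  then have "\<bar>Im \<zeta>\<bar> * (hnorm H u)\<^sup>2 \<le> cmod (hinner H (hminus H (hscale H \<zeta> u) v) u)"
    by (metis abs_Im_le_cmod abs_mult abs_power2)
  also have "\<dots> \<le> hnorm H (hminus H (hscale H \<zeta> u) v) * hnorm H u"
    using c by (intro cauchy_schwarz) auto
  finally have "(\<bar>Im \<zeta>\<bar> * hnorm H u) * hnorm H u \<le> hnorm H (hminus H (hscale H \<zeta> u) v) * hnorm H u"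
    by (simp add: power2_eq_square mult.assoc)
  then show ?thesis
    using c norm_nonneg[OF c(1)] by (cases "hnorm H u = 0") (auto simp: mult_le_cancel_right)
qed

text \<open>The range of \<open>\<zeta> - T\<close> is dense, because a vector orthogonal to it
  would be an eigenvector of \<open>T\<close> with the non-real eigenvalue
  \<open>cnj \<zeta>\<close>. It is closed, because the lower bound turns a convergent sequence of
  images into a Cauchy sequence of preimages and \<open>T\<close> is closed.\<close>

lemma self_adjoint_resolvent_surj:
  assumes T: "self_adjoint H T" and \<zeta>: "Im \<zeta> \<noteq> 0" and w: "w \<in> hcar H"
  shows "\<exists>u v. (u, v) \<in> T \<and> hminus H (hscale H \<zeta> u) v = w"
proof -
  have lin: "linear_operator H T" using T by (simp add: self_adjoint_def)
  note Tc = linear_operator_carrier[OF lin]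
  have cl: "closed_operator H T" by (rule self_adjoint_closed[OF T])
  define R where "R = {hminus H (hscale H \<zeta> u) v | u v. (u, v) \<in> T}"
  have RI: "hminus H (hscale H \<zeta> u) v \<in> R" if "(u, v) \<in> T" for u v using that by (auto simp: R_def)
  have Rc: "R \<subseteq> hcar H" using Tc by (auto simp: R_def)
  have sub: "hsubspace H R"
    unfolding hsubspace_def
  proof (intro conjI ballI allI)
    have "hminus H (hscale H \<zeta> (hzero H)) (hzero H) \<in> R" by (rule RI[OF linear_operator_zero[OF lin]])
    then show "hzero H \<in> R" by simp
    fix x assume "x \<in> R"
    then obtain u v where x: "x = hminus H (hscale H \<zeta> u) v" "(u, v) \<in> T" by (auto simp: R_def)
    { fix c
      have "hscale H c x = hminus H (hscale H \<zeta> (hscale H c u)) (hscale H c v)"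
        by (rule vec_eqI) (use x Tc[OF x(2)] in \<open>auto simp: algebra_simps\<close>)
      then show "hscale H c x \<in> R" using RI[OF linear_operator_scale[OF lin x(2), of c]] by simp }
    fix y assume "y \<in> R"
    then obtain u' v' where y: "y = hminus H (hscale H \<zeta> u') v'" "(u', v') \<in> T" by (auto simp: R_def)
    have "hadd H x y = hminus H (hscale H \<zeta> (hadd H u u')) (hadd H v v')"
      by (rule vec_eqI) (use x y Tc[OF x(2)] Tc[OF y(2)] in \<open>auto simp: algebra_simps\<close>)
    then show "hadd H x y \<in> R" using RI[OF linear_operator_add[OF lin x(2) y(2)]] by simp
  qed (rule Rc)
  have "perp R \<subseteq> {hzero H}"
  proof
    fix z assume z: "z \<in> perp R"
    have zc: "z \<in> hcar H" using z perp_carrier by blast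
    have "(z, hscale H (cnj \<zeta>) z) \<in> hadjoint H T"
    proof (rule adjointI)
      fix x y assume xy: "(x, y) \<in> T"
      have "hinner H (hminus H (hscale H \<zeta> x) y) z = 0" using RI[OF xy] z by (auto simp: perp_def)
      then show "hinner H y z = hinner H x (hscale H (cnj \<zeta>) z)" using Tc[OF xy] zc by simp
    qed (use zc in auto)
    then have "(z, hscale H (cnj \<zeta>) z) \<in> T" using T by (simp add: self_adjoint_def)
    then have "\<bar>Im (cnj \<zeta>)\<bar> * hnorm H z \<le> 0"
      using self_adjoint_Im_bound[OF T, of z _ "cnj \<zeta>"] zc by fastforce
    then have "hnorm H z = 0" using \<zeta> norm_nonneg[OF zc] by (simp add: mult_le_0_iff)
    then show "z \<in> {hzero H}" using norm_eq_0 zc by simp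
  qed
  then have "w \<in> hclosure H R" using dense_iff[OF sub] w by simp
  then obtain ws where ws: "\<And>n. ws n \<in> R" "hconv H ws w" by (auto simp: hclosure_def)
  have "\<exists>u v. (u, v) \<in> T \<and> ws n = hminus H (hscale H \<zeta> u) v" for n using ws(1)[of n] by (auto simp: R_def)
  then obtain us vs where uv: "\<And>n. (us n, vs n) \<in> T" "\<And>n. ws n = hminus H (hscale H \<zeta> (us n)) (vs n)" by metis
  have c: "us n \<in> hcar H" "vs n \<in> hcar H" "ws n \<in> hcar H" for n using Tc[OF uv(1)[of n]] uv(2)[of n] by auto
  have bound: "\<bar>Im \<zeta>\<bar> * hnorm H (hminus H (us m) (us n)) \<le> hnorm H (hminus H (ws m) (ws n))" for m n
  proof -
    have "hminus H (ws m) (ws n) = hminus H (hscale H \<zeta> (hminus H (us m) (us n))) (hminus H (vs m) (vs n))"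
      by (rule vec_eqI) (use c uv(2) in \<open>auto simp: algebra_simps\<close>)
    then show ?thesis
      using self_adjoint_Im_bound[OF T linear_operator_minus[OF lin uv(1) uv(1)]] by simp
  qed
  have "\<exists>u\<in>hcar H. hconv H us u"
  proof (rule complete[OF c(1)])
    fix e :: real assume e: "0 < e"
    then have "\<forall>\<^sub>F n in sequentially. hnorm H (hminus H (ws n) w) < \<bar>Im \<zeta>\<bar> * e / 2"
      using ws(2) \<zeta> unfolding hconv_def by (intro order_tendstoD) auto
    then obtain N where N: "\<And>n. n \<ge> N \<Longrightarrow> hnorm H (hminus H (ws n) w) < \<bar>Im \<zeta>\<bar> * e / 2"
      by (auto simp: eventually_sequentially)
    have "hnorm H (hminus H (us m) (us n)) < e" if "m \<ge> N" "n \<ge> N" for m n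
    proof -
      have "\<bar>Im \<zeta>\<bar> * hnorm H (hminus H (us m) (us n)) < \<bar>Im \<zeta>\<bar> * e"
        using bound[of m n] N[OF that(1)] N[OF that(2)] norm_triangle_minus[of "ws m" w "ws n"]
          norm_minus_commute[of w "ws n"] c w by fastforce
      then show ?thesis using \<zeta> by simp
    qed
    then show "\<exists>N. \<forall>m\<ge>N. \<forall>n\<ge>N. hnorm H (hminus H (us m) (us n)) < e" by blast
  qed
  then obtain u where u: "u \<in> hcar H" "hconv H us u" by blast
  \<comment> \<open>The only possible value of \<open>T u\<close>, solved from
    \<open>\<zeta> u - v = w\<close>.\<close>
  define v where "v = hadd H (hscale H \<zeta> u) (hscale H (-1) w)"
  have vs: "vs = (\<lambda>n. hadd H (hscale H \<zeta> (us n)) (hscale H (-1) (ws n)))"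
    by (rule ext, rule vec_eqI) (use c uv(2) in auto)
  have "hconv H vs v"
    unfolding vs v_def using u c ws w by (intro conv_add conv_scale) auto
  then have "(u, v) \<in> T"
    using cl uv(1) u w unfolding closed_operator_def v_def by (meson add_closed scale_closed)
  moreover have "hminus H (hscale H \<zeta> u) v = w"
    by (rule vec_eqI) (use u w in \<open>auto simp: v_def\<close>)
  ultimately show ?thesis by blast
qed

text \<open>If \<open>T (T u) = 0\<close>, symmetry gives that \<open>T u\<close> has inner product
  0 with itself; so nothing new enters the kernel at the second power, and induction handles the
  rest.\<close>

lemma self_adjoint_ker_pow:
  assumes T: "self_adjoint H T" and k: "1 \<le> k"
  shows "hker H (T ^^ k) = hker H T"
  using k
proof (induction k rule: nat_induct_at_least)
  case (Suc k)
  have lin: "linear_operator H T" using T by (simp add: self_adjoint_def)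
  note Tc = linear_operator_carrier[OF lin]
  have "hker H (T ^^ Suc k) = {u. \<exists>v. (u, v) \<in> T \<and> v \<in> hker H (T ^^ k)}"
    unfolding hker_def using relpow_Suc_D2[of _ _ k T] relpow_Suc_I2[of _ _ T _ k] by blast
  also have "\<dots> = {u. \<exists>v. (u, v) \<in> T \<and> v \<in> hker H T}" using Suc.IH by simp
  also have "\<dots> = hker H T"
  proof (intro equalityI subsetI; clarsimp simp: hker_def)
    fix u v assume uv: "(u, v) \<in> T" "(v, hzero H) \<in> T"
    have "hinner H v v = 0"
      using self_adjoint_symmetric[OF T uv] Tc[OF uv(1)] by simp
    then show "(u, hzero H) \<in> T" using inner_self_eq_0 Tc uv by metis
  next
    fix u assume "(u, hzero H) \<in> T"
    then show "\<exists>v. (u, v) \<in> T \<and> (v, hzero H) \<in> T" using linear_operator_zero[OF lin] by blast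
  qed
  finally show ?case .
qed simp

text \<open>The hypothesis says \<open>w = (T + c)^-1 u\<close>, written without an inverse as
  \<open>T w = u - c w\<close>. The conclusion says that this resolvent commutes with
  \<open>T ^^ l\<close>.\<close>

lemma resolvent_relpow:
  assumes lin: "linear_operator H T" and "(u, x) \<in> T ^^ l" "(w, hminus H u (hscale H c w)) \<in> T"
  shows "\<exists>z. (w, z) \<in> T ^^ l \<and> (z, hminus H x (hscale H c z)) \<in> T"
  using assms(2)
proof (induction l arbitrary: x)
  case 0
  then show ?case using assms(3) by auto
next
  case (Suc l)
  then obtain y where y: "(u, y) \<in> T ^^ l" "(y, x) \<in> T" by auto
  obtain z where z: "(w, z) \<in> T ^^ l" "(z, hminus H y (hscale H c z)) \<in> T" using Suc.IH[OF y(1)] by blast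
  have "(hminus H y (hscale H c z), hminus H x (hscale H c (hminus H y (hscale H c z)))) \<in> T"
    by (intro linear_operator_minus[OF lin] linear_operator_scale[OF lin] y z)
  then show ?case using z by auto
qed

text \<open>\<open>T\<^sup>l u\<close> is the limit of \<open>T\<^sup>l\<^sup>+\<^sup>1 (T + it)\<^sup>-\<^sup>1 u\<close> as \<open>t\<close> tends to \<open>0\<close>.\<close>

lemma self_adjoint_closure_range_pow:
  assumes T: "self_adjoint H T" and l: "1 \<le> l"
  shows "hclosure H (Range (T ^^ l)) = hclosure H (Range T)"
  using l
proof (induction l rule: nat_induct_at_least)
  case (Suc l)
  have lin: "linear_operator H T" using T by (simp add: self_adjoint_def)
  note Tc = linear_operator_carrier[OF lin]
  obtain l' where l': "l = Suc l'" using Suc.hyps by (cases l) auto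
  have RTc: "Range T \<subseteq> hcar H" using Tc by auto
  have Rc: "Range (T ^^ Suc l) \<subseteq> hcar H" using Tc by auto
  have "Range (T ^^ l) \<subseteq> hclosure H (Range (T ^^ Suc l))"
  proof
    fix x assume "x \<in> Range (T ^^ l)"
    then obtain u where u: "(u, x) \<in> T ^^ l" by blast
    then obtain y where y: "(u, y) \<in> T ^^ l'" "(y, x) \<in> T" using l' by auto
    have uc: "u \<in> hcar H"
      using u l' Tc by (metis relpow_Suc_D2)
    have xyc: "x \<in> hcar H" "y \<in> hcar H" using Tc y by auto
    have "\<exists>s\<in>Range (T ^^ Suc l). hnorm H (hminus H s x) < e" if e: "0 < e" for e
    proof -
      \<comment> \<open>Chosen so that \<open>2 * hnorm H y * t < e\<close>; the summand 1 covers
        \<open>y = 0\<close>.\<close>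
      define t where "t = e / (2 * hnorm H y + 1)"
      have t: "0 < t" "2 * hnorm H y * t < e"
        using e norm_nonneg[OF xyc(2)] by (auto simp: t_def field_simps add_nonneg_pos)
      obtain w v where w: "(w, v) \<in> T" "hminus H (hscale H (- \<i> * t) w) v = hscale H (-1) u"
        using self_adjoint_resolvent_surj[OF T, of "- \<i> * t" "hscale H (-1) u"] t uc by auto
      have wc: "w \<in> hcar H" "v \<in> hcar H" using Tc w by auto
      have "v = hminus H u (hscale H (\<i> * t) w)"
      proof (rule vec_eqI)
        fix a assume a: "a \<in> hcar H"
        have "hinner H (hminus H (hscale H (- \<i> * t) w) v) a = hinner H (hscale H (-1) u) a" using w by simp
        then show "hinner H v a = hinner H (hminus H u (hscale H (\<i> * t) w)) a"
          using a uc wc by (simp add: algebra_simps)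
      qed (use wc uc in auto)
      then have wT: "(w, hminus H u (hscale H (\<i> * t) w)) \<in> T" using w by simp
      obtain z where z: "(w, z) \<in> T ^^ l'" "(z, hminus H y (hscale H (\<i> * t) z)) \<in> T"
        using resolvent_relpow[OF lin y(1) wT] by blast
      define z' where "z' = hminus H y (hscale H (\<i> * t) z)"
      \<comment> \<open>Here \<open>z = (T + it)^-1 y\<close>, \<open>z' = T z\<close> and
        \<open>s = T z'\<close>. Since \<open>x = T y\<close>, the error \<open>s - x\<close> is
        \<open>-it z'\<close>, and \<open>z'\<close> has norm at most \<open>2 * hnorm H y\<close>
        uniformly in \<open>t\<close>. The step uses that \<open>x\<close> has a preimage
        \<open>y\<close>, which is why \<open>l\<close> is at least 1.\<close>
      define s where "s = hminus H x (hscale H (\<i> * t) z')"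
      have zc: "z \<in> hcar H" "z' \<in> hcar H" using Tc z z'_def by auto
      have "(z', s) \<in> T"
        unfolding z'_def s_def by (intro linear_operator_minus[OF lin] linear_operator_scale[OF lin] y z)
      then have "(w, s) \<in> T ^^ Suc l" using z by (auto simp: z'_def l')
      moreover have "hnorm H (hminus H s x) < e"
      proof -
        have "\<bar>Im (- \<i> * t)\<bar> * hnorm H z \<le> hnorm H (hminus H (hscale H (- \<i> * t) z) z')"
          using self_adjoint_Im_bound[OF T z(2), of "- \<i> * t"] z'_def by simp
        moreover have "hminus H (hscale H (- \<i> * t) z) z' = hscale H (-1) y"
          by (rule vec_eqI) (use zc xyc in \<open>auto simp: z'_def\<close>)
        ultimately have tz: "t * hnorm H z \<le> hnorm H y" using t xyc by simp
        have "hnorm H z' \<le> hnorm H y + hnorm H (hscale H (- \<i> * t) z)"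
        proof -
          have "z' = hadd H y (hscale H (- \<i> * t) z)"
            by (rule vec_eqI) (use zc xyc in \<open>auto simp: z'_def\<close>)
          then show ?thesis using norm_triangle[of y "hscale H (- \<i> * t) z"] xyc zc by simp
        qed
        then have z'2: "hnorm H z' \<le> 2 * hnorm H y" using tz t zc by (simp add: norm_mult)
        have "hminus H s x = hscale H (- \<i> * t) z'"
          by (rule vec_eqI) (use zc xyc in \<open>auto simp: s_def\<close>)
        then have "hnorm H (hminus H s x) = t * hnorm H z'" using zc t by (simp add: norm_mult)
        also have "\<dots> \<le> t * (2 * hnorm H y)" using z'2 t by simp
        also have "\<dots> < e" using t by (simp add: mult.commute mult.left_commute)
        finally show ?thesis .
      qed
      ultimately show ?thesis by blast
    qed
    then show "x \<in> hclosure H (Range (T ^^ Suc l))" using closure_iff[OF Rc] xyc by blast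
  qed
  then have "hclosure H (Range (T ^^ l)) \<subseteq> hclosure H (Range (T ^^ Suc l))"
    by (metis closure_mono closure_closure Rc)
  moreover have "hclosure H (Range (T ^^ Suc l)) \<subseteq> hclosure H (Range T)"
    by (rule closure_mono) auto
  ultimately show ?case using Suc.IH by blast
qed simp

end

section \<open>Bisectors, and bisectoriality in an equivalent norm\<close>

text \<open>Outside the bisector the absolute value of \<open>Arg \<zeta>\<close> lies strictly
  between \<open>\<theta>\<close> and \<open>pi - \<theta>\<close>, where the sine is at least
  \<open>sin \<theta>\<close>. This converts bounds in terms of \<open>Im \<zeta>\<close> into
  bounds in terms of \<open>cmod \<zeta>\<close>.\<close>

lemma Im_ge_outside_bisector:
  assumes \<theta>: "0 < \<theta>" "\<theta> < pi / 2" and \<zeta>: "\<zeta> \<notin> bisector \<theta>"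
  shows "cmod \<zeta> * sin \<theta> \<le> \<bar>Im \<zeta>\<bar>"
proof -
  have z: "\<zeta> \<noteq> 0" "\<theta> < \<bar>Arg \<zeta>\<bar>" "\<theta> < \<bar>Arg (-\<zeta>)\<bar>" using \<zeta> by (auto simp: bisector_def)
  define a where "a = \<bar>Arg \<zeta>\<bar>"
  have a: "\<theta> < a" "a < pi - \<theta>"
    using z Arg_minus[OF z(1)] mpi_less_Arg[of \<zeta>] Arg_le_pi[of \<zeta>] by (auto simp: a_def split: if_splits)
  have "sin \<theta> \<le> sin a"
  proof (cases "a \<le> pi / 2")
    case True then show ?thesis using a \<theta> by (intro sin_monotone_2pi_le) auto
  next
    case False
    have "sin \<theta> \<le> sin (pi - a)" using a \<theta> False by (intro sin_monotone_2pi_le) auto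
    then show ?thesis by simp
  qed
  also have "\<dots> = \<bar>sin (Arg \<zeta>)\<bar>"
  proof -
    have "0 \<le> sin a" using a \<theta> by (intro sin_ge_zero) auto
    then show ?thesis by (auto simp: a_def abs_if split: if_splits)
  qed
  finally have "cmod \<zeta> * sin \<theta> \<le> cmod \<zeta> * \<bar>sin (Arg \<zeta>)\<bar>" by (simp add: mult_left_mono)
  also have "\<dots> = \<bar>Im \<zeta>\<bar>"
  proof -
    have "Im \<zeta> = cmod \<zeta> * sin (Arg \<zeta>)" using rcis_cmod_Arg[of \<zeta>] by (metis Im_rcis)
    then show ?thesis by (simp add: abs_mult)
  qed
  finally show ?thesis .
qed

lemma Im_0_in_bisector: "Im \<zeta> = 0 \<Longrightarrow> \<zeta> \<in> bisector 0"
proof -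
  assume "Im \<zeta> = 0"
  then have z: "\<zeta> = of_real (Re \<zeta>)" by (simp add: complex_eq_iff)
  consider "0 < Re \<zeta>" | "Re \<zeta> = 0" | "Re \<zeta> < 0" by linarith
  then show ?thesis
  proof cases
    case 1
    then have "Arg \<zeta> = 0" by (subst z) (simp add: Arg_of_real)
    then show ?thesis by (simp add: bisector_def)
  next
    case 2
    then have "\<zeta> = 0" by (subst z) simp
    then show ?thesis by (simp add: bisector_def)
  next
    case 3
    have "- \<zeta> = of_real (- Re \<zeta>)" by (subst z) simp
    then have "Arg (- \<zeta>) = 0" using 3 by (simp only: Arg_of_real) simp
    then show ?thesis by (simp add: bisector_def)
  qed
qed

text \<open>The resolvent graph involves only the linear operations, which \<open>K\<close> shares
  with \<open>H\<close>, so solvability is inherited from self-adjointness in \<open>H\<close>. Each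
  norm is exchanged once, which costs the factor \<open>C * C\<close>. The spectrum is real, hence
  the angle 0. Taking \<open>K = H\<close> and \<open>C = 1\<close> covers the operator's own
  norm.\<close>

lemma self_adjoint_bisectorial_equivalent:
  fixes H K :: "'v hilb"
  assumes "hilbert_space H" and "self_adjoint H T"
    and ops: "hcar K = hcar H" "hadd K = hadd H" "hscale K = hscale H"
    and C: "1 \<le> C" "\<And>u. u \<in> hcar H \<Longrightarrow> hnorm K u \<le> C * hnorm H u"
      "\<And>u. u \<in> hcar H \<Longrightarrow> hnorm H u \<le> C * hnorm K u"
    and cl: "closed_operator K T"
  shows "bisectorial K T"
proof -
  interpret hilbert_space H by fact
  have T: "self_adjoint H T" by fact
  have lin: "linear_operator H T" using T by (simp add: self_adjoint_def)
  note Tc = linear_operator_carrier[OF lin]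
  have res: "resolvent K T \<zeta> = resolvent H T \<zeta>" for \<zeta>
    by (simp add: resolvent_def hminus_def ops)
  have bound: "\<bar>Im \<zeta>\<bar> * hnorm K u \<le> C * C * hnorm K w" if "(w, u) \<in> resolvent K T \<zeta>" for w u \<zeta>
  proof -
    have "(w, u) \<in> resolvent H T \<zeta>" using that res by simp
    then obtain v where v: "(u, v) \<in> T" "w = hminus H (hscale H \<zeta> u) v" by (auto simp: resolvent_def)
    have c: "u \<in> hcar H" "w \<in> hcar H" using Tc[OF v(1)] v by auto
    have "\<bar>Im \<zeta>\<bar> * hnorm K u \<le> \<bar>Im \<zeta>\<bar> * (C * hnorm H u)" using C c by (intro mult_left_mono) auto
    also have "\<dots> = C * (\<bar>Im \<zeta>\<bar> * hnorm H u)" by simp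
    also have "\<dots> \<le> C * hnorm H w" using self_adjoint_Im_bound[OF T v(1), of \<zeta>] v C by (intro mult_left_mono) auto
    also have "\<dots> \<le> C * (C * hnorm K w)" using C c by (intro mult_left_mono) auto
    finally show ?thesis by simp
  qed
  have spec: "\<zeta> \<in> bisector 0" if "\<zeta> \<in> hspectrum K T" for \<zeta>
  proof (rule ccontr)
    assume "\<zeta> \<notin> bisector 0"
    then have Im: "Im \<zeta> \<noteq> 0" using Im_0_in_bisector by blast
    have "single_valued (resolvent K T \<zeta>)"
    proof (rule single_valuedI)
      fix w u u' assume "(w, u) \<in> resolvent K T \<zeta>" "(w, u') \<in> resolvent K T \<zeta>"
      then obtain v v' where v: "(u, v) \<in> T" "(u', v') \<in> T" "w = hminus H (hscale H \<zeta> u) v" "w = hminus H (hscale H \<zeta> u') v'"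
        unfolding res unfolding resolvent_def by blast
      have "hminus H (hscale H \<zeta> (hminus H u u')) (hminus H v v') = hminus H w w"
        by (subst (1) v(3), subst (1) v(4), rule vec_eqI) (use Tc[OF v(1)] Tc[OF v(2)] in \<open>auto simp: algebra_simps\<close>)
      then have "\<bar>Im \<zeta>\<bar> * hnorm H (hminus H u u') \<le> 0"
        using self_adjoint_Im_bound[OF T linear_operator_minus[OF lin v(1,2)], of \<zeta>] Tc[OF v(1)] v(3) by simp
      then have "hnorm H (hminus H u u') = 0"
        using Im norm_nonneg[of "hminus H u u'"] Tc[OF v(1)] Tc[OF v(2)]
        by (intro order_antisym) (auto simp: mult_le_0_iff)
      then show "u = u'" using norm_minus_eq_0 Tc v by blast
    qed
    moreover have "Domain (resolvent K T \<zeta>) = hcar K"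
    proof
      show "Domain (resolvent K T \<zeta>) \<subseteq> hcar K" unfolding res ops(1) unfolding resolvent_def using Tc by auto
      show "hcar K \<subseteq> Domain (resolvent K T \<zeta>)"
      proof
        fix w assume "w \<in> hcar K"
        then obtain u v where "(u, v) \<in> T" "hminus H (hscale H \<zeta> u) v = w"
          using self_adjoint_resolvent_surj[OF T Im] ops(1) by metis
        then show "w \<in> Domain (resolvent K T \<zeta>)" unfolding res unfolding resolvent_def by blast
      qed
    qed
    moreover have "\<forall>(w, u)\<in>resolvent K T \<zeta>. hnorm K u \<le> (C * C / \<bar>Im \<zeta>\<bar>) * hnorm K w"
      using bound[of _ _ \<zeta>] Im by (auto simp: field_simps)
    ultimately show False using that unfolding hspectrum_def by blast
  qed
  have "\<exists>B. \<forall>\<zeta>. \<zeta> \<notin> bisector \<theta> \<longrightarrow> (\<forall>(w, u)\<in>resolvent K T \<zeta>. cmod \<zeta> * hnorm K u \<le> B * hnorm K w)"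
    if \<theta>: "0 < \<theta>" "\<theta> < pi / 2" for \<theta>
  proof (intro exI[of _ "C * C / sin \<theta>"] allI impI, clarify)
    fix \<zeta> w u assume \<zeta>: "\<zeta> \<notin> bisector \<theta>" and wu: "(w, u) \<in> resolvent K T \<zeta>"
    have s: "0 < sin \<theta>" using \<theta> by (intro sin_gt_zero) auto
    have "u \<in> hcar H" using wu Tc by (auto simp: res resolvent_def)
    \<comment> \<open>Nonnegativity of the norm of \<open>K\<close> is drawn from the comparison
      with \<open>H\<close>, as \<open>K\<close> is only a record here.\<close>
    then have "0 \<le> C * hnorm K u" using C(3)[of u] norm_nonneg[of u] by linarith
    then have "0 \<le> hnorm K u" using C(1) by (simp add: zero_le_mult_iff)
    then have "cmod \<zeta> * sin \<theta> * hnorm K u \<le> \<bar>Im \<zeta>\<bar> * hnorm K u"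
      using Im_ge_outside_bisector[OF \<theta> \<zeta>] by (intro mult_right_mono) auto
    also have "\<dots> \<le> C * C * hnorm K w" by (rule bound[OF wu])
    finally show "cmod \<zeta> * hnorm K u \<le> C * C / sin \<theta> * hnorm K w"
      using s by (simp add: field_simps)
  qed
  then show ?thesis
    unfolding bisectorial_def using cl spec by (intro conjI exI[of _ 0]) auto
qed

subsection \<open>Hodge-Dirac operators\<close>

locale hodge_dirac_setting = hilbert_space H for H :: "'v hilb" +
  fixes d :: "'v graph"
  assumes d_closed: "closed_operator H d"
    and d_nilpotent: "nilpotent_operator H d"
    and d_dense: "densely_defined H d"
begin

abbreviation "d' \<equiv> hadjoint H d"
abbreviation "D \<equiv> hodge_dirac H d"

lemma d_linear: "linear_operator H d"
  using d_closed by (simp add: closed_operator_def)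

lemma d_carrier: "d \<subseteq> hcar H \<times> hcar H"
  using d_linear by (simp add: linear_operator_def)

lemma adj_closed: "closed_operator H d'"
  by (rule closed_operator_adjoint[OF d_carrier d_dense])

lemma adj_linear: "linear_operator H d'"
  using adj_closed by (simp add: closed_operator_def)

lemma ker_adj: "hker H d' = perp (Range d)"
  by (rule ker_adjoint[OF d_carrier])

lemma range_subset_ker: "Range d \<subseteq> hker H d"
  using d_nilpotent by (simp add: nilpotent_operator_def)

lemma ker_subspace: "hsubspace H (hker H d)"
  by (rule subspace_ker[OF d_linear])

lemma ker_closure: "hclosure H (hker H d) = hker H d"
  by (rule closed_operator_ker[OF d_closed])

lemma perp_ker_subset: "perp (hker H d) \<subseteq> hker H d'"
  unfolding ker_adj using range_subset_ker by (auto simp: perp_def)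

lemma ker_decomposition:
  assumes "u \<in> hcar H"
  obtains a b where "a \<in> hker H d" "b \<in> perp (hker H d)" "(b, hzero H) \<in> d'" "u = hadd H a b"
    "a \<in> hcar H" "b \<in> hcar H"
proof -
  obtain a b where ab: "a \<in> hclosure H (hker H d)" "b \<in> perp (hker H d)" "u = hadd H a b"
    using orthogonal_decomposition[OF ker_subspace assms] .
  moreover have "(b, hzero H) \<in> d'" using ab perp_ker_subset by (auto simp: hker_def)
  ultimately show ?thesis
    using that ker_closure ker_subspace perp_carrier subspace_subset by (metis subsetD)
qed

lemma dirac_iff: "(u, w) \<in> D \<longleftrightarrow> (\<exists>y z. (u, y) \<in> d \<and> (u, z) \<in> d' \<and> w = hadd H y z)"
  unfolding hodge_dirac_def hsum_def by blast

lemma dirac_linear: "linear_operator H D"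
  unfolding linear_operator_def
proof (intro conjI allI)
  note c = linear_operator_carrier[OF d_linear] linear_operator_carrier[OF adj_linear]
  show "D \<subseteq> hcar H \<times> hcar H" using c by (auto simp: dirac_iff)
  show "single_valued D"
    using linear_operator_fun[OF d_linear] linear_operator_fun[OF adj_linear]
    unfolding single_valued_def dirac_iff by metis
  show "(hzero H, hzero H) \<in> D"
    unfolding dirac_iff using linear_operator_zero[OF d_linear] linear_operator_zero[OF adj_linear]
    by (metis add_zero_left zero_closed)
  show "\<forall>(u, v)\<in>D. \<forall>(x, y)\<in>D. (hadd H u x, hadd H v y) \<in> D"
  proof clarify
    fix u v x y assume "(u, v) \<in> D" "(x, y) \<in> D"
    then obtain v1 v2 y1 y2 where v: "(u, v1) \<in> d" "(u, v2) \<in> d'" "v = hadd H v1 v2"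
      "(x, y1) \<in> d" "(x, y2) \<in> d'" "y = hadd H y1 y2" unfolding dirac_iff by blast
    have "hadd H v y = hadd H (hadd H v1 y1) (hadd H v2 y2)"
      by (rule vec_eqI) (use v c(1)[OF v(1)] c(2)[OF v(2)] c(1)[OF v(4)] c(2)[OF v(5)] in auto)
    then show "(hadd H u x, hadd H v y) \<in> D"
      unfolding dirac_iff using linear_operator_add[OF d_linear v(1,4)] linear_operator_add[OF adj_linear v(2,5)] by blast
  qed
  show "\<forall>(u, v)\<in>D. (hscale H r u, hscale H r v) \<in> D" for r
  proof clarify
    fix u v assume "(u, v) \<in> D"
    then obtain v1 v2 where v: "(u, v1) \<in> d" "(u, v2) \<in> d'" "v = hadd H v1 v2" unfolding dirac_iff by blast
    have "hscale H r v = hadd H (hscale H r v1) (hscale H r v2)"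
      by (rule vec_eqI) (use v c(1)[OF v(1)] c(2)[OF v(2)] in \<open>auto simp: algebra_simps\<close>)
    then show "(hscale H r u, hscale H r v) \<in> D"
      unfolding dirac_iff using linear_operator_scale[OF d_linear v(1)] linear_operator_scale[OF adj_linear v(2)] by blast
  qed
qed

text \<open>If \<open>x\<close> is orthogonal to the domain of \<open>d'\<close>, then
  \<open>(0, x)\<close> belongs to the double adjoint, hence to \<open>d\<close>, and
  \<open>d\<close> sends 0 to 0.\<close>

lemma adj_dense: "densely_defined H d'"
proof -
  have "perp (Domain d') \<subseteq> {hzero H}"
  proof
    fix x assume x: "x \<in> perp (Domain d')"
    then have xc: "x \<in> hcar H" using perp_carrier by blast
    have "(hzero H, x) \<in> hadjoint H d'"
      using x xc linear_operator_carrier[OF adj_linear] by (intro adjointI) (auto simp: perp_def)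
    then have "(hzero H, x) \<in> d" using biadjoint_subset[OF d_closed] by blast
    then show "x \<in> {hzero H}" using linear_operator_fun[OF d_linear] linear_operator_zero[OF d_linear] by blast
  qed
  then show ?thesis
    unfolding densely_defined_def using dense_iff[OF subspace_Domain[OF adj_linear]] by blast
qed

text \<open>The components of \<open>u\<close> along the splitting \<open>ker d \<oplus> (ker d)\<^sup>\<bottom>\<close> stay in the domain of each of
  \<open>d\<close> and \<open>d\<^sup>*\<close>, and each operator annihilates one of them.\<close>

lemma d_component:
  assumes "(u, y) \<in> d" "u = hadd H a b" "a \<in> hker H d" "b \<in> perp (hker H d)"
  shows "(b, y) \<in> d" "(b, y) \<in> D"
proof -
  have c: "a \<in> hcar H" "b \<in> hcar H" "y \<in> hcar H"
    using assms linear_operator_carrier[OF d_linear] perp_carrier by (auto simp: hker_def)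
  have "(hminus H u a, hminus H y (hzero H)) \<in> d"
    using assms by (intro linear_operator_minus[OF d_linear]) (auto simp: hker_def)
  then show 1: "(b, y) \<in> d" using assms(2) c by simp
  have "(b, hzero H) \<in> d'" using assms(4) perp_ker_subset by (auto simp: hker_def)
  then show "(b, y) \<in> D" unfolding dirac_iff using 1 c by (metis add_zero_right)
qed

lemma adj_component:
  assumes "(u, y) \<in> d'" "u = hadd H a b" "a \<in> hker H d" "b \<in> perp (hker H d)"
  shows "(a, y) \<in> d'" "(a, y) \<in> D"
proof -
  have b: "(b, hzero H) \<in> d'" using assms(4) perp_ker_subset by (auto simp: hker_def)
  have c: "a \<in> hcar H" "b \<in> hcar H" "y \<in> hcar H"
    using assms linear_operator_carrier[OF d_linear] perp_carrier adjoint_carrier[OF assms(1)]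
    by (auto simp: hker_def)
  have "(hminus H u b, hminus H y (hzero H)) \<in> d'"
    using assms b by (intro linear_operator_minus[OF adj_linear])
  then show 1: "(a, y) \<in> d'" using assms(2) c by simp
  have "(a, hzero H) \<in> d" using assms(3) by (simp add: hker_def)
  then show "(a, y) \<in> D" unfolding dirac_iff using 1 c by (metis add_zero_left)
qed

text \<open>The component in the complement of \<open>ker d\<close> of an element of
  \<open>dom d\<close>, and the component in \<open>ker d\<close> of an element of
  \<open>dom d'\<close>, already lie in \<open>dom D\<close>. So if \<open>x\<close> is orthogonal
  to \<open>dom D\<close>, its two components are orthogonal to the dense domains of
  \<open>d\<close> and of \<open>d'\<close> respectively.\<close>

lemma dirac_dense: "densely_defined H D"
proof -
  have "perp (Domain D) \<subseteq> {hzero H}"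
  proof
    fix x assume x: "x \<in> perp (Domain D)"
    then have xc: "x \<in> hcar H" using perp_carrier by blast
    obtain p q where pq: "p \<in> hker H d" "q \<in> perp (hker H d)" "x = hadd H p q" "p \<in> hcar H" "q \<in> hcar H"
      using ker_decomposition[OF xc] by metis
    have xD: "hinner H a x = 0" if "(a, y) \<in> D" for a y using x that by (auto simp: perp_def)
    have "q \<in> perp (Domain d)"
    proof -
      have "hinner H u q = 0" if uy: "(u, y) \<in> d" for u y
      proof -
        obtain a b where ab: "a \<in> hker H d" "b \<in> perp (hker H d)" "u = hadd H a b" "a \<in> hcar H" "b \<in> hcar H"
          using ker_decomposition linear_operator_carrier[OF d_linear uy] by metis
        have "hinner H b x = 0" using xD d_component(2)[OF uy ab(3,1,2)] by blast
        moreover have "hinner H b p = 0" "hinner H a q = 0"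
          using perpD[OF ab(2) pq(1) pq(4)] perpD[OF pq(2) ab(1) ab(4)] by auto
        ultimately show ?thesis using ab pq by simp
      qed
      then show ?thesis using pq by (auto simp: perp_def)
    qed
    then have q: "q = hzero H" using perp_dense[OF d_dense] subspace_subset[OF subspace_Domain[OF d_linear]] by blast
    have "p \<in> perp (Domain d')"
    proof -
      have "hinner H u p = 0" if uy: "(u, y) \<in> d'" for u y
      proof -
        obtain a b where ab: "a \<in> hker H d" "b \<in> perp (hker H d)" "u = hadd H a b" "a \<in> hcar H" "b \<in> hcar H"
          using ker_decomposition linear_operator_carrier[OF adj_linear uy] by metis
        have "hinner H a x = 0" using xD adj_component(2)[OF uy ab(3,1,2)] by blast
        moreover have "hinner H b p = 0" "hinner H a q = 0"
          using perpD[OF ab(2) pq(1) pq(4)] perpD[OF pq(2) ab(1) ab(4)] by auto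
        ultimately show ?thesis using ab pq by simp
      qed
      then show ?thesis using pq by (auto simp: perp_def)
    qed
    then have "p = hzero H" using perp_dense[OF adj_dense] subspace_subset[OF subspace_Domain[OF adj_linear]] by blast
    then show "x \<in> {hzero H}" using q pq by simp
  qed
  then show ?thesis
    unfolding densely_defined_def using dense_iff[OF subspace_Domain[OF dirac_linear]] by blast
qed

text \<open>For the nontrivial inclusion, split the value \<open>w = p + q\<close> along
  \<open>ker d\<close>. Testing with components of elements of \<open>dom d\<close> shows that
  \<open>q\<close> is the value of \<open>d'\<close> at \<open>v\<close>; testing with components of
  elements of \<open>dom d'\<close> shows that \<open>p\<close> is the value of the double adjoint,
  hence of \<open>d\<close>, at \<open>v\<close>.\<close>

lemma dirac_self_adjoint: "self_adjoint H D"
  unfolding self_adjoint_def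
proof (intro conjI dirac_linear dirac_dense equalityI subrelI)
  fix v w assume vw: "(v, w) \<in> hadjoint H D"
  have vwc: "v \<in> hcar H" "w \<in> hcar H" using adjoint_carrier[OF vw] by auto
  obtain p q where pq: "p \<in> hker H d" "q \<in> perp (hker H d)" "w = hadd H p q" "p \<in> hcar H" "q \<in> hcar H"
    using ker_decomposition[OF vwc(2)] by metis
  have "(v, q) \<in> d'"
  proof (rule adjointI)
    fix u y assume uy: "(u, y) \<in> d"
    obtain a b where ab: "a \<in> hker H d" "b \<in> perp (hker H d)" "u = hadd H a b" "a \<in> hcar H" "b \<in> hcar H"
      using ker_decomposition linear_operator_carrier[OF d_linear uy] by metis
    have "hinner H y v = hinner H b w" by (rule adjointD[OF vw d_component(2)[OF uy ab(3,1,2)]])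
    then show "hinner H y v = hinner H u q"
      using perpD[OF ab(2) pq(1) pq(4)] perpD[OF pq(2) ab(1) ab(4)] ab pq by simp
  qed (use vwc pq in auto)
  moreover have "(v, p) \<in> hadjoint H d'"
  proof (rule adjointI)
    fix u y assume uy: "(u, y) \<in> d'"
    obtain a b where ab: "a \<in> hker H d" "b \<in> perp (hker H d)" "u = hadd H a b" "a \<in> hcar H" "b \<in> hcar H"
      using ker_decomposition linear_operator_carrier[OF adj_linear uy] by metis
    have "hinner H y v = hinner H a w" by (rule adjointD[OF vw adj_component(2)[OF uy ab(3,1,2)]])
    then show "hinner H y v = hinner H u p"
      using perpD[OF ab(2) pq(1) pq(4)] perpD[OF pq(2) ab(1) ab(4)] ab pq by simp
  qed (use vwc pq in auto)
  then have "(v, p) \<in> d" using biadjoint_subset[OF d_closed] by blast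
  ultimately show "(v, w) \<in> D" unfolding dirac_iff using pq(3) by blast
next
  fix v w assume "(v, w) \<in> D"
  then obtain z1 z2 where z: "(v, z1) \<in> d" "(v, z2) \<in> d'" "w = hadd H z1 z2" unfolding dirac_iff by blast
  have vc: "v \<in> hcar H" "z1 \<in> hcar H" "z2 \<in> hcar H"
    using linear_operator_carrier[OF d_linear z(1)] linear_operator_carrier[OF adj_linear z(2)] by auto
  show "(v, w) \<in> hadjoint H D"
  proof (rule adjointI)
    fix u y assume "(u, y) \<in> D"
    then obtain y1 y2 where y: "(u, y1) \<in> d" "(u, y2) \<in> d'" "y = hadd H y1 y2" unfolding dirac_iff by blast
    have uc: "u \<in> hcar H" "y1 \<in> hcar H" "y2 \<in> hcar H"
      using linear_operator_carrier[OF d_linear y(1)] linear_operator_carrier[OF adj_linear y(2)] by auto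
    have "hinner H y1 v = hinner H u z2" by (rule adjointD[OF z(2) y(1)])
    moreover have "hinner H z1 u = hinner H v y2" by (rule adjointD[OF y(2) z(1)])
    then have "hinner H y2 v = hinner H u z1"
      using inner_commute uc vc by metis
    ultimately show "hinner H y v = hinner H u w" using y z uc vc by simp
  qed (use vc z in auto)
qed

lemma dirac_carrier: "D \<subseteq> hcar H \<times> hcar H"
  using dirac_linear by (simp add: linear_operator_def)

text \<open>By nilpotency \<open>d u\<close> lies in \<open>ker d\<close> and is therefore
  orthogonal to \<open>d' u\<close>; a sum of orthogonal vectors vanishes only if both do.\<close>

lemma ker_dirac: "hker H D = hker H d \<inter> hker H d'"
proof (intro equalityI subsetI)
  fix u assume "u \<in> hker H D"
  then obtain y z where yz: "(u, y) \<in> d" "(u, z) \<in> d'" "hzero H = hadd H y z" by (auto simp: hker_def dirac_iff)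
  have c: "u \<in> hcar H" "y \<in> hcar H" "z \<in> hcar H"
    using linear_operator_carrier[OF d_linear yz(1)] linear_operator_carrier[OF adj_linear yz(2)] by auto
  have "(y, hzero H) \<in> d" using yz range_subset_ker by (auto simp: hker_def)
  then have "hinner H y z = 0" using adjointD[OF yz(2)] c by fastforce
  moreover have "hinner H y (hadd H y z) = 0" using yz(3) c by (metis inner_zero_right)
  ultimately have "hinner H y y = 0" using c by simp
  then have "y = hzero H" using inner_self_eq_0 c by blast
  then have "y = hzero H" "z = hzero H" using yz(3) c by auto
  then show "u \<in> hker H d \<inter> hker H d'" using yz(1,2) by (simp add: hker_def)
next
  fix u assume "u \<in> hker H d \<inter> hker H d'"
  then have "(u, hzero H) \<in> d" "(u, hzero H) \<in> d'" by (auto simp: hker_def)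
  moreover have "hzero H = hadd H (hzero H) (hzero H)" by simp
  ultimately have "(u, hzero H) \<in> D" unfolding dirac_iff by blast
  then show "u \<in> hker H D" by (simp add: hker_def)
qed

lemma ker_dirac_eq_perp: "hker H D = perp (Range D)"
  using ker_adjoint[OF dirac_carrier] dirac_self_adjoint by (simp add: self_adjoint_def)

lemma closure_range_dirac: "hclosure H (Range D) = perp (hker H D)"
  using ker_dirac_eq_perp perp_perp[OF subspace_Range[OF dirac_linear]] by simp

lemma closure_range_d_subset: "hclosure H (Range d) \<subseteq> perp (hker H D)"
proof -
  have Rc: "Range d \<subseteq> hcar H" using d_carrier by auto
  have "Range d \<subseteq> perp (hker H D)"
  proof
    fix y assume y: "y \<in> Range d"
    have "hinner H s y = 0" if "s \<in> hker H D" for s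
      using that y perpD[of s "Range d" y] Rc unfolding ker_dirac ker_adj by blast
    then show "y \<in> perp (hker H D)" using y Rc by (auto simp: perp_def)
  qed
  moreover have "hker H D \<subseteq> hcar H" using ker_dirac_eq_perp perp_carrier by simp
  ultimately show ?thesis using closure_mono closure_perp by metis
qed

lemma perp_ker_subset_range: "perp (hker H d) \<subseteq> perp (hker H D)"
  unfolding ker_dirac by (auto simp: perp_def)

text \<open>Isolates the part of the closed range of \<open>D\<close> that does not depend on the
  inner product. An element of \<open>ker d'\<close> splits into a vector of \<open>ker d\<close>
  that is again in \<open>ker d'\<close>, hence in \<open>ker D\<close>, and a vector orthogonal to
  \<open>ker d\<close>; \<open>x\<close> is orthogonal to both, so it lies in the double complement
  of \<open>Range d\<close>.\<close>

lemma ker_inter_range: "hker H d \<inter> perp (hker H D) = hclosure H (Range d)"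
proof (intro equalityI subsetI)
  fix x assume x: "x \<in> hker H d \<inter> perp (hker H D)"
  then have xc: "x \<in> hcar H" using perp_carrier by blast
  have "hinner H y x = 0" if y: "y \<in> perp (Range d)" for y
  proof -
    have yc: "y \<in> hcar H" using y perp_carrier by blast
    obtain a b where ab: "a \<in> hker H d" "b \<in> perp (hker H d)" "y = hadd H a b" "a \<in> hcar H" "b \<in> hcar H"
      using ker_decomposition[OF yc] by metis
    have "(y, hzero H) \<in> d'" using y ker_adj by (auto simp: hker_def)
    then have "(a, hzero H) \<in> d'" by (rule adj_component(1)[OF _ ab(3,1,2)])
    then have "a \<in> hker H D" using ab(1) by (simp add: ker_dirac) (simp add: hker_def)
    then have "hinner H a x = 0" using x by (auto simp: perp_def)
    moreover have "hinner H b x = 0" using perpD[OF ab(2), of x] x xc by auto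
    ultimately show ?thesis using ab xc by simp
  qed
  then have "x \<in> perp (perp (Range d))" using xc by (auto simp: perp_def)
  then show "x \<in> hclosure H (Range d)" using perp_perp[OF subspace_Range[OF d_linear]] by simp
next
  fix x assume x: "x \<in> hclosure H (Range d)"
  have "hclosure H (Range d) \<subseteq> hker H d"
    using range_subset_ker ker_closure closure_minimal by blast
  then show "x \<in> hker H d \<inter> perp (hker H D)" using x closure_range_d_subset by blast
qed

text \<open>The Hodge decomposition of \<open>ker d\<close>: subtracting the orthogonal projection
  onto \<open>ker D\<close>, a subspace of \<open>ker d\<close>, leaves a remainder in
  \<open>ker d\<close>, and \<open>ker_inter_range\<close> identifies where it lies.\<close>

lemma harmonic_decomposition:
  assumes u: "u \<in> hker H d"
  obtains a b where "a \<in> hker H D" "b \<in> hclosure H (Range d)" "u = hadd H a b" "a \<in> hcar H" "b \<in> hcar H"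
proof -
  have uc: "u \<in> hcar H" using u subspace_subset[OF ker_subspace] by blast
  have sub: "hsubspace H (hker H D)" by (rule subspace_ker[OF dirac_linear])
  have cl: "hclosure H (hker H D) = hker H D"
    by (rule closed_operator_ker[OF self_adjoint_closed[OF dirac_self_adjoint]])
  obtain a b where ab: "a \<in> hker H D" "b \<in> perp (hker H D)" "u = hadd H a b"
    using orthogonal_decomposition[OF sub uc] cl by metis
  have c: "a \<in> hcar H" "b \<in> hcar H" using ab sub subspace_subset perp_carrier by blast+
  have "hminus H u a \<in> hker H d"
    using u ab ker_dirac by (intro subspace_minus[OF ker_subspace]) auto
  then have "b \<in> hker H d" using ab c by simp
  then have "b \<in> hclosure H (Range d)" using ab ker_inter_range by blast
  then show ?thesis using that ab c by blast
qed

end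

subsection \<open>Two equivalent inner products\<close>

locale equivalent_hilbert_spaces = H1: hilbert_space H1 + H2: hilbert_space H2
  for H1 H2 :: "'v hilb" +
  fixes C :: real
  assumes car_eq: "hcar H2 = hcar H1" and add_eq: "hadd H2 = hadd H1"
    and zero_eq: "hzero H2 = hzero H1" and scale_eq: "hscale H2 = hscale H1"
    and C_ge_1: "1 \<le> C"
    and norm_le: "u \<in> hcar H1 \<Longrightarrow> hnorm H2 u \<le> C * hnorm H1 u"
    and norm_ge: "u \<in> hcar H1 \<Longrightarrow> hnorm H1 u \<le> C * hnorm H2 u"
begin

lemma minus_eq: "hminus H2 = hminus H1"
  by (intro ext) (simp add: hminus_def add_eq scale_eq)

lemma subspace_eq: "hsubspace H2 = hsubspace H1"
  by (intro ext) (simp add: hsubspace_def car_eq add_eq zero_eq scale_eq)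

lemma linear_operator_eq: "linear_operator H2 = linear_operator H1"
  by (intro ext) (simp add: linear_operator_def car_eq add_eq zero_eq scale_eq)

lemma ker_eq: "hker H2 = hker H1"
  by (intro ext) (simp add: hker_def zero_eq)

lemma conv_eq:
  assumes "\<And>n. xs n \<in> hcar H1" "u \<in> hcar H1"
  shows "hconv H2 xs u \<longleftrightarrow> hconv H1 xs u"
proof
  have c: "hminus H1 (xs n) u \<in> hcar H1" for n using assms by simp
  have c2: "0 \<le> hnorm H2 (hminus H1 (xs n) u)" for n using c car_eq by simp
  assume L: "hconv H2 xs u"
  have "(\<lambda>n. C * hnorm H2 (hminus H1 (xs n) u)) \<longlonglongrightarrow> 0"
    using L unfolding hconv_def minus_eq by (rule tendsto_mult_right_zero)
  then show "hconv H1 xs u" unfolding hconv_def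
    by (rule Lim_null_comparison[rotated]) (use c norm_ge in auto)
next
  have c: "hminus H1 (xs n) u \<in> hcar H1" for n using assms by simp
  have c2: "0 \<le> hnorm H2 (hminus H1 (xs n) u)" for n using c car_eq by simp
  assume L: "hconv H1 xs u"
  have "(\<lambda>n. C * hnorm H1 (hminus H1 (xs n) u)) \<longlonglongrightarrow> 0"
    using L unfolding hconv_def by (rule tendsto_mult_right_zero)
  then show "hconv H2 xs u" unfolding hconv_def minus_eq
    by (rule Lim_null_comparison[rotated]) (use c c2 norm_le in auto)
qed

lemma closure_eq: assumes "S \<subseteq> hcar H1" shows "hclosure H2 S = hclosure H1 S"
  unfolding hclosure_def car_eq using conv_eq assms by (metis (no_types, lifting) subsetD)

lemma closed_operator_eq: "closed_operator H2 T \<longleftrightarrow> closed_operator H1 T"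
proof -
  have "hconv H2 xs u = hconv H1 xs u" "hconv H2 ys v = hconv H1 ys v"
    if "linear_operator H1 T" "\<forall>n. (xs n, ys n) \<in> T" "u \<in> hcar H1" "v \<in> hcar H1" for xs ys u v
  proof -
    have "xs n \<in> hcar H1" "ys n \<in> hcar H1" for n using that linear_operator_carrier by metis+
    then show "hconv H2 xs u = hconv H1 xs u" "hconv H2 ys v = hconv H1 ys v"
      using that conv_eq by blast+
  qed
  then show ?thesis unfolding closed_operator_def linear_operator_eq car_eq by metis
qed

lemma nilpotent_operator_eq: "nilpotent_operator H2 T \<longleftrightarrow> nilpotent_operator H1 T"
  by (simp add: nilpotent_operator_def ker_eq)

lemma densely_defined_eq: "linear_operator H1 T \<Longrightarrow> densely_defined H2 T \<longleftrightarrow> densely_defined H1 T"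
  unfolding densely_defined_def car_eq
  by (subst closure_eq) (auto dest: linear_operator_carrier)

end

locale two_hodge_dirac = equivalent_hilbert_spaces H1 H2 C + hodge_dirac_setting H1 d
  for H1 H2 :: "'v hilb" and C d

sublocale two_hodge_dirac \<subseteq> snd: hodge_dirac_setting H2 d
  by unfold_locales (use d_closed d_nilpotent d_dense d_linear closed_operator_eq nilpotent_operator_eq densely_defined_eq in auto)

context two_hodge_dirac
begin

abbreviation "D1 \<equiv> hodge_dirac H1 d"
abbreviation "D2 \<equiv> hodge_dirac H2 d"
abbreviation "R1 \<equiv> hclosure H1 (Range D1)"

lemma bisectorial_11: "bisectorial H1 D1"
  by (rule self_adjoint_bisectorial_equivalent[where H = H1 and C = 1])
    (use H1.hilbert_space_axioms dirac_self_adjoint H1.self_adjoint_closed in auto)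

lemma bisectorial_22: "bisectorial H2 D2"
  by (rule self_adjoint_bisectorial_equivalent[where H = H2 and C = 1])
    (use H2.hilbert_space_axioms snd.dirac_self_adjoint H2.self_adjoint_closed in auto)

lemma bisectorial_21: "bisectorial H2 D1"
  by (rule self_adjoint_bisectorial_equivalent[where H = H1 and C = C])
    (use H1.hilbert_space_axioms dirac_self_adjoint H1.self_adjoint_closed closed_operator_eq
      car_eq add_eq scale_eq C_ge_1 norm_le norm_ge in auto)

lemma bisectorial_12: "bisectorial H1 D2"
  by (rule self_adjoint_bisectorial_equivalent[where H = H2 and C = C])
    (use H2.hilbert_space_axioms snd.dirac_self_adjoint H2.self_adjoint_closed closed_operator_eq
      car_eq add_eq scale_eq C_ge_1 norm_le norm_ge in auto)

lemma R1_eq: "R1 = H1.perp (hker H1 D1)"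
  by (rule closure_range_dirac)

lemma closure_range_d_eq: "hclosure H2 (Range d) = hclosure H1 (Range d)"
  using d_carrier by (intro closure_eq) auto

lemma R1_subspace: "hsubspace H1 R1"
  by (rule H1.subspace_closure[OF subspace_Range[OF dirac_linear]])

lemma ker_d_inter_R1: "hker H1 d \<inter> R1 = hclosure H1 (Range d)"
  unfolding R1_eq by (rule ker_inter_range)

lemma ker1_subset: "hker H1 D1 \<subseteq> hker H1 d"
  using ker_dirac by blast

lemma ker2_subset: "hker H2 D2 \<subseteq> hker H1 d"
  using snd.ker_dirac ker_eq by auto

lemma ker1_subspace: "hsubspace H1 (hker H1 D1)"
  by (rule H1.subspace_ker[OF dirac_linear])

lemma ker2_subspace: "hsubspace H1 (hker H2 D2)"
  using H2.subspace_ker[OF snd.dirac_linear] subspace_eq by simp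

lemma ker1_inter: "hker H1 D1 \<inter> R1 \<subseteq> {hzero H1}"
  unfolding R1_eq using H1.inner_self_eq_0 H1.perp_carrier by (auto simp: H1.perp_def)

text \<open>An element of the intersection lies in \<open>ker d\<close> and in \<open>R1\<close>,
  hence in the closure of \<open>Range d\<close>. This set is the same for both inner products, and
  for the second it is orthogonal to \<open>ker D2\<close>, so the element is orthogonal to
  itself.\<close>

lemma ker2_inter: "hker H2 D2 \<inter> R1 \<subseteq> {hzero H1}"
proof
  fix x assume x: "x \<in> hker H2 D2 \<inter> R1"
  then have "x \<in> hclosure H2 (Range d)"
    using ker2_subset ker_d_inter_R1 closure_range_d_eq by blast
  then have "x \<in> H2.perp (hker H2 D2)" using snd.closure_range_d_subset by blast
  then have "hinner H2 x x = 0" "x \<in> hcar H2" using x by (auto simp: H2.perp_def)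
  then show "x \<in> {hzero H1}" using H2.inner_self_eq_0 zero_eq by simp
qed

lemma direct_sum_ker1: "direct_sum H1 (hker H1 D1) R1"
  unfolding direct_sum_def
proof (intro conjI ker1_subspace R1_subspace equalityI ker1_inter ballI)
  show "{hzero H1} \<subseteq> hker H1 D1 \<inter> R1" using ker1_subspace R1_subspace by (auto simp: hsubspace_def)
  fix v assume v: "v \<in> hcar H1"
  have "hclosure H1 (hker H1 D1) = hker H1 D1"
    by (rule H1.closed_operator_ker[OF H1.self_adjoint_closed[OF dirac_self_adjoint]])
  then show "\<exists>a\<in>hker H1 D1. \<exists>b\<in>R1. v = hadd H1 a b"
    unfolding R1_eq using H1.orthogonal_decomposition[OF ker1_subspace v] by metis
qed

text \<open>The two inner products act one after the other: the first splits \<open>v\<close> along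
  \<open>ker d\<close>, the second splits the component in \<open>ker d\<close> into a
  \<open>D2\<close>-harmonic part and a part in the closure of \<open>Range d\<close>. Both
  remainders belong to \<open>R1\<close>.\<close>

lemma direct_sum_ker2: "direct_sum H1 (hker H2 D2) R1"
  unfolding direct_sum_def
proof (intro conjI ker2_subspace R1_subspace equalityI ker2_inter ballI)
  show "{hzero H1} \<subseteq> hker H2 D2 \<inter> R1" using ker2_subspace R1_subspace by (auto simp: hsubspace_def)
  fix v assume v: "v \<in> hcar H1"
  obtain p q where pq: "p \<in> hker H1 d" "q \<in> H1.perp (hker H1 d)" "v = hadd H1 p q" "p \<in> hcar H1" "q \<in> hcar H1"
    using ker_decomposition[OF v] by metis
  obtain a b where ab: "a \<in> hker H2 D2" "b \<in> hclosure H2 (Range d)" "p = hadd H1 a b" "a \<in> hcar H1" "b \<in> hcar H1"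
    using snd.harmonic_decomposition[of p] pq ker_eq add_eq car_eq by metis
  have "b \<in> R1" using ab(2) closure_range_d_eq ker_d_inter_R1 by blast
  moreover have "q \<in> R1" using pq(2) perp_ker_subset_range R1_eq by blast
  ultimately have "hadd H1 b q \<in> R1" using R1_subspace by (auto simp: hsubspace_def)
  moreover have "v = hadd H1 a (hadd H1 b q)"
    by (rule H1.vec_eqI) (use ab pq in auto)
  ultimately show "\<exists>a\<in>hker H2 D2. \<exists>b\<in>R1. v = hadd H1 a b" using ab by blast
qed

end

section \<open>Projections along a complementary subspace\<close>

context hilbert_space
begin

lemma direct_sum_unique:
  assumes "direct_sum H A B" "a \<in> A" "b \<in> B" "a' \<in> A" "b' \<in> B" "hadd H a b = hadd H a' b'"
  shows "a = a'"
proof -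
  have s: "hsubspace H A" "hsubspace H B" "A \<inter> B = {hzero H}" using assms by (auto simp: direct_sum_def)
  have c: "a \<in> hcar H" "a' \<in> hcar H" "b \<in> hcar H" "b' \<in> hcar H"
    using assms s by (auto simp: hsubspace_def)
  have "hminus H a a' = hminus H b' b"
  proof (rule vec_eqI)
    fix w assume w: "w \<in> hcar H"
    have "hinner H (hadd H a b) w = hinner H (hadd H a' b') w" using assms by simp
    then show "hinner H (hminus H a a') w = hinner H (hminus H b' b) w" using c w by (simp add: algebra_simps)
  qed (use c in auto)
  moreover have "hminus H a a' \<in> A" "hminus H b' b \<in> B" using assms s subspace_minus by auto
  ultimately have "hminus H a a' = hzero H" using s(3) by auto
  then show ?thesis using norm_minus_eq_0 c by (metis norm_zero)
qed

lemma proj_along_eqI: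
  assumes "direct_sum H A B" "a \<in> A" "b \<in> B"
  shows "proj_along H A B (hadd H a b) = a"
  unfolding proj_along_def
  by (rule the_equality) (use assms direct_sum_unique in blast)+

lemma proj_along_props:
  assumes ds: "direct_sum H A B" and v: "v \<in> hcar H"
  shows "proj_along H A B v \<in> A" "hminus H v (proj_along H A B v) \<in> B"
proof -
  obtain a b where ab: "a \<in> A" "b \<in> B" "v = hadd H a b" using ds v by (auto simp: direct_sum_def)
  have c: "a \<in> hcar H" "b \<in> hcar H" using ab ds by (auto simp: direct_sum_def hsubspace_def)
  show "proj_along H A B v \<in> A" "hminus H v (proj_along H A B v) \<in> B"
    unfolding ab(3) proj_along_eqI[OF ds ab(1,2)] using ab c by auto
qed

lemma proj_along_eqI':
  assumes ds: "direct_sum H A B" and "v \<in> hcar H" "a \<in> A" "hminus H v a \<in> B"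
  shows "proj_along H A B v = a"
proof -
  have "a \<in> hcar H" using assms by (auto simp: direct_sum_def hsubspace_def)
  then have "v = hadd H a (hminus H v a)" using assms by simp
  then show ?thesis using proj_along_eqI[OF ds assms(3,4)] by simp
qed

end

section \<open>The isomorphism between the two kernels\<close>

context two_hodge_dirac
begin

abbreviation "\<Phi> \<equiv> proj_along H1 (hker H1 D1) R1"
abbreviation "\<Psi> \<equiv> proj_along H1 (hker H2 D2) R1"

lemma ker1_carrier: "u \<in> hker H1 D1 \<Longrightarrow> u \<in> hcar H1"
  using ker1_subspace by (auto simp: hsubspace_def)

lemma ker2_carrier: "u \<in> hker H2 D2 \<Longrightarrow> u \<in> hcar H1"
  using ker2_subspace by (auto simp: hsubspace_def)

lemma R1_minus_commute: "u \<in> hcar H1 \<Longrightarrow> v \<in> hcar H1 \<Longrightarrow> hminus H1 u v \<in> R1 \<Longrightarrow> hminus H1 v u \<in> R1"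
proof -
  assume a: "u \<in> hcar H1" "v \<in> hcar H1" "hminus H1 u v \<in> R1"
  have "hminus H1 v u = hscale H1 (-1) (hminus H1 u v)"
    by (rule H1.vec_eqI) (use a in auto)
  then show ?thesis using a R1_subspace by (auto simp: hsubspace_def)
qed

lemma \<Phi>_iff: "v \<in> hcar H1 \<Longrightarrow> \<Phi> v = u \<longleftrightarrow> u \<in> hker H1 D1 \<and> hminus H1 v u \<in> R1"
  using H1.proj_along_props[OF direct_sum_ker1] H1.proj_along_eqI'[OF direct_sum_ker1] by blast

lemma \<Psi>_iff: "v \<in> hcar H1 \<Longrightarrow> \<Psi> v = u \<longleftrightarrow> u \<in> hker H2 D2 \<and> hminus H1 v u \<in> R1"
  using H1.proj_along_props[OF direct_sum_ker2] H1.proj_along_eqI'[OF direct_sum_ker2] by blast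

text \<open>Both maps project along the same \<open>R1\<close>: for \<open>u\<close> and
  \<open>v\<close> in the two kernels, the single condition that \<open>v - u\<close> lies in
  \<open>R1\<close> expresses both \<open>\<Phi> v = u\<close> and
  \<open>\<Psi> u = v\<close>.\<close>

lemma \<Psi>_\<Phi>: "v \<in> hker H2 D2 \<Longrightarrow> \<Psi> (\<Phi> v) = v"
  using \<Phi>_iff \<Psi>_iff R1_minus_commute ker1_carrier ker2_carrier by metis

lemma \<Phi>_\<Psi>: "u \<in> hker H1 D1 \<Longrightarrow> \<Phi> (\<Psi> u) = u"
  using \<Phi>_iff \<Psi>_iff R1_minus_commute ker1_carrier ker2_carrier by metis

lemma \<Phi>_bij: "bij_betw \<Phi> (hker H2 D2) (hker H1 D1)"
  by (rule bij_betw_byWitness[where f' = \<Psi>])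
    (use \<Psi>_\<Phi> \<Phi>_\<Psi> \<Phi>_iff \<Psi>_iff ker1_carrier ker2_carrier in \<open>blast+\<close>)

lemma \<Phi>_add: "u \<in> hcar H1 \<Longrightarrow> v \<in> hcar H1 \<Longrightarrow> \<Phi> (hadd H1 u v) = hadd H1 (\<Phi> u) (\<Phi> v)"
proof -
  assume uv: "u \<in> hcar H1" "v \<in> hcar H1"
  have p: "\<Phi> u \<in> hker H1 D1" "hminus H1 u (\<Phi> u) \<in> R1" "\<Phi> v \<in> hker H1 D1" "hminus H1 v (\<Phi> v) \<in> R1"
    using \<Phi>_iff uv by blast+
  have "hminus H1 (hadd H1 u v) (hadd H1 (\<Phi> u) (\<Phi> v)) = hadd H1 (hminus H1 u (\<Phi> u)) (hminus H1 v (\<Phi> v))"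
    by (rule H1.vec_eqI) (use uv p ker1_carrier in auto)
  then show ?thesis using uv p ker1_subspace R1_subspace \<Phi>_iff by (auto simp: hsubspace_def)
qed

lemma \<Phi>_scale: "u \<in> hcar H1 \<Longrightarrow> \<Phi> (hscale H1 c u) = hscale H1 c (\<Phi> u)"
proof -
  assume u: "u \<in> hcar H1"
  have p: "\<Phi> u \<in> hker H1 D1" "hminus H1 u (\<Phi> u) \<in> R1" using \<Phi>_iff u by blast+
  have "hminus H1 (hscale H1 c u) (hscale H1 c (\<Phi> u)) = hscale H1 c (hminus H1 u (\<Phi> u))"
    by (rule H1.vec_eqI) (use u p ker1_carrier in \<open>auto simp: algebra_simps\<close>)
  then show ?thesis using u p ker1_subspace R1_subspace \<Phi>_iff by (auto simp: hsubspace_def)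
qed

text \<open>\<open>v - \<Phi> v\<close> lies in the closure of the range of \<open>d\<close>, which is orthogonal to \<open>\<Phi> v\<close> for the first
  inner product and to \<open>v\<close> for the second.\<close>

lemma \<Phi>_bounds:
  assumes v: "v \<in> hker H2 D2"
  shows "hnorm H1 (\<Phi> v) \<le> hnorm H1 v" "hnorm H2 v \<le> hnorm H2 (\<Phi> v)"
proof -
  define u where "u = \<Phi> v"
  have vc: "v \<in> hcar H1" using v ker2_carrier by blast
  have u: "u \<in> hker H1 D1" "hminus H1 v u \<in> R1" using \<Phi>_iff vc u_def by blast+
  have uc: "u \<in> hcar H1" using u ker1_carrier by blast
  define r where "r = hminus H1 v u"
  have rc: "r \<in> hcar H1" using uc vc r_def by simp
  have "r \<in> hker H1 d"
    unfolding r_def using u v ker1_subset ker2_subset by (intro H1.subspace_minus[OF ker_subspace]) auto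
  then have r: "r \<in> hclosure H1 (Range d)" using u ker_d_inter_R1 r_def by blast
  have "hinner H1 u r = 0"
    using r closure_range_d_subset u(1) by (auto simp: H1.perp_def)
  moreover have "v = hadd H1 u r" using uc vc by (simp add: r_def)
  ultimately have "(hnorm H1 v)\<^sup>2 = (hnorm H1 u)\<^sup>2 + (hnorm H1 r)\<^sup>2"
    using H1.pythagoras uc rc by simp
  then have "(hnorm H1 u)\<^sup>2 \<le> (hnorm H1 v)\<^sup>2" by simp
  then show "hnorm H1 (\<Phi> v) \<le> hnorm H1 v" unfolding u_def[symmetric] by (rule power2_le_imp_le) (use vc in simp)
  have r2: "r \<in> H2.perp (hker H2 D2)" using r snd.closure_range_d_subset closure_range_d_eq by blast
  have "hinner H2 v (hscale H2 (-1) r) = 0"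
    using r2 v vc rc car_eq by (auto simp: H2.perp_def)
  moreover have "u = hadd H2 v (hscale H2 (-1) r)"
    by (rule H1.vec_eqI) (use uc vc in \<open>auto simp: r_def add_eq scale_eq\<close>)
  ultimately have "(hnorm H2 u)\<^sup>2 = (hnorm H2 v)\<^sup>2 + (hnorm H2 (hscale H2 (-1) r))\<^sup>2"
    using H2.pythagoras[of v "hscale H2 (-1) r"] H2.scale_closed[of r "-1"] vc rc car_eq by simp
  then have "(hnorm H2 v)\<^sup>2 \<le> (hnorm H2 u)\<^sup>2" by simp
  then show "hnorm H2 v \<le> hnorm H2 (\<Phi> v)" unfolding u_def[symmetric] by (rule power2_le_imp_le) (use uc car_eq in simp)
qed

lemma \<Phi>_iso_on:
  assumes A: "A \<subseteq> hker H2 D2" and bij: "bij_betw \<Phi> A B"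
  shows "hilb_iso H2 A H1 B \<Phi>"
  unfolding hilb_iso_def
proof (intro conjI ballI allI exI[of _ "C"] bij C_ge_1)
  fix u assume u: "u \<in> A"
  then have uc: "u \<in> hcar H1" "u \<in> hker H2 D2" using A ker2_carrier by auto
  have pc: "\<Phi> u \<in> hcar H1" using \<Phi>_iff uc ker1_carrier by blast
  \<comment> \<open>\<open>\<Phi>\<close> does not increase the first norm and does not decrease the
    second, so one exchange of norms suffices on either side and the constant is \<open>C\<close>
    itself.\<close>
  have "hnorm H2 u \<le> C * hnorm H1 (\<Phi> u)"
    using \<Phi>_bounds(2)[OF uc(2)] norm_le[OF pc] by linarith
  then show "hnorm H2 u / C \<le> hnorm H1 (\<Phi> u)" using C_ge_1 by (simp add: field_simps)
  show "hnorm H1 (\<Phi> u) \<le> C * hnorm H2 u"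
    using \<Phi>_bounds(1)[OF uc(2)] norm_ge[OF uc(1)] by linarith
  show "\<Phi> (hscale H2 c u) = hscale H1 c (\<Phi> u)" for c using \<Phi>_scale uc scale_eq by simp
  fix v assume "v \<in> A"
  then show "\<Phi> (hadd H2 u v) = hadd H1 (\<Phi> u) (\<Phi> v)" using \<Phi>_add uc add_eq A ker2_carrier by auto
qed

lemma \<Phi>_inv_into: "u \<in> hker H1 D1 \<Longrightarrow> inv_into (hker H2 D2) \<Phi> u = \<Psi> u"
  using \<Phi>_bij \<Phi>_\<Psi> \<Psi>_iff ker1_carrier by (intro inv_into_f_eq) (auto simp: bij_betw_def)

text \<open>Symmetry of \<open>P\<close> for both inner products carries the invariance of
  \<open>ker d\<close> and \<open>Range d\<close> over to the adjoint kernels, hence to both kernels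
  of the Hodge-Dirac operators. Then \<open>P\<close> commutes with \<open>\<Phi>\<close>, and a
  bijection commuting with \<open>P\<close> matches the fixed points of \<open>P\<close>. It will be
  applied to the degree projections.\<close>

lemma commuting_projection:
  assumes Pc: "\<And>u. u \<in> hcar H1 \<Longrightarrow> P u \<in> hcar H1"
    and P1: "\<And>u v. u \<in> hcar H1 \<Longrightarrow> v \<in> hcar H1 \<Longrightarrow> hinner H1 (P u) v = hinner H1 u (P v)"
    and P2: "\<And>u v. u \<in> hcar H1 \<Longrightarrow> v \<in> hcar H1 \<Longrightarrow> hinner H2 (P u) v = hinner H2 u (P v)"
    and Pker: "\<And>u. u \<in> hker H1 d \<Longrightarrow> P u \<in> hker H1 d"
    and Pran: "\<And>y. y \<in> Range d \<Longrightarrow> P y \<in> Range d"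
  shows "bij_betw \<Phi> {v \<in> hker H2 D2. P v = v} {u \<in> hker H1 D1. P u = u}"
proof -
  have Rc: "Range d \<subseteq> hcar H1" using d_carrier by auto
  have k1: "P u \<in> hker H1 D1" if u: "u \<in> hker H1 D1" for u
  proof -
    have "P u \<in> H1.perp (Range d)"
      using u Pran P1 Pc Rc ker1_carrier[OF u] unfolding ker_dirac ker_adj H1.perp_def
      by (auto simp: subset_iff) (metis Range.intros)
    then show ?thesis using u Pker ker_dirac ker_adj by auto
  qed
  have k2: "P u \<in> hker H2 D2" if u: "u \<in> hker H2 D2" for u
  proof -
    have "P u \<in> H2.perp (Range d)"
      using u Pran P2 Pc Rc ker2_carrier[OF u] unfolding snd.ker_dirac snd.ker_adj H2.perp_def car_eq
      by (auto simp: subset_iff) (metis Range.intros)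
    then show ?thesis using u Pker snd.ker_dirac snd.ker_adj ker_eq by auto
  qed
  \<comment> \<open>By duality: symmetry passes invariance from \<open>Range d\<close> to its
    complement and back to the double complement, which is the closure.\<close>
  have Pcl: "P x \<in> hclosure H1 (Range d)" if x: "x \<in> hclosure H1 (Range d)" for x
  proof -
    have xp: "x \<in> H1.perp (H1.perp (Range d))"
      using x H1.perp_perp[OF subspace_Range[OF d_linear]] by simp
    then have xc: "x \<in> hcar H1" by (auto simp: H1.perp_def)
    have "hinner H1 w (P x) = 0" if w: "w \<in> H1.perp (Range d)" for w
    proof -
      have wc: "w \<in> hcar H1" using w by (auto simp: H1.perp_def)
      have "hinner H1 s (P w) = 0" if "s \<in> Range d" for s
        using w that Pran P1[of s w] Rc wc by (auto simp: H1.perp_def)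
      then have "P w \<in> H1.perp (Range d)" using Pc wc by (auto simp: H1.perp_def)
      then have "hinner H1 (P w) x = 0" using xp by (auto simp: H1.perp_def)
      then show ?thesis using P1 wc xc by simp
    qed
    then have "P x \<in> H1.perp (H1.perp (Range d))" using Pc xc by (auto simp: H1.perp_def)
    then show ?thesis using H1.perp_perp[OF subspace_Range[OF d_linear]] by simp
  qed
  \<comment> \<open>Additivity of \<open>P\<close> follows from its symmetry, by testing against all
    vectors.\<close>
  have Pminus: "P (hminus H1 u v) = hminus H1 (P u) (P v)" if "u \<in> hcar H1" "v \<in> hcar H1" for u v
    by (rule H1.vec_eqI) (use that Pc P1 in auto)
  have comm: "\<Phi> (P v) = P (\<Phi> v)" if v: "v \<in> hker H2 D2" for v
  proof -
    have vc: "v \<in> hcar H1" using v ker2_carrier by blast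
    have u: "\<Phi> v \<in> hker H1 D1" "hminus H1 v (\<Phi> v) \<in> R1" using \<Phi>_iff vc by blast+
    have "hminus H1 v (\<Phi> v) \<in> hker H1 d"
      using u v ker1_subset ker2_subset by (intro H1.subspace_minus[OF ker_subspace]) auto
    then have "hminus H1 v (\<Phi> v) \<in> hclosure H1 (Range d)" using u ker_d_inter_R1 by blast
    then have "P (hminus H1 v (\<Phi> v)) \<in> R1" using Pcl ker_d_inter_R1 by blast
    then show ?thesis using \<Phi>_iff Pc vc k1[OF u(1)] Pminus u(1) ker1_carrier by simp
  qed
  show ?thesis
  proof (rule bij_betw_subset[OF \<Phi>_bij])
    show "\<Phi> ` {v \<in> hker H2 D2. P v = v} = {u \<in> hker H1 D1. P u = u}"
    proof (intro equalityI subsetI)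
      fix u assume "u \<in> \<Phi> ` {v \<in> hker H2 D2. P v = v}"
      then obtain v where v: "v \<in> hker H2 D2" "P v = v" "u = \<Phi> v" by blast
      then have "P u = u" using comm[OF v(1)] by simp
      then show "u \<in> {u \<in> hker H1 D1. P u = u}" using v \<Phi>_iff ker2_carrier by blast
    next
      fix u assume u: "u \<in> {u \<in> hker H1 D1. P u = u}"
      define v where "v = \<Psi> u"
      have v: "v \<in> hker H2 D2" "\<Phi> v = u" using u \<Psi>_iff ker1_carrier \<Phi>_\<Psi> v_def by blast+
      then have "\<Phi> (P v) = \<Phi> v" using comm u by simp
      then have "P v = v" using \<Psi>_\<Phi> k2 v by metis
      then show "u \<in> \<Phi> ` {v \<in> hker H2 D2. P v = v}" using v by blast
    qed
  qed auto
qed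

end

subsection \<open>The Cauchy-Binet formula\<close>

lemma bij_betw_nth_sorted:
  fixes I :: "'n::{finite,linorder} set"
  shows "bij_betw (\<lambda>a. sorted_list_of_set I ! a) {..<card I} I"
  using bij_betw_nth[of "sorted_list_of_set I" "{..<card I}" I] by simp

lemma mat_minor_eq:
  assumes "card I = k" "card J = k"
  shows "mat_minor A I J = (\<Sum>\<pi> | \<pi> permutes {..<k}. of_int (sign \<pi>) *
    (\<Prod>a<k. A $ (sorted_list_of_set I ! a) $ (sorted_list_of_set J ! \<pi> a)))"
  using assms by (simp add: mat_minor_def)

text \<open>A determinant with two equal rows: composing with the transposition of \<open>a\<close>
  and \<open>b\<close> keeps every product and flips every sign, so the sum equals its
  negative.\<close>

lemma alternating_sum_eq_0:
  fixes h :: "nat \<Rightarrow> nat \<Rightarrow> real"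
  assumes ab: "a < k" "b < k" "a \<noteq> b" "\<And>m. h a m = h b m"
  shows "(\<Sum>\<pi> | \<pi> permutes {..<k}. of_int (sign \<pi>) * (\<Prod>i<k. h i (\<pi> i))) = 0"
proof -
  let ?\<tau> = "Transposition.transpose a b"
  have \<tau>: "?\<tau> permutes {..<k}" using ab by (intro permutes_swap_id) auto
  have "(\<Sum>\<pi> | \<pi> permutes {..<k}. of_int (sign \<pi>) * (\<Prod>i<k. h i (\<pi> i))) =
      (\<Sum>\<pi> | \<pi> permutes {..<k}. of_int (sign (\<pi> \<circ> ?\<tau>)) * (\<Prod>i<k. h i ((\<pi> \<circ> ?\<tau>) i)))"
    by (rule sum.reindex_bij_witness[of _ "\<lambda>\<pi>. \<pi> \<circ> ?\<tau>" "\<lambda>\<pi>. \<pi> \<circ> ?\<tau>"])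
      (use \<tau> in \<open>auto simp: permutes_compose o_assoc[symmetric]\<close>)
  also have "\<dots> = (\<Sum>\<pi> | \<pi> permutes {..<k}. - (of_int (sign \<pi>) * (\<Prod>i<k. h i (\<pi> i))))"
  proof (rule sum.cong[OF refl])
    fix \<pi> assume "\<pi> \<in> {\<pi>. \<pi> permutes {..<k}}"
    then have \<pi>: "\<pi> permutes {..<k}" by simp
    have p: "permutation \<pi>" "permutation ?\<tau>" using \<pi> \<tau> permutation_permutes by blast+
    have "sign (\<pi> \<circ> ?\<tau>) = - sign \<pi>"
      using sign_compose[OF p] ab by (simp add: sign_swap_id)
    moreover have "(\<Prod>i<k. h i ((\<pi> \<circ> ?\<tau>) i)) = (\<Prod>i<k. h (?\<tau> i) ((\<pi> \<circ> ?\<tau>) i))"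
      by (rule prod.cong) (use ab in \<open>auto simp: Transposition.transpose_def\<close>)
    moreover have "\<dots> = (\<Prod>i<k. h i (\<pi> i))"
      using prod.permute[OF \<tau>, of "\<lambda>i. h i (\<pi> i)"] by (simp add: o_def)
    ultimately show "of_int (sign (\<pi> \<circ> ?\<tau>)) * (\<Prod>i<k. h i ((\<pi> \<circ> ?\<tau>) i)) =
        - (of_int (sign \<pi>) * (\<Prod>i<k. h i (\<pi> i)))" by simp
  qed
  finally show ?thesis by (simp add: sum_negf)
qed

lemma alternating_sum_permuted:
  fixes h :: "nat \<Rightarrow> nat \<Rightarrow> real"
  assumes \<sigma>: "\<sigma> permutes {..<k}"
  shows "(\<Sum>\<pi> | \<pi> permutes {..<k}. of_int (sign \<pi>) * (\<Prod>i<k. h (\<sigma> i) (\<pi> i))) =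
    of_int (sign \<sigma>) * (\<Sum>\<pi> | \<pi> permutes {..<k}. of_int (sign \<pi>) * (\<Prod>i<k. h i (\<pi> i)))"
proof -
  have "(\<Sum>\<pi> | \<pi> permutes {..<k}. of_int (sign \<pi>) * (\<Prod>i<k. h (\<sigma> i) (\<pi> i))) =
      (\<Sum>\<pi> | \<pi> permutes {..<k}. of_int (sign (\<pi> \<circ> \<sigma>)) * (\<Prod>i<k. h (\<sigma> i) ((\<pi> \<circ> \<sigma>) i)))"
    by (rule sum.reindex_bij_witness[of _ "\<lambda>\<pi>. \<pi> \<circ> \<sigma>" "\<lambda>\<pi>. \<pi> \<circ> inv \<sigma>"])
      (use \<sigma> in \<open>auto simp: permutes_compose permutes_inv o_assoc[symmetric] permutes_inv_o\<close>)
  also have "\<dots> = (\<Sum>\<pi> | \<pi> permutes {..<k}. of_int (sign \<sigma>) * (of_int (sign \<pi>) * (\<Prod>i<k. h i (\<pi> i))))"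
  proof (rule sum.cong[OF refl])
    fix \<pi> assume "\<pi> \<in> {\<pi>. \<pi> permutes {..<k}}"
    then have \<pi>: "\<pi> permutes {..<k}" by simp
    have p: "permutation \<pi>" "permutation \<sigma>" using \<pi> \<sigma> permutation_permutes by blast+
    have "(\<Prod>i<k. h (\<sigma> i) ((\<pi> \<circ> \<sigma>) i)) = (\<Prod>i<k. h i (\<pi> i))"
      using prod.permute[OF \<sigma>, of "\<lambda>i. h i (\<pi> i)"] by (simp add: o_def)
    then show "of_int (sign (\<pi> \<circ> \<sigma>)) * (\<Prod>i<k. h (\<sigma> i) ((\<pi> \<circ> \<sigma>) i)) =
        of_int (sign \<sigma>) * (of_int (sign \<pi>) * (\<Prod>i<k. h i (\<pi> i)))"
      by (simp add: sign_compose[OF p])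
  qed
  finally show ?thesis by (simp add: sum_distrib_left)
qed

text \<open>An injective function on \<open>{..<k}\<close> is a permutation followed by the increasing enumeration of
  its image.\<close>

lemma sum_inj_functions:
  fixes g :: "(nat \<Rightarrow> 'n::{finite,linorder}) \<Rightarrow> real"
  shows "(\<Sum>f | f \<in> {..<k} \<rightarrow>\<^sub>E UNIV \<and> inj_on f {..<k}. g f) =
    (\<Sum>K | card K = k. \<Sum>\<sigma> | \<sigma> permutes {..<k}. g (restrict (\<lambda>a. sorted_list_of_set K ! \<sigma> a) {..<k}))"
proof -
  let ?e = "\<lambda>K a. sorted_list_of_set K ! a"
  let ?\<sigma> = "\<lambda>f a. if a < k then inv_into {..<k} (?e (f ` {..<k})) (f a) else a"
  let ?S = "Sigma {K :: 'n set. card K = k} (\<lambda>_. {\<sigma>. \<sigma> permutes {..<k}})"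
  let ?r = "\<lambda>p. restrict (\<lambda>a. ?e (fst p) (snd p a)) {..<k}"
  have "(\<Sum>f | f \<in> {..<k} \<rightarrow>\<^sub>E UNIV \<and> inj_on f {..<k}. g f) = (\<Sum>p\<in>?S. g (?r p))"
  proof (rule sum.reindex_bij_witness[of _ ?r "\<lambda>f. (f ` {..<k}, ?\<sigma> f)"])
    fix f :: "nat \<Rightarrow> 'n" assume "f \<in> {f. f \<in> {..<k} \<rightarrow>\<^sub>E UNIV \<and> inj_on f {..<k}}"
    then have f: "f \<in> {..<k} \<rightarrow>\<^sub>E UNIV" "inj_on f {..<k}" by auto
    have c: "card (f ` {..<k}) = k" using f by (simp add: card_image)
    have e: "bij_betw (?e (f ` {..<k})) {..<k} (f ` {..<k})" using bij_betw_nth_sorted[of "f ` {..<k}"] c by simp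
    have \<sigma>e: "?e (f ` {..<k}) (?\<sigma> f a) = f a" if "a < k" for a
    proof -
      have "f a \<in> ?e (f ` {..<k}) ` {..<k}" using e that unfolding bij_betw_def by blast
      then show ?thesis using that by (simp add: f_inv_into_f)
    qed
    have r: "restrict (\<lambda>a. ?e (f ` {..<k}) (?\<sigma> f a)) {..<k} = f"
    proof
      fix a show "restrict (\<lambda>a. ?e (f ` {..<k}) (?\<sigma> f a)) {..<k} a = f a"
        using f(1) \<sigma>e[of a] by (cases "a < k") (auto simp: PiE_def extensional_def)
    qed
    show "?r (f ` {..<k}, ?\<sigma> f) = f" using r by simp
    then show "g (?r (f ` {..<k}, ?\<sigma> f)) = g f" by simp
    have "bij_betw (inv_into {..<k} (?e (f ` {..<k})) \<circ> f) {..<k} {..<k}"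
      using f by (intro bij_betw_trans[OF _ bij_betw_inv_into[OF e]]) (auto simp: bij_betw_def)
    then have "bij_betw (?\<sigma> f) {..<k} {..<k}" by (rule bij_betw_cong[THEN iffD1, rotated]) auto
    then have "?\<sigma> f permutes {..<k}" by (rule bij_imp_permutes) auto
    then show "(f ` {..<k}, ?\<sigma> f) \<in> ?S" using c by simp
  next
    fix p assume "p \<in> ?S"
    then obtain K \<sigma> where p: "p = (K, \<sigma>)" and K: "card K = k" and \<sigma>: "\<sigma> permutes {..<k}" by auto
    have e: "bij_betw (?e K) {..<k} K" using bij_betw_nth_sorted[of K] K by simp
    let ?f = "?r p"
    have bij: "bij_betw (?e K \<circ> \<sigma>) {..<k} K" by (rule bij_betw_trans[OF permutes_imp_bij[OF \<sigma>] e])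
    have img: "?f ` {..<k} = K" using bij by (auto simp: bij_betw_def image_def p)
    have "?\<sigma> ?f = \<sigma>"
    proof
      fix a show "?\<sigma> ?f a = \<sigma> a"
        unfolding img using \<sigma> e permutes_in_image[OF \<sigma>, of a] permutes_not_in[OF \<sigma>, of a]
        by (auto simp: bij_betw_def p)
    qed
    then show "(?f ` {..<k}, ?\<sigma> ?f) = p" using img p by simp
    have "inj_on (?e K \<circ> \<sigma>) {..<k}" using bij by (simp add: bij_betw_def)
    then show "?f \<in> {f. f \<in> {..<k} \<rightarrow>\<^sub>E UNIV \<and> inj_on f {..<k}}" by (auto simp: inj_on_def p)
  qed
  then show ?thesis by (subst sum.Sigma) (auto simp: finite_permutations case_prod_beta')
qed

text \<open>Expanding the entries of \<open>A ** B\<close> gives a sum over functions choosing an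
  intermediate index for each row. Non-injective functions contribute a determinant with two equal
  rows, which is 0. An injective one is a set \<open>K\<close> together with a permutation; the sign
  of that permutation, extracted from the minor of \<open>B\<close>, completes the minor of
  \<open>A\<close>.\<close>

theorem cauchy_binet:
  fixes A B :: "'n::{finite,linorder} rmat"
  shows "mat_minor (A ** B) I J = (\<Sum>K\<in>UNIV. mat_minor A I K * mat_minor B K J)"
proof (cases "card I = card J")
  case False
  then have "mat_minor A I K * mat_minor B K J = 0" for K by (auto simp: mat_minor_def)
  then have "(\<Sum>K\<in>UNIV. mat_minor A I K * mat_minor B K J) = 0" by (intro sum.neutral ballI)
  then show ?thesis using False by (simp only: mat_minor_def[of "A ** B"] if_False)
next
  case True
  define k where "k = card I"
  have k: "card I = k" "card J = k" using True by (auto simp: k_def)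
  let ?e = "\<lambda>K a. sorted_list_of_set K ! a"
  let ?D = "\<lambda>f. \<Sum>\<pi> | \<pi> permutes {..<k}. of_int (sign \<pi>) * (\<Prod>a<k. B $ f a $ ?e J (\<pi> a))"
  have finP: "finite {\<pi>. \<pi> permutes {..<k}}" by (simp add: finite_permutations)
  have finF: "finite ({..<k} \<rightarrow>\<^sub>E (UNIV :: 'n set))" by (intro finite_PiE) auto
  have "mat_minor (A ** B) I J = (\<Sum>\<pi> | \<pi> permutes {..<k}. of_int (sign \<pi>) *
      (\<Sum>f\<in>{..<k} \<rightarrow>\<^sub>E UNIV. \<Prod>a<k. A $ ?e I a $ f a * B $ f a $ ?e J (\<pi> a)))"
    unfolding mat_minor_eq[OF k] matrix_matrix_mult_def by (simp add: prod_sum_PiE)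
  also have "\<dots> = (\<Sum>f\<in>{..<k} \<rightarrow>\<^sub>E UNIV. (\<Prod>a<k. A $ ?e I a $ f a) * ?D f)"
    unfolding prod.distrib sum_distrib_left by (subst sum.swap) (simp add: ac_simps)
  also have "\<dots> = (\<Sum>f | f \<in> {..<k} \<rightarrow>\<^sub>E UNIV \<and> inj_on f {..<k}. (\<Prod>a<k. A $ ?e I a $ f a) * ?D f)"
  proof (rule sum.mono_neutral_right[OF finF])
    show "\<forall>f\<in>({..<k} \<rightarrow>\<^sub>E UNIV) - {f. f \<in> {..<k} \<rightarrow>\<^sub>E UNIV \<and> inj_on f {..<k}}. (\<Prod>a<k. A $ ?e I a $ f a) * ?D f = 0"
    proof
      fix f assume "f \<in> ({..<k} \<rightarrow>\<^sub>E (UNIV::'n set)) - {f. f \<in> {..<k} \<rightarrow>\<^sub>E UNIV \<and> inj_on f {..<k}}"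
      then obtain a b where "a < k" "b < k" "a \<noteq> b" "f a = f b" by (auto simp: inj_on_def)
      then have "?D f = 0" by (intro alternating_sum_eq_0[of a k b "\<lambda>a m. B $ f a $ ?e J m"]) auto
      then show "(\<Prod>a<k. A $ ?e I a $ f a) * ?D f = 0" by simp
    qed
  qed auto
  also have "\<dots> = (\<Sum>K | card K = k. \<Sum>\<sigma> | \<sigma> permutes {..<k}. (\<Prod>a<k. A $ ?e I a $ ?e K (\<sigma> a)) *
      (\<Sum>\<pi> | \<pi> permutes {..<k}. of_int (sign \<pi>) * (\<Prod>a<k. B $ ?e K (\<sigma> a) $ ?e J (\<pi> a))))"
    unfolding sum_inj_functions by simp
  also have "\<dots> = (\<Sum>K | card K = k. \<Sum>\<sigma> | \<sigma> permutes {..<k}. (\<Prod>a<k. A $ ?e I a $ ?e K (\<sigma> a)) *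
      (of_int (sign \<sigma>) * mat_minor B K J))"
  proof (intro sum.cong refl)
    fix K \<sigma> assume "K \<in> {K :: 'n set. card K = k}" "\<sigma> \<in> {\<sigma>. \<sigma> permutes {..<k}}"
    then have K: "card K = k" and \<sigma>: "\<sigma> permutes {..<k}" by auto
    show "(\<Prod>a<k. A $ ?e I a $ ?e K (\<sigma> a)) *
      (\<Sum>\<pi> | \<pi> permutes {..<k}. of_int (sign \<pi>) * (\<Prod>a<k. B $ ?e K (\<sigma> a) $ ?e J (\<pi> a))) =
      (\<Prod>a<k. A $ ?e I a $ ?e K (\<sigma> a)) * (of_int (sign \<sigma>) * mat_minor B K J)"
      unfolding mat_minor_eq[OF K k(2)]
      by (subst alternating_sum_permuted[OF \<sigma>, of "\<lambda>a m. B $ ?e K a $ ?e J m"]) simp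
  qed
  also have "\<dots> = (\<Sum>K | card K = k. mat_minor A I K * mat_minor B K J)"
    by (intro sum.cong refl) (simp add: mat_minor_eq[OF k(1)] sum_distrib_left sum_distrib_right ac_simps)
  also have "\<dots> = (\<Sum>K\<in>UNIV. mat_minor A I K * mat_minor B K J)"
    by (rule sum.mono_neutral_left) (auto simp: mat_minor_def k)
  finally show ?thesis .
qed

text \<open>A nonzero product of entries of the identity forces the enumeration of \<open>I\<close>
  to be that of \<open>J\<close> rearranged by \<open>\<pi>\<close>; both are enumerations in
  increasing order, so \<open>I = J\<close> and \<open>\<pi> = id\<close>.\<close>

lemma mat_minor_mat_1:
  "mat_minor (mat 1 :: 'n::{finite,linorder} rmat) I J = (if I = J then 1 else 0)"
proof (cases "card I = card J")
  case False
  then show ?thesis by (auto simp: mat_minor_def)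
next
  case True
  define k where "k = card I"
  have k: "card I = k" "card J = k" using True by (auto simp: k_def)
  let ?e = "\<lambda>K a. sorted_list_of_set K ! a"
  have eI: "bij_betw (?e I) {..<k} I" and eJ: "bij_betw (?e J) {..<k} J"
    using bij_betw_nth_sorted[of I] bij_betw_nth_sorted[of J] k by auto
  have zero: "(\<Prod>a<k. (mat 1 :: 'n rmat) $ ?e I a $ ?e J (\<pi> a)) = 0"
    if \<pi>: "\<pi> permutes {..<k}" and ne: "\<not> (I = J \<and> \<pi> = id)" for \<pi>
  proof (rule ccontr)
    assume "(\<Prod>a<k. (mat 1 :: 'n rmat) $ ?e I a $ ?e J (\<pi> a)) \<noteq> 0"
    then have eq: "?e I a = ?e J (\<pi> a)" if "a < k" for a
      using that by (auto simp: mat_def split: if_splits)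
    have "bij_betw (?e J \<circ> \<pi>) {..<k} J" by (rule bij_betw_trans[OF permutes_imp_bij[OF \<pi>] eJ])
    then have "bij_betw (?e I) {..<k} J" by (rule bij_betw_cong[THEN iffD1, rotated]) (simp add: eq)
    then have IJ: "I = J" using eI by (simp add: bij_betw_def)
    have "\<pi> a = a" for a
    proof (cases "a < k")
      case True
      then have "\<pi> a < k" using permutes_in_image[OF \<pi>, of a] by simp
      then show ?thesis using eq[OF True] eI IJ True by (auto simp: bij_betw_def inj_on_def)
    qed (use permutes_not_in[OF \<pi>] in simp)
    then have "\<pi> = id" by auto
    then show False using IJ ne by simp
  qed
  show ?thesis
  proof (cases "I = J")
    case True
    have "mat_minor (mat 1 :: 'n rmat) I J = (\<Sum>\<pi>\<in>{id}. of_int (sign \<pi>) *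
      (\<Prod>a<k. (mat 1 :: 'n rmat) $ ?e I a $ ?e J (\<pi> a)))"
      unfolding mat_minor_eq[OF k]
      by (rule sum.mono_neutral_right) (use zero permutes_id in \<open>auto simp: finite_permutations\<close>)
    then show ?thesis using True by (simp add: mat_def)
  next
    case False
    have "of_int (sign \<pi>) * (\<Prod>a<k. (mat 1 :: 'n rmat) $ ?e I a $ ?e J (\<pi> a)) = 0"
      if "\<pi> \<in> {\<pi>. \<pi> permutes {..<k}}" for \<pi>
      using zero[of \<pi>] that False by (simp only: mem_Collect_eq) simp
    then have "mat_minor (mat 1 :: 'n rmat) I J = 0" unfolding mat_minor_eq[OF k] by (intro sum.neutral ballI)
    then show ?thesis using False by simp
  qed
qed

lemma mat_minor_transpose:
  "mat_minor (Finite_Cartesian_Product.transpose A) I J = mat_minor A J I"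
proof (cases "card I = card J")
  case False
  then show ?thesis by (auto simp: mat_minor_def)
next
  case True
  define k where "k = card I"
  have k: "card I = k" "card J = k" using True by (auto simp: k_def)
  let ?e = "\<lambda>K a. sorted_list_of_set K ! a"
  have "mat_minor (Finite_Cartesian_Product.transpose A) I J = (\<Sum>\<pi> | \<pi> permutes {..<k}. of_int (sign \<pi>) *
    (\<Prod>a<k. A $ ?e J (\<pi> a) $ ?e I a))"
    unfolding mat_minor_eq[OF k] by (simp add: Finite_Cartesian_Product.transpose_def)
  also have "\<dots> = (\<Sum>\<pi> | \<pi> permutes {..<k}. of_int (sign (inv \<pi>)) * (\<Prod>a<k. A $ ?e J (inv \<pi> a) $ ?e I a))"
    by (rule sum_permutations_inverse)
  also have "\<dots> = mat_minor A J I"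
    unfolding mat_minor_eq[OF k(2,1)]
  proof (rule sum.cong[OF refl])
    fix \<pi> assume "\<pi> \<in> {\<pi>. \<pi> permutes {..<k}}"
    then have \<pi>: "\<pi> permutes {..<k}" by simp
    have "permutation \<pi>" using \<pi> permutation_permutes by blast
    moreover have "(\<Prod>a<k. A $ ?e J (inv \<pi> a) $ ?e I a) = (\<Prod>a<k. A $ ?e J a $ ?e I (\<pi> a))"
      using prod.permute[OF \<pi>, of "\<lambda>a. A $ ?e J (inv \<pi> a) $ ?e I a"] permutes_inverses(2)[OF \<pi>] by (simp add: o_def)
    ultimately show "of_int (sign (inv \<pi>)) * (\<Prod>a<k. A $ ?e J (inv \<pi> a) $ ?e I a) =
      of_int (sign \<pi>) * (\<Prod>a<k. A $ ?e J a $ ?e I (\<pi> a))" by (simp add: sign_inverse)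
  qed
  finally show ?thesis .
qed

text \<open>At most \<open>fact CARD('n)\<close> products of at most \<open>CARD('n)\<close>
  entries; \<open>1 \<le> C\<close> allows one exponent for minors of all sizes.\<close>

lemma mat_minor_bound:
  fixes A :: "'n::{finite,linorder} rmat"
  assumes A: "\<And>i j. \<bar>A $ i $ j\<bar> \<le> C" and C: "1 \<le> C"
  shows "\<bar>mat_minor A I J\<bar> \<le> fact CARD('n) * C ^ CARD('n)"
proof (cases "card I = card J")
  case False
  then show ?thesis using C by (auto simp: mat_minor_def)
next
  case True
  define k where "k = card I"
  have k: "card I = k" "card J = k" using True by (auto simp: k_def)
  have kn: "k \<le> CARD('n)" using card_mono[of UNIV I] k by simp
  have "\<bar>mat_minor A I J\<bar> \<le> (\<Sum>\<pi> | \<pi> permutes {..<k}. C ^ k)"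
    unfolding mat_minor_eq[OF k]
  proof (rule order_trans[OF sum_abs sum_mono])
    fix \<pi>
    have "\<bar>\<Prod>a<k. A $ (sorted_list_of_set I ! a) $ (sorted_list_of_set J ! \<pi> a)\<bar> \<le> (\<Prod>a<k. C)"
      unfolding abs_prod by (rule prod_mono) (use A in auto)
    then show "\<bar>of_int (sign \<pi>) * (\<Prod>a<k. A $ (sorted_list_of_set I ! a) $ (sorted_list_of_set J ! \<pi> a))\<bar> \<le> C ^ k"
      by (simp add: abs_mult sign_def)
  qed
  also have "\<dots> = fact k * C ^ k" by (simp add: card_permutations)
  also have "\<dots> \<le> fact CARD('n) * C ^ CARD('n)"
    using kn C by (intro mult_mono fact_mono power_increasing) auto
  finally show ?thesis .
qed

lemma det_bound:
  fixes A :: "'n::finite rmat"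
  assumes A: "\<And>i j. \<bar>A $ i $ j\<bar> \<le> C"
  shows "\<bar>det A\<bar> \<le> fact CARD('n) * C ^ CARD('n)"
proof -
  have "\<bar>det A\<bar> \<le> (\<Sum>\<pi> | \<pi> permutes (UNIV :: 'n set). C ^ CARD('n))"
    unfolding det_def
  proof (rule order_trans[OF sum_abs sum_mono])
    fix \<pi> :: "'n \<Rightarrow> 'n"
    have "\<bar>\<Prod>i\<in>UNIV. A $ i $ \<pi> i\<bar> \<le> (\<Prod>i\<in>(UNIV :: 'n set). C)"
      unfolding abs_prod by (rule prod_mono) (use A in auto)
    then show "\<bar>of_int (sign \<pi>) * (\<Prod>i\<in>UNIV. A $ i $ \<pi> i)\<bar> \<le> C ^ CARD('n)"
      by (simp add: abs_mult sign_def)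
  qed
  also have "\<dots> = fact CARD('n) * C ^ CARD('n)" by (simp add: card_permutations)
  finally show ?thesis .
qed

lemma inner_matrix_vector_mult:
  fixes A :: "real^'n^'m"
  shows "x \<bullet> (A *v y) = (Finite_Cartesian_Product.transpose A *v x) \<bullet> y"
  by (metis dot_lmul_matrix vector_transpose_matrix transpose_transpose)

lemma matrix_inv_eqI:
  fixes A B :: "'n::finite rmat"
  assumes "A ** B = mat 1" "B ** A = mat 1"
  shows "matrix_inv A = B"
proof -
  have "A ** matrix_inv A = mat 1 \<and> matrix_inv A ** A = mat 1"
    unfolding matrix_inv_def by (rule someI[of _ B]) (use assms in auto)
  then show ?thesis using assms by (metis matrix_mul_assoc matrix_mul_lid matrix_mul_rid)
qed

text \<open>Functoriality of the pullback, in reversed order, is Cauchy-Binet read on coefficients.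
  All coordinate independence of form norms rests on it.\<close>

lemma form_pullback_mult:
  "form_pullback (A ** B) \<omega> = form_pullback B (form_pullback A \<omega>)"
  unfolding form_pullback_def vec_eq_iff cauchy_binet
  by (auto simp: sum_distrib_left sum_distrib_right mult.assoc mult.left_commute intro: sum.swap)

lemma form_pullback_mat_1 [simp]: "form_pullback (mat 1) \<omega> = \<omega>"
proof -
  have "(\<Sum>I\<in>UNIV. of_real (mat_minor (mat 1 :: 'a rmat) I J) * \<omega> $ I) = (\<Sum>I\<in>UNIV. if I = J then \<omega> $ I else 0)" for J
    by (rule sum.cong) (auto simp: mat_minor_mat_1)
  then show ?thesis by (simp add: form_pullback_def vec_eq_iff)
qed

lemma form_pullback_add: "form_pullback A (\<omega> + \<eta>) = form_pullback A \<omega> + form_pullback A \<eta>"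
  by (simp add: form_pullback_def vec_eq_iff distrib_left sum.distrib)

lemma form_pullback_scale: "form_pullback A (c *s \<omega>) = c *s form_pullback A \<omega>"
  by (simp add: form_pullback_def vec_eq_iff sum_distrib_left mult.left_commute)

lemma form_pullback_zero [simp]: "form_pullback A 0 = 0"
  by (simp add: form_pullback_def vec_eq_iff)

lemma form_pullback_inverse:
  "A ** B = mat 1 \<Longrightarrow> form_pullback B (form_pullback A \<omega>) = \<omega>"
  by (simp flip: form_pullback_mult)

definition degree_filter :: "nat set \<Rightarrow> 'n::finite form \<Rightarrow> 'n form" where
  "degree_filter S \<omega> = (\<chi> I. if card I \<in> S then \<omega> $ I else 0)"

text \<open>\<open>mat_minor\<close> vanishes between index sets of different cardinality, so
  pullback preserves degree.\<close>

lemma form_pullback_degree_filter: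
  "form_pullback A (degree_filter S \<omega>) = degree_filter S (form_pullback A \<omega>)"
  unfolding form_pullback_def degree_filter_def vec_eq_iff
  by (auto simp: mat_minor_def intro!: sum.cong sum.neutral)

text \<open>The matrix of the pullback is indexed by pairs of subsets, whence the square of
  \<open>CARD('n set)\<close>; each entry is a minor and is bounded by
  \<open>mat_minor_bound\<close>.\<close>

lemma form_pullback_bound:
  fixes A :: "'n::{finite,linorder} rmat"
  assumes A: "\<And>i j. \<bar>A $ i $ j\<bar> \<le> C" and C: "1 \<le> C"
  shows "norm (form_pullback A \<omega>) \<le> (real CARD('n set))\<^sup>2 * (fact CARD('n) * C ^ CARD('n)) * norm \<omega>"
proof -
  let ?B = "fact CARD('n) * C ^ CARD('n)"
  have "norm (form_pullback A \<omega>) \<le> (\<Sum>J\<in>UNIV. norm (form_pullback A \<omega> $ J))"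
    unfolding norm_vec_def by (rule L2_set_le_sum) simp
  also have "\<dots> \<le> (\<Sum>J\<in>(UNIV :: 'n set set). \<Sum>I\<in>(UNIV :: 'n set set). ?B * norm \<omega>)"
  proof (rule sum_mono)
    fix J :: "'n set"
    show "norm (form_pullback A \<omega> $ J) \<le> (\<Sum>I\<in>(UNIV :: 'n set set). ?B * norm \<omega>)"
      unfolding form_pullback_def vec_lambda_beta
    proof (rule sum_norm_le)
      fix I :: "'n set"
      show "norm (complex_of_real (mat_minor A I J) * \<omega> $ I) \<le> ?B * norm \<omega>"
        unfolding norm_mult norm_of_real
        by (intro mult_mono mat_minor_bound assms Finite_Cartesian_Product.norm_nth_le) (use C in auto)
    qed
  qed
  finally show ?thesis by (simp add: power2_eq_square mult.assoc)
qed

subsection \<open>Orthonormal frames of a positive definite matrix\<close>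

definition posdef :: "'n::finite rmat \<Rightarrow> bool" where
  "posdef G \<longleftrightarrow> Finite_Cartesian_Product.transpose G = G \<and> (\<forall>u. u \<noteq> 0 \<longrightarrow> 0 < u \<bullet> (G *v u))"

text \<open>The columns of \<open>A\<close> are orthonormal for \<open>G\<close>. Pulling forms back
  by \<open>A\<close> then turns \<open>form_inner G\<close> into the standard Hermitian product,
  which reduces all pointwise estimates to the Euclidean case.\<close>

definition frame :: "'n::finite rmat \<Rightarrow> 'n rmat \<Rightarrow> bool" where
  "frame G A \<longleftrightarrow> Finite_Cartesian_Product.transpose A ** G ** A = mat 1"

text \<open>As long as fewer than \<open>CARD('n)\<close> vectors are chosen, the vectors
  \<open>G *v b i\<close> span a proper subspace. A nonzero vector that is orthogonal to it in the
  Euclidean sense is orthogonal to every \<open>b i\<close> for \<open>G\<close>, and only needs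
  normalising.\<close>

lemma posdef_orthonormal_vectors:
  fixes G :: "'n::finite rmat"
  assumes G: "posdef G" and S: "finite S"
  shows "\<exists>b. \<forall>i\<in>S. \<forall>j\<in>S. b i \<bullet> (G *v b j) = (if i = (j :: 'n) then 1 else 0)"
  using S
proof (induction S)
  case (insert k S)
  then obtain b where b: "\<And>i j. i \<in> S \<Longrightarrow> j \<in> S \<Longrightarrow> b i \<bullet> (G *v b j) = (if i = j then 1 else 0)" by blast
  let ?W = "(\<lambda>i. G *v b i) ` S"
  have "card S < CARD('n)" using insert.hyps by (metis finite card_seteq not_le_imp_less subset_UNIV UNIV_I)
  then have "dim ?W < DIM(real^'n)"
    using dim_le_card'[of ?W] card_image_le[OF insert.hyps(1), of "\<lambda>i. G *v b i"] insert.hyps by simp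
  then obtain v where v: "v \<noteq> 0" "\<And>y. y \<in> span ?W \<Longrightarrow> orthogonal v y"
    using orthogonal_to_subspace_exists by blast
  have sym: "x \<bullet> (G *v y) = y \<bullet> (G *v x)" for x y
    using G inner_matrix_vector_mult[of x G y] by (simp add: posdef_def inner_commute)
  have vb: "v \<bullet> (G *v b i) = 0" if "i \<in> S" for i
    using v(2)[of "G *v b i"] that by (auto simp: orthogonal_def span_base)
  define q where "q = v \<bullet> (G *v v)"
  have q: "0 < q" using G v by (simp add: posdef_def q_def)
  define w where "w = (1 / sqrt q) *\<^sub>R v"
  have Gw: "G *v w = (1 / sqrt q) *\<^sub>R (G *v v)" by (simp add: w_def matrix_vector_mult_scaleR)
  have "w \<bullet> (G *v w) = 1" using q by (simp add: Gw) (simp add: w_def q_def[symmetric] real_div_sqrt)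
  moreover have "w \<bullet> (G *v b i) = 0" "b i \<bullet> (G *v w) = 0" if "i \<in> S" for i
    using vb[OF that] sym[of "b i" w] by (auto simp: w_def)
  ultimately show ?case
    using b insert.hyps by (intro exI[of _ "b(k := w)"]) auto
qed simp

lemma frame_exists:
  fixes G :: "'n::finite rmat"
  assumes G: "posdef G" shows "\<exists>A. frame G A"
proof -
  obtain b :: "'n \<Rightarrow> real^'n" where b: "\<And>i j. b i \<bullet> (G *v b j) = (if i = j then 1 else 0)"
    using posdef_orthonormal_vectors[OF G finite, of UNIV] by auto
  let ?A = "\<chi> r c. b c $ r"
  have "(Finite_Cartesian_Product.transpose ?A ** G ** ?A) $ i $ j = b i \<bullet> (G *v b j)" for i j
  proof -
    have "(Finite_Cartesian_Product.transpose ?A ** G ** ?A) $ i $ j = (Finite_Cartesian_Product.transpose ?A ** (G ** ?A)) $ i $ j"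
      by (simp add: matrix_mul_assoc)
    also have "\<dots> = b i \<bullet> (G *v b j)"
      by (simp add: matrix_matrix_mult_def matrix_vector_mult_def inner_vec_def Finite_Cartesian_Product.transpose_def)
    finally show ?thesis .
  qed
  then have "frame G ?A" by (simp add: frame_def vec_eq_iff mat_def b)
  then show ?thesis by blast
qed

lemma frame_matrix_inv:
  assumes "frame G A"
  shows "matrix_inv G = A ** Finite_Cartesian_Product.transpose A" "invertible G" "invertible A"
proof -
  have 1: "Finite_Cartesian_Product.transpose A ** (G ** A) = mat 1" using assms by (simp add: frame_def matrix_mul_assoc)
  then have "(G ** A) ** Finite_Cartesian_Product.transpose A = mat 1" by (simp add: matrix_left_right_inverse)
  then have 2: "G ** (A ** Finite_Cartesian_Product.transpose A) = mat 1" by (simp add: matrix_mul_assoc)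
  then have 3: "(A ** Finite_Cartesian_Product.transpose A) ** G = mat 1" by (simp add: matrix_left_right_inverse)
  show "invertible G" using 2 3 unfolding invertible_def by blast
  show "matrix_inv G = A ** Finite_Cartesian_Product.transpose A" using matrix_inv_eqI[OF 2 3] .
  have "(Finite_Cartesian_Product.transpose A ** G) ** A = mat 1" using assms by (simp add: frame_def)
  then show "invertible A" using invertible_left_inverse by blast
qed

definition std_inner :: "'n::finite form \<Rightarrow> 'n form \<Rightarrow> complex" where
  "std_inner \<omega> \<eta> = (\<Sum>K\<in>UNIV. \<omega> $ K * cnj (\<eta> $ K))"

lemma std_inner_self: "std_inner \<omega> \<omega> = of_real ((norm \<omega>)\<^sup>2)"
proof -
  have "std_inner \<omega> \<omega> = (\<Sum>K\<in>UNIV. of_real ((cmod (\<omega> $ K))\<^sup>2))"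
    unfolding std_inner_def by (simp only: complex_norm_square)
  then show ?thesis by (simp add: norm_vec_def L2_set_def real_sqrt_pow2 sum_nonneg)
qed

lemma std_inner_norm_le: "norm (std_inner \<omega> \<eta>) \<le> norm \<omega> * norm \<eta>"
proof -
  have "norm (std_inner \<omega> \<eta>) \<le> (\<Sum>K\<in>UNIV. \<bar>norm (\<omega> $ K)\<bar> * \<bar>norm (\<eta> $ K)\<bar>)"
    unfolding std_inner_def by (rule sum_norm_le) (simp add: norm_mult)
  also have "\<dots> \<le> norm \<omega> * norm \<eta>"
    unfolding norm_vec_def by (rule L2_set_mult_ineq)
  finally show ?thesis .
qed

text \<open>The dual metric is \<open>A ** transpose A\<close>, and Cauchy-Binet writes each of its
  minors as a sum over \<open>K\<close> of products of two minors of \<open>A\<close>, that is, of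
  coefficients of the two pullbacks.\<close>

lemma form_inner_frame:
  assumes "frame G A"
  shows "form_inner G \<omega> \<eta> = std_inner (form_pullback A \<omega>) (form_pullback A \<eta>)"
proof -
  have "std_inner (form_pullback A \<omega>) (form_pullback A \<eta>) = (\<Sum>K\<in>UNIV. \<Sum>I\<in>UNIV. \<Sum>J\<in>UNIV.
      of_real (mat_minor A I K * mat_minor A J K) * \<omega> $ I * cnj (\<eta> $ J))"
    by (simp add: std_inner_def form_pullback_def sum_product cnj_sum ac_simps)
  also have "\<dots> = (\<Sum>I\<in>UNIV. \<Sum>J\<in>UNIV. \<Sum>K\<in>UNIV.
      of_real (mat_minor A I K * mat_minor A J K) * \<omega> $ I * cnj (\<eta> $ J))"
    by (subst sum.swap, rule sum.cong[OF refl], rule sum.swap)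
  also have "\<dots> = form_inner G \<omega> \<eta>"
    by (simp add: form_inner_def frame_matrix_inv[OF assms] cauchy_binet mat_minor_transpose sum_distrib_right of_real_sum)
  finally show ?thesis by simp
qed

lemma form_norm_frame: "frame G A \<Longrightarrow> form_norm G \<omega> = norm (form_pullback A \<omega>)"
  by (simp add: form_norm_def form_inner_frame std_inner_self)

lemma metric_norm_frame:
  assumes "frame G A" shows "metric_norm G (A *v w) = norm w"
proof -
  have "(A *v w) \<bullet> (G *v (A *v w)) = w \<bullet> ((Finite_Cartesian_Product.transpose A ** G ** A) *v w)"
    using inner_matrix_vector_mult[of w "Finite_Cartesian_Product.transpose A" "G *v (A *v w)"]
    by (simp add: matrix_vector_mul_assoc[symmetric])
  then show ?thesis using assms by (simp add: frame_def metric_norm_def norm_eq_sqrt_inner)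
qed

lemma frame_transform:
  assumes A: "frame G A" and P: "P ** Q = mat 1"
  shows "frame (Finite_Cartesian_Product.transpose P ** G ** P) (Q ** A)"
proof -
  have "Finite_Cartesian_Product.transpose (Q ** A) ** (Finite_Cartesian_Product.transpose P ** G ** P) ** (Q ** A) =
    Finite_Cartesian_Product.transpose A ** Finite_Cartesian_Product.transpose (P ** Q) ** G ** (P ** Q) ** A"
    by (simp add: matrix_transpose_mul matrix_mul_assoc)
  also have "\<dots> = mat 1" using A P by (simp add: frame_def transpose_mat)
  finally show ?thesis by (simp add: frame_def)
qed

lemma form_inner_transform:
  assumes G: "posdef G" and P: "P ** Q = mat 1"
  shows "form_inner (Finite_Cartesian_Product.transpose P ** G ** P) (form_pullback P \<omega>) (form_pullback P \<eta>) = form_inner G \<omega> \<eta>"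
proof -
  obtain A where A: "frame G A" using frame_exists[OF G] by blast
  have "form_pullback (Q ** A) (form_pullback P \<zeta>) = form_pullback A \<zeta>" for \<zeta>
    by (simp add: matrix_mul_assoc P flip: form_pullback_mult)
  then show ?thesis
    unfolding form_inner_frame[OF A] form_inner_frame[OF frame_transform[OF A P]] by simp
qed

lemma frame_det:
  assumes "frame G A" shows "det G * (det A)\<^sup>2 = 1" "0 < det G" "det A \<noteq> 0"
proof -
  have "det (Finite_Cartesian_Product.transpose A ** G ** A) = 1" using assms by (simp add: frame_def)
  then show 1: "det G * (det A)\<^sup>2 = 1" by (simp add: det_mul det_transpose power2_eq_square ac_simps)
  then show 2: "det A \<noteq> 0" by auto
  then have "0 < (det A)\<^sup>2" by simp
  then show "0 < det G" using 1 by (metis zero_less_mult_pos2 zero_less_one)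
qed

text \<open>The constant of \<open>form_pullback_bound\<close>; it also dominates the bound on the
  determinant, so one number serves for norms of forms and for volume densities.\<close>

definition comparison_const :: "'n::finite itself \<Rightarrow> real \<Rightarrow> real" where
  "comparison_const _ C = (real CARD('n set))\<^sup>2 * (fact CARD('n) * C ^ CARD('n))"

lemma comparison_const_ge_1: "1 \<le> C \<Longrightarrow> 1 \<le> comparison_const TYPE('n::finite) C"
  unfolding comparison_const_def
  using mult_mono[of 1 "(real CARD('n set))\<^sup>2" 1 "fact CARD('n) * C ^ CARD('n)"]
    mult_mono[of "1::real" "fact CARD('n)" 1 "C ^ CARD('n)"] one_le_power[of C "CARD('n)"]
    one_le_power[of "real CARD('n set)" 2]
  by (simp add: Suc_le_eq)

text \<open>The matrix \<open>E\<close> expresses the \<open>G2\<close>-orthonormal frame in the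
  \<open>G1\<close>-orthonormal one; each column has \<open>G1\<close>-norm at most
  \<open>C\<close>, hence entries at most \<open>C\<close>. The two conclusions point in opposite
  directions: forms are dual to vectors, so an upper bound for \<open>G1\<close> by
  \<open>G2\<close> on vectors reverses on forms, while the volume densities are compared in the
  original direction, with ratio the absolute value of \<open>det E\<close>.\<close>

lemma metric_comparison:
  fixes G1 G2 :: "'n::{finite,linorder} rmat"
  assumes G: "posdef G1" "posdef G2" and C: "1 \<le> C"
    and le: "\<And>u. metric_norm G1 u \<le> C * metric_norm G2 u"
  shows "form_norm G2 \<omega> \<le> comparison_const TYPE('n) C * form_norm G1 \<omega>"
    and "sqrt (det G1) \<le> comparison_const TYPE('n) C * sqrt (det G2)"
proof -
  obtain A1 A2 where A: "frame G1 A1" "frame G2 A2" using frame_exists G by blast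
  obtain B where B: "A1 ** B = mat 1" "B ** A1 = mat 1"
    using frame_matrix_inv(3)[OF A(1)] unfolding invertible_def by blast
  define E where "E = B ** A2"
  have A2: "A2 = A1 ** E" by (simp add: E_def matrix_mul_assoc B)
  have E: "\<bar>E $ i $ j\<bar> \<le> C" for i j
  proof -
    have "\<bar>E $ i $ j\<bar> = \<bar>(E *v axis j 1) $ i\<bar>" by (simp add: matrix_vector_mul_component inner_axis)
    also have "\<dots> \<le> norm (E *v axis j 1)" by (rule component_le_norm_cart)
    also have "\<dots> = metric_norm G1 (A2 *v axis j 1)"
      using metric_norm_frame[OF A(1), of "E *v axis j 1"] by (simp add: A2 matrix_vector_mul_assoc)
    also have "\<dots> \<le> C * metric_norm G2 (A2 *v axis j 1)" by (rule le)
    also have "\<dots> = C" by (simp add: metric_norm_frame[OF A(2)])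
    finally show ?thesis .
  qed
  show "form_norm G2 \<omega> \<le> comparison_const TYPE('n) C * form_norm G1 \<omega>"
    unfolding form_norm_frame[OF A(1)] form_norm_frame[OF A(2)] A2 form_pullback_mult comparison_const_def
    by (rule form_pullback_bound[OF E C])
  have "\<bar>det E\<bar> \<le> 1 * (fact CARD('n) * C ^ CARD('n))" using det_bound[OF E] by simp
  also have "\<dots> \<le> comparison_const TYPE('n) C"
    unfolding comparison_const_def using C
    by (intro mult_right_mono) (auto simp: Suc_le_eq intro!: one_le_power)
  finally have dE: "\<bar>det E\<bar> \<le> comparison_const TYPE('n) C" .
  have "det G1 * (det A1)\<^sup>2 = det G2 * (det E)\<^sup>2 * (det A1)\<^sup>2"
    using frame_det(1)[OF A(1)] frame_det(1)[OF A(2)] by (simp add: A2 det_mul power_mult_distrib ac_simps)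
  then have "det G1 = det G2 * (det E)\<^sup>2" using frame_det(3)[OF A(1)] by simp
  then have "sqrt (det G1) = \<bar>det E\<bar> * sqrt (det G2)" by (simp add: real_sqrt_mult)
  also have "\<dots> \<le> comparison_const TYPE('n) C * sqrt (det G2)"
    using dE frame_det(2)[OF A(2)] by (intro mult_right_mono) auto
  finally show "sqrt (det G1) \<le> comparison_const TYPE('n) C * sqrt (det G2)" .
qed

subsection \<open>The extended inner product\<close>

lemma form_inner_add_left: "form_inner G (\<omega> + \<omega>') \<eta> = form_inner G \<omega> \<eta> + form_inner G \<omega>' \<eta>"
  by (simp add: form_inner_def algebra_simps sum.distrib)

lemma form_inner_scale_left: "form_inner G (c *s \<omega>) \<eta> = c * form_inner G \<omega> \<eta>"
  by (simp add: form_inner_def sum_distrib_left ac_simps)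

lemma form_inner_zero_left [simp]: "form_inner G 0 \<eta> = 0"
  by (simp add: form_inner_def)

lemma form_inner_commute: assumes "posdef G" shows "form_inner G \<omega> \<eta> = cnj (form_inner G \<eta> \<omega>)"
proof -
  obtain A where A: "frame G A" using frame_exists assms by blast
  show ?thesis unfolding form_inner_frame[OF A] std_inner_def by (simp add: cnj_sum mult.commute)
qed

lemma form_inner_self: assumes "posdef G" shows "form_inner G \<omega> \<omega> = of_real ((form_norm G \<omega>)\<^sup>2)"
proof -
  obtain A where A: "frame G A" using frame_exists assms by blast
  show ?thesis by (simp only: form_norm_frame[OF A] form_inner_frame[OF A] std_inner_self)
qed

lemma form_norm_nonneg: assumes "posdef G" shows "0 \<le> form_norm G \<omega>"
  using frame_exists[OF assms] form_norm_frame by fastforce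

lemma form_inner_norm_le: assumes "posdef G" shows "norm (form_inner G \<omega> \<eta>) \<le> form_norm G \<omega> * form_norm G \<eta>"
proof -
  obtain A where A: "frame G A" using frame_exists assms by blast
  show ?thesis by (simp only: form_norm_frame[OF A] form_inner_frame[OF A] std_inner_norm_le)
qed

lemma form_norm_triangle: assumes "posdef G" shows "form_norm G (\<omega> + \<eta>) \<le> form_norm G \<omega> + form_norm G \<eta>"
proof -
  obtain A where A: "frame G A" using frame_exists assms by blast
  show ?thesis by (simp add: form_norm_frame[OF A] form_pullback_add norm_triangle_ineq)
qed

lemma form_norm_scale: assumes "posdef G" shows "form_norm G (c *s \<omega>) = cmod c * form_norm G \<omega>"
proof -
  obtain A where A: "frame G A" using frame_exists assms by blast
  have "norm (c *s (\<eta> :: 'a form)) = cmod c * norm \<eta>" for \<eta>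
    by (simp add: norm_vec_def norm_mult L2_set_right_distrib)
  then show ?thesis by (simp add: form_norm_frame[OF A] form_pullback_scale)
qed

lemma form_norm_eq_0: assumes "posdef G" shows "form_norm G \<omega> = 0 \<longleftrightarrow> \<omega> = 0"
proof -
  obtain A where A: "frame G A" using frame_exists assms by blast
  obtain B where B: "A ** B = mat 1"
    using frame_matrix_inv(3)[OF A] unfolding invertible_def by blast
  have "form_pullback A \<omega> = 0 \<Longrightarrow> \<omega> = 0" using form_pullback_inverse[OF B, of \<omega>] by simp
  then show ?thesis by (auto simp: form_norm_frame[OF A])
qed

text \<open>A bound at one fixed \<open>G\<close>, with no uniformity: it is used at a single point
  to turn summability in the norm of \<open>g x\<close> into convergence of coefficients.\<close>

lemma form_norm_lower_bound: assumes "posdef G" obtains c where "0 < c" "\<And>\<omega>. norm \<omega> \<le> c * form_norm G \<omega>"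
proof -
  obtain A where A: "frame G A" using frame_exists assms by blast
  obtain B where B: "A ** B = mat 1"
    using frame_matrix_inv(3)[OF A] unfolding invertible_def by blast
  define C where "C = Max (insert 1 {\<bar>B $ i $ j\<bar> | i j. True})"
  have fin: "finite {\<bar>B $ i $ j\<bar> | i j. True}"
    by (rule finite_subset[of _ "(\<lambda>(i, j). \<bar>B $ i $ j\<bar>) ` UNIV"]) auto
  have C: "1 \<le> C" "\<And>i j. \<bar>B $ i $ j\<bar> \<le> C" using fin by (auto simp: C_def intro!: Max_ge)
  have "norm \<omega> \<le> comparison_const TYPE('a) C * form_norm G \<omega>" for \<omega>
    using form_pullback_bound[OF C(2,1), of "form_pullback A \<omega>"]
    by (simp add: form_norm_frame[OF A] form_pullback_inverse[OF B] comparison_const_def)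
  then show ?thesis using that comparison_const_ge_1[OF C(1), where 'n = 'a] by (meson less_le_trans zero_less_one)
qed

text \<open>Gram minors between different degrees vanish, so forms of different degrees are
  orthogonal for every metric and the degree projections are symmetric for all of them at
  once.\<close>

lemma form_inner_degree_filter:
  "form_inner G (degree_filter S \<omega>) \<eta> = form_inner G \<omega> (degree_filter S \<eta>)"
  unfolding form_inner_def degree_filter_def
  by (intro sum.cong refl) (auto simp: mat_minor_def)

lemma form_norm_degree_filter_le:
  assumes "posdef G" shows "form_norm G (degree_filter S \<omega>) \<le> form_norm G \<omega>"
proof -
  obtain A where A: "frame G A" using frame_exists assms by blast
  have "norm (degree_filter S \<eta>) \<le> norm \<eta>" for \<eta> :: "'a form"
    by (rule norm_le_componentwise_cart) (simp add: degree_filter_def)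
  then show ?thesis by (simp add: form_norm_frame[OF A] form_pullback_degree_filter)
qed

section \<open>Measurability of determinants, inverses and inner products\<close>

lemma borel_measurable_vec_nth:
  fixes f :: "'a \<Rightarrow> 'b::euclidean_space^'n"
  assumes "f \<in> borel_measurable M"
  shows "(\<lambda>x. f x $ i) \<in> borel_measurable M"
  using assms by (rule borel_measurable_continuous_on[rotated]) (intro continuous_intros)

lemma borel_measurable_cnj: "cnj \<in> borel_measurable borel"
  by (intro borel_measurable_continuous_onI continuous_intros)

lemma borel_measurable_vecI:
  fixes f :: "'a \<Rightarrow> 'b::euclidean_space^'n"
  assumes "\<And>i. (\<lambda>x. f x $ i) \<in> borel_measurable M"
  shows "f \<in> borel_measurable M"
  unfolding borel_measurable_euclidean_space[of f]
proof
  fix b :: "'b^'n" assume "b \<in> Basis"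
  then obtain i u where b: "b = axis i u" "u \<in> Basis" by (auto simp: Basis_vec_def)
  have "(\<lambda>x. f x $ i \<bullet> u) \<in> borel_measurable M" using assms[of i] by simp
  then show "(\<lambda>x. f x \<bullet> b) \<in> borel_measurable M" by (simp add: b inner_axis)
qed

context
  fixes M :: "'a measure" and F :: "'a \<Rightarrow> 'n::{finite,linorder} rmat"
  assumes F: "F \<in> borel_measurable M"
begin

lemma borel_measurable_matrix_entry: "(\<lambda>x. F x $ i $ j) \<in> borel_measurable M"
  by (intro borel_measurable_vec_nth F)

lemma borel_measurable_det: "(\<lambda>x. det (F x)) \<in> borel_measurable M"
  unfolding det_def by (intro borel_measurable_sum borel_measurable_times borel_measurable_prod
      borel_measurable_const borel_measurable_matrix_entry)

lemma borel_measurable_mat_minor: "(\<lambda>x. mat_minor (F x) I J) \<in> borel_measurable M"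
proof (cases "card I = card J")
  case True
  then show ?thesis unfolding mat_minor_def if_P[OF True]
    by (intro borel_measurable_sum borel_measurable_times borel_measurable_prod
      borel_measurable_const borel_measurable_matrix_entry)
qed (simp add: mat_minor_def)

end

text \<open>An explicit rational formula for the entries of the inverse, from which measurability of
  the inverse can be read off.\<close>

lemma matrix_inv_cramer:
  fixes A :: "'n::finite rmat"
  assumes "det A \<noteq> 0"
  shows "matrix_inv A $ k $ l = det (\<chi> i j. if j = k then axis l 1 $ i else A $ i $ j) / det A"
proof -
  obtain B where B: "A ** B = mat 1" "B ** A = mat 1"
    using assms invertible_det_nz unfolding invertible_def by blast
  have "A *v (B *v axis l 1) = axis l 1" by (simp add: matrix_vector_mul_assoc B)
  then have "B *v axis l 1 = (\<chi> k. det (\<chi> i j. if j = k then axis l 1 $ i else A $ i $ j) / det A)"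
    using cramer[OF assms] by blast
  moreover have "B $ k $ l = (B *v axis l 1) $ k" by (simp add: matrix_vector_mul_component inner_axis)
  ultimately show ?thesis by (simp add: matrix_inv_eqI[OF B])
qed

text \<open>On singular matrices \<open>matrix_inv\<close> takes one fixed, unspecified value.\<close>

lemma matrix_inv_singular:
  fixes A B :: "'n::finite rmat"
  assumes "det A = 0" "det B = 0"
  shows "matrix_inv A = matrix_inv B"
proof -
  have "\<not> invertible A" "\<not> invertible B" using assms invertible_det_nz by auto
  then have "(\<lambda>A'. A ** A' = mat 1 \<and> A' ** A = mat 1) = (\<lambda>A'. B ** A' = mat 1 \<and> A' ** B = mat 1)"
    unfolding invertible_def by blast
  then show ?thesis unfolding matrix_inv_def by simp
qed

context
  fixes M :: "'a measure" and F :: "'a \<Rightarrow> 'n::{finite,linorder} rmat"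
  assumes F: "F \<in> borel_measurable M"
begin

lemma borel_measurable_matrix_inv: "(\<lambda>x. matrix_inv (F x)) \<in> borel_measurable M"
proof (intro borel_measurable_vecI)
  fix k l
  have det0: "det (0 :: 'n rmat) = 0" by (simp add: det_def power_0_left)
  \<comment> \<open>The zero matrix represents all singular matrices, on which
    \<open>matrix_inv\<close> is constant; so the inverse is a case distinction between a constant
    and a quotient of measurable functions.\<close>
  have eq: "matrix_inv (F x) $ k $ l = (if det (F x) = 0 then matrix_inv 0 $ k $ l
      else det (\<chi> i j. if j = k then axis l 1 $ i else F x $ i $ j) / det (F x))" for x
    using matrix_inv_cramer[of "F x" k l] matrix_inv_singular[of "F x" 0] det0 by auto
  have [measurable]: "(\<lambda>x. det (F x)) \<in> borel_measurable M" by (rule borel_measurable_det[OF F])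
  have "(\<lambda>x. \<chi> i j. if j = k then axis l 1 $ i else F x $ i $ j) \<in> borel_measurable M"
  proof (intro borel_measurable_vecI)
    fix r s
    show "(\<lambda>x. (\<chi> i j. if j = k then axis l 1 $ i else F x $ i $ j) $ r $ s) \<in> borel_measurable M"
      by (cases "s = k") (simp_all add: borel_measurable_matrix_entry[OF F])
  qed
  then have [measurable]: "(\<lambda>x. det (\<chi> i j. if j = k then axis l 1 $ i else F x $ i $ j)) \<in> borel_measurable M"
    by (rule borel_measurable_det)
  show "(\<lambda>x. matrix_inv (F x) $ k $ l) \<in> borel_measurable M" unfolding eq by measurable
qed

lemma borel_measurable_form_inner:
  assumes "\<omega> \<in> borel_measurable M" "\<eta> \<in> borel_measurable M"
  shows "(\<lambda>x. form_inner (F x) (\<omega> x) (\<eta> x)) \<in> borel_measurable M"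
  unfolding form_inner_def
  by (intro borel_measurable_sum borel_measurable_times borel_measurable_vec_nth assms
      borel_measurable_of_real[THEN measurable_compose[rotated]]
      borel_measurable_cnj[THEN measurable_compose[rotated]] borel_measurable_mat_minor borel_measurable_matrix_inv)

end

subsection \<open>Functions of class C^k\<close>

lemma C_k_on_subset: "C_k_on k W f \<Longrightarrow> V \<subseteq> W \<Longrightarrow> C_k_on k V f"
  by (induction k arbitrary: f) (auto intro: continuous_on_subset)

lemma C_k_on_cong:
  assumes W: "open W" and "C_k_on k W f" "\<And>x. x \<in> W \<Longrightarrow> f x = g x"
  shows "C_k_on k W g"
  using assms(2,3)
proof (induction k arbitrary: f g)
  case 0
  then show ?case by (auto cong: continuous_on_cong)
next
  case (Suc k)
  have d: "(g has_derivative frechet_derivative f (at x)) (at x)" if "x \<in> W" for x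
  proof -
    have "f differentiable at x" using Suc.prems(1) that by simp
    then have "(f has_derivative frechet_derivative f (at x)) (at x)" by (rule frechet_derivative_works[THEN iffD1])
    then show ?thesis by (rule has_derivative_transform_within_open[OF _ W that]) (rule Suc.prems(2))
  qed
  then have e: "frechet_derivative g (at x) = frechet_derivative f (at x)" if "x \<in> W" for x
    using frechet_derivative_at[OF d[OF that]] by simp
  have "C_k_on k W (\<lambda>x. frechet_derivative g (at x) v)" for v
  proof (rule Suc.IH[of "\<lambda>x. frechet_derivative f (at x) v"])
    show "C_k_on k W (\<lambda>x. frechet_derivative f (at x) v)" using Suc.prems(1) by simp
  qed (simp add: e)
  moreover have "g differentiable at x" if "x \<in> W" for x using d[OF that] by (auto simp: differentiable_def)
  ultimately show ?case by simp
qed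

lemma C_k_on_SucI:
  assumes W: "open W" and d: "\<And>x. x \<in> W \<Longrightarrow> (f has_derivative f' x) (at x)"
    and "\<And>v. C_k_on k W (\<lambda>x. f' x v)"
  shows "C_k_on (Suc k) W f"
proof -
  have e: "frechet_derivative f (at x) = f' x" if "x \<in> W" for x
    using frechet_derivative_at[OF d[OF that]] by simp
  have "C_k_on k W (\<lambda>x. frechet_derivative f (at x) v)" for v
    by (rule C_k_on_cong[OF W assms(3)[of v]]) (simp add: e)
  then show ?thesis using d by (auto simp: differentiable_def)
qed

lemma C_k_on_SucD:
  assumes "C_k_on (Suc k) W f"
  shows "x \<in> W \<Longrightarrow> (f has_derivative frechet_derivative f (at x)) (at x)"
    and "C_k_on k W (\<lambda>x. frechet_derivative f (at x) v)"
  using assms by (auto simp: frechet_derivative_works)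

lemma C_k_on_Suc: "C_k_on (Suc k) W f \<Longrightarrow> C_k_on k W f"
proof (induction k arbitrary: f)
  case 0
  then have "\<forall>x\<in>W. isCont f x" by (auto intro: differentiable_imp_continuous_within)
  then show ?case by (simp add: continuous_at_imp_continuous_on)
next
  case (Suc k)
  have "C_k_on k W (\<lambda>x. frechet_derivative f (at x) v)" for v
    by (rule Suc.IH[OF C_k_on_SucD(2)[OF Suc.prems]])
  then show ?case using Suc.prems by simp
qed

lemma C_k_on_const: "C_k_on k W (\<lambda>_. c)"
  by (induction k arbitrary: c) auto

lemma C_k_on_ident: assumes "open W" shows "C_k_on k W (\<lambda>x. x)"
proof (cases k)
  case (Suc m)
  show ?thesis unfolding Suc
    by (rule C_k_on_SucI[OF assms has_derivative_ident C_k_on_const])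
qed simp

lemma C_k_on_bounded_linear:
  assumes W: "open W" and L: "bounded_linear L" and "C_k_on k W f"
  shows "C_k_on k W (\<lambda>x. L (f x))"
  using assms(3)
proof (induction k arbitrary: f)
  case 0
  then show ?case using L by (auto intro: continuous_on_compose2[OF linear_continuous_on[OF L]])
next
  case (Suc k)
  show ?case
    by (rule C_k_on_SucI[OF W bounded_linear.has_derivative[OF L C_k_on_SucD(1)[OF Suc.prems]]])
      (auto intro: Suc.IH C_k_on_SucD(2)[OF Suc.prems])
qed

lemma C_k_on_add:
  assumes W: "open W" and "C_k_on k W f" "C_k_on k W g"
  shows "C_k_on k W (\<lambda>x. f x + g x)"
  using assms(2,3)
proof (induction k arbitrary: f g)
  case 0
  then show ?case by (auto intro: continuous_intros)
next
  case (Suc k)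
  show ?case
    by (rule C_k_on_SucI[OF W has_derivative_add[OF C_k_on_SucD(1)[OF Suc.prems(1)] C_k_on_SucD(1)[OF Suc.prems(2)]]])
      (auto intro: Suc.IH C_k_on_SucD(2)[OF Suc.prems(1)] C_k_on_SucD(2)[OF Suc.prems(2)])
qed

lemma C_k_on_sum:
  assumes W: "open W" and "\<And>i. i \<in> I \<Longrightarrow> C_k_on k W (f i)"
  shows "C_k_on k W (\<lambda>x. \<Sum>i\<in>I. f i x)"
  using assms(2) by (induction I rule: infinite_finite_induct) (auto intro: C_k_on_const C_k_on_add[OF W])

lemma C_k_on_bilinear:
  assumes W: "open W" and B: "bounded_bilinear B" and "C_k_on k W f" "C_k_on k W g"
  shows "C_k_on k W (\<lambda>x. B (f x) (g x))"
  using assms(3,4)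
proof (induction k arbitrary: f g)
  case 0
  then show ?case using B by (auto intro: bounded_bilinear.continuous_on)
next
  case (Suc k)
  show ?case
    by (rule C_k_on_SucI[OF W bounded_bilinear.FDERIV[OF B C_k_on_SucD(1)[OF Suc.prems(1)] C_k_on_SucD(1)[OF Suc.prems(2)]]])
      (auto intro!: C_k_on_add[OF W] Suc.IH C_k_on_SucD(2)[OF Suc.prems(1)] C_k_on_SucD(2)[OF Suc.prems(2)]
        C_k_on_Suc[OF Suc.prems(1)] C_k_on_Suc[OF Suc.prems(2)])
qed

lemmas C_k_on_mult = C_k_on_bilinear[OF _ bounded_bilinear_mult]
lemmas C_k_on_scaleR = C_k_on_bilinear[OF _ bounded_bilinear_scaleR]

lemma C_k_on_prod:
  fixes f :: "'i \<Rightarrow> 'a::real_normed_vector \<Rightarrow> real"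
  assumes W: "open W" and "\<And>i. i \<in> I \<Longrightarrow> C_k_on k W (f i)"
  shows "C_k_on k W (\<lambda>x. \<Prod>i\<in>I. f i x)"
  using assms(2) by (induction I rule: infinite_finite_induct) (auto intro: C_k_on_const C_k_on_mult[OF W])

lemma C_k_on_compose:
  fixes f :: "'b::euclidean_space \<Rightarrow> 'c::real_normed_vector"
  assumes W: "open W" and V: "open V" and gW: "g ` W \<subseteq> V"
    and "C_k_on k V f" "C_k_on k W g"
  shows "C_k_on k W (\<lambda>x. f (g x))"
  using assms(4,5)
proof (induction k arbitrary: f)
  case 0
  then show ?case using gW by (auto intro: continuous_on_compose2)
next
  case (Suc k)
  let ?f' = "\<lambda>x. frechet_derivative f (at x)" and ?g' = "\<lambda>x. frechet_derivative g (at x)"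
  have d: "((\<lambda>x. f (g x)) has_derivative (\<lambda>v. ?f' (g x) (?g' x v))) (at x)" if "x \<in> W" for x
    by (rule has_derivative_compose[OF C_k_on_SucD(1)[OF Suc.prems(2) that] C_k_on_SucD(1)[OF Suc.prems(1)]])
      (use gW that in auto)
  show ?case
  proof (rule C_k_on_SucI[OF W d])
    fix v
    \<comment> \<open>The direction \<open>?g' x v\<close> varies with \<open>x\<close>, whereas the
      induction hypothesis concerns derivatives in a fixed direction; expanding it in the basis
      separates the two dependences.\<close>
    have "C_k_on k W (\<lambda>x. \<Sum>b\<in>Basis. (?g' x v \<bullet> b) *\<^sub>R ?f' (g x) b)"
      by (intro C_k_on_sum[OF W] C_k_on_scaleR[OF W] C_k_on_bounded_linear[OF W bounded_linear_inner_left]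
          C_k_on_SucD(2)[OF Suc.prems(2)] Suc.IH C_k_on_SucD(2)[OF Suc.prems(1)] C_k_on_Suc[OF Suc.prems(2)])
    then show "C_k_on k W (\<lambda>x. ?f' (g x) (?g' x v))"
    proof (rule C_k_on_cong[OF W])
      fix x assume "x \<in> W"
      then have "linear (?f' (g x))"
        using C_k_on_SucD(1)[OF Suc.prems(1), of "g x"] gW by (auto intro: has_derivative_linear)
      then have "?f' (g x) (\<Sum>b\<in>Basis. (?g' x v \<bullet> b) *\<^sub>R b) = (\<Sum>b\<in>Basis. (?g' x v \<bullet> b) *\<^sub>R ?f' (g x) b)"
        by (simp add: linear_sum linear_scale)
      then show "(\<Sum>b\<in>Basis. (?g' x v \<bullet> b) *\<^sub>R ?f' (g x) b) = ?f' (g x) (?g' x v)"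
        by (simp add: euclidean_representation)
    qed
  qed
qed

lemma C_k_on_vecI:
  fixes f :: "'a::real_normed_vector \<Rightarrow> 'b::euclidean_space^'n"
  assumes W: "open W" and "\<And>i. C_k_on k W (\<lambda>x. f x $ i)"
  shows "C_k_on k W f"
proof -
  have "linear (\<lambda>z :: 'b. axis i z :: 'b^'n)" for i
    by (rule linearI) (auto simp: axis_def vec_eq_iff)
  then have "bounded_linear (\<lambda>z :: 'b. axis i z :: 'b^'n)" for i by (simp add: linear_conv_bounded_linear)
  then have "C_k_on k W (\<lambda>x. \<Sum>i\<in>UNIV. axis i (f x $ i))"
    by (intro C_k_on_sum[OF W] C_k_on_bounded_linear[OF W _ assms(2)])
  moreover have "(\<Sum>i\<in>UNIV. axis i (z $ i)) = z" for z :: "'b^'n"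
    by (simp add: vec_eq_iff axis_def if_distrib cong: if_cong)
  ultimately show ?thesis by simp
qed

lemma C_k_on_form_pullback:
  fixes F :: "'a::real_normed_vector \<Rightarrow> 'n::{finite,linorder} rmat"
  assumes W: "open W" and F: "\<And>i j. C_k_on k W (\<lambda>x. F x $ i $ j)" and \<omega>: "C_k_on k W \<omega>"
  shows "C_k_on k W (\<lambda>x. form_pullback (F x) (\<omega> x))"
proof (rule C_k_on_vecI[OF W])
  fix J
  have m: "C_k_on k W (\<lambda>x. mat_minor (F x) I J)" for I
  proof (cases "card I = card J")
    case True
    then show ?thesis unfolding mat_minor_def if_P[OF True]
      by (intro C_k_on_sum[OF W] C_k_on_mult[OF W] C_k_on_prod[OF W] C_k_on_const F)
  qed (simp add: mat_minor_def C_k_on_const)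
  show "C_k_on k W (\<lambda>x. form_pullback (F x) (\<omega> x) $ J)"
    unfolding form_pullback_def vec_lambda_beta
    by (intro C_k_on_sum[OF W] C_k_on_mult[OF W] C_k_on_bounded_linear[OF W bounded_linear_of_real]
        C_k_on_bounded_linear[OF W bounded_linear_vec_nth] m \<omega>)
qed

subsection \<open>A bump function\<close>

text \<open>The polynomial parameter makes the family closed under differentiation: with
  \<open>s = 1 / t\<close>, the derivative of \<open>p(s) exp(-s)\<close> in \<open>t\<close> has
  polynomial \<open>s^2 (p - p')\<close>. Smoothness then follows by an induction over all
  \<open>p\<close> simultaneously.\<close>

definition bump_tail :: "real poly \<Rightarrow> real \<Rightarrow> real" where
  "bump_tail p t = (if t \<le> 0 then 0 else poly p (1 / t) * exp (- (1 / t)))"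

lemma poly_times_exp_tendsto_0: "((\<lambda>s. poly p s * exp (- s)) \<longlongrightarrow> (0 :: real)) at_top"
proof -
  have "((\<lambda>s. \<Sum>i\<le>degree p. coeff p i * (s ^ i / exp s)) \<longlongrightarrow> (\<Sum>i\<le>degree p. coeff p i * 0)) at_top"
    by (intro tendsto_intros tendsto_power_div_exp_0)
  then show ?thesis by (simp add: poly_altdef sum_distrib_right exp_minus divide_inverse mult.assoc)
qed

lemma bump_tail_has_derivative:
  "(bump_tail p has_real_derivative bump_tail (monom 1 2 * (p - pderiv p)) t) (at t)"
proof -
  consider "t < 0" | "t = 0" | "0 < t" by linarith
  then show ?thesis
  proof cases
    case 1
    have "((\<lambda>_. 0) has_real_derivative 0) (at t)" by simp
    then have "(bump_tail p has_real_derivative 0) (at t)"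
      by (rule has_field_derivative_transform_within_open[where S = "{..<0}"]) (use 1 in \<open>auto simp: bump_tail_def\<close>)
    then show ?thesis using 1 by (simp add: bump_tail_def)
  next
    case 3
    have "((\<lambda>t. poly p (1 / t) * exp (- (1 / t))) has_real_derivative
        (poly (pderiv p) (1 / t) * (- 1 / t\<^sup>2)) * exp (- (1 / t)) + poly p (1 / t) * (exp (- (1 / t)) * (1 / t\<^sup>2))) (at t)"
      using 3 by (auto intro!: derivative_eq_intros DERIV_chain2[OF poly_DERIV] simp: power2_eq_square)
    then have "(bump_tail p has_real_derivative
        (poly (pderiv p) (1 / t) * (- 1 / t\<^sup>2)) * exp (- (1 / t)) + poly p (1 / t) * (exp (- (1 / t)) * (1 / t\<^sup>2))) (at t)"
      by (rule has_field_derivative_transform_within_open[where S = "{0<..}"]) (use 3 in \<open>auto simp: bump_tail_def\<close>)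
    moreover have "(poly (pderiv p) (1 / t) * (- 1 / t\<^sup>2)) * exp (- (1 / t)) + poly p (1 / t) * (exp (- (1 / t)) * (1 / t\<^sup>2))
      = bump_tail (monom 1 2 * (p - pderiv p)) t"
      using 3 by (simp add: bump_tail_def poly_monom field_simps)
    ultimately show ?thesis by simp
  next
    case 2
    \<comment> \<open>The difference quotient at 0 divides by \<open>t\<close>, that is, multiplies
      the polynomial in \<open>1 / t\<close> by its variable: this is
      \<open>pCons 0 p\<close>.\<close>
    have "((\<lambda>t. poly (pCons 0 p) (1 / t) * exp (- (1 / t))) \<longlongrightarrow> (0 :: real)) (at_right 0)"
      using filterlim_compose[OF poly_times_exp_tendsto_0 filterlim_inverse_at_top_right, of "pCons 0 p"]
      by (simp add: inverse_eq_divide)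
    then have "((\<lambda>t. bump_tail p t / t) \<longlongrightarrow> 0) (at_right 0)"
      by (rule Lim_transform_eventually)
        (use eventually_at_right_less[of 0] in \<open>auto simp: bump_tail_def elim!: eventually_mono\<close>)
    moreover have "((\<lambda>t. bump_tail p t / t) \<longlongrightarrow> 0) (at_left 0)"
      by (rule Lim_transform_eventually[OF tendsto_const])
        (use eventually_at_left_real[of "-1" 0] in \<open>auto simp: bump_tail_def elim!: eventually_mono\<close>)
    ultimately have "((\<lambda>t. bump_tail p t / t) \<longlongrightarrow> 0) (at 0)" by (simp add: filterlim_split_at)
    then show ?thesis using 2 by (simp add: has_field_derivative_iff bump_tail_def)
  qed
qed

lemma C_k_on_bump_tail: "C_k_on k UNIV (bump_tail p)"
proof (induction k arbitrary: p)
  case 0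
  then show ?case
    by (simp, rule DERIV_continuous_on[OF has_field_derivative_at_within[OF bump_tail_has_derivative]])
next
  case (Suc k)
  show ?case
    by (rule C_k_on_SucI[OF open_UNIV bump_tail_has_derivative[of p, unfolded has_field_derivative_def]])
      (use Suc.IH in \<open>auto intro: C_k_on_mult[OF open_UNIV] C_k_on_const\<close>)
qed

text \<open>The factor \<open>m\<close> steepens the edges without moving the support: since
  \<open>exp(-1/(m t))\<close> tends to 1 for \<open>t > 0\<close>, the functions tend to the
  indicator of the open box while staying between 0 and 1.\<close>

definition bump :: "nat \<Rightarrow> real^'n \<Rightarrow> real^'n \<Rightarrow> real^'n \<Rightarrow> real" where
  "bump m a b y = (\<Prod>i\<in>UNIV. bump_tail 1 (real m * (y $ i - a $ i)) * bump_tail 1 (real m * (b $ i - y $ i)))"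

lemma C_k_on_bump:
  fixes a b :: "real^'n"
  shows "C_k_on k UNIV (bump m a b)"
  unfolding bump_def
proof (intro C_k_on_prod C_k_on_mult open_UNIV)
  fix i
  have c: "C_k_on k UNIV (\<lambda>y :: real^'n. y $ i)"
    by (intro C_k_on_bounded_linear[OF open_UNIV bounded_linear_vec_nth] C_k_on_ident open_UNIV)
  have "C_k_on k UNIV (\<lambda>y :: real^'n. real m * (y $ i + (- a $ i)))"
    by (intro C_k_on_mult C_k_on_add C_k_on_const c open_UNIV)
  then show "C_k_on k UNIV (\<lambda>y :: real^'n. bump_tail 1 (real m * (y $ i - a $ i)))"
    using C_k_on_compose[OF open_UNIV open_UNIV subset_UNIV C_k_on_bump_tail] by simp
  have "C_k_on k UNIV (\<lambda>y :: real^'n. real m * (b $ i + (- 1) * y $ i))"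
    by (intro C_k_on_mult C_k_on_add C_k_on_const c open_UNIV)
  then show "C_k_on k UNIV (\<lambda>y :: real^'n. bump_tail 1 (real m * (b $ i - y $ i)))"
    using C_k_on_compose[OF open_UNIV open_UNIV subset_UNIV C_k_on_bump_tail] by simp
qed

lemma bump_tail_1_bounds: "0 \<le> bump_tail 1 t" "bump_tail 1 t \<le> 1"
  by (auto simp: bump_tail_def)

lemma bump_bounds: "0 \<le> bump m a b y" "bump m a b y \<le> 1"
  unfolding bump_def
  by (auto intro!: prod_nonneg prod_le_1 mult_nonneg_nonneg mult_le_one bump_tail_1_bounds)

lemma bump_support: "y \<notin> cbox a b \<Longrightarrow> bump m a b y = 0"
proof -
  assume "y \<notin> cbox a b"
  then obtain i where "y $ i < a $ i \<or> b $ i < y $ i" by (auto simp: mem_box_cart not_le)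
  then have "real m * (y $ i - a $ i) \<le> 0 \<or> real m * (b $ i - y $ i) \<le> 0"
    by (auto simp: mult_le_0_iff)
  then show ?thesis unfolding bump_def by (intro prod_zero bexI[of _ i]) (auto simp: bump_tail_def)
qed

lemma bump_tail_1_tendsto: "(\<lambda>m. bump_tail 1 (real m * t)) \<longlonglongrightarrow> (if 0 < t then 1 else 0)"
proof (cases "0 < t")
  case True
  have "(\<lambda>m. exp (- (inverse (real m) * (1 / t)))) \<longlonglongrightarrow> exp (- (0 * (1 / t)))"
    by (intro tendsto_intros lim_inverse_n)
  then have "(\<lambda>m. exp (- (1 / (real m * t)))) \<longlonglongrightarrow> 1" by (simp add: field_simps)
  then have "(\<lambda>m. bump_tail 1 (real m * t)) \<longlonglongrightarrow> 1"
    by (rule Lim_transform_eventually)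
      (use True in \<open>auto simp: bump_tail_def mult_le_0_iff intro!: eventually_sequentiallyI[of 1]\<close>)
  then show ?thesis using True by simp
qed (simp add: bump_tail_def mult_nonneg_nonpos)

lemma bump_tendsto: "(\<lambda>m. bump m a b y) \<longlonglongrightarrow> indicator (box a b) y"
proof -
  have "(\<lambda>m. bump m a b y) \<longlonglongrightarrow> (\<Prod>i\<in>UNIV. (if 0 < y $ i - a $ i then 1 else 0) * (if 0 < b $ i - y $ i then 1 else 0))"
    unfolding bump_def by (intro tendsto_prod tendsto_mult bump_tail_1_tendsto)
  also have "(\<Prod>i\<in>UNIV. (if 0 < y $ i - a $ i then 1 else 0) * (if 0 < b $ i - y $ i then 1 else 0)) = (indicator (box a b) y :: real)"
  proof (cases "y \<in> box a b")
    case True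
    then show ?thesis by (simp add: mem_box_cart)
  next
    case False
    then obtain i where "\<not> (a $ i < y $ i \<and> y $ i < b $ i)" by (auto simp: mem_box_cart)
    then have "(\<Prod>i\<in>UNIV. (if 0 < y $ i - a $ i then 1 else 0) * (if 0 < b $ i - y $ i then 1 else 0)) = (0 :: real)"
      by (intro prod_zero bexI[of _ i]) auto
    moreover have "indicator (box a b) y = (0 :: real)" using False by simp
    ultimately show ?thesis by (rule trans[OF _ sym])
  qed
  finally show ?thesis .
qed

subsection \<open>Change of variables\<close>

text \<open>The change of variables theorem of the library requires a well-ordered index type. A copy of
  a finite linearly ordered type is one.\<close>

datatype 'n wo = Wo (unwo: 'n)

instance wo :: (finite) finite
proof
  have "(UNIV :: 'a wo set) = range Wo" by (metis surjI wo.collapse)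
  then show "finite (UNIV :: 'a wo set)" using finite_imageI[OF finite, of Wo] by metis
qed

instantiation wo :: (linorder) linorder
begin

definition less_eq_wo :: "'a wo \<Rightarrow> 'a wo \<Rightarrow> bool" where "less_eq_wo x y \<longleftrightarrow> unwo x \<le> unwo y"
definition less_wo :: "'a wo \<Rightarrow> 'a wo \<Rightarrow> bool" where "less_wo x y \<longleftrightarrow> unwo x < unwo y"

instance by standard (auto simp: less_eq_wo_def less_wo_def wo.expand)

end

instance wo :: ("{finite,linorder}") wellorder
proof (rule wf_wellorderI)
  have "acyclic ({(x, y). x < (y :: 'a wo)}\<inverse>)"
    by (rule acyclicI_order[where f = unwo]) (auto simp: less_wo_def)
  then have "acyclic {(x, y). x < (y :: 'a wo)}" by (simp only: acyclic_converse)
  then show "wf {(x, y). x < (y :: 'a wo)}" by (intro finite_acyclic_wf) auto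
qed intro_classes

lemma bij_unwo: "bij (unwo :: 'n wo \<Rightarrow> 'n)"
  by (rule o_bij[where g = Wo]) auto

lemma bij_Wo: "bij (Wo :: 'n \<Rightarrow> 'n wo)"
  by (rule o_bij[where g = unwo]) auto

text \<open>Conjugation by the relabelling is a sign-preserving bijection between the permutations
  of the two index types.\<close>

lemma det_unwo:
  fixes A :: "real^'n^'n"
  shows "det (\<chi> i j. A $ unwo i $ unwo j) = det A"
proof -
  have "(\<Sum>p | p permutes (UNIV :: 'n wo set). of_int (sign p) * (\<Prod>i\<in>UNIV. A $ unwo i $ unwo (p i))) =
      (\<Sum>p | p permutes (UNIV :: 'n set). of_int (sign p) * (\<Prod>i\<in>UNIV. A $ i $ p i))"
  proof (rule sum.reindex_bij_witness[of _ "\<lambda>q. Wo \<circ> q \<circ> unwo" "\<lambda>p. unwo \<circ> p \<circ> Wo"])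
    fix p assume "p \<in> {p. p permutes (UNIV :: 'n wo set)}"
    then have p: "p permutes (UNIV :: 'n wo set)" by simp
    show "Wo \<circ> (unwo \<circ> p \<circ> Wo) \<circ> unwo = p" by (auto simp: fun_eq_iff)
    have "bij (unwo \<circ> p \<circ> Wo)" using permutes_bij[OF p] bij_unwo bij_Wo by (intro bij_comp)
    then show "unwo \<circ> p \<circ> Wo \<in> {p. p permutes (UNIV :: 'n set)}" by (auto intro!: bij_imp_permutes)
    have "inv unwo = (Wo :: 'n \<Rightarrow> 'n wo)" by (rule inv_equality) auto
    then have "map_permutation UNIV unwo p = unwo \<circ> p \<circ> Wo"
      using bij_unwo by (auto simp: map_permutation_def restrict_id_def bij_def fun_eq_iff)
    then have "sign (unwo \<circ> p \<circ> Wo) = sign p"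
      using sign_map_permutation[of "unwo :: 'n wo \<Rightarrow> 'n" UNIV p] p bij_is_inj[OF bij_unwo] by simp
    moreover have "(\<Prod>i\<in>UNIV. A $ unwo i $ unwo (p i)) = (\<Prod>i\<in>UNIV. A $ i $ (unwo \<circ> p \<circ> Wo) i)"
      by (rule prod.reindex_bij_witness[of _ Wo unwo]) auto
    ultimately show "of_int (sign (unwo \<circ> p \<circ> Wo)) * (\<Prod>i\<in>UNIV. A $ i $ (unwo \<circ> p \<circ> Wo) i) =
      of_int (sign p) * (\<Prod>i\<in>UNIV. A $ unwo i $ unwo (p i))" by simp
  next
    fix q assume "q \<in> {q. q permutes (UNIV :: 'n set)}"
    then have q: "q permutes (UNIV :: 'n set)" by simp
    show "unwo \<circ> (Wo \<circ> q \<circ> unwo) \<circ> Wo = q" by (auto simp: fun_eq_iff)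
    have "bij (Wo \<circ> q \<circ> unwo)" using permutes_bij[OF q] bij_unwo bij_Wo by (intro bij_comp)
    then show "Wo \<circ> q \<circ> unwo \<in> {p. p permutes (UNIV :: 'n wo set)}" by (auto intro!: bij_imp_permutes)
  qed
  then show ?thesis by (simp add: det_def)
qed

lemma prod_Basis_cart:
  fixes x :: "real^'n"
  shows "(\<Prod>b\<in>Basis. x \<bullet> b) = (\<Prod>i\<in>UNIV. x $ i)"
proof -
  have B: "(Basis :: (real^'n) set) = range (\<lambda>i. axis i 1)" by (auto simp: Basis_vec_def)
  have "inj (\<lambda>i :: 'n. axis i (1 :: real))" by (auto simp: inj_on_def axis_eq_axis)
  then show ?thesis unfolding B by (subst prod.reindex) (auto simp: inner_axis)
qed

context
  fixes f :: "'m::finite \<Rightarrow> 'n::finite"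
  assumes f: "bij f"
begin

lemma linear_reindex: "linear (\<lambda>x :: real^'n. \<chi> i. x $ f i)"
  by (rule linearI) (auto simp: vec_eq_iff)

lemma reindex_in_lebesgue:
  assumes "A \<in> sets lebesgue" shows "(\<lambda>x :: real^'n. \<chi> i. x $ f i) ` A \<in> sets lebesgue"
proof (rule differentiable_image_in_sets_lebesgue[OF assms])
  have "CARD('m) = CARD('n)" using f by (metis bij_betw_same_card)
  then show "DIM(real^'n) \<le> DIM(real^'m)" by simp
qed (intro linear_imp_differentiable_on linear_reindex)

end

text \<open>Relabelling coordinates maps boxes to boxes and permutes the factors of their volume,
  which determines the Borel measure; the completion then carries over.\<close>

lemma lebesgue_reindex:
  fixes f :: "'m::finite \<Rightarrow> 'n::finite"
  assumes f: "bij f"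
  defines "T \<equiv> \<lambda>x :: real^'n. \<chi> i. x $ f i"
  shows "T \<in> lebesgue \<rightarrow>\<^sub>M lebesgue" "distr lebesgue lebesgue T = lebesgue"
proof -
  define T' where "T' = (\<lambda>y :: real^'m. \<chi> j. y $ inv f j)"
  have TT': "T (T' y) = y" "T' (T x) = x" for x y
    using f by (auto simp: T_def T'_def vec_eq_iff inv_f_f bij_is_inj surj_f_inv_f bij_is_surj)
  have vim: "T -` A = T' ` A" for A using TT' by (auto simp: image_def) (metis TT'(2))
  show T: "T \<in> lebesgue \<rightarrow>\<^sub>M lebesgue"
    by (rule measurableI)
      (use reindex_in_lebesgue[OF bij_imp_bij_inv[OF f]] in \<open>auto simp: vim T'_def\<close>)
  have Tb: "T \<in> borel_measurable borel"
    unfolding T_def by (intro borel_measurable_continuous_onI linear_continuous_on linear_reindex[THEN linear_conv_bounded_linear[THEN iffD1]] f)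
  have "lborel = distr lborel borel T"
  proof (rule lborel_eqI)
    fix l u :: "real^'m" assume le: "\<And>b. b \<in> Basis \<Longrightarrow> l \<bullet> b \<le> u \<bullet> b"
    have le': "l $ i \<le> u $ i" for i using le[of "axis i 1"] by (simp add: inner_axis)
    have "T -` box l u = box (T' l) (T' u)"
      unfolding T_def T'_def using f
      by (auto simp: mem_box_cart) (metis bij_inv_eq_iff)+
    then have "emeasure (distr lborel borel T) (box l u) = emeasure lborel (box (T' l) (T' u))"
      using Tb by (simp add: emeasure_distr)
    also have "\<dots> = ennreal (\<Prod>b\<in>Basis. (T' u - T' l) \<bullet> b)"
      by (rule emeasure_lborel_box) (auto simp: Basis_vec_def inner_axis T'_def le')
    also have "(\<Prod>b\<in>Basis. (T' u - T' l) \<bullet> b) = (\<Prod>j\<in>UNIV. (u - l) $ inv f j)"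
      unfolding prod_Basis_cart by (simp add: T'_def)
    also have "\<dots> = (\<Prod>i\<in>UNIV. (u - l) $ i)"
      by (rule prod.reindex_bij_witness[of _ f "inv f"]) (use f in \<open>auto simp: inv_f_f bij_is_inj surj_f_inv_f bij_is_surj\<close>)
    finally show "emeasure (distr lborel borel T) (box l u) = ennreal (\<Prod>b\<in>Basis. (u - l) \<bullet> b)"
      by (simp add: prod_Basis_cart)
  qed simp
  then have eq: "distr lebesgue lborel T = lborel"
    using Tb by (subst distr_completion) (auto cong: distr_cong)
  have "completion (distr lebesgue lborel T) = distr lebesgue lebesgue T"
    by (rule completion.completion_distr_eq) (use Tb eq in \<open>auto simp: measurable_completion\<close>)
  then show "distr lebesgue lebesgue T = lebesgue" by (simp add: eq)
qed

text \<open>For nonnegative measurable functions \<open>has_integral\<close> fixes every finite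
  value of the Lebesgue integral. Having the same finite values includes having none, so the
  infinite case is covered too.\<close>

lemma cov_has_integral_imp_nn_integral:
  fixes F G :: "'a::euclidean_space \<Rightarrow> real" 
  assumes "\<And>x. 0 \<le> F x" "\<And>x. 0 \<le> G x" "F \<in> borel_measurable lebesgue" "G \<in> borel_measurable lebesgue"
    and "\<And>r. (F has_integral r) UNIV \<longleftrightarrow> (G has_integral r) UNIV"
  shows "integral\<^sup>N lebesgue F = integral\<^sup>N lebesgue G"
proof -
  have eq: "integral\<^sup>N lebesgue F = ennreal r \<longleftrightarrow> integral\<^sup>N lebesgue G = ennreal r" if "0 \<le> r" for r
    using assms(5)[of r] has_integral_iff_nn_integral_lebesgue[of F r, OF assms(1)]
      has_integral_iff_nn_integral_lebesgue[of G r, OF assms(2)] assms that by auto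
  show ?thesis
  proof (cases "integral\<^sup>N lebesgue F" rule: ennreal_cases)
    case (real r) then show ?thesis using eq by auto
  next
    case top
    then show ?thesis using eq by (cases "integral\<^sup>N lebesgue G" rule: ennreal_cases) auto
  qed
qed

lemma nn_integral_change_of_variables_wellorder:
  fixes g h :: "real^'m::{finite,wellorder} \<Rightarrow> real^'m::_" and f :: "real^'m::_ \<Rightarrow> real"
  assumes g: "\<And>x. x \<in> S \<Longrightarrow> (g has_derivative (*v) (J x)) (at x within S)"
    and h: "\<And>y. y \<in> T \<Longrightarrow> (h has_derivative (*v) (K y)) (at y within T)"
    and f: "\<And>y. y \<in> T \<Longrightarrow> 0 \<le> f y"
    and gh: "\<And>x. x \<in> S \<Longrightarrow> g x \<in> T \<and> h (g x) = x" "\<And>y. y \<in> T \<Longrightarrow> h y \<in> S \<and> g (h y) = y"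
    and JK: "\<And>y. y \<in> T \<Longrightarrow> K y ** J (h y) = mat 1"
    and meas: "(\<lambda>y. if y \<in> T then f y else 0) \<in> borel_measurable lebesgue"
      "(\<lambda>x. if x \<in> S then \<bar>det (J x)\<bar> * f (g x) else 0) \<in> borel_measurable lebesgue"
  shows "(\<integral>\<^sup>+x. ennreal (if x \<in> S then \<bar>det (J x)\<bar> * f (g x) else 0) \<partial>lebesgue) =
    (\<integral>\<^sup>+y. ennreal (if y \<in> T then f y else 0) \<partial>lebesgue)"
proof (rule cov_has_integral_imp_nn_integral)
  fix r
  have "((\<lambda>x. \<bar>det (matrix ((*v) (J x)))\<bar> * f (g x)) has_integral r) S \<longleftrightarrow> (f has_integral r) T"
  proof (rule cov_invertible_nonneg_eq[OF g h f gh])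
    show "(*v) (K y) \<circ> (*v) (J (h y)) = id" if "y \<in> T" for y
      using JK[OF that] by (simp add: fun_eq_iff matrix_vector_mul_assoc)
  qed
  then show "((\<lambda>x. if x \<in> S then \<bar>det (J x)\<bar> * f (g x) else 0) has_integral r) UNIV \<longleftrightarrow>
      ((\<lambda>y. if y \<in> T then f y else 0) has_integral r) UNIV"
    by (simp add: has_integral_restrict_UNIV matrix_of_matrix_vector_mul)
qed (use f gh meas in auto)

text \<open>Conjugation by the relabelling \<open>R\<close> moves everything to the well-ordered
  index type, where the Jacobians become \<open>P (J x)\<close> with the same determinants, and
  integrals are unchanged.\<close>

proposition nn_integral_change_of_variables:
  fixes g h :: "real^'n::{finite,linorder} \<Rightarrow> real^'n::_" and f :: "real^'n::_ \<Rightarrow> real"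
  assumes g: "\<And>x. x \<in> S \<Longrightarrow> (g has_derivative (*v) (J x)) (at x within S)"
    and h: "\<And>y. y \<in> T \<Longrightarrow> (h has_derivative (*v) (K y)) (at y within T)"
    and f: "\<And>y. y \<in> T \<Longrightarrow> 0 \<le> f y"
    and gh: "\<And>x. x \<in> S \<Longrightarrow> g x \<in> T \<and> h (g x) = x" "\<And>y. y \<in> T \<Longrightarrow> h y \<in> S \<and> g (h y) = y"
    and JK: "\<And>y. y \<in> T \<Longrightarrow> K y ** J (h y) = mat 1"
    and meas: "(\<lambda>y. if y \<in> T then f y else 0) \<in> borel_measurable lebesgue"
      "(\<lambda>x. if x \<in> S then \<bar>det (J x)\<bar> * f (g x) else 0) \<in> borel_measurable lebesgue"
  shows "(\<integral>\<^sup>+x. ennreal (if x \<in> S then \<bar>det (J x)\<bar> * f (g x) else 0) \<partial>lebesgue) =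
    (\<integral>\<^sup>+y. ennreal (if y \<in> T then f y else 0) \<partial>lebesgue)"
proof -
  define R where "R = (\<lambda>x :: real^'n::_. \<chi> i :: ('n::_) wo. x $ unwo i)"
  define R' where "R' = (\<lambda>y :: real^('n::_) wo. \<chi> j :: 'n::_. y $ Wo j)"
  define P where "P = (\<lambda>A :: real^'n::_^'n::_. \<chi> i j :: ('n::_) wo. A $ unwo i $ unwo j)"
  have RR [simp]: "R (R' y) = y" "R' (R x) = x" for x y
    by (auto simp: R_def R'_def vec_eq_iff)
  have R'm: "R' \<in> lebesgue \<rightarrow>\<^sub>M lebesgue" and R'd: "distr lebesgue lebesgue R' = lebesgue"
    unfolding R'_def by (rule lebesgue_reindex[OF bij_Wo])+
  have lin: "linear R" "linear R'" unfolding R_def R'_def using linear_reindex bij_unwo bij_Wo by blast+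
  have bl: "bounded_linear R" "bounded_linear R'" using lin by (simp_all add: linear_conv_bounded_linear)
  have Pmul: "P A *v R v = R (A *v v)" for A v
    unfolding P_def R_def matrix_vector_mult_def vec_eq_iff
    by (auto intro!: sum.reindex_bij_witness[of _ Wo unwo])
  have Pmm: "P A ** P B = P (A ** B)" for A B
    unfolding P_def matrix_matrix_mult_def vec_eq_iff
    by (auto intro!: sum.reindex_bij_witness[of _ Wo unwo])
  have P1: "P (mat 1) = mat 1" by (auto simp: P_def mat_def vec_eq_iff wo.expand)
  have detP: "det (P A) = det A" for A unfolding P_def by (rule det_unwo)
  have mem: "y \<in> R ` A \<longleftrightarrow> R' y \<in> A" for y A by (metis RR image_iff)
  have der: "((R \<circ> q \<circ> R') has_derivative (*v) (P B)) (at (R x) within R ` A)"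
    if "(q has_derivative (*v) B) (at x within A)" for q B x A
  proof -
    have "(q has_derivative (*v) B) (at (R' (R x)) within R' ` R ` A)"
      using that by (simp add: image_image)
    then have "((q \<circ> R') has_derivative ((*v) B \<circ> R')) (at (R x) within R ` A)"
      by (intro diff_chain_within bounded_linear_imp_has_derivative bl)
    then have "((R \<circ> (q \<circ> R')) has_derivative (R \<circ> ((*v) B \<circ> R'))) (at (R x) within R ` A)"
      by (rule diff_chain_within) (intro bounded_linear_imp_has_derivative bl)
    moreover have "R \<circ> ((*v) B \<circ> R') = (*v) (P B)" using Pmul[of B "R' _"] by (auto simp: fun_eq_iff)
    ultimately show ?thesis by (simp add: o_assoc)
  qed
  let ?FS = "\<lambda>x. if x \<in> S then \<bar>det (J x)\<bar> * f (g x) else 0"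
  let ?FT = "\<lambda>y. if y \<in> T then f y else 0"
  have tr: "(\<integral>\<^sup>+x. ennreal (F x) \<partial>lebesgue) = (\<integral>\<^sup>+x. ennreal (F (R' x)) \<partial>lebesgue)"
    if "F \<in> borel_measurable lebesgue" for F :: "real^'n::_ \<Rightarrow> real"
    by (subst R'd[symmetric], rule nn_integral_distr[OF R'm]) (use that in simp)
  have "(\<integral>\<^sup>+x. ennreal (?FS (R' x)) \<partial>lebesgue) = (\<integral>\<^sup>+y. ennreal (?FT (R' y)) \<partial>lebesgue)"
  proof -
    have "(\<integral>\<^sup>+x. ennreal (if x \<in> R ` S then \<bar>det (P (J (R' x)))\<bar> * (f \<circ> R') ((R \<circ> g \<circ> R') x) else 0) \<partial>lebesgue) =
      (\<integral>\<^sup>+y. ennreal (if y \<in> R ` T then (f \<circ> R') y else 0) \<partial>lebesgue)"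
    proof (rule nn_integral_change_of_variables_wellorder[where h = "R \<circ> h \<circ> R'" and K = "\<lambda>y. P (K (R' y))"])
      show "((R \<circ> g \<circ> R') has_derivative (*v) (P (J (R' x)))) (at x within R ` S)" if "x \<in> R ` S" for x
        using der[OF g, of "R' x"] that mem by auto
      show "((R \<circ> h \<circ> R') has_derivative (*v) (P (K (R' y)))) (at y within R ` T)" if "y \<in> R ` T" for y
        using der[OF h, of "R' y"] that mem by auto
      show "P (K (R' y)) ** P (J (R' ((R \<circ> h \<circ> R') y))) = mat 1" if "y \<in> R ` T" for y
        using JK[of "R' y"] that mem by (simp add: Pmm P1)
      show "(\<lambda>y. if y \<in> R ` T then (f \<circ> R') y else 0) \<in> borel_measurable lebesgue"
        using measurable_compose[OF R'm meas(1)] unfolding mem o_def .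
      show "(\<lambda>x. if x \<in> R ` S then \<bar>det (P (J (R' x)))\<bar> * (f \<circ> R') ((R \<circ> g \<circ> R') x) else 0) \<in> borel_measurable lebesgue"
        using measurable_compose[OF R'm meas(2)] unfolding mem detP o_def RR .
    qed (use f gh mem in auto)
    then show ?thesis unfolding mem detP o_def RR .
  qed
  then show ?thesis using tr[OF meas(1)] tr[OF meas(2)] by simp
qed

subsection \<open>Charts\<close>

definition relatively_open :: "(real^'n::{finite,linorder}) set \<Rightarrow> bool" where
  "relatively_open S \<longleftrightarrow> open S \<or> openin (top_of_set half_space) S"

lemma relatively_openE:
  assumes "relatively_open S"
  obtains T where "open T" "S = T \<or> S = T \<inter> half_space"
  using assms by (auto simp: relatively_open_def openin_open)

lemma closed_half_space: "closed (half_space :: (real^'n::{finite,linorder}) set)"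
  unfolding half_space_def by (intro closed_Collect_le continuous_intros)

lemma relatively_open_lebesgue:
  assumes "relatively_open S" shows "S \<in> sets lebesgue"
proof -
  obtain T where "open T" "S = T \<or> S = T \<inter> half_space" using relatively_openE[OF assms] .
  then have "S \<in> sets borel" using borel_closed[OF closed_half_space] by (auto intro: borel_open sets.Int)
  then show ?thesis by simp
qed

text \<open>Also at a boundary point of the half-space, a small positive step along every basis
  vector stays in \<open>S\<close>. One side suffices to determine a linear map, so Jacobians of
  transition maps are well defined up to the boundary.\<close>

lemma relatively_open_derivative_unique:
  fixes f :: "real^'n::{finite,linorder} \<Rightarrow> 'b::real_normed_vector"
  assumes S: "relatively_open S" and x: "x \<in> S"
    and "(f has_derivative f') (at x within S)" "(f has_derivative f'') (at x within S)"
  shows "f' = f''"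
proof (rule frechet_derivative_unique_within[OF assms(3,4)])
  fix b :: "real^'n::_" and e :: real assume b: "b \<in> Basis" and e: "0 < e"
  obtain T where T: "open T" "S = T \<or> S = T \<inter> half_space" using relatively_openE[OF S] .
  then obtain r where r: "0 < r" "ball x r \<subseteq> T" using x open_contains_ball by blast
  define d where "d = min (e / 2) (r / 2)"
  have d: "0 < d" "d < e" "d < r" using e r by (auto simp: d_def)
  have "x + d *\<^sub>R b \<in> ball x r" using d b by (simp add: dist_norm)
  moreover have "x + d *\<^sub>R b \<in> half_space" if "x \<in> half_space"
    using that b d by (auto simp: half_space_def Basis_vec_def axis_def)
  ultimately have "x + d *\<^sub>R b \<in> S" using T r x by blast
  then show "\<exists>d. 0 < \<bar>d\<bar> \<and> \<bar>d\<bar> < e \<and> x + d *\<^sub>R b \<in> S" using d by (intro exI[of _ d]) auto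
qed

text \<open>Points that are not interior lie on the bounding hyperplane. Forms supported in the
  interior can therefore detect everything up to a null set.\<close>

lemma relatively_open_interior:
  assumes S: "relatively_open S" shows "negligible (S - interior S)"
proof -
  obtain T where T: "open T" "S = T \<or> S = T \<inter> half_space" using relatively_openE[OF S] .
  have "S - interior S \<subseteq> {x. x $ Max UNIV = 0}"
  proof
    fix x assume x: "x \<in> S - interior S"
    show "x \<in> {x. x $ Max UNIV = 0}"
    proof (rule ccontr)
      assume n: "x \<notin> {x. x $ Max UNIV = 0}"
      have "open {x :: real^'a::_. 0 < x $ Max UNIV}" by (intro open_Collect_less continuous_intros)
      then have o: "open (T \<inter> {x. 0 < x $ Max UNIV})" using T by auto
      show False
      proof (cases "S = T")
        case True then show False using x T interior_open by auto
      next
        case False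
        then have ST: "S = T \<inter> half_space" using T by simp
        have "T \<inter> {x. 0 < x $ Max UNIV} \<subseteq> S" using ST by (auto simp: half_space_def)
        moreover have "x \<in> T \<inter> {x. 0 < x $ Max UNIV}" using x n ST by (auto simp: half_space_def)
        ultimately show False using x o interiorI by blast
      qed
    qed
  qed
  moreover have "negligible {x :: real^'a::_. x $ Max UNIV = 0}"
    using negligible_standard_hyperplane[of "axis (Max UNIV) (1::real)" 0] by (simp add: inner_axis)
  ultimately show ?thesis using negligible_subset by blast
qed

lemma smooth_on_differentiable:
  assumes "smooth_on S f" shows "f differentiable_on S"
  unfolding differentiable_on_def
proof
  fix x assume x: "x \<in> S"
  have "\<exists>W F. open W \<and> x \<in> W \<and> (\<forall>k. C_k_on k W F) \<and> (\<forall>y\<in>W \<inter> S. F y = f y)"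
    using bspec[OF assms[unfolded smooth_on_def] x] .
  then obtain W F where W: "open W" "x \<in> W" "\<forall>k. C_k_on k W F" "\<forall>y\<in>W \<inter> S. F y = f y"
    by (elim exE conjE)
  have "F differentiable at x" using W(2) spec[OF W(3), of "Suc 0"] by (simp only: C_k_on.simps)
  then obtain D where "(F has_derivative D) (at x)" by (auto simp: differentiable_def)
  then have "(F has_derivative D) (at x within S \<inter> W)" by (rule has_derivative_at_withinI)
  then have "(f has_derivative D) (at x within S \<inter> W)"
    by (rule has_derivative_transform[rotated 2]) (use x W in auto)
  moreover have "at x within S \<inter> W = at x within S"
    by (rule at_within_nhd[OF W(2,1)]) auto
  ultimately show "f differentiable at x within S" by (auto simp: differentiable_def)
qed

locale smooth_mfd =
  fixes M :: "('a::{t2_space,second_countable_topology}, 'n::{finite,linorder}) chart set"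
  assumes mfd: "smooth_manifold M"
begin

abbreviation overlap :: "('a, 'n) chart \<Rightarrow> ('a, 'n) chart \<Rightarrow> 'n rvec set" where
  "overlap c c' \<equiv> snd c ` (fst c \<inter> fst c')"

abbreviation transition :: "('a, 'n) chart \<Rightarrow> ('a, 'n) chart \<Rightarrow> 'n rvec \<Rightarrow> 'n rvec" where
  "transition c c' \<equiv> snd c' \<circ> chart_inv c"

lemma is_chart: "c \<in> M \<Longrightarrow> is_chart c"
  using mfd by (simp add: smooth_manifold_def)

lemma chart_open: "c \<in> M \<Longrightarrow> open (fst c)"
  using is_chart by (simp add: is_chart_def)

lemma chart_homeomorphism: "c \<in> M \<Longrightarrow> homeomorphism (fst c) (chart_image c) (snd c) (chart_inv c)"
  using is_chart by (simp add: is_chart_def)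

lemma chart_inv_left [simp]: "c \<in> M \<Longrightarrow> p \<in> fst c \<Longrightarrow> chart_inv c (snd c p) = p"
  using chart_homeomorphism by (simp add: homeomorphism_def)

lemma chart_inv_right: "y \<in> chart_image c \<Longrightarrow> snd c (chart_inv c y) = y"
  by (rule f_inv_into_f)

lemma chart_inv_mem: "y \<in> chart_image c \<Longrightarrow> chart_inv c y \<in> fst c"
  by (rule inv_into_into)

lemma chart_inj: "c \<in> M \<Longrightarrow> inj_on (snd c) (fst c)"
  by (rule inj_on_inverseI[where g = "chart_inv c"]) simp

lemma chart_relatively_open:
  assumes c: "c \<in> M" and V: "open V"
  shows "relatively_open (snd c ` (fst c \<inter> V))"
proof -
  have "openin (top_of_set (fst c)) (fst c \<inter> V)" using V by (auto simp: openin_open)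
  then have o: "openin (top_of_set (chart_image c)) (snd c ` (fst c \<inter> V))"
    using homeomorphism_imp_open_map[OF chart_homeomorphism[OF c]] by blast
  have "open (chart_image c) \<or> openin (top_of_set half_space) (chart_image c)"
    using is_chart[OF c] by (simp add: is_chart_def)
  then show ?thesis
  proof
    assume "open (chart_image c)"
    then show ?thesis using o openin_open_trans by (auto simp: relatively_open_def)
  next
    assume "openin (top_of_set half_space) (chart_image c)"
    then show ?thesis using o openin_trans by (auto simp: relatively_open_def)
  qed
qed

lemma overlap_relatively_open: "c \<in> M \<Longrightarrow> c' \<in> M \<Longrightarrow> relatively_open (overlap c c')"
  by (intro chart_relatively_open chart_open)

lemma image_relatively_open: "c \<in> M \<Longrightarrow> relatively_open (chart_image c)"
  using overlap_relatively_open[of c c] by simp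

lemma image_lebesgue: "c \<in> M \<Longrightarrow> chart_image c \<in> sets lebesgue"
  using image_relatively_open relatively_open_lebesgue by blast

lemma transition_smooth:
  assumes "c \<in> M" "c' \<in> M" shows "smooth_on (overlap c c') (transition c c')"
  using mfd assms unfolding smooth_manifold_def compatible_def by blast

lemma transition_has_derivative:
  assumes c: "c \<in> M" "c' \<in> M" and p: "p \<in> fst c" "p \<in> fst c'"
  shows "(transition c c' has_derivative (*v) (transition_jacobian c c' p)) (at (snd c p) within overlap c c')"
proof -
  have "transition c c' differentiable (at (snd c p) within overlap c c')"
    using smooth_on_differentiable[OF transition_smooth[OF c]] p by (auto simp: differentiable_on_def)
  then show ?thesis unfolding transition_jacobian_def using jacobian_works by blast
qed

text \<open>The derivative may be tested on a smaller neighbourhood \<open>V\<close>. The chain rule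
  needs this, since compositions of transition maps are available only on triple overlaps.\<close>

lemma jacobian_eqI:
  assumes c: "c \<in> M" "c' \<in> M" and p: "p \<in> fst c" "p \<in> fst c'" and V: "open V" "p \<in> V"
    and "(transition c c' has_derivative (*v) A) (at (snd c p) within snd c ` (fst c \<inter> fst c' \<inter> V))"
  shows "transition_jacobian c c' p = A"
proof -
  let ?W = "snd c ` (fst c \<inter> fst c' \<inter> V)"
  have "relatively_open ?W"
    using chart_relatively_open[OF c(1), of "fst c' \<inter> V"] V chart_open[OF c(2)] by (simp add: Int_assoc open_Int)
  moreover have "snd c p \<in> ?W" using p V by auto
  moreover have "(transition c c' has_derivative (*v) (transition_jacobian c c' p)) (at (snd c p) within ?W)"
    using transition_has_derivative[OF c p] by (rule has_derivative_subset) auto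
  ultimately have "(*v) (transition_jacobian c c' p) = (*v) A"
    using relatively_open_derivative_unique assms(7) by blast
  then show ?thesis by (metis matrix_of_matrix_vector_mul)
qed

lemma jacobian_chain:
  assumes c: "c \<in> M" "c' \<in> M" "c'' \<in> M" and p: "p \<in> fst c" "p \<in> fst c'" "p \<in> fst c''"
  shows "transition_jacobian c c'' p = transition_jacobian c' c'' p ** transition_jacobian c c' p"
proof (rule jacobian_eqI[OF c(1,3) p(1,3) chart_open[OF c(2)] p(2)])
  let ?W = "snd c ` (fst c \<inter> fst c'' \<inter> fst c')"
  have 1: "(transition c c' has_derivative (*v) (transition_jacobian c c' p)) (at (snd c p) within ?W)"
    using transition_has_derivative[OF c(1,2) p(1,2)] by (rule has_derivative_subset) auto
  have "(transition c' c'' has_derivative (*v) (transition_jacobian c' c'' p)) (at (snd c' p) within transition c c' ` ?W)"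
    using transition_has_derivative[OF c(2,3) p(2,3)]
    by (rule has_derivative_subset) (use c(1) in auto)
  then have "((transition c' c'' \<circ> transition c c') has_derivative
      ((*v) (transition_jacobian c' c'' p) \<circ> (*v) (transition_jacobian c c' p))) (at (snd c p) within ?W)"
    using c(1) p(1) by (intro diff_chain_within[OF 1]) simp
  then have "(transition c c'' has_derivative
      ((*v) (transition_jacobian c' c'' p) \<circ> (*v) (transition_jacobian c c' p))) (at (snd c p) within ?W)"
    by (rule has_derivative_transform[rotated 2]) (use c p in auto)
  then show "(transition c c'' has_derivative
      (*v) (transition_jacobian c' c'' p ** transition_jacobian c c' p)) (at (snd c p) within ?W)"
    by (simp add: o_def matrix_vector_mul_assoc)
qed

lemma jacobian_same:
  assumes c: "c \<in> M" and p: "p \<in> fst c" shows "transition_jacobian c c p = mat 1"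
proof (rule jacobian_eqI[OF c c p p open_UNIV UNIV_I])
  have "((\<lambda>x. x) has_derivative (*v) (mat 1)) (at (snd c p) within snd c ` (fst c \<inter> fst c \<inter> UNIV))"
    by (simp add: matrix_vector_mul_lid[abs_def])
  then show "(transition c c has_derivative (*v) (mat 1)) (at (snd c p) within snd c ` (fst c \<inter> fst c \<inter> UNIV))"
    by (rule has_derivative_transform[rotated 2]) (use c p in auto)
qed

lemma jacobian_inverse:
  assumes c: "c \<in> M" "c' \<in> M" and p: "p \<in> fst c" "p \<in> fst c'"
  shows "transition_jacobian c' c p ** transition_jacobian c c' p = mat 1"
  using jacobian_chain[OF c c(1) p p(1)] jacobian_same[OF c(1) p(1)] by simp

lemma pref_chart: "pref_chart M p \<in> M" "p \<in> fst (pref_chart M p)"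
proof -
  have "\<exists>c. c \<in> M \<and> p \<in> fst c" using mfd unfolding smooth_manifold_def by blast
  then have "pref_chart M p \<in> M \<and> p \<in> fst (pref_chart M p)" unfolding pref_chart_def by (rule someI_ex)
  then show "pref_chart M p \<in> M" "p \<in> fst (pref_chart M p)" by auto
qed

lemma chart_pull_push:
  assumes "c \<in> M" "p \<in> fst c"
  shows "chart_pull M c p ** chart_push M c p = mat 1" "chart_push M c p ** chart_pull M c p = mat 1"
  unfolding chart_pull_def chart_push_def
  using assms pref_chart by (auto intro: jacobian_inverse)

lemma chart_pull_transition:
  assumes "c \<in> M" "c' \<in> M" "p \<in> fst c" "p \<in> fst c'"
  shows "chart_pull M c p = chart_pull M c' p ** transition_jacobian c c' p"
  unfolding chart_pull_def using assms pref_chart by (auto intro: jacobian_chain)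

lemma chart_push_pull:
  assumes "c \<in> M" "c' \<in> M" "p \<in> fst c" "p \<in> fst c'"
  shows "chart_push M c p ** chart_pull M c' p = transition_jacobian c' c p"
  unfolding chart_pull_def chart_push_def using assms pref_chart by (auto intro: jacobian_chain[symmetric])

lemma form_in_chart_at:
  "c \<in> M \<Longrightarrow> p \<in> fst c \<Longrightarrow> form_in_chart M c \<omega> (snd c p) = form_pullback (chart_pull M c p) (\<omega> p)"
  by (simp add: form_in_chart_def)

lemma metric_in_chart_at:
  "c \<in> M \<Longrightarrow> p \<in> fst c \<Longrightarrow> metric_in_chart M c g (snd c p) =
    Finite_Cartesian_Product.transpose (chart_pull M c p) ** g p ** chart_pull M c p"
  by (simp add: metric_in_chart_def Let_def)

lemma metric_in_chart_transition:
  assumes "c \<in> M" "c' \<in> M" "p \<in> fst c" "p \<in> fst c'"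
  shows "metric_in_chart M c g (snd c p) = Finite_Cartesian_Product.transpose (transition_jacobian c c' p) **
    metric_in_chart M c' g (snd c' p) ** transition_jacobian c c' p"
  using assms chart_pull_transition[OF assms]
  by (simp add: metric_in_chart_at matrix_transpose_mul matrix_mul_assoc)

lemma sqrt_det_transition:
  assumes "c \<in> M" "c' \<in> M" "p \<in> fst c" "p \<in> fst c'"
  shows "sqrt (det (metric_in_chart M c g (snd c p))) =
    \<bar>det (transition_jacobian c c' p)\<bar> * sqrt (det (metric_in_chart M c' g (snd c' p)))"
proof -
  have "det (metric_in_chart M c g (snd c p)) =
      (det (transition_jacobian c c' p))\<^sup>2 * det (metric_in_chart M c' g (snd c' p))"
    unfolding metric_in_chart_transition[OF assms] by (simp add: det_mul det_transpose power2_eq_square ac_simps)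
  \<comment> \<open>\<open>sqrt\<close> is extended oddly to negative reals and is multiplicative
    everywhere, so the formula also holds at points where \<open>g\<close> is degenerate or
    indefinite.\<close>
  then show ?thesis by (simp add: real_sqrt_mult)
qed

lemma metric_in_chart_posdef:
  assumes c: "c \<in> M" and p: "p \<in> fst c" and g: "posdef (g p)"
  shows "posdef (metric_in_chart M c g (snd c p))"
  unfolding posdef_def metric_in_chart_at[OF c p]
proof (intro conjI allI impI)
  let ?A = "chart_pull M c p"
  have sym: "Finite_Cartesian_Product.transpose (g p) = g p" using g by (simp add: posdef_def)
  show "Finite_Cartesian_Product.transpose (Finite_Cartesian_Product.transpose ?A ** g p ** ?A) =
    Finite_Cartesian_Product.transpose ?A ** g p ** ?A"
    by (simp add: matrix_transpose_mul sym matrix_mul_assoc)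
  fix u :: "real^'n::_" assume u: "u \<noteq> 0"
  have "chart_push M c p *v (?A *v u) = u" by (simp add: matrix_vector_mul_assoc chart_pull_push[OF c p])
  then have "?A *v u \<noteq> 0" using u by auto
  then have "0 < (?A *v u) \<bullet> (g p *v (?A *v u))" using g by (simp add: posdef_def)
  also have "\<dots> = u \<bullet> ((Finite_Cartesian_Product.transpose ?A ** g p ** ?A) *v u)"
    using inner_matrix_vector_mult[of u "Finite_Cartesian_Product.transpose ?A" "g p *v (?A *v u)"]
    by (simp add: matrix_vector_mul_assoc[symmetric])
  finally show "0 < u \<bullet> ((Finite_Cartesian_Product.transpose ?A ** g p ** ?A) *v u)" .
qed

lemma form_inner_in_chart:
  assumes c: "c \<in> M" and p: "p \<in> fst c" and g: "posdef (g p)"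
  shows "form_inner (metric_in_chart M c g (snd c p)) (form_in_chart M c \<omega> (snd c p)) (form_in_chart M c \<eta> (snd c p)) =
    form_inner (g p) (\<omega> p) (\<eta> p)"
  unfolding form_in_chart_at[OF c p] metric_in_chart_at[OF c p]
  by (rule form_inner_transform[OF g chart_pull_push(1)[OF c p]])

lemma form_norm_in_chart:
  assumes c: "c \<in> M" and p: "p \<in> fst c" and g: "posdef (g p)"
  shows "form_norm (metric_in_chart M c g (snd c p)) (form_in_chart M c \<omega> (snd c p)) = form_norm (g p) (\<omega> p)"
  unfolding form_norm_def form_inner_in_chart[of c p g, OF assms] ..

lemma form_in_chart_eq_0_iff:
  assumes c: "c \<in> M" and p: "p \<in> fst c"
  shows "form_in_chart M c \<omega> (snd c p) = 0 \<longleftrightarrow> \<omega> p = 0"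
  using form_pullback_inverse[OF chart_pull_push(1)[OF c p], of "\<omega> p"]
  by (auto simp: form_in_chart_at[OF c p])

subsection \<open>Measurable and null sets\<close>

lemma transition_image:
  assumes "c \<in> M" "B \<subseteq> fst c" shows "snd c' ` B = transition c c' ` (snd c ` B)"
  using assms by (force simp: image_iff)

lemma measurable_transition:
  assumes c: "c \<in> M" "c' \<in> M" and B: "B \<subseteq> fst c" "B \<subseteq> fst c'" and "snd c ` B \<in> sets lebesgue"
  shows "snd c' ` B \<in> sets lebesgue"
  unfolding transition_image[OF c(1) B(1), of c']
proof (rule differentiable_image_in_sets_lebesgue[OF assms(5)])
  show "transition c c' differentiable_on snd c ` B"
    using smooth_on_differentiable[OF transition_smooth[OF c]]
    by (rule differentiable_on_subset) (use B in auto)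
qed simp

lemma null_transition:
  assumes c: "c \<in> M" "c' \<in> M" and B: "B \<subseteq> fst c" "B \<subseteq> fst c'" and "snd c ` B \<in> null_sets lebesgue"
  shows "snd c' ` B \<in> null_sets lebesgue"
  unfolding transition_image[OF c(1) B(1), of c'] negligible_iff_null_sets[symmetric]
proof (rule negligible_differentiable_image_negligible)
  show "negligible (snd c ` B)" using assms(5) by (simp add: negligible_iff_null_sets)
  show "transition c c' differentiable_on snd c ` B"
    using smooth_on_differentiable[OF transition_smooth[OF c]]
    by (rule differentiable_on_subset) (use B in auto)
qed simp

lemma countable_subatlas:
  assumes "A \<subseteq> M" "(\<Union>c\<in>A. fst c) = UNIV"
  obtains cs :: "nat \<Rightarrow> ('a, 'n) chart" where "\<And>i. cs i \<in> A" "(\<Union>i. fst (cs i)) = UNIV"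
proof -
  obtain F where F: "F \<subseteq> fst ` A" "countable F" "\<Union>F = \<Union>(fst ` A)"
    using Lindelof[of "fst ` A"] chart_open assms(1) by blast
  have U: "\<Union>F = UNIV" using F assms by simp
  then have "F \<noteq> {}" by auto
  then obtain s :: "nat \<Rightarrow> 'a set" where s: "range s = F" using range_from_nat_into[OF _ F(2)] by metis
  have "\<exists>c\<in>A. fst c = s i" for i :: nat using s F(1) by blast
  then obtain cs where cs: "\<And>i. cs i \<in> A" "\<And>i. fst (cs i) = s i" by metis
  have "(\<Union>i. fst (cs i)) = UNIV" using s U cs(2) by auto
  then show ?thesis using that cs by blast
qed

text \<open>The definition ranges over the whole maximal atlas; a countable cover suffices because
  transition maps preserve null sets and any chart domain is a countable union of overlaps.\<close>

lemma null_iff_subatlas: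
  assumes cs: "\<And>i::nat. cs i \<in> M" "(\<Union>i. fst (cs i)) = UNIV"
  shows "manifold_null M A \<longleftrightarrow> (\<forall>i. snd (cs i) ` (A \<inter> fst (cs i)) \<in> null_sets lebesgue)"
proof
  assume R: "\<forall>i. snd (cs i) ` (A \<inter> fst (cs i)) \<in> null_sets lebesgue"
  show "manifold_null M A"
    unfolding manifold_null_def
  proof
    fix c assume c: "c \<in> M"
    have "snd c ` (A \<inter> fst c \<inter> fst (cs i)) \<in> null_sets lebesgue" for i
    proof (rule null_transition[OF cs(1) c])
      have "snd (cs i) ` (A \<inter> fst c \<inter> fst (cs i)) \<subseteq> snd (cs i) ` (A \<inter> fst (cs i))" by auto
      then show "snd (cs i) ` (A \<inter> fst c \<inter> fst (cs i)) \<in> null_sets lebesgue"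
        using R null_sets_completion_subset by blast
    qed auto
    then have "(\<Union>i. snd c ` (A \<inter> fst c \<inter> fst (cs i))) \<in> null_sets lebesgue" by blast
    moreover have "(\<Union>i. snd c ` (A \<inter> fst c \<inter> fst (cs i))) = snd c ` (A \<inter> fst c)"
      using cs(2) by (auto simp: image_UN[symmetric])
    ultimately show "snd c ` (A \<inter> fst c) \<in> null_sets lebesgue" by simp
  qed
qed (use cs in \<open>simp add: manifold_null_def\<close>)

lemma manifold_null_subset: "manifold_null M A \<Longrightarrow> B \<subseteq> A \<Longrightarrow> manifold_null M B"
  unfolding manifold_null_def using null_sets_completion_subset by (metis Int_mono image_mono subset_refl)

lemma manifold_null_UN: "(\<And>i::nat. manifold_null M (A i)) \<Longrightarrow> manifold_null M (\<Union>i. A i)"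
  unfolding manifold_null_def UN_extend_simps(4) image_UN by blast

lemma ae_mono: "ae M P \<Longrightarrow> (\<And>x. P x \<Longrightarrow> Q x) \<Longrightarrow> ae M Q"
  unfolding ae_def by (erule manifold_null_subset) auto

lemma ae_all_nat: "(\<And>i::nat. ae M (P i)) \<Longrightarrow> ae M (\<lambda>x. \<forall>i. P i x)"
  unfolding ae_def using manifold_null_UN[of "\<lambda>i. {x. \<not> P i x}"] by (simp add: Collect_ex_eq[symmetric])

lemma sigma_algebra_measurable: "sigma_algebra UNIV {A. manifold_measurable M A}"
proof -
  have c: "manifold_measurable M (- A)" if "manifold_measurable M A" for A
    unfolding manifold_measurable_def
  proof
    fix c assume c: "c \<in> M"
    have "snd c ` (- A \<inter> fst c) = chart_image c - snd c ` (A \<inter> fst c)"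
      using chart_inj[OF c] by (auto simp: inj_on_def)
    then show "snd c ` (- A \<inter> fst c) \<in> sets lebesgue"
      using that image_lebesgue[OF c] c unfolding manifold_measurable_def by auto
  qed
  show ?thesis
    unfolding sigma_algebra_iff2
  proof (intro conjI ballI allI impI)
    show "UNIV - A \<in> {A. manifold_measurable M A}" if "A \<in> {A. manifold_measurable M A}" for A
      using c that by (simp add: Compl_eq_Diff_UNIV)
    fix A :: "nat \<Rightarrow> 'a set" assume "range A \<subseteq> {A. manifold_measurable M A}"
    then have "\<And>i. manifold_measurable M (A i)" by auto
    then show "(\<Union>i. A i) \<in> {A. manifold_measurable M A}"
      unfolding mem_Collect_eq manifold_measurable_def UN_extend_simps(4) image_UN by blast
  qed (auto simp: manifold_measurable_def)
qed

end

subsection \<open>The volume measure\<close>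

locale rough_mfd = smooth_mfd M
  for M :: "('a::{t2_space,second_countable_topology}, 'n::{finite,linorder}) chart set" +
  fixes g :: "'a \<Rightarrow> 'n rmat"
  assumes rough: "rough_metric M g"
begin

lemma comparability_atlas:
  "\<exists>cs :: nat \<Rightarrow> ('a, 'n) chart. (\<forall>i. comparability_chart M g (cs i)) \<and> (\<Union>i. fst (cs i)) = UNIV"
proof -
  have "{c. comparability_chart M g c} \<subseteq> M" by (auto simp: comparability_chart_def)
  moreover have "(\<Union>c\<in>{c. comparability_chart M g c}. fst c) = UNIV"
    using rough by (auto simp: rough_metric_def)
  ultimately show ?thesis using countable_subatlas by (metis mem_Collect_eq)
qed

lemma comparability_chart_mem: "comparability_chart M g c \<Longrightarrow> c \<in> M"
  by (simp add: comparability_chart_def)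

lemma metric_norm_pos_imp:
  assumes "0 < metric_norm G u" shows "0 < u \<bullet> (G *v u)"
  using assms by (simp add: metric_norm_def)

text \<open>The lower comparability bound is strict for nonzero \<open>u\<close>, because
  \<open>chart_push\<close> is invertible.\<close>

lemma comparability_posdef:
  assumes c: "comparability_chart M g c" shows "ae M (\<lambda>p. p \<in> fst c \<longrightarrow> posdef (g p))"
proof -
  obtain C where C: "1 \<le> C" and ae: "ae M (\<lambda>y. y \<in> fst c \<longrightarrow>
        (\<forall>u. norm (chart_push M c y *v u) / C \<le> metric_norm (g y) u \<and>
             metric_norm (g y) u \<le> C * norm (chart_push M c y *v u)))"
    using c unfolding comparability_chart_def by blast
  show ?thesis
  proof (rule ae_mono[OF ae], intro impI)
    fix p assume p: "p \<in> fst c" and "p \<in> fst c \<longrightarrow> (\<forall>u. norm (chart_push M c p *v u) / C \<le> metric_norm (g p) u \<and>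
             metric_norm (g p) u \<le> C * norm (chart_push M c p *v u))"
    then have le: "norm (chart_push M c p *v u) / C \<le> metric_norm (g p) u" for u by blast
    show "posdef (g p)"
      unfolding posdef_def
    proof (intro conjI allI impI)
      show "Finite_Cartesian_Product.transpose (g p) = g p" using rough by (simp add: rough_metric_def)
      fix u :: "real^'n::_" assume u: "u \<noteq> 0"
      have "chart_pull M c p *v (chart_push M c p *v u) = u"
        by (simp add: matrix_vector_mul_assoc chart_pull_push(1)[OF comparability_chart_mem[OF c] p])
      then have "chart_push M c p *v u \<noteq> 0" using u by auto
      then have "0 < norm (chart_push M c p *v u) / C" using C by simp
      then show "0 < u \<bullet> (g p *v u)" using le[of u] by (intro metric_norm_pos_imp) linarith
    qed
  qed
qed

lemma ae_posdef: "ae M (\<lambda>p. posdef (g p))"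
proof -
  obtain cs :: "nat \<Rightarrow> ('a, 'n) chart" where cs: "\<And>i. comparability_chart M g (cs i)" "(\<Union>i. fst (cs i)) = UNIV"
    using comparability_atlas by auto
  have "ae M (\<lambda>p. \<forall>i. p \<in> fst (cs i) \<longrightarrow> posdef (g p))" by (intro ae_all_nat comparability_posdef cs)
  then show ?thesis by (rule ae_mono) (use cs(2) in blast)
qed

definition dens :: "('a, 'n) chart \<Rightarrow> 'n rvec \<Rightarrow> real" where
  "dens c y = sqrt (det (metric_in_chart M c g y))"

lemma metric_in_chart_measurable: "c \<in> M \<Longrightarrow> metric_in_chart M c g \<in> borel_measurable (lebesgue_on (chart_image c))"
  using rough by (simp add: rough_metric_def measurable_metric_def)

lemma dens_measurable: "c \<in> M \<Longrightarrow> dens c \<in> borel_measurable (lebesgue_on (chart_image c))"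
proof -
  assume "c \<in> M"
  then have [measurable]: "(\<lambda>y. det (metric_in_chart M c g y)) \<in> borel_measurable (lebesgue_on (chart_image c))"
    by (rule borel_measurable_det[OF metric_in_chart_measurable])
  show ?thesis unfolding dens_def[abs_def] by measurable
qed

text \<open>\<open>dens\<close> can be negative on the null set where the metric is not positive
  definite. \<open>max 0\<close> supplies the nonnegative integrand that the change of variables
  asks for, and agrees with the truncation that \<open>ennreal\<close> performs in the definition of
  the volume.\<close>

lemma dens_restrict_measurable:
  assumes "c \<in> M" "S \<subseteq> chart_image c" "S \<in> sets lebesgue"
  shows "(\<lambda>y. if y \<in> S then max 0 (dens c y) else 0) \<in> borel_measurable lebesgue"
proof -
  have "dens c \<in> borel_measurable (lebesgue_on S)"
    using measurable_restrict_mono[OF dens_measurable[OF assms(1)] assms(2)] by simp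
  then have "(\<lambda>y. max 0 (dens c y)) \<in> borel_measurable (lebesgue_on S)" by measurable
  then show ?thesis by (rule borel_measurable_if[OF assms(3), THEN iffD2])
qed

definition chart_measure :: "('a, 'n) chart \<Rightarrow> 'n rvec measure" where
  "chart_measure c = density lebesgue (\<lambda>y. ennreal (if y \<in> chart_image c then max 0 (dens c y) else 0))"

lemma sets_chart_measure [simp]: "sets (chart_measure c) = sets lebesgue"
  by (simp add: chart_measure_def)

definition chart_vol :: "('a, 'n) chart \<Rightarrow> 'a set \<Rightarrow> ennreal" where
  "chart_vol c A = (\<integral>\<^sup>+y\<in>snd c ` A. ennreal (sqrt (det (metric_in_chart M c g y))) \<partial>lebesgue)"

lemma manifold_measurableD: "manifold_measurable M A \<Longrightarrow> c \<in> M \<Longrightarrow> A \<subseteq> fst c \<Longrightarrow> snd c ` A \<in> sets lebesgue"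
  unfolding manifold_measurable_def by (metis inf.absorb1)

lemma chart_vol_restrict:
  assumes "A \<subseteq> fst c"
  shows "chart_vol c A = (\<integral>\<^sup>+y. ennreal (if y \<in> snd c ` A then max 0 (dens c y) else 0) \<partial>lebesgue)"
  unfolding chart_vol_def dens_def
  by (intro nn_integral_cong) (auto simp: max_def ennreal_neg split: split_indicator)

lemma chart_vol_emeasure:
  assumes c: "c \<in> M" and A: "manifold_measurable M A" "A \<subseteq> fst c"
  shows "chart_vol c A = emeasure (chart_measure c) (snd c ` A)"
proof -
  have "(\<lambda>y. if y \<in> chart_image c then max 0 (dens c y) else 0) \<in> borel_measurable lebesgue"
    by (intro dens_restrict_measurable c image_lebesgue) auto
  then have "emeasure (chart_measure c) (snd c ` A) =
      (\<integral>\<^sup>+y\<in>snd c ` A. ennreal (if y \<in> chart_image c then max 0 (dens c y) else 0) \<partial>lebesgue)"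
    unfolding chart_measure_def using manifold_measurableD[OF A(1) c A(2)] by (intro emeasure_density) auto
  also have "\<dots> = chart_vol c A"
    unfolding chart_vol_restrict[OF A(2)]
    by (intro nn_integral_cong) (use A(2) in \<open>auto split: split_indicator\<close>)
  finally show ?thesis ..
qed

lemma chart_vol_suminf:
  assumes c: "c \<in> M" and A: "\<And>i::nat. manifold_measurable M (A i)" "\<And>i. A i \<subseteq> fst c" "disjoint_family A"
  shows "chart_vol c (\<Union>i. A i) = (\<Sum>i. chart_vol c (A i))"
proof -
  have U: "manifold_measurable M (\<Union>i. A i)"
    using sigma_algebra.countable_nat_UN[OF sigma_algebra_measurable, of A] A by auto
  have "disjoint_family (\<lambda>i. snd c ` A i)"
    using A(3) chart_inj[OF c] A(2) unfolding disjoint_family_on_def inj_on_def by blast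
  then have "(\<Sum>i. emeasure (chart_measure c) (snd c ` A i)) = emeasure (chart_measure c) (\<Union>i. snd c ` A i)"
    by (intro suminf_emeasure) (use manifold_measurableD[OF A(1) c A(2)] in auto)
  then show ?thesis
    using chart_vol_emeasure[OF c U] chart_vol_emeasure[OF c A(1) A(2)] A(2) by (simp add: UN_least image_UN)
qed

lemma dens_transition:
  assumes "c \<in> M" "c' \<in> M" "p \<in> fst c" "p \<in> fst c'"
  shows "max 0 (dens c (snd c p)) = \<bar>det (transition_jacobian c c' p)\<bar> * max 0 (dens c' (snd c' p))"
  unfolding dens_def sqrt_det_transition[OF assms] by (simp add: max_def zero_le_mult_iff mult_le_0_iff)

text \<open>The density picks up exactly the absolute Jacobian determinant of the transition map, so
  the change of variables formula makes the volume independent of the chart.\<close>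

lemma chart_vol_transition:
  assumes c: "c \<in> M" "c' \<in> M" and A: "manifold_measurable M A" "A \<subseteq> fst c" "A \<subseteq> fst c'"
  shows "chart_vol c A = chart_vol c' A"
proof -
  let ?S = "snd c ` A" and ?T = "snd c' ` A"
  let ?J = "\<lambda>x. transition_jacobian c c' (chart_inv c x)" and ?K = "\<lambda>y. transition_jacobian c' c (chart_inv c' y)"
  have eq: "max 0 (dens c x) = \<bar>det (?J x)\<bar> * max 0 (dens c' (transition c c' x))" if x: "x \<in> ?S" for x
  proof -
    obtain p where p: "p \<in> A" "x = snd c p" using x by blast
    then have "p \<in> fst c" "p \<in> fst c'" using A by auto
    then show ?thesis using dens_transition[OF c, of p] p c(1) by simp
  qed
  have eq': "(if x \<in> ?S then \<bar>det (?J x)\<bar> * max 0 (dens c' (transition c c' x)) else 0) =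
      (if x \<in> ?S then max 0 (dens c x) else 0)" for x
    using eq[of x] by (cases "x \<in> ?S") (simp_all only: if_True if_False)
  have "(\<integral>\<^sup>+x. ennreal (if x \<in> ?S then \<bar>det (?J x)\<bar> * max 0 (dens c' (transition c c' x)) else 0) \<partial>lebesgue) =
    (\<integral>\<^sup>+y. ennreal (if y \<in> ?T then max 0 (dens c' y) else 0) \<partial>lebesgue)"
  proof (rule nn_integral_change_of_variables[where h = "transition c' c" and K = ?K])
    show "(transition c c' has_derivative (*v) (?J x)) (at x within ?S)" if x: "x \<in> ?S" for x
    proof -
      obtain p where p: "p \<in> A" "x = snd c p" using x by blast
      then have pc: "p \<in> fst c" "p \<in> fst c'" using A by auto
      have "(transition c c' has_derivative (*v) (transition_jacobian c c' p)) (at (snd c p) within ?S)"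
        by (rule has_derivative_subset[OF transition_has_derivative[OF c pc]]) (use A in auto)
      then show ?thesis using p(2) pc c(1) by simp
    qed
    show "(transition c' c has_derivative (*v) (?K y)) (at y within ?T)" if y: "y \<in> ?T" for y
    proof -
      obtain p where p: "p \<in> A" "y = snd c' p" using y by blast
      then have pc: "p \<in> fst c'" "p \<in> fst c" using A by auto
      have "(transition c' c has_derivative (*v) (transition_jacobian c' c p)) (at (snd c' p) within ?T)"
        by (rule has_derivative_subset[OF transition_has_derivative[OF c(2,1) pc]]) (use A in auto)
      then show ?thesis using p(2) pc c(2) by simp
    qed
    show "?K y ** ?J (transition c' c y) = mat 1" if y: "y \<in> ?T" for y
      using that A c jacobian_inverse[OF c] by (auto simp: subset_iff)
    show "(\<lambda>y. if y \<in> ?T then max 0 (dens c' y) else 0) \<in> borel_measurable lebesgue"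
      using A manifold_measurableD[OF A(1) c(2) A(3)] by (intro dens_restrict_measurable c) auto
    show "(\<lambda>x. if x \<in> ?S then \<bar>det (?J x)\<bar> * max 0 (dens c' (transition c c' x)) else 0) \<in> borel_measurable lebesgue"
      unfolding eq' using A manifold_measurableD[OF A(1) c(1) A(2)] by (intro dens_restrict_measurable c) auto
  qed (use A c in \<open>auto simp: subset_iff\<close>)
  then show ?thesis unfolding eq' chart_vol_restrict[OF A(2)] chart_vol_restrict[OF A(3)] .
qed

lemma manifold_measurable_Int_chart:
  assumes "manifold_measurable M A" "open V" shows "manifold_measurable M (A \<inter> V)"
  unfolding manifold_measurable_def
proof
  fix c assume c: "c \<in> M"
  have "snd c ` (A \<inter> V \<inter> fst c) = snd c ` (A \<inter> fst c) \<inter> snd c ` (fst c \<inter> V)"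
    using inj_on_image_Int[OF chart_inj[OF c], of "A \<inter> fst c" "fst c \<inter> V"] by (simp add: Int_ac)
  then show "snd c ` (A \<inter> V \<inter> fst c) \<in> sets lebesgue"
    using assms(1) relatively_open_lebesgue[OF chart_relatively_open[OF c assms(2)]] c
    unfolding manifold_measurable_def by auto
qed

lemma manifold_measurable_UNIV: "manifold_measurable M UNIV"
  using image_lebesgue by (simp add: manifold_measurable_def)

lemma manifold_measurable_open: "open V \<Longrightarrow> manifold_measurable M V"
  using manifold_measurable_Int_chart[OF manifold_measurable_UNIV] by simp

lemma partition_exists:
  assumes cs: "\<And>i::nat. cs i \<in> M" "(\<Union>i. fst (cs i)) = UNIV"
  obtains W where "\<And>i::nat. manifold_measurable M (W i)" "\<And>i. W i \<subseteq> fst (cs i)" "disjoint_family W" "(\<Union>i. W i) = UNIV"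
proof -
  define W where "W = disjointed (\<lambda>i. fst (cs i))"
  interpret sigma_algebra UNIV "{A. manifold_measurable M A}" by (rule sigma_algebra_measurable)
  have "range W \<subseteq> {A. manifold_measurable M A}"
    unfolding W_def by (intro range_disjointed_sets) (auto intro!: manifold_measurable_open chart_open cs)
  then have "\<And>i. manifold_measurable M (W i)" by auto
  moreover have "\<And>i. W i \<subseteq> fst (cs i)" unfolding W_def by (rule disjointed_subset)
  moreover have "disjoint_family W" unfolding W_def by (rule disjoint_family_disjointed)
  moreover have "(\<Union>i. W i) = UNIV" unfolding W_def UN_disjointed_eq by (rule cs(2))
  ultimately show ?thesis using that by blast
qed

lemma manifold_measurable_Int:
  "manifold_measurable M A \<Longrightarrow> manifold_measurable M B \<Longrightarrow> manifold_measurable M (A \<inter> B)"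
proof -
  interpret sigma_algebra UNIV "{A. manifold_measurable M A}" by (rule sigma_algebra_measurable)
  show "manifold_measurable M A \<Longrightarrow> manifold_measurable M B \<Longrightarrow> manifold_measurable M (A \<inter> B)"
    using Int by simp
qed

text \<open>A countable atlas is cut into disjoint measurable pieces \<open>W i\<close>, each
  measured in its own chart. Chart independence shows that the result has the prescribed density in
  every comparability chart, not only in the chosen ones.\<close>

lemma volume_measure_exists: "\<exists>\<mu>. is_volume_measure M g \<mu>"
proof -
  obtain cs :: "nat \<Rightarrow> ('a, 'n) chart" where cs: "\<And>i. comparability_chart M g (cs i)" "(\<Union>i. fst (cs i)) = UNIV"
    using comparability_atlas by auto
  have csM: "cs i \<in> M" for i using cs(1) comparability_chart_mem by blast
  obtain W where W: "\<And>i. manifold_measurable M (W i)" "\<And>i. W i \<subseteq> fst (cs i)" "disjoint_family W" "(\<Union>i. W i) = UNIV"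
    using partition_exists[of cs, OF csM cs(2)] by metis
  define \<mu> where "\<mu> A = (\<Sum>i. chart_vol (cs i) (A \<inter> W i))" for A
  let ?S = "{A. manifold_measurable M A}"
  have pos: "positive ?S \<mu>" unfolding positive_def \<mu>_def chart_vol_def by simp
  have add: "countably_additive ?S \<mu>"
    unfolding countably_additive_def
  proof (intro allI impI)
    fix A :: "nat \<Rightarrow> 'a set" assume A: "range A \<subseteq> ?S" "disjoint_family A" "(\<Union>i. A i) \<in> ?S"
    have Am: "manifold_measurable M (A k)" for k using A by auto
    have 1: "chart_vol (cs i) ((\<Union>k. A k) \<inter> W i) = (\<Sum>k. chart_vol (cs i) (A k \<inter> W i))" for i
    proof -
      have "disjoint_family (\<lambda>k. A k \<inter> W i)" using A(2) unfolding disjoint_family_on_def by blast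
      then have "chart_vol (cs i) (\<Union>k. A k \<inter> W i) = (\<Sum>k. chart_vol (cs i) (A k \<inter> W i))"
        using W by (intro chart_vol_suminf csM manifold_measurable_Int Am) auto
      then show ?thesis by simp
    qed
    \<comment> \<open>The double series is exchanged by reading the outer sum as an integral over
      counting measure.\<close>
    have "(\<Sum>i. \<Sum>k. chart_vol (cs i) (A k \<inter> W i)) = (\<integral>\<^sup>+i. (\<Sum>k. chart_vol (cs i) (A k \<inter> W i)) \<partial>count_space UNIV)"
      by (rule nn_integral_count_space_nat[symmetric])
    also have "\<dots> = (\<Sum>k. \<integral>\<^sup>+i. chart_vol (cs i) (A k \<inter> W i) \<partial>count_space UNIV)"
      by (rule nn_integral_suminf) simp
    also have "\<dots> = (\<Sum>k. \<mu> (A k))" unfolding \<mu>_def by (simp add: nn_integral_count_space_nat)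
    finally show "(\<Sum>k. \<mu> (A k)) = \<mu> (\<Union>k. A k)" unfolding \<mu>_def[of "\<Union>k. A k"] 1 by simp
  qed
  define N where "N = measure_of UNIV ?S \<mu>"
  have N: "space N = UNIV" "sets N = ?S"
    unfolding N_def using sigma_algebra.sigma_sets_eq[OF sigma_algebra_measurable] by auto
  have em: "emeasure N A = \<mu> A" if "manifold_measurable M A" for A
    unfolding N_def using that by (intro emeasure_measure_of_sigma[OF sigma_algebra_measurable pos add]) simp
  have "is_volume_measure M g N"
    unfolding is_volume_measure_def
  proof (intro conjI N allI impI, elim conjE)
    fix c A assume c: "comparability_chart M g c" and A: "A \<in> sets N" "A \<subseteq> fst c"
    have cM: "c \<in> M" using c comparability_chart_mem by blast
    have Am: "manifold_measurable M A" using A N by simp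
    have "chart_vol (cs i) (A \<inter> W i) = chart_vol c (A \<inter> W i)" for i
      using W(1,2)[of i] A(2) by (intro chart_vol_transition csM cM manifold_measurable_Int Am) auto
    then have "emeasure N A = (\<Sum>i. chart_vol c (A \<inter> W i))" unfolding em[OF Am] \<mu>_def by simp
    also have "\<dots> = chart_vol c (\<Union>i. A \<inter> W i)"
      using A(2) W(3) by (intro chart_vol_suminf[symmetric] cM manifold_measurable_Int Am W)
        (auto simp: disjoint_family_on_def)
    also have "(\<Union>i. A \<inter> W i) = A" using W(4) by blast
    finally show "emeasure N A = (\<integral>\<^sup>+y\<in>snd c ` A. ennreal (sqrt (det (metric_in_chart M c g y))) \<partial>lebesgue)"
      by (simp add: chart_vol_def)
  qed
  then show ?thesis by blast
qed

lemma volume_measure_unique: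
  assumes "is_volume_measure M g \<mu>" "is_volume_measure M g \<nu>" shows "\<mu> = \<nu>"
proof (rule measure_eqI)
  show "sets \<mu> = sets \<nu>" using assms by (simp add: is_volume_measure_def)
  fix A assume A: "A \<in> sets \<mu>"
  obtain cs :: "nat \<Rightarrow> ('a, 'n) chart" where cs: "\<And>i. comparability_chart M g (cs i)" "(\<Union>i. fst (cs i)) = UNIV"
    using comparability_atlas by auto
  have csM: "cs i \<in> M" for i using cs(1) comparability_chart_mem by blast
  obtain W where W: "\<And>i. manifold_measurable M (W i)" "\<And>i. W i \<subseteq> fst (cs i)" "disjoint_family W" "(\<Union>i. W i) = UNIV"
    using partition_exists[of cs, OF csM cs(2)] by metis
  have Am: "manifold_measurable M A" using A assms(1) by (simp add: is_volume_measure_def)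
  have e: "emeasure \<kappa> A = (\<Sum>i. chart_vol (cs i) (A \<inter> W i))" if \<kappa>: "is_volume_measure M g \<kappa>" for \<kappa>
  proof -
    have m: "A \<inter> W i \<in> sets \<kappa>" for i using manifold_measurable_Int[OF Am W(1)] \<kappa> by (simp add: is_volume_measure_def)
    have "emeasure \<kappa> (\<Union>i. A \<inter> W i) = (\<Sum>i. emeasure \<kappa> (A \<inter> W i))"
      using m W(3) by (intro suminf_emeasure[symmetric]) (auto simp: disjoint_family_on_def)
    moreover have "(\<Union>i. A \<inter> W i) = A" using W(4) by blast
    moreover have "emeasure \<kappa> (A \<inter> W i) = chart_vol (cs i) (A \<inter> W i)" for i
      using \<kappa> m[of i] cs(1)[of i] W(2)[of i] unfolding is_volume_measure_def chart_vol_def by blast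
    ultimately show ?thesis by simp
  qed
  show "emeasure \<mu> A = emeasure \<nu> A" using e assms by simp
qed

abbreviation "vol \<equiv> volume_measure M g"

lemma is_volume: "is_volume_measure M g vol"
  unfolding volume_measure_def
  using volume_measure_exists volume_measure_unique by (metis (no_types, lifting) theI')

lemma space_vol [simp]: "space vol = UNIV"
  using is_volume by (simp add: is_volume_measure_def)

lemma sets_vol: "sets vol = {A. manifold_measurable M A}"
  using is_volume by (simp add: is_volume_measure_def)

lemma emeasure_vol:
  assumes "comparability_chart M g c" "manifold_measurable M A" "A \<subseteq> fst c"
  shows "emeasure vol A = emeasure (chart_measure c) (snd c ` A)"
proof -
  have "A \<in> sets vol" using assms(2) by (simp add: sets_vol)
  then have "emeasure vol A = chart_vol c A"
    using is_volume assms unfolding is_volume_measure_def chart_vol_def by blast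
  then show ?thesis using chart_vol_emeasure[OF comparability_chart_mem[OF assms(1)] assms(2,3)] by simp
qed

section \<open>Null sets, completeness and sigma-finiteness of the volume measure\<close>

lemma manifold_null_imp_measurable: "manifold_null M A \<Longrightarrow> manifold_measurable M A"
  unfolding manifold_null_def manifold_measurable_def by auto

lemma ae_dens_pos:
  assumes c: "c \<in> M" shows "AE y in lebesgue. y \<in> chart_image c \<longrightarrow> posdef (metric_in_chart M c g y) \<and> 0 < dens c y"
proof -
  let ?N = "{p. \<not> posdef (g p)}"
  have N: "snd c ` (?N \<inter> fst c) \<in> null_sets lebesgue"
    using ae_posdef c unfolding ae_def manifold_null_def by blast
  show ?thesis
  proof (rule AE_I'[OF N], rule subsetI)
    fix y assume "y \<in> {y \<in> space lebesgue. \<not> (y \<in> chart_image c \<longrightarrow> posdef (metric_in_chart M c g y) \<and> 0 < dens c y)}"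
    then obtain p where p: "p \<in> fst c" "y = snd c p" and ny: "\<not> (posdef (metric_in_chart M c g (snd c p)) \<and> 0 < dens c (snd c p))"
      by blast
    have "\<not> posdef (g p)"
    proof
      assume "posdef (g p)"
      then have pd: "posdef (metric_in_chart M c g (snd c p))" by (rule metric_in_chart_posdef[OF c p(1)])
      then have "0 < det (metric_in_chart M c g (snd c p))" using frame_exists frame_det(2) by blast
      then show False using pd ny by (simp add: dens_def)
    qed
    then show "y \<in> snd c ` (?N \<inter> fst c)" using p by blast
  qed
qed

lemma chart_measure_null:
  assumes c: "c \<in> M" and B: "B \<in> sets lebesgue" "B \<subseteq> chart_image c"
  shows "emeasure (chart_measure c) B = 0 \<longleftrightarrow> B \<in> null_sets lebesgue"
proof -
  have m: "(\<lambda>y. ennreal (if y \<in> chart_image c then max 0 (dens c y) else 0)) \<in> borel_measurable lebesgue"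
    using dens_restrict_measurable[OF c order_refl image_lebesgue[OF c]] by simp
  have "emeasure (chart_measure c) B = 0 \<longleftrightarrow> B \<in> null_sets (chart_measure c)" using B by (auto simp: null_sets_def)
  also have "\<dots> \<longleftrightarrow> B \<in> sets lebesgue \<and> (AE y in lebesgue. y \<in> B \<longrightarrow> ennreal (if y \<in> chart_image c then max 0 (dens c y) else 0) = 0)"
    unfolding chart_measure_def by (rule null_sets_density_iff[OF m])
  also have "\<dots> \<longleftrightarrow> (AE y in lebesgue. y \<notin> B)"
  proof -
    have p: "AE y in lebesgue. y \<in> chart_image c \<longrightarrow> 0 < dens c y" using ae_dens_pos[OF c] by eventually_elim auto
    have "AE y in lebesgue. (y \<in> B \<longrightarrow> ennreal (if y \<in> chart_image c then max 0 (dens c y) else 0) = 0) \<longleftrightarrow> y \<notin> B"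
      using p by eventually_elim (use B(2) in \<open>auto simp: max_def\<close>)
    then have "(AE y in lebesgue. y \<in> B \<longrightarrow> ennreal (if y \<in> chart_image c then max 0 (dens c y) else 0) = 0) \<longleftrightarrow>
        (AE y in lebesgue. y \<notin> B)"
      by (rule eventually_subst)
    then show ?thesis using B by simp
  qed
  also have "\<dots> \<longleftrightarrow> B \<in> null_sets lebesgue" using B AE_iff_null_sets[of B lebesgue] by simp
  finally show ?thesis .
qed

text \<open>The density is positive almost everywhere, so chart by chart the volume has the Lebesgue
  null sets. Through this, \<open>ae M\<close> and \<open>AE x in vol\<close> become
  interchangeable, and the null sets of different rough metrics coincide.\<close>

lemma null_sets_vol: "null_sets vol = {A. manifold_null M A}"
proof (intro set_eqI iffI)
  obtain cs :: "nat \<Rightarrow> ('a, 'n) chart" where cs: "\<And>i. comparability_chart M g (cs i)" "(\<Union>i. fst (cs i)) = UNIV"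
    using comparability_atlas by auto
  have csM: "cs i \<in> M" for i using cs(1) comparability_chart_mem by blast
  have key: "emeasure vol (A \<inter> fst (cs i)) = 0 \<longleftrightarrow> snd (cs i) ` (A \<inter> fst (cs i)) \<in> null_sets lebesgue"
    if A: "manifold_measurable M A" for A i
  proof -
    have m: "manifold_measurable M (A \<inter> fst (cs i))" by (intro manifold_measurable_Int_chart chart_open csM A)
    show ?thesis
      using emeasure_vol[OF cs(1)[of i] m] chart_measure_null[OF csM[of i] manifold_measurableD[OF m csM[of i]]]
      by (simp add: image_mono)
  qed
  fix A
  { assume "A \<in> null_sets vol"
    then have A: "manifold_measurable M A" "emeasure vol A = 0" by (auto simp: null_sets_def sets_vol)
    have "emeasure vol (A \<inter> fst (cs i)) = 0" for i
      using A(2) emeasure_mono[of "A \<inter> fst (cs i)" A vol] A(1) by (simp add: sets_vol)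
    then show "A \<in> {A. manifold_null M A}"
      using key[OF A(1)] null_iff_subatlas[of cs, OF csM cs(2)] by simp }
  { assume "A \<in> {A. manifold_null M A}"
    then have A: "manifold_null M A" "manifold_measurable M A" using manifold_null_imp_measurable by auto
    have "A \<inter> fst (cs i) \<in> null_sets vol" for i
    proof -
      have "manifold_measurable M (A \<inter> fst (cs i))" by (intro manifold_measurable_Int_chart chart_open csM A(2))
      moreover have "emeasure vol (A \<inter> fst (cs i)) = 0" using key[OF A(2)] A(1) csM unfolding manifold_null_def by blast
      ultimately show ?thesis by (simp add: null_sets_def sets_vol)
    qed
    then have "(\<Union>i. A \<inter> fst (cs i)) \<in> null_sets vol" by blast
    moreover have "(\<Union>i. A \<inter> fst (cs i)) = A" using cs(2) by blast
    ultimately show "A \<in> null_sets vol" by simp }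
qed

lemma ae_iff_AE: "ae M P \<longleftrightarrow> (AE x in vol. P x)"
proof
  assume "ae M P"
  then have "{x. \<not> P x} \<in> null_sets vol" by (simp add: ae_def null_sets_vol)
  then show "AE x in vol. P x" by (rule AE_I') auto
next
  assume "AE x in vol. P x"
  then obtain N where "N \<in> null_sets vol" "{x. \<not> P x} \<subseteq> N" by (auto simp: eventually_ae_filter)
  then show "ae M P" using manifold_null_subset by (auto simp: ae_def null_sets_vol)
qed

lemma vol_complete: "A \<in> null_sets vol \<Longrightarrow> B \<subseteq> A \<Longrightarrow> B \<in> sets vol"
  using manifold_null_subset manifold_null_imp_measurable by (auto simp: null_sets_vol sets_vol)

text \<open>Completeness of the volume measure: a change on a null set cannot destroy measurability.
  It lets functions be defined arbitrarily where the metric is degenerate.\<close>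

lemma measurable_vol_AE:
  fixes f f' :: "'a \<Rightarrow> 'b::topological_space"
  assumes f: "f \<in> borel_measurable vol" and ae: "AE x in vol. f x = f' x"
  shows "f' \<in> borel_measurable vol"
proof (rule borel_measurableI)
  fix S :: "'b set" assume S: "open S"
  obtain N where N: "N \<in> null_sets vol" "{x. f x \<noteq> f' x} \<subseteq> N" using ae by (auto simp: eventually_ae_filter)
  have "f x = f' x" if "x \<notin> N" for x using N(2) that by blast
  then have "f' -` S = (f -` S - N) \<union> (f' -` S \<inter> N)" by auto
  moreover have "f -` S \<in> sets vol" using f S measurable_sets[of f vol borel S] by simp
  moreover have "f' -` S \<inter> N \<in> sets vol" by (rule vol_complete[OF N(1)]) auto
  moreover have "f -` S - N \<in> sets vol" using calculation(2) N(1) by (intro sets.Diff) auto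
  ultimately show "f' -` S \<inter> space vol \<in> sets vol" by (metis sets.Un inf_top_right space_vol)
qed

lemma measurable_volI:
  fixes f :: "'a \<Rightarrow> 'b::topological_space"
  assumes "\<And>c. c \<in> M \<Longrightarrow> (\<lambda>y. f (chart_inv c y)) \<in> borel_measurable (lebesgue_on (chart_image c))"
  shows "f \<in> borel_measurable vol"
proof (rule borel_measurableI)
  fix S :: "'b set" assume S: "open S"
  have "manifold_measurable M (f -` S)"
    unfolding manifold_measurable_def
  proof
    fix c assume c: "c \<in> M"
    have "(\<lambda>y. f (chart_inv c y)) -` S \<inter> space (lebesgue_on (chart_image c)) \<in> sets (lebesgue_on (chart_image c))"
      by (rule measurable_sets[OF assms[OF c]]) (use S in simp)
    moreover have "(\<lambda>y. f (chart_inv c y)) -` S \<inter> space (lebesgue_on (chart_image c)) = snd c ` (f -` S \<inter> fst c)"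
      using c by (auto simp: image_iff)
    ultimately show "snd c ` (f -` S \<inter> fst c) \<in> sets lebesgue"
      using image_lebesgue[OF c] by (auto simp: sets_restrict_space_iff)
  qed
  then show "f -` S \<inter> space vol \<in> sets vol" by (simp add: sets_vol)
qed

lemma measurable_vol_chart:
  fixes f :: "'a \<Rightarrow> 'b::topological_space"
  assumes f: "f \<in> borel_measurable vol" and c: "c \<in> M"
  shows "(\<lambda>y. f (chart_inv c y)) \<in> borel_measurable (lebesgue_on (chart_image c))"
proof (rule borel_measurableI)
  fix S :: "'b set" assume S: "open S"
  have "manifold_measurable M (f -` S)" using f S measurable_sets[of f vol borel S] by (simp add: sets_vol)
  then have "snd c ` (f -` S \<inter> fst c) \<in> sets lebesgue" using c by (simp add: manifold_measurable_def)
  moreover have "(\<lambda>y. f (chart_inv c y)) -` S \<inter> space (lebesgue_on (chart_image c)) = snd c ` (f -` S \<inter> fst c)"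
    using c by (auto simp: image_iff)
  ultimately show "(\<lambda>y. f (chart_inv c y)) -` S \<inter> space (lebesgue_on (chart_image c)) \<in> sets (lebesgue_on (chart_image c))"
    using image_lebesgue[OF c] by (auto simp: sets_restrict_space_iff)
qed

text \<open>In each comparability chart, the points at which both \<open>norm\<close> and the
  density are at most \<open>k\<close> have volume at most \<open>k\<close> times that of a ball;
  these pieces exhaust the manifold.\<close>

lemma sigma_finite_vol: "sigma_finite_measure vol"
proof
  obtain cs :: "nat \<Rightarrow> ('a, 'n) chart" where cs: "\<And>i. comparability_chart M g (cs i)" "(\<Union>i. fst (cs i)) = UNIV"
    using comparability_atlas by auto
  have csM: "cs i \<in> M" for i using cs(1) comparability_chart_mem by blast
  define B where "B i k = {y \<in> chart_image (cs i). norm y \<le> real k \<and> dens (cs i) y \<le> real k}" for i k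
  have Bm: "B i k \<in> sets lebesgue" for i k
  proof -
    have [measurable]: "dens (cs i) \<in> borel_measurable (lebesgue_on (chart_image (cs i)))" by (rule dens_measurable[OF csM])
    have "{y \<in> space (lebesgue_on (chart_image (cs i))). dens (cs i) y \<le> real k} \<in> sets (lebesgue_on (chart_image (cs i)))"
      by measurable
    then have "{y \<in> chart_image (cs i). dens (cs i) y \<le> real k} \<in> sets lebesgue"
      using image_lebesgue[OF csM] by (simp add: sets_restrict_space_iff)
    moreover have "B i k = {y \<in> chart_image (cs i). dens (cs i) y \<le> real k} \<inter> cball 0 (real k)"
      by (auto simp: B_def)
    ultimately show ?thesis by auto
  qed
  define E where "E i k = chart_inv (cs i) ` B i k" for i k
  have Bsub: "B i k \<subseteq> chart_image (cs i)" for i k by (auto simp: B_def)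
  have Esub: "E i k \<subseteq> fst (cs i)" for i k 
  proof
    fix p assume "p \<in> E i k"
    then obtain y where "y \<in> B i k" "p = chart_inv (cs i) y" by (auto simp: E_def)
    then show "p \<in> fst (cs i)" using chart_inv_mem[of y "cs i"] Bsub[of i k] by blast
  qed
  have sE: "snd (cs i) ` E i k = B i k" for i k
  proof -
    have "snd (cs i) (chart_inv (cs i) y) = y" if "y \<in> B i k" for y
      using chart_inv_right[of y "cs i"] Bsub[of i k] that by blast
    then show ?thesis by (simp add: E_def image_image)
  qed
  have Em: "manifold_measurable M (E i k)" for i k
    unfolding manifold_measurable_def
  proof
    fix c assume c: "c \<in> M"
    show "snd c ` (E i k \<inter> fst c) \<in> sets lebesgue"
    proof (rule measurable_transition[OF csM[of i] c])
      have "snd (cs i) ` (E i k \<inter> fst c) = snd (cs i) ` E i k \<inter> overlap (cs i) c"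
        using inj_on_image_Int[OF chart_inj[OF csM[of i]], of "E i k" "fst (cs i) \<inter> fst c"] Esub[of i k]
        by (simp add: Int_absorb2 flip: Int_assoc)
      then show "snd (cs i) ` (E i k \<inter> fst c) \<in> sets lebesgue"
        using sE Bm relatively_open_lebesgue[OF overlap_relatively_open[OF csM c]] by auto
    qed (use Esub in auto)
  qed
  have fin: "emeasure vol (E i k) \<noteq> \<infinity>" for i k
  proof -
    have "emeasure vol (E i k) = (\<integral>\<^sup>+y. ennreal (if y \<in> B i k then max 0 (dens (cs i) y) else 0) \<partial>lebesgue)"
      using emeasure_vol[OF cs(1) Em Esub] chart_vol_emeasure[OF csM Em Esub] chart_vol_restrict[OF Esub] sE by simp
    also have "\<dots> \<le> (\<integral>\<^sup>+y. ennreal (real k) * indicator (cball 0 (real k) :: 'n rvec set) y \<partial>lebesgue)"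
      by (intro nn_integral_mono) (auto simp: B_def split: split_indicator intro!: ennreal_leI)
    also have "\<dots> = ennreal (real k) * emeasure lebesgue (cball 0 (real k) :: 'n rvec set)"
      by (rule nn_integral_cmult_indicator) simp
    also have "\<dots> < \<infinity>"
      using fmeasurableD2[OF lmeasurable_cball] by (auto simp: ennreal_mult_less_top top.not_eq_extremum)
    finally show ?thesis by simp
  qed
  have "(\<Union>i k. E i k) = UNIV"
  proof (intro set_eqI iffI UNIV_I)
    fix p :: 'a
    obtain i where i: "p \<in> fst (cs i)" using cs(2) by blast
    obtain k :: nat where k: "max (norm (snd (cs i) p)) (dens (cs i) (snd (cs i) p)) \<le> real k" using real_arch_simple by blast
    have "snd (cs i) p \<in> B i k" using i k by (auto simp: B_def)
    then have "p \<in> E i k" unfolding E_def using i csM by (metis chart_inv_left image_eqI)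
    then show "p \<in> (\<Union>i k. E i k)" by blast
  qed
  then have "\<Union> (range (\<lambda>(i, k). E i k)) = space vol" by auto
  moreover have "range (\<lambda>(i, k). E i k) \<subseteq> sets vol" using Em by (auto simp: sets_vol)
  moreover have "\<forall>a\<in>range (\<lambda>(i, k). E i k). emeasure vol a \<noteq> \<infinity>" using fin by auto
  ultimately show "\<exists>A. countable A \<and> A \<subseteq> sets vol \<and> \<Union> A = space vol \<and> (\<forall>a\<in>A. emeasure vol a \<noteq> \<infinity>)"
    by (intro exI[of _ "range (\<lambda>(i, k). E i k)"]) auto
qed

section \<open>Integrals over the manifold computed in a chart\<close>

lemma restrict_vol_eq:
  assumes c: "comparability_chart M g c"
  shows "restrict_space vol (fst c) =
    distr (density (lebesgue_on (chart_image c)) (\<lambda>y. ennreal (dens c y))) (restrict_space vol (fst c)) (chart_inv c)"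
    (is "?R = distr ?D ?R _")
    and "chart_inv c \<in> density (lebesgue_on (chart_image c)) (\<lambda>y. ennreal (dens c y)) \<rightarrow>\<^sub>M restrict_space vol (fst c)"
proof -
  have cM: "c \<in> M" using c comparability_chart_mem by blast
  have fM: "fst c \<in> sets vol" using chart_open[OF cM] manifold_measurable_open by (simp add: sets_vol)
  have setsR: "A \<in> sets ?R \<longleftrightarrow> manifold_measurable M A \<and> A \<subseteq> fst c" for A
    using fM by (auto simp: sets_restrict_space_iff sets_vol)
  have vim: "chart_inv c -` A \<inter> chart_image c = snd c ` A" if "A \<subseteq> fst c" for A
    using that cM by (auto simp: image_iff)
  show inv: "chart_inv c \<in> ?D \<rightarrow>\<^sub>M ?R"
  proof (rule measurableI)
    show "chart_inv c y \<in> space ?R" if "y \<in> space ?D" for y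
      using that chart_inv_mem by (simp add: space_restrict_space)
    fix A assume "A \<in> sets ?R"
    then have A: "manifold_measurable M A" "A \<subseteq> fst c" using setsR by auto
    show "chart_inv c -` A \<inter> space ?D \<in> sets ?D"
      using manifold_measurableD[OF A(1) cM A(2)] A(2) image_lebesgue[OF cM] by (auto simp: vim sets_restrict_space_iff)
  qed
  show "?R = distr ?D ?R (chart_inv c)"
  proof (rule measure_eqI)
    fix A assume AR: "A \<in> sets ?R"
    then have A: "manifold_measurable M A" "A \<subseteq> fst c" using setsR by auto
    have sA: "snd c ` A \<in> sets lebesgue" "snd c ` A \<subseteq> chart_image c" using manifold_measurableD[OF A(1) cM A(2)] A(2) by auto
    have "emeasure (distr ?D ?R (chart_inv c)) A = emeasure ?D (snd c ` A)"
      using emeasure_distr[OF inv AR] vim[OF A(2)] by simp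
    also have "\<dots> = (\<integral>\<^sup>+y. ennreal (dens c y) * indicator (snd c ` A) y \<partial>lebesgue_on (chart_image c))"
      using sA image_lebesgue[OF cM] dens_measurable[OF cM]
      by (intro emeasure_density) (auto simp: sets_restrict_space_iff)
    also have "\<dots> = (\<integral>\<^sup>+y. ennreal (dens c y) * indicator (snd c ` A) y * indicator (chart_image c) y \<partial>lebesgue)"
      using image_lebesgue[OF cM] by (intro nn_integral_restrict_space) auto
    also have "\<dots> = chart_vol c A"
      unfolding chart_vol_def dens_def[symmetric] using sA(2) by (intro nn_integral_cong) (auto split: split_indicator)
    also have "\<dots> = emeasure vol A" using emeasure_vol[OF c A] chart_vol_emeasure[OF cM A] by simp
    also have "\<dots> = emeasure ?R A" using fM A(2) by (intro emeasure_restrict_space[symmetric]) auto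
    finally show "emeasure ?R A = emeasure (distr ?D ?R (chart_inv c)) A" ..
  qed simp
qed

lemma nn_integral_chart:
  assumes c: "comparability_chart M g c" and f: "f \<in> borel_measurable vol"
  shows "(\<integral>\<^sup>+x\<in>fst c. f x \<partial>vol) = (\<integral>\<^sup>+y. ennreal (dens c y) * f (chart_inv c y) \<partial>lebesgue_on (chart_image c))"
proof -
  have cM: "c \<in> M" using c comparability_chart_mem by blast
  have fM: "fst c \<in> sets vol" using chart_open[OF cM] manifold_measurable_open by (simp add: sets_vol)
  have fR: "f \<in> borel_measurable (restrict_space vol (fst c))" by (rule measurable_restrict_space1[OF f])
  have "(\<integral>\<^sup>+x\<in>fst c. f x \<partial>vol) = (\<integral>\<^sup>+x. f x \<partial>restrict_space vol (fst c))"
    using fM by (intro nn_integral_restrict_space[symmetric]) auto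
  also have "\<dots> = (\<integral>\<^sup>+y. f (chart_inv c y) \<partial>density (lebesgue_on (chart_image c)) (\<lambda>y. ennreal (dens c y)))"
    by (subst restrict_vol_eq(1)[OF c], rule nn_integral_distr[OF restrict_vol_eq(2)[OF c]]) (use fR in simp)
  also have "\<dots> = (\<integral>\<^sup>+y. ennreal (dens c y) * f (chart_inv c y) \<partial>lebesgue_on (chart_image c))"
    by (rule nn_integral_density) (use dens_measurable[OF cM] measurable_vol_chart[OF f cM] in auto)
  finally show ?thesis .
qed

lemma integral_chart:
  fixes f :: "'a \<Rightarrow> complex"
  assumes c: "comparability_chart M g c" and f: "f \<in> borel_measurable vol" and supp: "\<And>x. x \<notin> fst c \<Longrightarrow> f x = 0"
  shows "(\<integral>x. f x \<partial>vol) = (\<integral>y. dens c y *\<^sub>R f (chart_inv c y) \<partial>lebesgue_on (chart_image c))"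
proof -
  have cM: "c \<in> M" using c comparability_chart_mem by blast
  have fM: "fst c \<in> sets vol" using chart_open[OF cM] manifold_measurable_open by (simp add: sets_vol)
  have fR: "f \<in> borel_measurable (restrict_space vol (fst c))" by (rule measurable_restrict_space1[OF f])
  have "(\<integral>x. f x \<partial>vol) = (\<integral>x. indicator (fst c) x *\<^sub>R f x \<partial>vol)"
    using supp by (intro Bochner_Integration.integral_cong) (auto simp: indicator_def)
  also have "\<dots> = (\<integral>x. f x \<partial>restrict_space vol (fst c))"
    using fM by (intro integral_restrict_space[symmetric]) auto
  also have "\<dots> = (\<integral>y. f (chart_inv c y) \<partial>density (lebesgue_on (chart_image c)) (\<lambda>y. ennreal (dens c y)))"
    by (subst restrict_vol_eq(1)[OF c], rule integral_distr[OF restrict_vol_eq(2)[OF c]]) (use fR in simp)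
  also have "\<dots> = (\<integral>y. dens c y *\<^sub>R f (chart_inv c y) \<partial>lebesgue_on (chart_image c))"
  proof (rule integral_density)
    have "AE y in lebesgue. y \<in> chart_image c \<longrightarrow> 0 \<le> dens c y" using ae_dens_pos[OF cM] by eventually_elim auto
    then show "AE y in lebesgue_on (chart_image c). 0 \<le> dens c y"
      using image_lebesgue[OF cM] by (subst AE_restrict_space_iff) auto
  qed (use dens_measurable[OF cM] measurable_vol_chart[OF f cM] in auto)
  finally show ?thesis .
qed

end

subsection \<open>Completeness of the space of square integrable forms\<close>

lemma scaleR_eq_vector_scale: "r *\<^sub>R (y :: complex^'k) = of_real r *s y"
  unfolding vec_eq_iff vector_scaleR_component vector_smult_component
  by (simp add: scaleR_conv_of_real)

lemma tendsto_form_pullback: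
  assumes "(f \<longlongrightarrow> \<omega>) F" shows "((\<lambda>n. form_pullback A (f n)) \<longlongrightarrow> form_pullback A \<omega>) F"
proof -
  have "linear (form_pullback A)"
  proof (rule linearI)
    show "form_pullback A (x + y) = form_pullback A x + form_pullback A y" for x y by (rule form_pullback_add)
    show "form_pullback A (r *\<^sub>R x) = r *\<^sub>R form_pullback A x" for r x
      by (simp only: scaleR_eq_vector_scale form_pullback_scale)
  qed
  then have "bounded_linear (form_pullback A)" by (simp add: linear_conv_bounded_linear)
  then show ?thesis using assms by (rule bounded_linear.tendsto)
qed

lemma tendsto_form_norm:
  assumes G: "posdef G" and "(f \<longlongrightarrow> \<omega>) F" shows "((\<lambda>n. form_norm G (f n)) \<longlongrightarrow> form_norm G \<omega>) F"
proof -
  obtain A where A: "frame G A" using frame_exists[OF G] by blast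
  show ?thesis unfolding form_norm_frame[OF A] by (intro tendsto_norm tendsto_form_pullback assms(2))
qed

lemma convergent_form_pullback_iff:
  assumes "A ** B = mat 1"
  shows "convergent (\<lambda>n. form_pullback A (f n)) \<longleftrightarrow> convergent f"
proof
  assume "convergent (\<lambda>n. form_pullback A (f n))"
  then obtain l where "(\<lambda>n. form_pullback A (f n)) \<longlonglongrightarrow> l" by (auto simp: convergent_def)
  then have "(\<lambda>n. form_pullback B (form_pullback A (f n))) \<longlonglongrightarrow> form_pullback B l" by (rule tendsto_form_pullback)
  then show "convergent f" by (auto simp: convergent_def form_pullback_inverse[OF assms])
qed (auto simp: convergent_def dest: tendsto_form_pullback)

text \<open>The default 0 is compatible with coordinates: pullback by an invertible matrix preserves
  both convergence and divergence, and fixes 0. The pointwise limit of forms therefore has the same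
  description in every chart, and measurability can be tested there.\<close>

definition lim_or_zero :: "(nat \<Rightarrow> 'b::real_normed_vector) \<Rightarrow> 'b" where
  "lim_or_zero f = (if convergent f then lim f else 0)"

lemma lim_or_zero_eqI: "f \<longlonglongrightarrow> l \<Longrightarrow> lim_or_zero f = l"
  by (auto simp: lim_or_zero_def convergent_def limI)

lemma lim_or_zero_form_pullback:
  assumes "A ** B = mat 1"
  shows "form_pullback A (lim_or_zero f) = lim_or_zero (\<lambda>n. form_pullback A (f n))"
proof (cases "convergent f")
  case True
  then have "f \<longlonglongrightarrow> lim_or_zero f" by (simp add: lim_or_zero_def convergent_LIMSEQ_iff)
  then have "(\<lambda>n. form_pullback A (f n)) \<longlonglongrightarrow> form_pullback A (lim_or_zero f)" by (rule tendsto_form_pullback)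
  then show ?thesis using lim_or_zero_eqI by metis
next
  case False
  then show ?thesis using convergent_form_pullback_iff[OF assms, of f] by (simp add: lim_or_zero_def)
qed

lemma borel_measurable_lim_or_zero:
  fixes f :: "nat \<Rightarrow> 'a \<Rightarrow> 'b::euclidean_space"
  assumes f: "\<And>n. f n \<in> borel_measurable N"
  shows "(\<lambda>x. lim_or_zero (\<lambda>n. f n x)) \<in> borel_measurable N"
proof -
  have [measurable]: "f n \<in> borel_measurable N" for n by (rule f)
  have [measurable]: "Measurable.pred N (\<lambda>x. convergent (\<lambda>n. f n x))"
    unfolding Cauchy_convergent_iff[symmetric] pred_def by measurable
  have [measurable]: "(\<lambda>x. lim (\<lambda>n. f n x)) \<in> borel_measurable N" by (rule borel_measurable_lim_metric[OF f])
  show ?thesis unfolding lim_or_zero_def by measurable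
qed

section \<open>Measurable forms and their classes\<close>

context smooth_mfd
begin

lemma measurable_form_add:
  assumes "measurable_form M \<omega>" "measurable_form M \<eta>" shows "measurable_form M (\<lambda>x. \<omega> x + \<eta> x)"
proof -
  have "form_in_chart M c (\<lambda>x. \<omega> x + \<eta> x) = (\<lambda>y. form_in_chart M c \<omega> y + form_in_chart M c \<eta> y)" for c
    by (simp add: form_in_chart_def Let_def form_pullback_add fun_eq_iff)
  then show ?thesis
    using assms unfolding measurable_form_def by (auto simp only: intro!: borel_measurable_add)
qed

lemma measurable_form_scale:
  assumes "measurable_form M \<omega>" shows "measurable_form M (\<lambda>x. r *s \<omega> x)"
  unfolding measurable_form_def
proof
  fix c assume c: "c \<in> M"
  have "form_in_chart M c (\<lambda>x. r *s \<omega> x) = (\<lambda>y. r *s form_in_chart M c \<omega> y)"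
    by (simp add: form_in_chart_def Let_def form_pullback_scale fun_eq_iff)
  moreover have "(\<lambda>y. (r *s form_in_chart M c \<omega> y) $ i) \<in> borel_measurable (lebesgue_on (chart_image c))" for i
    using borel_measurable_vec_nth[OF bspec[OF assms[unfolded measurable_form_def] c], of i] by simp
  ultimately show "form_in_chart M c (\<lambda>x. r *s \<omega> x) \<in> borel_measurable (lebesgue_on (chart_image c))"
    by (auto intro: borel_measurable_vecI)
qed

lemma measurable_form_zero: "measurable_form M (\<lambda>x. 0)"
proof -
  have "form_in_chart M c (\<lambda>x. 0) = (\<lambda>y. 0)" for c by (simp add: form_in_chart_def fun_eq_iff)
  then show ?thesis by (simp add: measurable_form_def)
qed

lemma measurable_form_degree_filter:
  assumes "measurable_form M \<omega>" shows "measurable_form M (\<lambda>x. degree_filter S (\<omega> x))"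
  unfolding measurable_form_def
proof
  fix c assume c: "c \<in> M"
  have "form_in_chart M c (\<lambda>x. degree_filter S (\<omega> x)) = (\<lambda>y. degree_filter S (form_in_chart M c \<omega> y))"
    by (simp add: form_in_chart_def Let_def form_pullback_degree_filter fun_eq_iff)
  moreover have "(\<lambda>y. degree_filter S (form_in_chart M c \<omega> y) $ i) \<in> borel_measurable (lebesgue_on (chart_image c))" for i
    using borel_measurable_vec_nth[OF bspec[OF assms[unfolded measurable_form_def] c], of i]
    unfolding degree_filter_def by (cases "card i \<in> S") auto
  ultimately show "form_in_chart M c (\<lambda>x. degree_filter S (\<omega> x)) \<in> borel_measurable (lebesgue_on (chart_image c))"
    by (auto intro: borel_measurable_vecI)
qed

lemma measurable_form_minus:
  assumes "measurable_form M \<omega>" "measurable_form M \<eta>" shows "measurable_form M (\<lambda>x. \<omega> x - \<eta> x)"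
proof -
  have "(\<lambda>x. \<omega> x - \<eta> x) = (\<lambda>x. \<omega> x + (-1) *s \<eta> x)" by (simp add: fun_eq_iff vec_eq_iff)
  then show ?thesis using measurable_form_add[OF assms(1) measurable_form_scale[OF assms(2), of "-1"]] by simp
qed

lemma measurable_form_lim:
  assumes "\<And>n. measurable_form M (\<omega> n)" shows "measurable_form M (\<lambda>x. lim_or_zero (\<lambda>n. \<omega> n x))"
  unfolding measurable_form_def
proof
  fix c assume c: "c \<in> M"
  have "(\<lambda>y. lim_or_zero (\<lambda>n. form_in_chart M c (\<omega> n) y)) \<in> borel_measurable (lebesgue_on (chart_image c))"
    using assms c by (intro borel_measurable_lim_or_zero) (auto simp: measurable_form_def)
  moreover have "form_in_chart M c (\<lambda>x. lim_or_zero (\<lambda>n. \<omega> n x)) y = lim_or_zero (\<lambda>n. form_in_chart M c (\<omega> n) y)"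
    if "y \<in> chart_image c" for y
    unfolding form_in_chart_def Let_def
    by (rule lim_or_zero_form_pullback[OF chart_pull_push(1)[OF c chart_inv_mem[OF that]]])
  ultimately show "form_in_chart M c (\<lambda>x. lim_or_zero (\<lambda>n. \<omega> n x)) \<in> borel_measurable (lebesgue_on (chart_image c))"
    by (subst measurable_cong) auto
qed

lemma form_class_eqI: "ae M (\<lambda>x. \<omega> x = \<eta> x) \<Longrightarrow> form_class M \<omega> = form_class M \<eta>"
proof -
  assume a: "ae M (\<lambda>x. \<omega> x = \<eta> x)"
  \<comment> \<open>The conjunction of two statements is taken from the countable version; in this
    context there is no measure whose \<open>AE\<close> could be used.\<close>
  have two: "ae M (\<lambda>x. P x \<and> Q x)" if "ae M P" "ae M Q" for P Q
  proof -
    have "ae M (\<lambda>x. \<forall>i::nat. if i = 0 then P x else Q x)" 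
    proof (rule ae_all_nat)
      show "ae M (\<lambda>x. if i = 0 then P x else Q x)" for i :: nat using that by (cases i) simp_all
    qed
    then show ?thesis by (rule ae_mono) (metis zero_neq_one)
  qed
  have "ae M (\<lambda>x. \<zeta> x = \<omega> x) \<longleftrightarrow> ae M (\<lambda>x. \<zeta> x = \<eta> x)" for \<zeta>
  proof
    assume "ae M (\<lambda>x. \<zeta> x = \<omega> x)"
    from two[OF this a] show "ae M (\<lambda>x. \<zeta> x = \<eta> x)" by (rule ae_mono) auto
  next
    assume "ae M (\<lambda>x. \<zeta> x = \<eta> x)"
    from two[OF this a] show "ae M (\<lambda>x. \<zeta> x = \<omega> x)" by (rule ae_mono) auto
  qed
  then show ?thesis by (simp add: form_class_def)
qed

lemma ae_refl: "(\<And>x. P x) \<Longrightarrow> ae M P"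
  by (simp add: ae_def manifold_null_def)

lemma mem_form_class: "measurable_form M \<omega> \<Longrightarrow> \<omega> \<in> form_class M \<omega>"
  by (simp add: form_class_def ae_refl)

lemma rep_form_class:
  assumes "measurable_form M \<omega>"
  shows "measurable_form M (rep (form_class M \<omega>))" "ae M (\<lambda>x. rep (form_class M \<omega>) x = \<omega> x)"
proof -
  have "rep (form_class M \<omega>) \<in> form_class M \<omega>" 
    unfolding rep_def by (rule someI[of "\<lambda>\<omega>'. \<omega>' \<in> form_class M \<omega>", OF mem_form_class[OF assms]])
  then show "measurable_form M (rep (form_class M \<omega>))" "ae M (\<lambda>x. rep (form_class M \<omega>) x = \<omega> x)"
    by (auto simp: form_class_def)
qed

end

section \<open>The inner product and completeness\<close>

context rough_mfd
begin

abbreviation "L2 \<equiv> L2_forms M g"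

definition sq_norm :: "('a \<Rightarrow> 'n form) \<Rightarrow> ennreal" where
  "sq_norm \<omega> = (\<integral>\<^sup>+x. ennreal ((form_norm (g x) (\<omega> x))\<^sup>2) \<partial>vol)"

definition finite_energy :: "('a \<Rightarrow> 'n form) \<Rightarrow> bool" where
  "finite_energy \<omega> \<longleftrightarrow> measurable_form M \<omega> \<and> sq_norm \<omega> < \<infinity>"

lemma AE_posdef: "AE x in vol. posdef (g x)"
  using ae_posdef ae_iff_AE by blast

text \<open>The chart formula for the inner product is valid where the metric is positive definite.
  The function is replaced by 0 elsewhere, shown measurable in charts, and compared with the
  original almost everywhere.\<close>

lemma form_inner_measurable:
  assumes "measurable_form M \<omega>" "measurable_form M \<eta>"
  shows "(\<lambda>x. form_inner (g x) (\<omega> x) (\<eta> x)) \<in> borel_measurable vol"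
proof (rule measurable_vol_AE)
  let ?f = "\<lambda>x. if posdef (g x) then form_inner (g x) (\<omega> x) (\<eta> x) else 0"
  show "?f \<in> borel_measurable vol"
  proof (rule measurable_volI)
    fix c assume c: "c \<in> M"
    let ?L = "lebesgue_on (chart_image c)"
    have "manifold_measurable M {x. \<not> posdef (g x)}"
      using ae_posdef manifold_null_imp_measurable by (simp add: ae_def)
    then have "snd c ` ({x. \<not> posdef (g x)} \<inter> fst c) \<in> sets lebesgue" using c by (simp add: manifold_measurable_def)
    moreover have "snd c ` ({x. \<not> posdef (g x)} \<inter> fst c) = {y \<in> space ?L. \<not> posdef (g (chart_inv c y))}"
      using c by (auto simp: image_iff)
    ultimately have N: "{y \<in> space ?L. \<not> posdef (g (chart_inv c y))} \<in> sets ?L"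
      using image_lebesgue[OF c] by (simp add: sets_restrict_space_iff)
    have [measurable]: "Measurable.pred ?L (\<lambda>y. posdef (g (chart_inv c y)))"
      using sets.compl_sets[OF N] by (simp add: pred_def set_diff_eq cong: conj_cong)
    have [measurable]: "(\<lambda>y. form_inner (metric_in_chart M c g y) (form_in_chart M c \<omega> y) (form_in_chart M c \<eta> y)) \<in> borel_measurable ?L"
      using assms c by (intro borel_measurable_form_inner metric_in_chart_measurable) (auto simp: measurable_form_def)
    have "(\<lambda>y. if posdef (g (chart_inv c y)) then
        form_inner (metric_in_chart M c g y) (form_in_chart M c \<omega> y) (form_in_chart M c \<eta> y) else 0) \<in> borel_measurable ?L"
      by measurable
    moreover have "?f (chart_inv c y) = (if posdef (g (chart_inv c y)) then
        form_inner (metric_in_chart M c g y) (form_in_chart M c \<omega> y) (form_in_chart M c \<eta> y) else 0)" if "y \<in> space ?L" for y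
      using that c form_inner_in_chart[OF c, of "chart_inv c y" g \<omega> \<eta>] chart_inv_mem[of y c] chart_inv_right[of y c] by auto
    ultimately show "(\<lambda>y. ?f (chart_inv c y)) \<in> borel_measurable ?L"
      by (subst measurable_cong) auto
  qed
  show "AE x in vol. ?f x = form_inner (g x) (\<omega> x) (\<eta> x)" using AE_posdef by eventually_elim auto
qed

lemma form_norm_measurable:
  assumes "measurable_form M \<omega>" shows "(\<lambda>x. form_norm (g x) (\<omega> x)) \<in> borel_measurable vol"
  unfolding form_norm_def using form_inner_measurable[OF assms assms] by measurable

lemma sq_norm_cong:
  assumes "ae M (\<lambda>x. \<omega> x = \<eta> x)" shows "sq_norm \<omega> = sq_norm \<eta>"
  unfolding sq_norm_def
proof (rule nn_integral_cong_AE)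
  show "AE x in vol. ennreal ((form_norm (g x) (\<omega> x))\<^sup>2) = ennreal ((form_norm (g x) (\<eta> x))\<^sup>2)"
    using assms[unfolded ae_iff_AE] by eventually_elim simp
qed

lemma car_iff: "u \<in> hcar L2 \<longleftrightarrow> (\<exists>\<omega>. u = form_class M \<omega> \<and> finite_energy \<omega>)"
  by (auto simp: L2_forms_def finite_energy_def sq_norm_def)

lemma form_class_car: "finite_energy \<omega> \<Longrightarrow> form_class M \<omega> \<in> hcar L2"
  using car_iff by blast

lemma rep_car:
  assumes "u \<in> hcar L2"
  shows "finite_energy (rep u)" "form_class M (rep u) = u"
proof -
  obtain \<omega> where w: "u = form_class M \<omega>" "finite_energy \<omega>" using assms car_iff by blast
  have m: "measurable_form M \<omega>" using w by (simp add: finite_energy_def)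
  show "finite_energy (rep u)"
    using rep_form_class[OF m] sq_norm_cong[of "rep u" \<omega>] w by (simp add: finite_energy_def)
  show "form_class M (rep u) = u" using form_class_eqI[OF rep_form_class(2)[OF m]] w by simp
qed

lemma rep_class_AE: "finite_energy \<omega> \<Longrightarrow> AE x in vol. rep (form_class M \<omega>) x = \<omega> x"
  using rep_form_class(2) ae_iff_AE by (simp add: finite_energy_def)

lemma finite_energy_add:
  assumes "finite_energy \<omega>" "finite_energy \<eta>" shows "finite_energy (\<lambda>x. \<omega> x + \<eta> x)"
  unfolding finite_energy_def
proof
  have m: "measurable_form M \<omega>" "measurable_form M \<eta>" using assms by (auto simp: finite_energy_def)
  note [measurable] = form_norm_measurable[OF m(1)] form_norm_measurable[OF m(2)]
  show "measurable_form M (\<lambda>x. \<omega> x + \<eta> x)" by (intro measurable_form_add m)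
  have "AE x in vol. ennreal ((form_norm (g x) (\<omega> x + \<eta> x))\<^sup>2) \<le>
      2 * ennreal ((form_norm (g x) (\<omega> x))\<^sup>2) + 2 * ennreal ((form_norm (g x) (\<eta> x))\<^sup>2)"
    using AE_posdef
  proof eventually_elim
    fix x assume G: "posdef (g x)"
    have "(form_norm (g x) (\<omega> x + \<eta> x))\<^sup>2 \<le> (form_norm (g x) (\<omega> x) + form_norm (g x) (\<eta> x))\<^sup>2"
      by (intro power_mono form_norm_triangle form_norm_nonneg G)
    also have "\<dots> \<le> 2 * (form_norm (g x) (\<omega> x))\<^sup>2 + 2 * (form_norm (g x) (\<eta> x))\<^sup>2"
      using sum_squares_bound[of "form_norm (g x) (\<omega> x)" "form_norm (g x) (\<eta> x)"] by (simp add: power2_sum)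
    finally have "ennreal ((form_norm (g x) (\<omega> x + \<eta> x))\<^sup>2) \<le> ennreal (2 * (form_norm (g x) (\<omega> x))\<^sup>2 + 2 * (form_norm (g x) (\<eta> x))\<^sup>2)"
      by (rule ennreal_leI)
    then show "ennreal ((form_norm (g x) (\<omega> x + \<eta> x))\<^sup>2) \<le>
      2 * ennreal ((form_norm (g x) (\<omega> x))\<^sup>2) + 2 * ennreal ((form_norm (g x) (\<eta> x))\<^sup>2)"
      by (simp add: ennreal_mult)
  qed
  then have "sq_norm (\<lambda>x. \<omega> x + \<eta> x) \<le> (\<integral>\<^sup>+x. 2 * ennreal ((form_norm (g x) (\<omega> x))\<^sup>2) + 2 * ennreal ((form_norm (g x) (\<eta> x))\<^sup>2) \<partial>vol)"
    unfolding sq_norm_def by (rule nn_integral_mono_AE)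
  also have "\<dots> = 2 * sq_norm \<omega> + 2 * sq_norm \<eta>"
    unfolding sq_norm_def by (simp add: nn_integral_add nn_integral_cmult)
  also have "\<dots> < \<infinity>" using assms by (simp add: finite_energy_def ennreal_mult_less_top)
  finally show "sq_norm (\<lambda>x. \<omega> x + \<eta> x) < \<infinity>" .
qed

lemma finite_energy_scale:
  assumes "finite_energy \<omega>" shows "finite_energy (\<lambda>x. r *s \<omega> x)"
  unfolding finite_energy_def
proof
  have m: "measurable_form M \<omega>" using assms by (auto simp: finite_energy_def)
  note [measurable] = form_norm_measurable[OF m]
  show "measurable_form M (\<lambda>x. r *s \<omega> x)" by (intro measurable_form_scale m)
  have "AE x in vol. ennreal ((form_norm (g x) (r *s \<omega> x))\<^sup>2) = ennreal ((cmod r)\<^sup>2) * ennreal ((form_norm (g x) (\<omega> x))\<^sup>2)"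
    using AE_posdef by eventually_elim (simp add: form_norm_scale power_mult_distrib ennreal_mult)
  then have "sq_norm (\<lambda>x. r *s \<omega> x) = ennreal ((cmod r)\<^sup>2) * sq_norm \<omega>"
    unfolding sq_norm_def by (subst nn_integral_cong_AE) (auto simp: nn_integral_cmult)
  then show "sq_norm (\<lambda>x. r *s \<omega> x) < \<infinity>" using assms by (simp add: finite_energy_def ennreal_mult_less_top)
qed

lemma finite_energy_zero: "finite_energy (\<lambda>x. 0)"
  by (simp add: finite_energy_def measurable_form_zero sq_norm_def form_norm_def)

lemma finite_energy_minus:
  assumes "finite_energy \<omega>" "finite_energy \<eta>" shows "finite_energy (\<lambda>x. \<omega> x - \<eta> x)"
proof -
  have "(\<lambda>x. \<omega> x - \<eta> x) = (\<lambda>x. \<omega> x + (-1) *s \<eta> x)" by (simp add: fun_eq_iff vec_eq_iff)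
  then show ?thesis using finite_energy_add[OF assms(1) finite_energy_scale[OF assms(2), of "-1"]] by simp
qed

lemma finite_energy_degree_filter:
  assumes "finite_energy \<omega>" shows "finite_energy (\<lambda>x. degree_filter S (\<omega> x))"
  unfolding finite_energy_def
proof
  have m: "measurable_form M \<omega>" using assms by (auto simp: finite_energy_def)
  show "measurable_form M (\<lambda>x. degree_filter S (\<omega> x))" by (intro measurable_form_degree_filter m)
  have "AE x in vol. ennreal ((form_norm (g x) (degree_filter S (\<omega> x)))\<^sup>2) \<le> ennreal ((form_norm (g x) (\<omega> x))\<^sup>2)"
    using AE_posdef by eventually_elim (intro ennreal_leI power_mono form_norm_degree_filter_le form_norm_nonneg)
  then have "sq_norm (\<lambda>x. degree_filter S (\<omega> x)) \<le> sq_norm \<omega>" unfolding sq_norm_def by (rule nn_integral_mono_AE)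
  then show "sq_norm (\<lambda>x. degree_filter S (\<omega> x)) < \<infinity>" using assms by (auto simp: finite_energy_def)
qed

definition energy :: "('a \<Rightarrow> 'n form) \<Rightarrow> ('a \<Rightarrow> 'n form) \<Rightarrow> complex" where
  "energy \<omega> \<eta> = (\<integral>x. form_inner (g x) (\<omega> x) (\<eta> x) \<partial>vol)"

lemma form_inner_integrable:
  assumes "finite_energy \<omega>" "finite_energy \<eta>"
  shows "integrable vol (\<lambda>x. form_inner (g x) (\<omega> x) (\<eta> x))"
proof (rule integrableI_bounded)
  have m: "measurable_form M \<omega>" "measurable_form M \<eta>" using assms by (auto simp: finite_energy_def)
  note [measurable] = form_norm_measurable[OF m(1)] form_norm_measurable[OF m(2)]
  show "(\<lambda>x. form_inner (g x) (\<omega> x) (\<eta> x)) \<in> borel_measurable vol" by (rule form_inner_measurable[OF m])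
  have "AE x in vol. ennreal (norm (form_inner (g x) (\<omega> x) (\<eta> x))) \<le>
      ennreal ((form_norm (g x) (\<omega> x))\<^sup>2) + ennreal ((form_norm (g x) (\<eta> x))\<^sup>2)"
    using AE_posdef
  proof eventually_elim
    fix x assume G: "posdef (g x)"
    have n: "0 \<le> form_norm (g x) (\<omega> x)" "0 \<le> form_norm (g x) (\<eta> x)" using form_norm_nonneg[OF G] by auto
    have "norm (form_inner (g x) (\<omega> x) (\<eta> x)) \<le> form_norm (g x) (\<omega> x) * form_norm (g x) (\<eta> x)"
      by (rule form_inner_norm_le[OF G])
    also have "\<dots> \<le> (form_norm (g x) (\<omega> x))\<^sup>2 + (form_norm (g x) (\<eta> x))\<^sup>2"
      using sum_squares_bound[of "form_norm (g x) (\<omega> x)" "form_norm (g x) (\<eta> x)"] mult_nonneg_nonneg[OF n] by linarith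
    finally show "ennreal (norm (form_inner (g x) (\<omega> x) (\<eta> x))) \<le>
      ennreal ((form_norm (g x) (\<omega> x))\<^sup>2) + ennreal ((form_norm (g x) (\<eta> x))\<^sup>2)"
      by (simp flip: ennreal_plus)
  qed
  then have "(\<integral>\<^sup>+x. ennreal (norm (form_inner (g x) (\<omega> x) (\<eta> x))) \<partial>vol) \<le>
      (\<integral>\<^sup>+x. ennreal ((form_norm (g x) (\<omega> x))\<^sup>2) + ennreal ((form_norm (g x) (\<eta> x))\<^sup>2) \<partial>vol)"
    by (rule nn_integral_mono_AE)
  also have "\<dots> = sq_norm \<omega> + sq_norm \<eta>" unfolding sq_norm_def by (rule nn_integral_add) measurable
  also have "\<dots> < \<infinity>" using assms by (simp add: finite_energy_def)
  finally show "(\<integral>\<^sup>+x. ennreal (norm (form_inner (g x) (\<omega> x) (\<eta> x))) \<partial>vol) < \<infinity>" .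
qed

lemma energy_cong:
  assumes "measurable_form M \<omega>" "measurable_form M \<eta>" "measurable_form M \<omega>'" "measurable_form M \<eta>'"
    and "AE x in vol. \<omega> x = \<omega>' x" "AE x in vol. \<eta> x = \<eta>' x"
  shows "energy \<omega> \<eta> = energy \<omega>' \<eta>'"
  unfolding energy_def
proof (rule integral_cong_AE)
  show "AE x in vol. form_inner (g x) (\<omega> x) (\<eta> x) = form_inner (g x) (\<omega>' x) (\<eta>' x)"
    using assms(5,6) by eventually_elim simp
qed (intro form_inner_measurable assms)+

lemma inner_L2: "hinner L2 u v = energy (rep u) (rep v)"
  by (simp add: L2_forms_def energy_def)

lemma inner_class:
  assumes "finite_energy \<omega>" "finite_energy \<eta>"
  shows "hinner L2 (form_class M \<omega>) (form_class M \<eta>) = energy \<omega> \<eta>"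
  unfolding inner_L2
  using assms rep_class_AE rep_form_class(1) by (intro energy_cong) (auto simp: finite_energy_def)

lemma add_L2: "hadd L2 u v = form_class M (\<lambda>x. rep u x + rep v x)"
  by (simp add: L2_forms_def)

lemma scale_L2: "hscale L2 r u = form_class M (\<lambda>x. r *s rep u x)"
  by (simp add: L2_forms_def)

lemma zero_L2: "hzero L2 = form_class M (\<lambda>x. 0)"
  by (simp add: L2_forms_def)

lemma add_class:
  assumes "finite_energy \<omega>" "finite_energy \<eta>"
  shows "hadd L2 (form_class M \<omega>) (form_class M \<eta>) = form_class M (\<lambda>x. \<omega> x + \<eta> x)"
  unfolding add_L2
proof (rule form_class_eqI)
  show "ae M (\<lambda>x. rep (form_class M \<omega>) x + rep (form_class M \<eta>) x = \<omega> x + \<eta> x)"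
    unfolding ae_iff_AE using rep_class_AE[OF assms(1)] rep_class_AE[OF assms(2)] by eventually_elim simp
qed

lemma scale_class:
  assumes "finite_energy \<omega>" shows "hscale L2 r (form_class M \<omega>) = form_class M (\<lambda>x. r *s \<omega> x)"
  unfolding scale_L2
proof (rule form_class_eqI)
  show "ae M (\<lambda>x. r *s rep (form_class M \<omega>) x = r *s \<omega> x)"
    unfolding ae_iff_AE using rep_class_AE[OF assms(1)] by eventually_elim simp
qed

lemma minus_class:
  assumes "finite_energy \<omega>" "finite_energy \<eta>"
  shows "hminus L2 (form_class M \<omega>) (form_class M \<eta>) = form_class M (\<lambda>x. \<omega> x - \<eta> x)"
proof -
  have "(\<lambda>x. \<omega> x - \<eta> x) = (\<lambda>x. \<omega> x + (-1) *s \<eta> x)" by (simp add: fun_eq_iff vec_eq_iff)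
  then show ?thesis
    unfolding hminus_def scale_class[OF assms(2)]
    by (simp only: add_class[OF assms(1) finite_energy_scale[OF assms(2)]])
qed

lemma energy_self:
  assumes "finite_energy \<omega>"
  shows "energy \<omega> \<omega> = of_real (Re (energy \<omega> \<omega>))" "0 \<le> Re (energy \<omega> \<omega>)" "ennreal (Re (energy \<omega> \<omega>)) = sq_norm \<omega>"
proof -
  have m: "measurable_form M \<omega>" using assms by (auto simp: finite_energy_def)
  note [measurable] = form_norm_measurable[OF m] form_inner_measurable[OF m m]
  have e: "energy \<omega> \<omega> = (\<integral>x. complex_of_real ((form_norm (g x) (\<omega> x))\<^sup>2) \<partial>vol)"
    unfolding energy_def
  proof (rule integral_cong_AE)
    show "AE x in vol. form_inner (g x) (\<omega> x) (\<omega> x) = complex_of_real ((form_norm (g x) (\<omega> x))\<^sup>2)"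
      using AE_posdef by eventually_elim (rule form_inner_self)
  qed measurable
  have e2: "energy \<omega> \<omega> = of_real (\<integral>x. (form_norm (g x) (\<omega> x))\<^sup>2 \<partial>vol)"
    unfolding e by (rule integral_complex_of_real)
  then show "energy \<omega> \<omega> = of_real (Re (energy \<omega> \<omega>))" by simp
  have "integrable vol (\<lambda>x. (form_norm (g x) (\<omega> x))\<^sup>2)"
    by (rule integrableI_bounded) (use assms in \<open>auto simp: finite_energy_def sq_norm_def\<close>)
  then have "ennreal (\<integral>x. (form_norm (g x) (\<omega> x))\<^sup>2 \<partial>vol) = sq_norm \<omega>"
    unfolding sq_norm_def by (intro nn_integral_eq_integral[symmetric]) auto
  then show "ennreal (Re (energy \<omega> \<omega>)) = sq_norm \<omega>" by (simp add: e2)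
  show "0 \<le> Re (energy \<omega> \<omega>)" unfolding e2 by simp
qed

lemma norm_class:
  assumes "finite_energy \<omega>" shows "ennreal ((hnorm L2 (form_class M \<omega>))\<^sup>2) = sq_norm \<omega>"
  unfolding hnorm_def inner_class[OF assms assms] using energy_self[OF assms] by simp

lemma sq_norm_eq_0:
  assumes "finite_energy \<omega>" "sq_norm \<omega> = 0" shows "AE x in vol. \<omega> x = 0"
proof -
  have m: "measurable_form M \<omega>" using assms by (auto simp: finite_energy_def)
  note [measurable] = form_norm_measurable[OF m]
  have "AE x in vol. ennreal ((form_norm (g x) (\<omega> x))\<^sup>2) = 0"
    using assms(2) unfolding sq_norm_def by (subst (asm) nn_integral_0_iff_AE) auto
  then show ?thesis using AE_posdef by eventually_elim (auto simp: form_norm_eq_0)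
qed

lemma energy_add_left:
  assumes "finite_energy \<omega>" "finite_energy \<eta>" "finite_energy \<zeta>"
  shows "energy (\<lambda>x. \<omega> x + \<eta> x) \<zeta> = energy \<omega> \<zeta> + energy \<eta> \<zeta>"
  unfolding energy_def form_inner_add_left using form_inner_integrable assms by simp

lemma energy_scale_left: "energy (\<lambda>x. r *s \<omega> x) \<zeta> = r * energy \<omega> \<zeta>"
  unfolding energy_def form_inner_scale_left by simp

lemma energy_commute:
  assumes "finite_energy \<omega>" "finite_energy \<eta>" shows "energy \<omega> \<eta> = cnj (energy \<eta> \<omega>)"
proof -
  have m: "measurable_form M \<omega>" "measurable_form M \<eta>" using assms by (auto simp: finite_energy_def)
  note [measurable] = form_inner_measurable[OF m] form_inner_measurable[OF m(2,1)]
  have [measurable]: "cnj \<in> borel_measurable borel" by (rule borel_measurable_cnj)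
  have "energy \<omega> \<eta> = (\<integral>x. cnj (form_inner (g x) (\<eta> x) (\<omega> x)) \<partial>vol)"
    unfolding energy_def
  proof (rule integral_cong_AE)
    show "AE x in vol. form_inner (g x) (\<omega> x) (\<eta> x) = cnj (form_inner (g x) (\<eta> x) (\<omega> x))"
      using AE_posdef by eventually_elim (rule form_inner_commute)
  qed measurable
  then show ?thesis by (simp add: energy_def)
qed

text \<open>Riesz-Fischer: along a subsequence with \<open>\<parallel>v\<^sub>k\<^sub>+\<^sub>1 - v\<^sub>k\<parallel>\<^sup>2 \<le> 4\<^sup>-\<^sup>k\<close> the sum
  \<open>\<Sum>k. 2\<^sup>k |v\<^sub>k\<^sub>+\<^sub>1 - v\<^sub>k|\<^sup>2\<close> is integrable, hence finite a.e.\<close>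

lemma pointwise_convergent_subsequence:
  assumes v: "\<And>k. finite_energy (v k)"
    and d: "\<And>k. sq_norm (\<lambda>x. v (Suc k) x - v k x) \<le> ennreal ((1/4) ^ k)"
  shows "AE x in vol. convergent (\<lambda>k. v k x)"
proof -
  let ?F = "\<lambda>k x. form_norm (g x) (v (Suc k) x - v k x)"
  have m: "measurable_form M (\<lambda>x. v (Suc k) x - v k x)" for k
    using v by (intro measurable_form_minus) (auto simp: finite_energy_def)
  have [measurable]: "?F k \<in> borel_measurable vol" for k by (rule form_norm_measurable[OF m])
  have "(\<integral>\<^sup>+x. (\<Sum>k. ennreal (2 ^ k * (?F k x)\<^sup>2)) \<partial>vol) = (\<Sum>k. \<integral>\<^sup>+x. ennreal (2 ^ k * (?F k x)\<^sup>2) \<partial>vol)"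
    by (rule nn_integral_suminf) measurable
  also have "\<dots> \<le> (\<Sum>k. ennreal ((1/2) ^ k))"
  proof (rule suminf_le)
    fix k
    have "(\<integral>\<^sup>+x. ennreal (2 ^ k * (?F k x)\<^sup>2) \<partial>vol) = ennreal (2 ^ k) * sq_norm (\<lambda>x. v (Suc k) x - v k x)"
      unfolding sq_norm_def by (subst nn_integral_cmult[symmetric]) (auto simp: ennreal_mult)
    also have "\<dots> \<le> ennreal (2 ^ k) * ennreal ((1/4) ^ k)" by (intro mult_left_mono d) simp
    also have "\<dots> = ennreal ((1/2) ^ k)" by (simp flip: ennreal_mult power_mult_distrib)
    finally show "(\<integral>\<^sup>+x. ennreal (2 ^ k * (?F k x)\<^sup>2) \<partial>vol) \<le> ennreal ((1/2) ^ k)" .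
  qed auto
  also have "\<dots> = ennreal (\<Sum>k. (1/2) ^ k)" by (rule suminf_ennreal2) (auto intro: summable_geometric)
  finally have "(\<integral>\<^sup>+x. (\<Sum>k. ennreal (2 ^ k * (?F k x)\<^sup>2)) \<partial>vol) < \<infinity>"
    unfolding infinity_ennreal_def by (rule le_less_trans) (rule ennreal_less_top)
  then have "(\<integral>\<^sup>+x. (\<Sum>k. ennreal (2 ^ k * (?F k x)\<^sup>2)) \<partial>vol) \<noteq> \<infinity>" by (rule less_imp_neq)
  then have "AE x in vol. (\<Sum>k. ennreal (2 ^ k * (?F k x)\<^sup>2)) \<noteq> \<infinity>"
    by (intro nn_integral_PInf_AE) measurable
  then show ?thesis using AE_posdef
  proof eventually_elim
    fix x assume fin: "(\<Sum>k. ennreal (2 ^ k * (?F k x)\<^sup>2)) \<noteq> \<infinity>" and G: "posdef (g x)"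
    obtain c where c: "0 < c" "\<And>\<omega>. norm \<omega> \<le> c * form_norm (g x) \<omega>" using form_norm_lower_bound[OF G] by blast
    define B where "B = enn2real (\<Sum>k. ennreal (2 ^ k * (?F k x)\<^sup>2))"
    have B: "(\<Sum>k. ennreal (2 ^ k * (?F k x)\<^sup>2)) = ennreal B" using fin by (simp add: B_def top.not_eq_extremum)
    have B0: "0 \<le> B" by (simp add: B_def)
    \<comment> \<open>Each term is dominated by the finite sum \<open>B\<close>; after taking roots,
      the weight \<open>2 ^ k\<close> leaves the geometric bound
      \<open>sqrt B * (1 / sqrt 2) ^ k\<close>, so the differences are summable in norm.\<close>
    have "2 ^ k * (?F k x)\<^sup>2 \<le> B" for k
    proof -
      have "ennreal (2 ^ k * (?F k x)\<^sup>2) = (\<Sum>j\<in>{k}. ennreal (2 ^ j * (?F j x)\<^sup>2))" by simp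
      also have "\<dots> \<le> (\<Sum>j. ennreal (2 ^ j * (?F j x)\<^sup>2))" by (rule sum_le_suminf) auto
      finally have "ennreal (2 ^ k * (?F k x)\<^sup>2) \<le> ennreal B" by (simp only: B)
      then show ?thesis using B0 by (simp add: ennreal_le_iff)
    qed
    then have "sqrt (2 ^ k * (?F k x)\<^sup>2) \<le> sqrt B" for k by (rule real_sqrt_le_mono)
    then have "sqrt 2 ^ k * ?F k x \<le> sqrt B" for k
      using form_norm_nonneg[OF G] by (simp add: real_sqrt_mult real_sqrt_power)
    then have F: "?F k x \<le> sqrt B * (1 / sqrt 2) ^ k" for k
      by (simp add: power_divide field_simps)
    have "summable (\<lambda>k. v (Suc k) x - v k x)"
    proof (rule summable_comparison_test')
      show "summable (\<lambda>k. c * (sqrt B * (1 / sqrt 2) ^ k))"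
        by (intro summable_mult summable_geometric) simp
      show "norm (v (Suc k) x - v k x) \<le> c * (sqrt B * (1 / sqrt 2) ^ k)" if "0 \<le> k" for k
        using c(2)[of "v (Suc k) x - v k x"] mult_left_mono[OF F, of c k] c(1) by linarith
    qed
    then have "convergent (\<lambda>n. \<Sum>k<n. v (Suc k) x - v k x)" by (simp add: summable_iff_convergent)
    then have "convergent (\<lambda>n. v n x - v 0 x)" by (simp only: sum_lessThan_telescope[of "\<lambda>k. v k x"])
    then have "convergent (\<lambda>n. (v n x - v 0 x) + v 0 x)" by (rule convergent_add[OF _ convergent_const])
    then show "convergent (\<lambda>k. v k x)" by simp
  qed
qed

text \<open>Fatou turns uniform bounds along the approximating sequence into the same bound for the
  pointwise limit; only indices from \<open>N\<close> on matter.\<close>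

lemma fatou_limit:
  assumes v: "\<And>k::nat. finite_energy (v k)" and w: "finite_energy w" and u: "measurable_form M u"
    and lim: "AE x in vol. (\<lambda>k. v k x) \<longlonglongrightarrow> u x"
    and le: "\<And>k. N \<le> k \<Longrightarrow> sq_norm (\<lambda>x. w x - v k x) \<le> B"
  shows "sq_norm (\<lambda>x. w x - u x) \<le> B"
proof -
  have m: "measurable_form M (\<lambda>x. w x - v k x)" for k
    using v w by (intro measurable_form_minus) (auto simp: finite_energy_def)
  have [measurable]: "(\<lambda>x. form_norm (g x) (w x - v k x)) \<in> borel_measurable vol" for k by (rule form_norm_measurable[OF m])
  have "AE x in vol. ennreal ((form_norm (g x) (w x - u x))\<^sup>2) = liminf (\<lambda>k. ennreal ((form_norm (g x) (w x - v k x))\<^sup>2))"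
    using lim AE_posdef
  proof eventually_elim
    fix x assume "(\<lambda>k. v k x) \<longlonglongrightarrow> u x" "posdef (g x)"
    then have "(\<lambda>k. ennreal ((form_norm (g x) (w x - v k x))\<^sup>2)) \<longlonglongrightarrow> ennreal ((form_norm (g x) (w x - u x))\<^sup>2)"
      by (intro tendsto_ennrealI tendsto_power tendsto_form_norm tendsto_intros)
    then show "ennreal ((form_norm (g x) (w x - u x))\<^sup>2) = liminf (\<lambda>k. ennreal ((form_norm (g x) (w x - v k x))\<^sup>2))"
      by (rule lim_imp_Liminf[OF sequentially_bot, symmetric])
  qed
  then have "sq_norm (\<lambda>x. w x - u x) = (\<integral>\<^sup>+x. liminf (\<lambda>k. ennreal ((form_norm (g x) (w x - v k x))\<^sup>2)) \<partial>vol)"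
    unfolding sq_norm_def by (rule nn_integral_cong_AE)
  also have "\<dots> \<le> liminf (\<lambda>k. sq_norm (\<lambda>x. w x - v k x))"
    unfolding sq_norm_def by (rule nn_integral_liminf) measurable
  also have "\<dots> \<le> B"
    by (rule order_trans[OF Liminf_le_Limsup Limsup_bounded]) (use le in \<open>auto simp: eventually_sequentially\<close>)
  finally show ?thesis .
qed

lemma L2_complete:
  assumes us: "\<And>n. us n \<in> hcar L2"
    and cauchy: "\<And>e. 0 < e \<Longrightarrow> \<exists>N. \<forall>m\<ge>N. \<forall>n\<ge>N. hnorm L2 (hminus L2 (us m) (us n)) < e"
  shows "\<exists>u\<in>hcar L2. hconv L2 us u"
proof -
  define w where "w n = rep (us n)" for n
  have w: "finite_energy (w n)" "us n = form_class M (w n)" for n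
    using rep_car[OF us] by (auto simp: w_def)
  have D: "ennreal ((hnorm L2 (hminus L2 (us m) (us n)))\<^sup>2) = sq_norm (\<lambda>x. w m x - w n x)" for m n
    unfolding w(2) minus_class[OF w(1) w(1)] by (rule norm_class[OF finite_energy_minus[OF w(1) w(1)]])
  have "\<exists>N. \<forall>m\<ge>N. \<forall>n\<ge>N. sq_norm (\<lambda>x. w m x - w n x) \<le> ennreal (e\<^sup>2)" if e: "0 < e" for e
  proof -
    obtain N where N: "\<forall>m\<ge>N. \<forall>n\<ge>N. hnorm L2 (hminus L2 (us m) (us n)) < e" using cauchy[OF e] by blast
    have "sq_norm (\<lambda>x. w m x - w n x) \<le> ennreal (e\<^sup>2)" if "m \<ge> N" "n \<ge> N" for m n
    proof -
      have "hnorm L2 (hminus L2 (us m) (us n)) < e" using N that by blast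
      moreover have "0 \<le> hnorm L2 (hminus L2 (us m) (us n))"
        unfolding w(2) minus_class[OF w(1) w(1)] hnorm_def
        using energy_self(2) inner_class finite_energy_minus[OF w(1) w(1)] by simp
      ultimately show ?thesis unfolding D[symmetric] by (intro ennreal_leI power_mono) auto
    qed
    then show ?thesis by blast
  qed
  then have "\<exists>N. \<forall>m\<ge>N. \<forall>n\<ge>N. sq_norm (\<lambda>x. w m x - w n x) \<le> ennreal (((1/2) ^ k)\<^sup>2)" for k :: nat by simp
  then obtain N where N: "\<And>k m n. m \<ge> N k \<Longrightarrow> n \<ge> N k \<Longrightarrow> sq_norm (\<lambda>x. w m x - w n x) \<le> ennreal (((1/2) ^ k)\<^sup>2)"
    by metis
  \<comment> \<open>Summing the thresholds makes both \<open>r k\<close> and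
    \<open>r (Suc k)\<close> pass \<open>N k\<close>; the summand \<open>k\<close> makes the indices
    unbounded, so that every threshold is eventually passed.\<close>
  define r where "r k = (\<Sum>i\<le>k. N i) + k" for k
  have r: "N k \<le> r k" "N k \<le> r (Suc k)" "k \<le> r k" for k
    using member_le_sum[of k "{..k}" N] by (auto simp: r_def)
  define v where "v k = w (r k)" for k
  have v: "finite_energy (v k)" for k by (simp add: v_def w)
  have "sq_norm (\<lambda>x. v (Suc k) x - v k x) \<le> ennreal ((1/4) ^ k)" for k
    using N[OF r(2) r(1)] by (simp add: v_def power2_eq_square flip: power_mult_distrib)
  then have conv: "AE x in vol. convergent (\<lambda>k. v k x)" by (rule pointwise_convergent_subsequence[OF v])
  define u where "u x = lim_or_zero (\<lambda>k. v k x)" for x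
  have um: "measurable_form M u" unfolding u_def[abs_def]
    using v by (intro measurable_form_lim) (auto simp: finite_energy_def)
  have lim: "AE x in vol. (\<lambda>k. v k x) \<longlonglongrightarrow> u x"
    using conv by eventually_elim (simp add: u_def lim_or_zero_def convergent_LIMSEQ_iff)
  have bound: "sq_norm (\<lambda>x. w n x - u x) \<le> ennreal (((1/2) ^ k)\<^sup>2)" if "n \<ge> N k" for n k
  proof (rule fatou_limit[OF v w(1) um lim])
    fix j assume "N k \<le> j"
    then have "N k \<le> r j" using r(3)[of j] by linarith
    then show "sq_norm (\<lambda>x. w n x - v j x) \<le> ennreal (((1/2) ^ k)\<^sup>2)" unfolding v_def using N that by blast
  qed
  have "finite_energy (\<lambda>x. w (N 0) x - u x)"
    unfolding finite_energy_def
  proof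
    show "measurable_form M (\<lambda>x. w (N 0) x - u x)" using w um by (intro measurable_form_minus) (auto simp: finite_energy_def)
    show "sq_norm (\<lambda>x. w (N 0) x - u x) < \<infinity>" using bound[of 0 "N 0"] by (simp add: le_less_trans)
  qed
  \<comment> \<open>The limit \<open>u\<close> is recovered as \<open>w - (w - u)\<close>, a
    difference of two forms of finite energy.\<close>
  then have "finite_energy (\<lambda>x. w (N 0) x - (w (N 0) x - u x))" by (rule finite_energy_minus[OF w(1)])
  then have u: "finite_energy u" by simp
  have le: "hnorm L2 (hminus L2 (us n) (form_class M u)) \<le> (1/2) ^ k" if "n \<ge> N k" for n k
  proof -
    have f: "finite_energy (\<lambda>x. w n x - u x)" by (rule finite_energy_minus[OF w(1) u])
    have "ennreal ((hnorm L2 (hminus L2 (us n) (form_class M u)))\<^sup>2) \<le> ennreal (((1/2) ^ k)\<^sup>2)"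
      unfolding w(2) minus_class[OF w(1) u] norm_class[OF f] by (rule bound[OF that])
    then have "(hnorm L2 (hminus L2 (us n) (form_class M u)))\<^sup>2 \<le> ((1/2) ^ k)\<^sup>2" by (simp add: ennreal_le_iff)
    then show ?thesis by (rule power2_le_imp_le) simp
  qed
  have nn: "0 \<le> hnorm L2 (hminus L2 (us n) (form_class M u))" for n
    unfolding w(2) minus_class[OF w(1) u] hnorm_def
    using energy_self(2) inner_class finite_energy_minus[OF w(1) u] by simp
  have "(\<lambda>n. hnorm L2 (hminus L2 (us n) (form_class M u))) \<longlonglongrightarrow> 0"
  proof (rule LIMSEQ_I)
    fix e :: real assume "0 < e"
    then obtain k where k: "(1/2) ^ k < e" using real_arch_pow_inv[of e "1/2"] by auto
    show "\<exists>no. \<forall>n\<ge>no. norm (hnorm L2 (hminus L2 (us n) (form_class M u)) - 0) < e"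
      using le[of k] nn k by (intro exI[of _ "N k"]) (force intro: le_less_trans)
  qed
  then show ?thesis using form_class_car[OF u] by (auto simp: hconv_def)
qed

lemma hilbert_L2: "hilbert_space L2"
proof
  fix u v w assume u: "u \<in> hcar L2" and v: "v \<in> hcar L2" and w: "w \<in> hcar L2"
  note r = rep_car[OF u] rep_car[OF v] rep_car[OF w]
  show "hadd L2 u v \<in> hcar L2" unfolding add_L2 by (intro form_class_car finite_energy_add r)
  show "hinner L2 (hadd L2 u v) w = hinner L2 u w + hinner L2 v w"
    using inner_class[OF finite_energy_add[OF r(1,3)] r(5)] energy_add_left[OF r(1,3,5)]
    by (simp add: add_L2 r inner_L2[of u w] inner_L2[of v w])
next
  fix u w r assume u: "u \<in> hcar L2" and w: "w \<in> hcar L2"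
  note e = rep_car[OF u] rep_car[OF w]
  show "hinner L2 (hscale L2 r u) w = r * hinner L2 u w"
    using inner_class[OF finite_energy_scale[OF e(1)] e(3)] energy_scale_left
    by (simp add: scale_L2 e inner_L2[of u w])
next
  fix u r assume u: "u \<in> hcar L2"
  show "hscale L2 r u \<in> hcar L2" unfolding scale_L2 by (intro form_class_car finite_energy_scale rep_car u)
  show "0 \<le> Re (hinner L2 u u)" unfolding inner_L2 by (intro energy_self(2) rep_car u)
next
  show "hzero L2 \<in> hcar L2" unfolding zero_L2 by (intro form_class_car finite_energy_zero)
next
  fix w assume w: "w \<in> hcar L2"
  have "hinner L2 (hzero L2) w = energy (\<lambda>x. 0) (rep w)"
    using inner_class[OF finite_energy_zero rep_car(1)[OF w]] by (simp add: zero_L2 rep_car(2)[OF w])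
  then show "hinner L2 (hzero L2) w = 0" by (simp add: energy_def)
next
  fix u v assume u: "u \<in> hcar L2" and v: "v \<in> hcar L2"
  show "hinner L2 u v = cnj (hinner L2 v u)" unfolding inner_L2 by (intro energy_commute rep_car u v)
  assume z: "hinner L2 (hminus L2 u v) (hminus L2 u v) = 0"
  note e = rep_car[OF u] rep_car[OF v]
  have f: "finite_energy (\<lambda>x. rep u x - rep v x)" by (rule finite_energy_minus[OF e(1,3)])
  have "hminus L2 u v = form_class M (\<lambda>x. rep u x - rep v x)" using minus_class[OF e(1,3)] e by simp
  then have "energy (\<lambda>x. rep u x - rep v x) (\<lambda>x. rep u x - rep v x) = 0" using z inner_class[OF f f] by simp
  then have "sq_norm (\<lambda>x. rep u x - rep v x) = 0" using energy_self(3)[OF f] by simp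
  then have "AE x in vol. rep u x - rep v x = 0" by (rule sq_norm_eq_0[OF f])
  then have "ae M (\<lambda>x. rep u x = rep v x)" unfolding ae_iff_AE by eventually_elim simp
  then show "u = v" using form_class_eqI e by metis
qed (rule L2_complete)

end

subsection \<open>Two mutually bounded metrics\<close>

text \<open>On the set where \<open>f\<close> exceeds \<open>K\<close>, the integral of
  \<open>f - K\<close> is at most 0, so the set is null. Cutting it with pieces of finite measure
  makes the subtraction of integrals legitimate in \<open>ennreal\<close>.\<close>

lemma (in sigma_finite_measure) AE_le_of_density_le:
  assumes f: "f \<in> borel_measurable M"
    and le: "\<And>A. A \<in> sets M \<Longrightarrow> emeasure (density M f) A \<le> ennreal K * emeasure M A"
  shows "AE x in M. f x \<le> ennreal K"
proof -
  note [measurable] = f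
  obtain E :: "nat \<Rightarrow> 'a set" where E: "range E \<subseteq> sets M" "(\<Union>i. E i) = space M" "\<And>i. emeasure M (E i) \<noteq> \<infinity>"
    using sigma_finite by blast
  have [measurable]: "E i \<in> sets M" for i using E(1) by auto
  have "AE x in M. x \<in> E i \<longrightarrow> f x \<le> ennreal K" for i
  proof -
    define A where "A = {x \<in> space M. ennreal K < f x} \<inter> E i"
    have [measurable]: "A \<in> sets M" unfolding A_def by measurable
    have KA: "(\<integral>\<^sup>+x. ennreal K * indicator A x \<partial>M) = ennreal K * emeasure M A" by (rule nn_integral_cmult_indicator) simp
    have "emeasure M A \<le> emeasure M (E i)" unfolding A_def by (intro emeasure_mono) auto
    then have "emeasure M A < \<infinity>" using E(3)[of i] by (simp add: top.not_eq_extremum le_less_trans)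
    then have fin: "(\<integral>\<^sup>+x. ennreal K * indicator A x \<partial>M) \<noteq> \<infinity>" unfolding KA by (simp add: ennreal_mult_less_top less_imp_neq)
    have "(\<integral>\<^sup>+x. (f x * indicator A x - ennreal K * indicator A x) \<partial>M) =
        (\<integral>\<^sup>+x. f x * indicator A x \<partial>M) - (\<integral>\<^sup>+x. ennreal K * indicator A x \<partial>M)"
      by (rule nn_integral_diff[OF _ _ fin]) (auto simp: A_def split: split_indicator)
    also have "(\<integral>\<^sup>+x. f x * indicator A x \<partial>M) = emeasure (density M f) A" by (rule emeasure_density[symmetric]) auto
    also have "emeasure (density M f) A - (\<integral>\<^sup>+x. ennreal K * indicator A x \<partial>M) = 0"
      using le[of A] KA fin by (simp add: diff_eq_0_iff_ennreal top.not_eq_extremum)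
    finally have "AE x in M. f x * indicator A x - ennreal K * indicator A x = 0"
      by (subst (asm) nn_integral_0_iff_AE) auto
    then show ?thesis using AE_space
    proof eventually_elim
      fix x assume "f x * indicator A x - ennreal K * indicator A x = 0" "x \<in> space M"
      then show "x \<in> E i \<longrightarrow> f x \<le> ennreal K"
        by (cases "x \<in> A") (auto simp: A_def diff_eq_0_iff_ennreal not_less)
    qed
  qed
  then have "AE x in M. \<forall>i. x \<in> E i \<longrightarrow> f x \<le> ennreal K" unfolding AE_all_countable by blast
  then show ?thesis using AE_space by eventually_elim (use E(2) in blast)
qed

context smooth_mfd
begin

lemma sqrt_det_in_chart:
  assumes "c \<in> M" "p \<in> fst c"
  shows "sqrt (det (metric_in_chart M c g (snd c p))) = \<bar>det (chart_pull M c p)\<bar> * sqrt (det (g p))"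
proof -
  have "det (metric_in_chart M c g (snd c p)) = (det (chart_pull M c p))\<^sup>2 * det (g p)"
    unfolding metric_in_chart_at[OF assms] by (simp add: det_mul det_transpose power2_eq_square ac_simps)
  then show ?thesis by (simp add: real_sqrt_mult)
qed

end

text \<open>The assumption is symmetric in the two metrics, so estimates are proved in one direction
  only and reversed through \<open>swapped\<close>.\<close>

locale two_rough = R1: rough_mfd M g1 + R2: rough_mfd M g2
  for M :: "('a::{t2_space,second_countable_topology}, 'n::{finite,linorder}) chart set" and g1 g2 :: "'a \<Rightarrow> 'n rmat" +
  fixes C K :: real
  assumes C_ge_1: "1 \<le> C" and K_def: "K = comparison_const TYPE('n) C"
    and bounded: "ae M (\<lambda>x. \<forall>u. metric_norm (g1 x) u \<le> C * metric_norm (g2 x) u \<and>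
      metric_norm (g2 x) u \<le> C * metric_norm (g1 x) u)"
begin

lemma K_ge_1: "1 \<le> K"
  unfolding K_def by (rule comparison_const_ge_1[OF C_ge_1])

lemma swapped: "two_rough M g2 g1 C K"
  by unfold_locales (use C_ge_1 K_def bounded in \<open>auto elim: R1.ae_mono\<close>)

lemma ae_comparison: "ae M (\<lambda>x. (\<forall>\<omega>. form_norm (g2 x) \<omega> \<le> K * form_norm (g1 x) \<omega>) \<and>
    sqrt (det (g2 x)) \<le> K * sqrt (det (g1 x)))"
proof -
  have "AE x in R1.vol. (\<forall>\<omega>. form_norm (g2 x) \<omega> \<le> K * form_norm (g1 x) \<omega>) \<and>
    sqrt (det (g2 x)) \<le> K * sqrt (det (g1 x))"
    using R1.AE_posdef R2.ae_posdef[unfolded R1.ae_iff_AE] bounded[unfolded R1.ae_iff_AE]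
  proof eventually_elim
    fix x assume G: "posdef (g1 x)" "posdef (g2 x)"
      and b: "\<forall>u. metric_norm (g1 x) u \<le> C * metric_norm (g2 x) u \<and> metric_norm (g2 x) u \<le> C * metric_norm (g1 x) u"
    show "(\<forall>\<omega>. form_norm (g2 x) \<omega> \<le> K * form_norm (g1 x) \<omega>) \<and> sqrt (det (g2 x)) \<le> K * sqrt (det (g1 x))"
      using metric_comparison(1)[OF G C_ge_1] metric_comparison(2)[OF G(2,1) C_ge_1] b unfolding K_def by blast
  qed
  then show ?thesis by (simp add: R1.ae_iff_AE)
qed

text \<open>Constants multiply. One atlas then computes both volume measures, which reduces their
  comparison to densities in common charts.\<close>

lemma comparability_chart_transfer:
  assumes "comparability_chart M g1 c" shows "comparability_chart M g2 c"
proof -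
  obtain B where B: "1 \<le> B" and ae: "ae M (\<lambda>y. y \<in> fst c \<longrightarrow>
        (\<forall>u. norm (chart_push M c y *v u) / B \<le> metric_norm (g1 y) u \<and>
             metric_norm (g1 y) u \<le> B * norm (chart_push M c y *v u)))"
    using assms unfolding comparability_chart_def by blast
  have "AE y in R1.vol. y \<in> fst c \<longrightarrow> (\<forall>u. norm (chart_push M c y *v u) / (C * B) \<le> metric_norm (g2 y) u \<and>
             metric_norm (g2 y) u \<le> (C * B) * norm (chart_push M c y *v u))"
    using ae[unfolded R1.ae_iff_AE] bounded[unfolded R1.ae_iff_AE]
  proof eventually_elim
    fix y assume a: "y \<in> fst c \<longrightarrow> (\<forall>u. norm (chart_push M c y *v u) / B \<le> metric_norm (g1 y) u \<and>
             metric_norm (g1 y) u \<le> B * norm (chart_push M c y *v u))"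
      and b: "\<forall>u. metric_norm (g1 y) u \<le> C * metric_norm (g2 y) u \<and> metric_norm (g2 y) u \<le> C * metric_norm (g1 y) u"
    show "y \<in> fst c \<longrightarrow> (\<forall>u. norm (chart_push M c y *v u) / (C * B) \<le> metric_norm (g2 y) u \<and>
             metric_norm (g2 y) u \<le> (C * B) * norm (chart_push M c y *v u))"
    proof (intro impI allI conjI)
      fix u assume y: "y \<in> fst c"
      have "norm (chart_push M c y *v u) / B \<le> C * metric_norm (g2 y) u" using a b y order_trans by blast
      then show "norm (chart_push M c y *v u) / (C * B) \<le> metric_norm (g2 y) u"
        using B C_ge_1 by (simp add: field_simps)
      have "metric_norm (g2 y) u \<le> C * metric_norm (g1 y) u" using b by blast
      also have "\<dots> \<le> C * (B * norm (chart_push M c y *v u))" using a y C_ge_1 by (intro mult_left_mono) auto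
      finally show "metric_norm (g2 y) u \<le> (C * B) * norm (chart_push M c y *v u)" by simp
    qed
  qed
  moreover have "1 \<le> C * B" using B C_ge_1 mult_mono[of 1 C 1 B] by simp
  ultimately show ?thesis
    using assms unfolding comparability_chart_def R1.ae_iff_AE[symmetric] by blast
qed

lemma chart_vol_le:
  assumes c: "c \<in> M" and A: "A \<subseteq> fst c" and m: "manifold_measurable M A"
  shows "R2.chart_vol c A \<le> ennreal K * R1.chart_vol c A"
proof -
  have "manifold_null M {x. \<not> ((\<forall>\<omega>. form_norm (g2 x) \<omega> \<le> K * form_norm (g1 x) \<omega>) \<and>
    sqrt (det (g2 x)) \<le> K * sqrt (det (g1 x)))}" (is "manifold_null M ?N")
    using ae_comparison by (simp add: ae_def)
  then have N: "snd c ` (?N \<inter> fst c) \<in> null_sets lebesgue" using c by (simp add: manifold_null_def)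
  have "AE y in lebesgue. y \<in> chart_image c \<longrightarrow> R2.dens c y \<le> K * R1.dens c y"
  proof (rule AE_I'[OF N], rule subsetI)
    fix y assume "y \<in> {y \<in> space lebesgue. \<not> (y \<in> chart_image c \<longrightarrow> R2.dens c y \<le> K * R1.dens c y)}"
    then obtain p where p: "p \<in> fst c" "y = snd c p" and n: "\<not> R2.dens c (snd c p) \<le> K * R1.dens c (snd c p)" by blast
    have "\<not> sqrt (det (g2 p)) \<le> K * sqrt (det (g1 p))"
    proof
      assume "sqrt (det (g2 p)) \<le> K * sqrt (det (g1 p))"
      \<comment> \<open>Passing from the fibre to the chart multiplies both densities by the same
        factor, so the comparison at \<open>p\<close> carries over.\<close>
      then have "\<bar>det (chart_pull M c p)\<bar> * sqrt (det (g2 p)) \<le> \<bar>det (chart_pull M c p)\<bar> * (K * sqrt (det (g1 p)))"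
        by (rule mult_left_mono) simp
      then show False
        using n unfolding R1.dens_def R2.dens_def R1.sqrt_det_in_chart[OF c p(1)] by (simp add: mult.left_commute)
    qed
    then show "y \<in> snd c ` (?N \<inter> fst c)" using p by blast
  qed
  then have "AE y in lebesgue. ennreal (if y \<in> snd c ` A then max 0 (R2.dens c y) else 0) \<le>
      ennreal K * ennreal (if y \<in> snd c ` A then max 0 (R1.dens c y) else 0)"
  proof eventually_elim
    fix y assume le: "y \<in> chart_image c \<longrightarrow> R2.dens c y \<le> K * R1.dens c y"
    show "ennreal (if y \<in> snd c ` A then max 0 (R2.dens c y) else 0) \<le>
      ennreal K * ennreal (if y \<in> snd c ` A then max 0 (R1.dens c y) else 0)"
    proof (cases "y \<in> snd c ` A")
      case True
      then have "R2.dens c y \<le> K * R1.dens c y" using le A by blast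
      also have "\<dots> \<le> K * max 0 (R1.dens c y)" using K_ge_1 by (intro mult_left_mono) auto
      finally have "max 0 (R2.dens c y) \<le> K * max 0 (R1.dens c y)" using K_ge_1 by simp
      then have "ennreal (max 0 (R2.dens c y)) \<le> ennreal K * ennreal (max 0 (R1.dens c y))"
        using K_ge_1 by (subst ennreal_mult[symmetric]) (auto intro: ennreal_leI)
      then show ?thesis using True by (simp only: if_True)
    qed simp
  qed
  then have "R2.chart_vol c A \<le> (\<integral>\<^sup>+y. ennreal K * ennreal (if y \<in> snd c ` A then max 0 (R1.dens c y) else 0) \<partial>lebesgue)"
    unfolding R2.chart_vol_restrict[OF A] by (rule nn_integral_mono_AE)
  also have "\<dots> = ennreal K * R1.chart_vol c A"
    unfolding R1.chart_vol_restrict[OF A]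
    using R1.dens_restrict_measurable[OF c _ R1.manifold_measurableD[OF m c A]] A
    by (intro nn_integral_cmult) auto
  finally show ?thesis .
qed

lemma emeasure_vol_le:
  assumes A: "manifold_measurable M A" shows "emeasure R2.vol A \<le> ennreal K * emeasure R1.vol A"
proof -
  obtain cs :: "nat \<Rightarrow> ('a, 'n) chart" where cs: "\<And>i. comparability_chart M g1 (cs i)" "(\<Union>i. fst (cs i)) = UNIV"
    using R1.comparability_atlas by auto
  have csM: "cs i \<in> M" for i using cs(1) R1.comparability_chart_mem by blast
  obtain W where W: "\<And>i. manifold_measurable M (W i)" "\<And>i. W i \<subseteq> fst (cs i)" "disjoint_family W" "(\<Union>i. W i) = UNIV"
    using R1.partition_exists[of cs, OF csM cs(2)] by metis
  have m: "manifold_measurable M (A \<inter> W i)" "A \<inter> W i \<subseteq> fst (cs i)" for i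
    using R1.manifold_measurable_Int[OF A W(1)] W(2)[of i] by auto
  have dis: "disjoint_family (\<lambda>i. A \<inter> W i)" using W(3) by (auto simp: disjoint_family_on_def)
  have U: "(\<Union>i. A \<inter> W i) = A" using W(4) by blast
  have e1: "emeasure R1.vol A = (\<Sum>i. R1.chart_vol (cs i) (A \<inter> W i))"
  proof -
    have "emeasure R1.vol (\<Union>i. A \<inter> W i) = (\<Sum>i. emeasure R1.vol (A \<inter> W i))"
      using m dis by (intro suminf_emeasure[symmetric]) (auto simp: R1.sets_vol)
    then show ?thesis using U R1.emeasure_vol[OF cs(1) m] R1.chart_vol_emeasure[OF csM m] by simp
  qed
  have e2: "emeasure R2.vol A = (\<Sum>i. R2.chart_vol (cs i) (A \<inter> W i))"
  proof -
    have "emeasure R2.vol (\<Union>i. A \<inter> W i) = (\<Sum>i. emeasure R2.vol (A \<inter> W i))"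
      using m dis by (intro suminf_emeasure[symmetric]) (auto simp: R2.sets_vol)
    then show ?thesis
      using U R2.emeasure_vol[OF comparability_chart_transfer[OF cs(1)] m] R2.chart_vol_emeasure[OF csM m] by simp
  qed
  have "(\<Sum>i. R2.chart_vol (cs i) (A \<inter> W i)) \<le> (\<Sum>i. ennreal K * R1.chart_vol (cs i) (A \<inter> W i))"
    by (intro suminf_le chart_vol_le csM m) auto
  also have "\<dots> = ennreal K * (\<Sum>i. R1.chart_vol (cs i) (A \<inter> W i))" by simp
  finally show ?thesis unfolding e1 e2 .
qed

text \<open>Both measures have the manifold null sets as null sets, which gives absolute continuity
  and hence the derivative; its bound comes from the setwise estimate of volumes.\<close>

lemma RN: "density R1.vol (RN_deriv R1.vol R2.vol) = R2.vol"
    "AE x in R1.vol. RN_deriv R1.vol R2.vol x \<le> ennreal K"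
proof -
  interpret sigma_finite_measure R1.vol by (rule R1.sigma_finite_vol)
  have "absolutely_continuous R1.vol R2.vol"
    by (simp add: absolutely_continuous_def R1.null_sets_vol R2.null_sets_vol)
  then show d: "density R1.vol (RN_deriv R1.vol R2.vol) = R2.vol"
    by (rule density_RN_deriv) (simp add: R1.sets_vol R2.sets_vol)
  show "AE x in R1.vol. RN_deriv R1.vol R2.vol x \<le> ennreal K"
    by (rule AE_le_of_density_le) (use emeasure_vol_le in \<open>auto simp: d R1.sets_vol\<close>)
qed

lemma nn_integral_vol_le:
  assumes f: "f \<in> borel_measurable R1.vol"
  shows "integral\<^sup>N R2.vol f \<le> ennreal K * integral\<^sup>N R1.vol f"
proof -
  have "integral\<^sup>N R2.vol f = (\<integral>\<^sup>+x. RN_deriv R1.vol R2.vol x * f x \<partial>R1.vol)"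
    by (subst RN(1)[symmetric], rule nn_integral_density) (use f in auto)
  also have "\<dots> \<le> (\<integral>\<^sup>+x. ennreal K * f x \<partial>R1.vol)"
    by (rule nn_integral_mono_AE) (use RN(2) in \<open>eventually_elim, auto intro: mult_right_mono\<close>)
  also have "\<dots> = ennreal K * integral\<^sup>N R1.vol f" by (rule nn_integral_cmult[OF f])
  finally show ?thesis .
qed

lemma sq_norm_le:
  assumes m: "measurable_form M \<omega>" shows "R2.sq_norm \<omega> \<le> ennreal (K ^ 4) * R1.sq_norm \<omega>"
proof -
  note [measurable] = R1.form_norm_measurable[OF m]
  have "AE x in R2.vol. ennreal ((form_norm (g2 x) (\<omega> x))\<^sup>2) \<le> ennreal (K\<^sup>2) * ennreal ((form_norm (g1 x) (\<omega> x))\<^sup>2)"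
    using ae_comparison[unfolded R2.ae_iff_AE] R2.AE_posdef
  proof eventually_elim
    fix x assume a: "(\<forall>\<omega>. form_norm (g2 x) \<omega> \<le> K * form_norm (g1 x) \<omega>) \<and> sqrt (det (g2 x)) \<le> K * sqrt (det (g1 x))"
      and G: "posdef (g2 x)"
    have "(form_norm (g2 x) (\<omega> x))\<^sup>2 \<le> (K * form_norm (g1 x) (\<omega> x))\<^sup>2"
      using a by (intro power_mono form_norm_nonneg[OF G]) auto
    then show "ennreal ((form_norm (g2 x) (\<omega> x))\<^sup>2) \<le> ennreal (K\<^sup>2) * ennreal ((form_norm (g1 x) (\<omega> x))\<^sup>2)"
      by (subst ennreal_mult[symmetric]) (auto simp: power_mult_distrib intro: ennreal_leI)
  qed
  then have "R2.sq_norm \<omega> \<le> (\<integral>\<^sup>+x. ennreal (K\<^sup>2) * ennreal ((form_norm (g1 x) (\<omega> x))\<^sup>2) \<partial>R2.vol)"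
    unfolding R2.sq_norm_def by (rule nn_integral_mono_AE)
  also have "\<dots> \<le> ennreal K * (\<integral>\<^sup>+x. ennreal (K\<^sup>2) * ennreal ((form_norm (g1 x) (\<omega> x))\<^sup>2) \<partial>R1.vol)"
    by (rule nn_integral_vol_le) measurable
  also have "\<dots> = ennreal K * (ennreal (K\<^sup>2) * R1.sq_norm \<omega>)"
    unfolding R1.sq_norm_def by (subst nn_integral_cmult) auto
  also have "\<dots> = ennreal (K ^ 3) * R1.sq_norm \<omega>"
    using K_ge_1 by (simp add: mult.assoc[symmetric] power3_eq_cube power2_eq_square flip: ennreal_mult)
  \<comment> \<open>Two factors \<open>K\<close> come from the squared norms and one from the
    measures; the exponent is rounded up to 4 so that the root is the plain power \<open>K\<close>
    squared.\<close>
  also have "\<dots> \<le> ennreal (K ^ 4) * R1.sq_norm \<omega>"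
    using K_ge_1 by (intro mult_right_mono ennreal_leI power_increasing) auto
  finally show ?thesis .
qed

lemma finite_energy_transfer: "R1.finite_energy \<omega> \<Longrightarrow> R2.finite_energy \<omega>"
  using sq_norm_le unfolding R1.finite_energy_def R2.finite_energy_def
  by (metis ennreal_less_top ennreal_mult_less_top infinity_ennreal_def le_less_trans)

lemma norm_le:
  assumes "u \<in> hcar R1.L2" shows "hnorm R2.L2 u \<le> K\<^sup>2 * hnorm R1.L2 u"
proof -
  obtain \<omega> where w: "u = form_class M \<omega>" "R1.finite_energy \<omega>" using assms R1.car_iff by blast
  have w2: "R2.finite_energy \<omega>" by (rule finite_energy_transfer[OF w(2)])
  have n: "0 \<le> hnorm R1.L2 u" using R1.energy_self(2) R1.inner_class w by (simp add: hnorm_def)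
  have "ennreal ((hnorm R2.L2 u)\<^sup>2) \<le> ennreal (K ^ 4) * ennreal ((hnorm R1.L2 u)\<^sup>2)"
    unfolding w(1) R1.norm_class[OF w(2)] R2.norm_class[OF w2] using w by (intro sq_norm_le) (simp add: R1.finite_energy_def)
  also have "\<dots> = ennreal ((K\<^sup>2 * hnorm R1.L2 u)\<^sup>2)"
    by (subst ennreal_mult[symmetric]) (auto simp: power_mult_distrib)
  finally have "(hnorm R2.L2 u)\<^sup>2 \<le> (K\<^sup>2 * hnorm R1.L2 u)\<^sup>2" by (simp add: ennreal_le_iff)
  then show ?thesis by (rule power2_le_imp_le) (use n in simp)
qed

lemma car_subset: "hcar R1.L2 \<subseteq> hcar R2.L2"
  using R1.car_iff R2.car_iff finite_energy_transfer by blast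

end

context two_rough
begin

interpretation sw: two_rough M g2 g1 C by (rule swapped)

lemma car_eq: "hcar R2.L2 = hcar R1.L2"
  using car_subset sw.car_subset by blast

lemma equivalent_L2: "equivalent_hilbert_spaces R1.L2 R2.L2 (K\<^sup>2)"
proof -
  interpret H1: hilbert_space R1.L2 by (rule R1.hilbert_L2)
  interpret H2: hilbert_space R2.L2 by (rule R2.hilbert_L2)
  show ?thesis
  proof
    show "hadd R2.L2 = hadd R1.L2" by (intro ext) (simp add: R1.add_L2 R2.add_L2)
    show "hscale R2.L2 = hscale R1.L2" by (intro ext) (simp add: R1.scale_L2 R2.scale_L2)
    show "hzero R2.L2 = hzero R1.L2" by (simp add: R1.zero_L2 R2.zero_L2)
    show "1 \<le> K\<^sup>2" using K_ge_1 by (rule one_le_power)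
  qed (use car_eq norm_le sw.norm_le in auto)
qed

lemma equivalent_norms_L2: "equivalent_norms R1.L2 R2.L2"
proof -
  interpret equivalent_hilbert_spaces R1.L2 R2.L2 "K\<^sup>2" by (rule equivalent_L2)
  show ?thesis
    unfolding equivalent_norms_def using C_ge_1 norm_le norm_ge K_ge_1
    by (intro exI[of _ "K\<^sup>2"]) (auto simp: pos_divide_le_eq mult.commute)
qed

lemma pairs_bounded: "mutually_bounded_pairs M (R1.vol, g1) (R2.vol, g2)"
proof -
  have "mutually_bounded_measures M R1.vol R2.vol"
    unfolding mutually_bounded_measures_def bounded_RN_deriv_def R1.ae_iff_AE
    using RN sw.RN R2.ae_iff_AE R1.ae_iff_AE by blast
  moreover have "mutually_bounded_on_forms M g1 g2"
    unfolding mutually_bounded_on_forms_def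
  proof (intro exI conjI)
    have "AE x in R1.vol. \<forall>\<omega>. form_norm (g1 x) \<omega> / K \<le> form_norm (g2 x) \<omega> \<and> form_norm (g2 x) \<omega> \<le> K * form_norm (g1 x) \<omega>"
      using ae_comparison[unfolded R1.ae_iff_AE] sw.ae_comparison[unfolded R1.ae_iff_AE]
      by eventually_elim (use K_ge_1 in \<open>auto simp: field_simps\<close>)
    then show "ae M (\<lambda>x. \<forall>\<omega>. form_norm (g1 x) \<omega> / K \<le> form_norm (g2 x) \<omega> \<and> form_norm (g2 x) \<omega> \<le> K * form_norm (g1 x) \<omega>)"
      by (simp add: R1.ae_iff_AE)
  qed (rule K_ge_1)
  ultimately show ?thesis by (simp add: mutually_bounded_pairs_def)
qed

end

subsection \<open>Degrees\<close>

context rough_mfd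
begin

text \<open>Sets of degrees rather than single ones, so that the relations for the separate degrees
  can be added up.\<close>

definition degree_proj :: "nat set \<Rightarrow> ('a, 'n) form_class \<Rightarrow> ('a, 'n) form_class" where
  "degree_proj S u = form_class M (\<lambda>x. degree_filter S (rep u x))"

lemma degree_part_eq: "degree_part M k u = degree_proj {k} u"
  by (simp add: degree_part_def degree_proj_def degree_filter_def)

lemma degree_proj_class:
  assumes "finite_energy \<omega>" shows "degree_proj S (form_class M \<omega>) = form_class M (\<lambda>x. degree_filter S (\<omega> x))"
  unfolding degree_proj_def
proof (rule form_class_eqI)
  show "ae M (\<lambda>x. degree_filter S (rep (form_class M \<omega>) x) = degree_filter S (\<omega> x))"
    unfolding ae_iff_AE using rep_class_AE[OF assms] by eventually_elim simp
qed

lemma degree_proj_car: "u \<in> hcar L2 \<Longrightarrow> degree_proj S u \<in> hcar L2"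
  unfolding degree_proj_def by (intro form_class_car finite_energy_degree_filter rep_car)

lemma degree_proj_inner:
  assumes u: "u \<in> hcar L2" and v: "v \<in> hcar L2"
  shows "hinner L2 (degree_proj S u) v = hinner L2 u (degree_proj S v)"
proof -
  note e = rep_car[OF u] rep_car[OF v]
  have "hinner L2 (degree_proj S u) v = energy (\<lambda>x. degree_filter S (rep u x)) (rep v)"
    using inner_class[OF finite_energy_degree_filter[OF e(1)] e(3)] e by (simp add: degree_proj_def)
  also have "\<dots> = energy (rep u) (\<lambda>x. degree_filter S (rep v x))"
    by (simp add: energy_def form_inner_degree_filter)
  also have "\<dots> = hinner L2 u (degree_proj S v)"
    using inner_class[OF e(1) finite_energy_degree_filter[OF e(3)]] e by (simp add: degree_proj_def)
  finally show ?thesis .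
qed

lemma degree_proj_add:
  assumes u: "u \<in> hcar L2" and "S \<inter> T = {}"
  shows "hadd L2 (degree_proj S u) (degree_proj T u) = degree_proj (S \<union> T) u"
proof -
  note f = finite_energy_degree_filter[OF rep_car(1)[OF u]]
  have "(\<lambda>x. degree_filter S (rep u x) + degree_filter T (rep u x)) = (\<lambda>x. degree_filter (S \<union> T) (rep u x))"
    using assms(2) by (auto simp: degree_filter_def vec_eq_iff fun_eq_iff)
  then show ?thesis unfolding degree_proj_def add_class[OF f f] by simp
qed

lemma degree_proj_degree_proj:
  assumes u: "u \<in> hcar L2" shows "degree_proj S (degree_proj T u) = degree_proj (S \<inter> T) u"
proof -
  have "degree_proj S (degree_proj T u) = form_class M (\<lambda>x. degree_filter S (degree_filter T (rep u x)))"
    unfolding degree_proj_def[of T] by (intro degree_proj_class finite_energy_degree_filter rep_car u)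
  also have "(\<lambda>x. degree_filter S (degree_filter T (rep u x))) = (\<lambda>x. degree_filter (S \<inter> T) (rep u x))"
    by (auto simp: degree_filter_def vec_eq_iff fun_eq_iff)
  finally show ?thesis by (simp add: degree_proj_def)
qed

lemma degree_proj_empty: "degree_proj {} u = hzero L2"
  by (simp add: degree_proj_def zero_L2 degree_filter_def zero_vec_def)

lemma degree_proj_zero: "degree_proj S (hzero L2) = hzero L2"
proof -
  have "degree_filter S 0 = (0 :: 'n form)" by (simp add: degree_filter_def vec_eq_iff)
  then show ?thesis unfolding zero_L2 by (simp add: degree_proj_class[OF finite_energy_zero])
qed

lemma degree_proj_all:
  assumes u: "u \<in> hcar L2" shows "degree_proj {..<Suc CARD('n)} u = u"
proof -
  have "card I < Suc CARD('n)" for I :: "'n set" using card_mono[of UNIV I] by (simp add: less_Suc_eq_le)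
  then have "degree_filter {..<Suc CARD('n)} \<omega> = \<omega>" for \<omega> :: "'n form"
    by (simp add: degree_filter_def vec_eq_iff)
  then show ?thesis by (simp add: degree_proj_def rep_car[OF u])
qed

lemma k_forms_iff:
  assumes u: "u \<in> hcar L2" shows "u \<in> k_forms M k \<longleftrightarrow> degree_proj {k} u = u"
proof
  note e = rep_car[OF u]
  have m: "measurable_form M (rep u)" using e by (simp add: finite_energy_def)
  { assume "u \<in> k_forms M k"
    moreover have "rep u \<in> u" using mem_form_class[OF m] e by simp
    ultimately have "ae M (\<lambda>x. \<forall>I. card I \<noteq> k \<longrightarrow> rep u x $ I = 0)" by (simp add: k_forms_def)
    then have "ae M (\<lambda>x. degree_filter {k} (rep u x) = rep u x)"
      by (rule ae_mono) (auto simp: degree_filter_def vec_eq_iff)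
    then show "degree_proj {k} u = u" using form_class_eqI e by (metis degree_proj_def) }
  { assume "degree_proj {k} u = u"
    then have eq: "u = form_class M (\<lambda>x. degree_filter {k} (rep u x))" by (simp add: degree_proj_def)
    show "u \<in> k_forms M k"
      unfolding k_forms_def
    proof (intro CollectI ballI)
      fix \<omega> assume "\<omega> \<in> u"
      then have "\<omega> \<in> form_class M (\<lambda>x. degree_filter {k} (rep u x))" using eq by blast
      then have "ae M (\<lambda>x. \<omega> x = degree_filter {k} (rep u x))" by (simp add: form_class_def)
      then show "ae M (\<lambda>x. \<forall>I. card I \<noteq> k \<longrightarrow> \<omega> x $ I = 0)"
        by (rule ae_mono) (simp add: degree_filter_def)
    qed }
qed

text \<open>Summing the relation over all degrees shows that the range has no component of degree \<open>0\<close>.\<close>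

lemma raises_degree_range:
  assumes lin: "linear_operator L2 d" and r: "raises_degree M d" and y: "y \<in> Range d"
  shows "degree_proj {k} y \<in> Range d"
proof (cases k)
  case (Suc j)
  then show ?thesis using r y unfolding raises_degree_def degree_part_eq by fast
next
  case 0
  obtain x where xy: "(x, y) \<in> d" using y by blast
  have c: "x \<in> hcar L2" "y \<in> hcar L2" using linear_operator_carrier[OF lin xy] by auto
  have sum: "(degree_proj {..<m} x, degree_proj (Suc ` {..<m}) y) \<in> d" for m
  proof (induction m)
    case 0
    then show ?case using linear_operator_zero[OF lin] by (simp add: degree_proj_empty)
  next
    case (Suc m)
    have "(degree_proj {m} x, degree_proj {Suc m} y) \<in> d"
      using r xy unfolding raises_degree_def degree_part_eq by fast
    then have "(hadd L2 (degree_proj {..<m} x) (degree_proj {m} x),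
        hadd L2 (degree_proj (Suc ` {..<m}) y) (degree_proj {Suc m} y)) \<in> d"
      by (rule linear_operator_add[OF lin Suc.IH])
    moreover have "{..<m} \<union> {m} = {..<Suc m}" "Suc ` {..<m} \<union> {Suc m} = Suc ` {..<Suc m}" by auto
    ultimately show ?case by (simp add: degree_proj_add c image_iff)
  qed
  \<comment> \<open>With all degrees of \<open>x\<close> summed, the left entry is \<open>x\<close>
    itself, so single-valuedness identifies \<open>y\<close> with its part of positive degree; its
    degree 0 part is then zero, and zero is in the range.\<close>
  have "(x, degree_proj (Suc ` {..<Suc CARD('n)}) y) \<in> d" using sum[of "Suc CARD('n)"] degree_proj_all[OF c(1)] by simp
  then have "y = degree_proj (Suc ` {..<Suc CARD('n)}) y" using linear_operator_fun[OF lin xy] by blast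
  then have "degree_proj {0} y = degree_proj ({0} \<inter> Suc ` {..<Suc CARD('n)}) y"
    using degree_proj_degree_proj[OF c(2)] by metis
  also have "\<dots> = hzero L2" by (simp add: degree_proj_empty)
  finally show ?thesis using 0 linear_operator_zero[OF lin] by auto
qed

lemma raises_degree_ker:
  assumes r: "raises_degree M d" and u: "u \<in> hker L2 d"
  shows "degree_proj {k} u \<in> hker L2 d"
proof -
  have "(degree_proj {k} u, degree_proj {Suc k} (hzero L2)) \<in> d"
    using r u unfolding raises_degree_def degree_part_eq hker_def by fast
  then show ?thesis by (simp add: degree_proj_zero hker_def)
qed

end

subsection \<open>Density of the smooth compactly supported forms\<close>

context smooth_mfd
begin

lemma chart_image_openin:
  assumes c: "c \<in> M" and V: "open V"
  obtains T where "open T" "snd c ` (fst c \<inter> V) = T \<inter> chart_image c"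
proof -
  have "openin (top_of_set (fst c)) (fst c \<inter> V)" using V by (auto simp: openin_open)
  then have "openin (top_of_set (chart_image c)) (snd c ` (fst c \<inter> V))"
    using homeomorphism_imp_open_map[OF chart_homeomorphism[OF c]] by blast
  then show ?thesis using that by (auto simp: openin_open Int_commute)
qed

definition chart_form :: "('a, 'n) chart \<Rightarrow> ('n rvec \<Rightarrow> 'n form) \<Rightarrow> 'a \<Rightarrow> 'n form" where
  "chart_form c f p = (if p \<in> fst c then form_pullback (chart_push M c p) (f (snd c p)) else 0)"

lemma chart_form_in_chart:
  assumes c: "c \<in> M" "c' \<in> M" and p: "p \<in> fst c" "p \<in> fst c'"
  shows "form_in_chart M c' (chart_form c f) (snd c' p) = form_pullback (transition_jacobian c' c p) (f (snd c p))"
  unfolding form_in_chart_at[OF c(2) p(2)] chart_form_def if_P[OF p(1)]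
  by (simp add: chart_push_pull[OF c p] flip: form_pullback_mult)

lemma chart_form_self:
  assumes c: "c \<in> M" and y: "y \<in> chart_image c"
  shows "form_in_chart M c (chart_form c f) y = f y"
proof -
  obtain p where p: "p \<in> fst c" "y = snd c p" using y by blast
  then show ?thesis using chart_form_in_chart[OF c c p(1) p(1), of f] jacobian_same[OF c p(1)] by simp
qed

text \<open>A transition map is smooth only as the restriction of some \<open>\<Phi>\<close> on an
  open set. The extension of the form is built from \<open>\<Phi>\<close> and its derivative, which
  agrees with the Jacobian of the transition on the chart image because derivatives within a
  relatively open set are unique.\<close>

lemma chart_form_smooth_inside:
  assumes c: "c \<in> M" "c' \<in> M" and f: "\<And>k. C_k_on k UNIV f" and p: "p \<in> fst c" "p \<in> fst c'"
  shows "\<exists>W F. open W \<and> snd c' p \<in> W \<and> (\<forall>k. C_k_on k W F) \<and>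
    (\<forall>y\<in>W \<inter> chart_image c'. F y = form_in_chart M c' (chart_form c f) y)"
proof -
  have "snd c' p \<in> overlap c' c" using p by blast
  from bspec[OF transition_smooth[OF c(2,1), unfolded smooth_on_def] this]
  obtain W \<Phi> where W: "open W" "snd c' p \<in> W" "\<forall>k. C_k_on k W \<Phi>"
      "\<forall>y\<in>W \<inter> overlap c' c. \<Phi> y = transition c' c y"
    by (elim exE conjE)
  obtain T where T: "open T" "snd c' ` (fst c' \<inter> fst c) = T \<inter> chart_image c'"
    using chart_image_openin[OF c(2) chart_open[OF c(1)]] .
  define V where "V = fst c' \<inter> snd c' -` W"
  have V: "open V"
    unfolding V_def using chart_open[OF c(2)] chart_homeomorphism[OF c(2)] W(1)
    by (auto simp: homeomorphism_def intro: continuous_open_preimage)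
  define F where "F y = form_pullback (matrix (frechet_derivative \<Phi> (at y))) (f (\<Phi> y))" for y
  have "C_k_on k (W \<inter> T) F" for k
    unfolding F_def[abs_def]
  proof (rule C_k_on_form_pullback)
    show "open (W \<inter> T)" using W T by blast
    have "C_k_on k W (\<lambda>y. frechet_derivative \<Phi> (at y) (axis j 1))" for j
      using C_k_on_SucD(2) W(3) by blast
    then have "C_k_on k (W \<inter> T) (\<lambda>y. frechet_derivative \<Phi> (at y) (axis j 1))" for j
      by (rule C_k_on_subset) auto
    then show "C_k_on k (W \<inter> T) (\<lambda>y. matrix (frechet_derivative \<Phi> (at y)) $ i $ j)" for i j
      unfolding matrix_def vec_lambda_beta by (rule C_k_on_bounded_linear[OF \<open>open (W \<inter> T)\<close> bounded_linear_vec_nth])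
    have "C_k_on k W (\<lambda>y. f (\<Phi> y))"
      by (rule C_k_on_compose[OF W(1) open_UNIV subset_UNIV f]) (use W(3) in blast)
    then show "C_k_on k (W \<inter> T) (\<lambda>y. f (\<Phi> y))" by (rule C_k_on_subset) auto
  qed
  moreover have "F y = form_in_chart M c' (chart_form c f) y" if y: "y \<in> W \<inter> T \<inter> chart_image c'" for y
  proof -
    have "y \<in> snd c' ` (fst c' \<inter> fst c)" using y T(2) by blast
    then obtain q where q: "q \<in> fst c'" "q \<in> fst c" "y = snd c' q" by blast
    have qV: "q \<in> V" using q y by (simp add: V_def)
    have eq: "\<Phi> z = transition c' c z" if "z \<in> snd c' ` (fst c' \<inter> fst c \<inter> V)" for z
      using that W(4) by (auto simp: V_def)
    have "(\<Phi> has_derivative frechet_derivative \<Phi> (at y)) (at y)"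
      using C_k_on_SucD(1)[of 0 W \<Phi> y] W(3) y by blast
    then have "(\<Phi> has_derivative frechet_derivative \<Phi> (at y)) (at y within snd c' ` (fst c' \<inter> fst c \<inter> V))"
      by (rule has_derivative_at_withinI)
    then have "(transition c' c has_derivative frechet_derivative \<Phi> (at y)) (at y within snd c' ` (fst c' \<inter> fst c \<inter> V))"
      by (rule has_derivative_transform[rotated 2]) (use q qV eq in auto)
    moreover have "frechet_derivative \<Phi> (at y) = (*v) (matrix (frechet_derivative \<Phi> (at y)))"
      using has_derivative_linear[OF \<open>(\<Phi> has_derivative frechet_derivative \<Phi> (at y)) (at y)\<close>] by (auto simp: matrix_works fun_eq_iff)
    ultimately have "transition_jacobian c' c q = matrix (frechet_derivative \<Phi> (at y))"
      using jacobian_eqI[OF c(2,1) q(1,2) V qV] q(3) by metis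
    moreover have "\<Phi> y = snd c q" using eq[of y] q qV c(2) by auto
    ultimately show ?thesis
      unfolding F_def q(3) using chart_form_in_chart[OF c q(2,1), of f] by (simp add: q(3))
  qed
  moreover have "snd c' p \<in> T" using T(2) p by blast
  ultimately show ?thesis using W(1,2) T(1) by (intro exI[of _ "W \<inter> T"] exI[of _ F]) auto
qed

text \<open>The preimage \<open>B'\<close> of \<open>B\<close> is compact, hence closed in the
  Hausdorff space. The form vanishes on its open complement, which settles smoothness at points
  outside the chart and compactness of the support.\<close>

lemma chart_form_Ccc:
  assumes c: "c \<in> M" and f: "\<And>k. C_k_on k UNIV f"
    and B: "compact B" "B \<subseteq> interior (chart_image c)" "\<And>y. y \<notin> B \<Longrightarrow> f y = 0"
  shows "chart_form c f \<in> Ccc_forms M"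
proof -
  have Bc: "B \<subseteq> chart_image c" using B(2) interior_subset by blast
  define B' where "B' = chart_inv c ` B"
  have "continuous_on (chart_image c) (chart_inv c)"
    using chart_homeomorphism[OF c] by (simp add: homeomorphism_def)
  then have B'c: "compact B'" unfolding B'_def by (rule compact_continuous_image[OF continuous_on_subset[OF _ Bc] B(1)])
  then have B'cl: "closed B'" by (rule compact_imp_closed)
  have B'sub: "q \<in> fst c \<and> snd c q \<in> B" if q: "q \<in> B'" for q
  proof -
    obtain y where "y \<in> B" "q = chart_inv c y" using q unfolding B'_def by blast
    then show ?thesis using chart_inv_mem[of y c] chart_inv_right[of y c] Bc by auto
  qed
  have zero: "chart_form c f q = 0" if q: "q \<notin> B'" for q
  proof (cases "q \<in> fst c")
    case True
    have "snd c q \<notin> B"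
    proof
      assume "snd c q \<in> B"
      then have "chart_inv c (snd c q) \<in> B'" unfolding B'_def by blast
      then show False using q True c by simp
    qed
    then show ?thesis using B(3) by (simp add: chart_form_def)
  qed (simp add: chart_form_def)
  have cl: "closure {x. chart_form c f x \<noteq> 0} \<subseteq> B'"
    by (rule closure_minimal[OF _ B'cl]) (use zero in blast)
  have "smooth_form M (chart_form c f)"
    unfolding smooth_form_def smooth_on_def
  proof (intro ballI)
    fix c' y assume c': "c' \<in> M" and y: "y \<in> chart_image c'"
    then obtain p where p: "p \<in> fst c'" "y = snd c' p" by blast
    show "\<exists>W F. open W \<and> y \<in> W \<and> (\<forall>k. C_k_on k W F) \<and>
        (\<forall>z\<in>W \<inter> chart_image c'. F z = form_in_chart M c' (chart_form c f) z)"
    proof (cases "p \<in> fst c")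
      case True
      then show ?thesis using chart_form_smooth_inside[OF c c' f True p(1)] p(2) by simp
    next
      case False
      have "open (- B')" using B'cl by (simp add: open_Compl)
      then obtain T where T: "open T" "snd c' ` (fst c' \<inter> - B') = T \<inter> chart_image c'"
        by (rule chart_image_openin[OF c'])
      have "p \<notin> B'" using False B'sub by blast
      then have "y \<in> T" using T(2) p by blast
      moreover have "0 = form_in_chart M c' (chart_form c f) z" if "z \<in> T \<inter> chart_image c'" for z
      proof -
        have "z \<in> snd c' ` (fst c' \<inter> - B')" using that T(2) by blast
        then obtain q where q: "q \<in> fst c'" "q \<notin> B'" "z = snd c' q" by blast
        then show ?thesis using zero[OF q(2)] by (simp add: form_in_chart_at[OF c' q(1)])
      qed
      ultimately show ?thesis using T(1) C_k_on_const[of _ T "0 :: 'n form"]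
        by (intro exI[of _ T] exI[of _ "\<lambda>_. 0"]) auto
    qed
  qed
  moreover have "compact (closure {x. chart_form c f x \<noteq> 0})"
    using compact_Int_closed[OF B'c closed_closure, of "{x. chart_form c f x \<noteq> 0}"] cl by (simp add: Int_absorb1)
  moreover have "closure {x. chart_form c f x \<noteq> 0} \<subseteq> manifold_interior M"
    using cl B'sub B(2) c unfolding manifold_interior_def by blast
  ultimately show ?thesis by (simp add: Ccc_forms_def)
qed

end

text \<open>Lebesgue differentiation: outside a null set \<open>F x\<close> is the limit of averages
  over small cubes with corner \<open>x\<close>. For \<open>x\<close> in the open box these cubes
  stay inside \<open>cbox a b\<close>, where all averages are zero.\<close>

lemma AE_zero_of_box_integrals:
  fixes F :: "real^'n \<Rightarrow> 'b::euclidean_space"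
  assumes int: "integrable lebesgue F"
    and box: "\<And>u v. cbox u v \<subseteq> cbox a b \<Longrightarrow> integral (cbox u v) F = 0"
  shows "negligible {x \<in> box a b. F x \<noteq> 0}"
proof -
  have Fi: "F integrable_on UNIV" using integrable_on_lebesgue[OF int] .
  then have "F integrable_on cbox u v" for u v
    using integrable_on_subcbox[OF Fi] by auto
  then obtain N where N: "negligible N" "\<And>x e. \<lbrakk>x \<notin> N; 0 < e\<rbrakk> \<Longrightarrow> \<exists>d>0. \<forall>h. 0 < h \<and> h < d \<longrightarrow>
      norm (integral (cbox x (x + h *\<^sub>R One)) F /\<^sub>R h ^ DIM(real^'n) - F x) < e"
    using integrable_ccontinuous_explicit[of F] by blast
  have "F x = 0" if x: "x \<in> box a b" "x \<notin> N" for x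
  proof (rule ccontr)
    assume nz: "F x \<noteq> 0"
    then obtain d where d: "0 < d" "\<And>h. 0 < h \<Longrightarrow> h < d \<Longrightarrow>
        norm (integral (cbox x (x + h *\<^sub>R One)) F /\<^sub>R h ^ DIM(real^'n) - F x) < norm (F x)"
      using N(2)[OF x(2), of "norm (F x)"] by auto
    obtain r where r: "0 < r" "ball x r \<subseteq> box a b" using x(1) open_box open_contains_ball by blast
    define m where "m = norm (One :: real^'n) + 1"
    have m: "0 < m" by (simp add: m_def add_nonneg_pos)
    \<comment> \<open>Below \<open>d\<close> for the differentiation estimate, and with
      \<open>h * m < r\<close> so that the opposite corner of the cube stays in the ball around
      \<open>x\<close>.\<close>
    define h where "h = min (d / 2) (r / (2 * m))"
    have h: "0 < h" "h < d" "h * m < r"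
    proof -
      show "0 < h" "h < d" using d r m by (auto simp: h_def)
      have "h * m \<le> r / (2 * m) * m" using m by (intro mult_right_mono) (auto simp: h_def)
      then show "h * m < r" using m r by simp
    qed
    have "x + h *\<^sub>R One \<in> ball x r"
    proof -
      have "dist x (x + h *\<^sub>R One) = h * norm (One :: real^'n)" using h by (simp add: dist_norm)
      also have "\<dots> \<le> h * m" using h by (simp add: m_def)
      finally show ?thesis using h by simp
    qed
    then have "x + h *\<^sub>R One \<in> box a b" using r by blast
    then have "cbox x (x + h *\<^sub>R One) \<subseteq> cbox a b"
      using x(1) by (force simp: mem_box)
    then have "integral (cbox x (x + h *\<^sub>R One)) F = 0" by (rule box)
    then show False using d(2)[OF h(1,2)] by simp
  qed
  then have "{x \<in> box a b. F x \<noteq> 0} \<subseteq> N" by blast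
  then show ?thesis by (rule negligible_subset[OF N(1)])
qed

context rough_mfd
begin

text \<open>In a comparability chart the metric is compared with the identity matrix, in both
  directions: the upper bound on vectors controls the volume density, the lower bound controls the
  norms of forms.\<close>

lemma chart_comparison:
  assumes c: "comparability_chart M g c"
  obtains K where "1 \<le> K" "AE y in lebesgue. y \<in> chart_image c \<longrightarrow>
    dens c y \<le> K \<and> (\<forall>\<omega>. form_norm (metric_in_chart M c g y) \<omega> \<le> K * form_norm (mat 1) \<omega>)"
proof -
  have cM: "c \<in> M" using c comparability_chart_mem by blast
  obtain C where C: "1 \<le> C" and ae: "ae M (\<lambda>y. y \<in> fst c \<longrightarrow>
        (\<forall>u. norm (chart_push M c y *v u) / C \<le> metric_norm (g y) u \<and>
             metric_norm (g y) u \<le> C * norm (chart_push M c y *v u)))"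
    using c unfolding comparability_chart_def by blast
  let ?P = "\<lambda>p. p \<in> fst c \<longrightarrow> posdef (g p) \<and>
        (\<forall>u. norm (chart_push M c p *v u) / C \<le> metric_norm (g p) u \<and>
             metric_norm (g p) u \<le> C * norm (chart_push M c p *v u))"
  have "AE p in vol. ?P p"
    using ae[unfolded ae_iff_AE] AE_posdef by eventually_elim blast
  then have "manifold_null M {p. \<not> ?P p}" by (simp only: ae_iff_AE[symmetric] ae_def)
  then have N: "snd c ` ({p. \<not> ?P p} \<inter> fst c) \<in> null_sets lebesgue" using cM by (simp only: manifold_null_def)
  let ?K = "comparison_const TYPE('n) C"
  have pd1: "posdef (mat 1 :: 'n rmat)" by (simp add: posdef_def transpose_mat)
  have "AE y in lebesgue. y \<in> chart_image c \<longrightarrow>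
    dens c y \<le> ?K \<and> (\<forall>\<omega>. form_norm (metric_in_chart M c g y) \<omega> \<le> ?K * form_norm (mat 1) \<omega>)"
  proof (rule AE_I'[OF N], rule subsetI)
    fix y assume "y \<in> {y \<in> space lebesgue. \<not> (y \<in> chart_image c \<longrightarrow>
      dens c y \<le> ?K \<and> (\<forall>\<omega>. form_norm (metric_in_chart M c g y) \<omega> \<le> ?K * form_norm (mat 1) \<omega>))}"
    then obtain p where p: "p \<in> fst c" "y = snd c p"
      and n: "\<not> (dens c (snd c p) \<le> ?K \<and> (\<forall>\<omega>. form_norm (metric_in_chart M c g (snd c p)) \<omega> \<le> ?K * form_norm (mat 1) \<omega>))"
      by blast
    have "\<not> ?P p"
    proof
      assume P: "?P p"
      let ?G = "metric_in_chart M c g (snd c p)"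
      have G: "posdef ?G" using metric_in_chart_posdef[OF cM p(1)] P p by blast
      have mn: "metric_norm ?G w = metric_norm (g p) (chart_pull M c p *v w)" for w
        unfolding metric_norm_def metric_in_chart_at[OF cM p(1)]
        using inner_matrix_vector_mult[of w "Finite_Cartesian_Product.transpose (chart_pull M c p)" "g p *v (chart_pull M c p *v w)"]
        by (simp add: matrix_vector_mul_assoc[symmetric])
      have pp: "chart_push M c p *v (chart_pull M c p *v w) = w" for w
        by (simp add: matrix_vector_mul_assoc chart_pull_push[OF cM p(1)])
      have m1: "metric_norm (mat 1) w = norm w" for w :: "'n rvec" by (simp add: metric_norm_def norm_eq_sqrt_inner)
      have up: "metric_norm ?G w \<le> C * metric_norm (mat 1) w" for w
        using P p(1) pp[of w] unfolding mn m1 by metis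
      have "norm w / C \<le> metric_norm ?G w" for w using P p(1) pp[of w] unfolding mn by metis
      then have lo: "metric_norm (mat 1) w \<le> C * metric_norm ?G w" for w
        unfolding m1 using C by (simp add: pos_divide_le_eq mult.commute)
      have "dens c (snd c p) \<le> ?K"
        using metric_comparison(2)[OF G pd1 C up] by (simp add: dens_def)
      then show False using n metric_comparison(1)[OF pd1 G C lo] by blast
    qed
    then show "y \<in> snd c ` ({p. \<not> ?P p} \<inter> fst c)" using p by blast
  qed
  then show ?thesis using that comparison_const_ge_1[OF C, where 'n = 'n] by blast
qed

text \<open>The coefficient functions tested against the bumps that approximate the indicator of a box.\<close>

lemma orthogonal_imp_zero_in_chart:
  assumes c: "comparability_chart M g c" and \<eta>: "finite_energy \<eta>"
    and Ccc: "\<And>\<omega>. \<omega> \<in> Ccc_forms M \<Longrightarrow> form_class M \<omega> \<in> hcar L2 \<and> hinner L2 (form_class M \<omega>) (form_class M \<eta>) = 0"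
    and ab: "cbox a b \<subseteq> interior (chart_image c)"
  shows "negligible {y \<in> box a b. dens c y *\<^sub>R form_inner (metric_in_chart M c g y) (axis I 1) (form_in_chart M c \<eta> y) \<noteq> 0}"
proof -
  have cM: "c \<in> M" using c comparability_chart_mem by blast
  let ?\<Omega> = "chart_image c" and ?L = "lebesgue_on (chart_image c)"
  have \<Omega>: "?\<Omega> \<in> sets lebesgue" by (rule image_lebesgue[OF cM])
  have abO: "cbox a b \<subseteq> ?\<Omega>" using ab interior_subset by blast
  have \<eta>m: "measurable_form M \<eta>" using \<eta> by (simp add: finite_energy_def)
  define h where "h y = dens c y *\<^sub>R form_inner (metric_in_chart M c g y) (axis I 1) (form_in_chart M c \<eta> y)" for y
  define F where "F y = (if y \<in> cbox a b then h y else 0)" for y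
  have hm: "h \<in> borel_measurable ?L"
    unfolding h_def[abs_def] using \<eta>m cM
    by (intro borel_measurable_scaleR dens_measurable borel_measurable_form_inner metric_in_chart_measurable borel_measurable_const)
      (auto simp: measurable_form_def)
  have Fm: "F \<in> borel_measurable lebesgue"
  proof -
    have "h \<in> borel_measurable (lebesgue_on (cbox a b))" using measurable_restrict_mono[OF hm abO] .
    then show ?thesis unfolding F_def[abs_def] by (rule borel_measurable_if[THEN iffD2, rotated]) auto
  qed
  have Fint: "integrable lebesgue F"
  proof (rule integrableI_bounded[OF Fm])
    obtain K where K: "1 \<le> K" "AE y in lebesgue. y \<in> ?\<Omega> \<longrightarrow>
      dens c y \<le> K \<and> (\<forall>\<omega>. form_norm (metric_in_chart M c g y) \<omega> \<le> K * form_norm (mat 1) \<omega>)"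
      using chart_comparison[OF c] by blast
    \<comment> \<open>The integrand is at most \<open>dens\<close> times the sum of the squared
      norms of \<open>\<eta>\<close> and of the constant form. The first part integrates to at most
      the energy of \<open>\<eta>\<close>; the second is bounded by \<open>B\<close> on the
      box.\<close>
    define B where "B = K * (K * form_norm (mat 1) (axis I 1 :: 'n form))\<^sup>2"
    let ?q = "\<lambda>y. ennreal (dens c y) * ennreal ((form_norm (g (chart_inv c y)) (\<eta> (chart_inv c y)))\<^sup>2)"
    have "AE y in lebesgue. ennreal (norm (F y)) \<le> ?q y * indicator ?\<Omega> y + ennreal B * indicator (cbox a b) y"
    proof -
      have "manifold_null M {p. \<not> posdef (g p)}" using ae_posdef by (simp add: ae_def)
      then have "snd c ` ({p. \<not> posdef (g p)} \<inter> fst c) \<in> null_sets lebesgue" using cM by (simp add: manifold_null_def)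
      then have N: "AE y in lebesgue. y \<notin> snd c ` ({p. \<not> posdef (g p)} \<inter> fst c)" by (rule AE_not_in)
      show ?thesis
        using K(2) ae_dens_pos[OF cM] N
      proof eventually_elim
        fix y assume k: "y \<in> ?\<Omega> \<longrightarrow> dens c y \<le> K \<and> (\<forall>\<omega>. form_norm (metric_in_chart M c g y) \<omega> \<le> K * form_norm (mat 1) \<omega>)"
          and d: "y \<in> ?\<Omega> \<longrightarrow> posdef (metric_in_chart M c g y) \<and> 0 < dens c y"
          and n: "y \<notin> snd c ` ({p. \<not> posdef (g p)} \<inter> fst c)"
        show "ennreal (norm (F y)) \<le> ?q y * indicator ?\<Omega> y + ennreal B * indicator (cbox a b) y"
        proof (cases "y \<in> cbox a b")
          case True
          then have yO: "y \<in> ?\<Omega>" using abO by blast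
          then obtain p where p: "p \<in> fst c" "y = snd c p" by blast
          have gp: "posdef (g p)" using n p by blast
          let ?G = "metric_in_chart M c g y"
          have G: "posdef ?G" and dy: "0 < dens c y" "dens c y \<le> K" using d k yO by auto
          let ?s = "form_norm ?G (axis I 1)" and ?t = "form_norm ?G (form_in_chart M c \<eta> y)"
          have st: "0 \<le> ?s" "0 \<le> ?t" using form_norm_nonneg[OF G] by auto
          have t: "?t = form_norm (g (chart_inv c y)) (\<eta> (chart_inv c y))"
            using form_norm_in_chart[of c p g \<eta>, OF cM p(1) gp] p cM by simp
          have s: "?s \<le> K * form_norm (mat 1) (axis I 1 :: 'n form)" using k yO by blast
          have "norm (F y) = dens c y * norm (form_inner ?G (axis I 1) (form_in_chart M c \<eta> y))"
            using True dy by (simp add: F_def h_def)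
          also have "\<dots> \<le> dens c y * (?s * ?t)" using dy by (intro mult_left_mono form_inner_norm_le[OF G]) auto
          also have "\<dots> \<le> dens c y * (?t\<^sup>2 + ?s\<^sup>2)"
            using dy sum_squares_bound[of ?s ?t] mult_nonneg_nonneg[OF st] by (intro mult_left_mono) linarith+
          also have "\<dots> = dens c y * ?t\<^sup>2 + dens c y * ?s\<^sup>2" by (rule distrib_left)
          also have "\<dots> \<le> dens c y * ?t\<^sup>2 + B"
            unfolding B_def using dy st s K(1) by (intro add_left_mono mult_mono power_mono) auto
          finally have "ennreal (norm (F y)) \<le> ennreal (dens c y * ?t\<^sup>2 + B)" by (rule ennreal_leI)
          also have "\<dots> = ?q y + ennreal B"
            using dy K(1) unfolding t by (subst ennreal_plus) (auto simp: ennreal_mult B_def)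
          finally show ?thesis using True yO by simp
        qed (simp add: F_def)
      qed
    qed
    then have "(\<integral>\<^sup>+y. ennreal (norm (F y)) \<partial>lebesgue) \<le> (\<integral>\<^sup>+y. ?q y * indicator ?\<Omega> y + ennreal B * indicator (cbox a b) y \<partial>lebesgue)"
      by (rule nn_integral_mono_AE)
    also have "\<dots> = (\<integral>\<^sup>+y. ?q y * indicator ?\<Omega> y \<partial>lebesgue) + (\<integral>\<^sup>+y. ennreal B * indicator (cbox a b) y \<partial>lebesgue)"
    proof (rule nn_integral_add)
      have "(\<lambda>x. ennreal ((form_norm (g x) (\<eta> x))\<^sup>2)) \<in> borel_measurable vol" using form_norm_measurable[OF \<eta>m] by measurable
      then have "(\<lambda>y. ennreal ((form_norm (g (chart_inv c y)) (\<eta> (chart_inv c y)))\<^sup>2)) \<in> borel_measurable ?L"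
        by (rule measurable_vol_chart[OF _ cM])
      then have "?q \<in> borel_measurable ?L" using dens_measurable[OF cM] by measurable
      then show "(\<lambda>y. ?q y * indicator ?\<Omega> y) \<in> borel_measurable lebesgue"
        using \<Omega> by (subst borel_measurable_restrict_space_iff_ennreal[symmetric]) auto
      show "(\<lambda>y. ennreal B * indicator (cbox a b) y) \<in> borel_measurable lebesgue"
        by (intro borel_measurable_times_ennreal borel_measurable_const borel_measurable_indicator) simp
    qed
    also have "(\<integral>\<^sup>+y. ?q y * indicator ?\<Omega> y \<partial>lebesgue) = (\<integral>\<^sup>+x\<in>fst c. ennreal ((form_norm (g x) (\<eta> x))\<^sup>2) \<partial>vol)"
    proof -
      have "(\<lambda>x. ennreal ((form_norm (g x) (\<eta> x))\<^sup>2)) \<in> borel_measurable vol" using form_norm_measurable[OF \<eta>m] by measurable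
      from nn_integral_chart[OF c this] show ?thesis using \<Omega> by (subst (asm) nn_integral_restrict_space) auto
    qed
    also have "\<dots> \<le> sq_norm \<eta>" unfolding sq_norm_def by (intro nn_integral_mono) (auto split: split_indicator)
    also have "sq_norm \<eta> + (\<integral>\<^sup>+y. ennreal B * indicator (cbox a b) y \<partial>lebesgue) < \<infinity>"
    proof -
      have "(\<integral>\<^sup>+y. ennreal B * indicator (cbox a b) y \<partial>lebesgue) = ennreal B * emeasure lebesgue (cbox a b)"
        by (rule nn_integral_cmult_indicator) simp
      also have "\<dots> < \<infinity>" by (simp add: ennreal_mult_less_top emeasure_lborel_cbox_eq)
      finally show ?thesis using \<eta> by (simp add: finite_energy_def)
    qed
    finally show "(\<integral>\<^sup>+y. ennreal (norm (F y)) \<partial>lebesgue) < \<infinity>" by (simp add: add_right_mono)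
  qed
  have bump0: "(\<integral>y. bump m u v y *\<^sub>R F y \<partial>lebesgue) = 0" if uv: "cbox u v \<subseteq> cbox a b" for u v and m :: nat
  proof -
    define f where "f y = of_real (bump m u v y) *s (axis I 1 :: 'n form)" for y
    have fC: "C_k_on k UNIV f" for k
    proof -
      have "C_k_on k UNIV (\<lambda>y. bump m u v y *\<^sub>R (axis I 1 :: 'n form))"
        by (intro C_k_on_scaleR open_UNIV C_k_on_bump C_k_on_const)
      then show ?thesis by (simp add: f_def[abs_def] scaleR_eq_vector_scale)
    qed
    let ?\<omega> = "chart_form c f"
    have "?\<omega> \<in> Ccc_forms M"
      by (rule chart_form_Ccc[OF cM fC compact_cbox[of u v]])
        (use uv ab bump_support in \<open>auto simp: f_def\<close>)
    then have Z: "form_class M ?\<omega> \<in> hcar L2" "hinner L2 (form_class M ?\<omega>) (form_class M \<eta>) = 0" using Ccc by auto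
    \<comment> \<open>Membership of the class in the carrier supplies a measurable representative
      that agrees with the test form almost everywhere; measurability of the integrand with the test
      form itself then follows by completeness.\<close>
    obtain \<omega>' where w': "form_class M ?\<omega> = form_class M \<omega>'" "finite_energy \<omega>'" using Z(1) car_iff by blast
    have "\<omega>' \<in> form_class M ?\<omega>" using w' mem_form_class by (simp add: finite_energy_def)
    then have AEw: "AE x in vol. \<omega>' x = ?\<omega> x" by (simp add: form_class_def ae_iff_AE)
    have e0: "energy \<omega>' \<eta> = 0" using Z(2) inner_class[OF w'(2) \<eta>] w'(1) by simp
    let ?\<phi> = "\<lambda>x. form_inner (g x) (?\<omega> x) (\<eta> x)"
    have \<omega>'m: "(\<lambda>x. form_inner (g x) (\<omega>' x) (\<eta> x)) \<in> borel_measurable vol"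
      using w'(2) \<eta>m by (intro form_inner_measurable) (auto simp: finite_energy_def)
    have AE\<phi>: "AE x in vol. form_inner (g x) (\<omega>' x) (\<eta> x) = ?\<phi> x" using AEw by eventually_elim simp
    have \<phi>m: "?\<phi> \<in> borel_measurable vol" by (rule measurable_vol_AE[OF \<omega>'m AE\<phi>])
    have "(\<integral>x. ?\<phi> x \<partial>vol) = energy \<omega>' \<eta>"
      unfolding energy_def by (rule integral_cong_AE[symmetric, OF \<omega>'m \<phi>m AE\<phi>])
    then have "0 = (\<integral>y. dens c y *\<^sub>R ?\<phi> (chart_inv c y) \<partial>?L)"
      using e0 integral_chart[OF c \<phi>m] by (simp add: chart_form_def)
    also have "\<dots> = (\<integral>y. indicator ?\<Omega> y *\<^sub>R (dens c y *\<^sub>R ?\<phi> (chart_inv c y)) \<partial>lebesgue)"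
      using \<Omega> by (intro integral_restrict_space) auto
    also have "\<dots> = (\<integral>y. bump m u v y *\<^sub>R F y \<partial>lebesgue)"
    proof (rule integral_cong_AE)
      have "(\<lambda>y. dens c y *\<^sub>R ?\<phi> (chart_inv c y)) \<in> borel_measurable ?L"
        by (intro borel_measurable_scaleR dens_measurable measurable_vol_chart \<phi>m cM)
      then show "(\<lambda>y. indicator ?\<Omega> y *\<^sub>R (dens c y *\<^sub>R ?\<phi> (chart_inv c y))) \<in> borel_measurable lebesgue"
        using \<Omega> by (subst borel_measurable_restrict_space_iff[symmetric]) auto
      have "continuous_on UNIV (bump m u v)" using C_k_on_bump[of 0] by simp
      then have "bump m u v \<in> borel_measurable lebesgue"
        by (intro measurable_completion) (simp add: borel_measurable_continuous_onI)
      then show "(\<lambda>y. bump m u v y *\<^sub>R F y) \<in> borel_measurable lebesgue" by (intro borel_measurable_scaleR Fm)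
      have "manifold_null M {p. \<not> posdef (g p)}" using ae_posdef by (simp add: ae_def)
      then have "snd c ` ({p. \<not> posdef (g p)} \<inter> fst c) \<in> null_sets lebesgue" using cM by (simp add: manifold_null_def)
      then have N: "AE y in lebesgue. y \<notin> snd c ` ({p. \<not> posdef (g p)} \<inter> fst c)" by (rule AE_not_in)
      then show "AE y in lebesgue. indicator ?\<Omega> y *\<^sub>R (dens c y *\<^sub>R ?\<phi> (chart_inv c y)) = bump m u v y *\<^sub>R F y"
      proof eventually_elim
        fix y assume n: "y \<notin> snd c ` ({p. \<not> posdef (g p)} \<inter> fst c)"
        show "indicator ?\<Omega> y *\<^sub>R (dens c y *\<^sub>R ?\<phi> (chart_inv c y)) = bump m u v y *\<^sub>R F y"
        proof (cases "y \<in> ?\<Omega>")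
          case True
          then obtain p where p: "p \<in> fst c" "y = snd c p" by blast
          have gp: "posdef (g p)" using n p by blast
          have "?\<phi> (chart_inv c y) = form_inner (metric_in_chart M c g y) (f y) (form_in_chart M c \<eta> y)"
            using form_inner_in_chart[of c p g ?\<omega> \<eta>, OF cM p(1) gp] chart_form_self[OF cM True, of f] p cM by simp
          also have "\<dots> = of_real (bump m u v y) * form_inner (metric_in_chart M c g y) (axis I 1) (form_in_chart M c \<eta> y)"
            by (simp add: f_def form_inner_scale_left)
          finally have e: "dens c y *\<^sub>R ?\<phi> (chart_inv c y) = bump m u v y *\<^sub>R h y"
            by (simp add: h_def scaleR_conv_of_real)
          show ?thesis
            using True e bump_support[of y u v m] uv by (cases "y \<in> cbox a b") (auto simp: F_def subset_iff)
        next
          case False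
          then show ?thesis using abO by (auto simp: F_def)
        qed
      qed
    qed
    finally show ?thesis ..
  qed
  have "integral (cbox u v) F = 0" if uv: "cbox u v \<subseteq> cbox a b" for u v
  proof -
    \<comment> \<open>Since the bumps take values in the unit interval and tend to the indicator of
      the open box, \<open>norm (F y)\<close> is an integrable majorant.\<close>
    have "(\<lambda>m. \<integral>y. bump m u v y *\<^sub>R F y \<partial>lebesgue) \<longlonglongrightarrow> (\<integral>y. indicator (box u v) y *\<^sub>R F y \<partial>lebesgue)"
    proof (rule integral_dominated_convergence[where w = "\<lambda>y. norm (F y)"])
      show "(\<lambda>y. indicator (box u v) y *\<^sub>R F y) \<in> borel_measurable lebesgue"
        by (intro borel_measurable_scaleR Fm borel_measurable_indicator) auto
      show "(\<lambda>y. bump m u v y *\<^sub>R F y) \<in> borel_measurable lebesgue" for m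
      proof -
        have "continuous_on UNIV (bump m u v)" using C_k_on_bump[of 0] by simp
        then have "bump m u v \<in> borel_measurable lebesgue"
          by (intro measurable_completion) (simp add: borel_measurable_continuous_onI)
        then show ?thesis by (intro borel_measurable_scaleR Fm)
      qed
      show "integrable lebesgue (\<lambda>y. norm (F y))" using Fint by (rule integrable_norm)
      show "AE y in lebesgue. (\<lambda>m. bump m u v y *\<^sub>R F y) \<longlonglongrightarrow> indicator (box u v) y *\<^sub>R F y"
        by (intro AE_I2 tendsto_scaleR bump_tendsto tendsto_const)
      show "AE y in lebesgue. norm (bump m u v y *\<^sub>R F y) \<le> norm (F y)" for m
      proof (rule AE_I2)
        fix y
        have "norm (bump m u v y *\<^sub>R F y) = bump m u v y * norm (F y)" using bump_bounds(1)[of m u v y] by simp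
        also have "\<dots> \<le> norm (F y)" using bump_bounds[of m u v y] by (intro mult_left_le_one_le) auto
        finally show "norm (bump m u v y *\<^sub>R F y) \<le> norm (F y)" .
      qed
    qed
    then have "(\<integral>y. indicator (box u v) y *\<^sub>R F y \<partial>lebesgue) = 0"
      using bump0[OF uv] by (simp add: LIMSEQ_const_iff)
    moreover have "set_integrable lebesgue (box u v) F"
      unfolding set_integrable_def using Fint by (intro integrable_mult_indicator) auto
    ultimately have "integral (box u v) F = 0"
      using set_lebesgue_integral_eq_integral(2)[of "box u v" F] by (simp add: set_lebesgue_integral_def)
    then show ?thesis by (simp add: integral_open_interval)
  qed
  then have "negligible {y \<in> box a b. F y \<noteq> 0}" by (rule AE_zero_of_box_integrals[OF Fint])
  moreover have "{y \<in> box a b. F y \<noteq> 0} = {y \<in> box a b. h y \<noteq> 0}" using box_subset_cbox[of a b] by (auto simp: F_def)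
  ultimately show ?thesis by (simp add: h_def)
qed

text \<open>Countably many boxes exhaust the interior of a chart image, and what is left of the
  image is null. Off a null set the representative is thus orthogonal to every basis form, hence to
  itself, and positive definiteness makes it zero; a countable atlas finishes.\<close>

lemma orthogonal_Ccc_imp_zero:
  assumes u: "u \<in> hcar L2"
    and Ccc: "\<And>\<omega>. \<omega> \<in> Ccc_forms M \<Longrightarrow> form_class M \<omega> \<in> hcar L2 \<and> hinner L2 (form_class M \<omega>) u = 0"
  shows "u = hzero L2"
proof -
  note e = rep_car[OF u]
  obtain cs :: "nat \<Rightarrow> ('a, 'n) chart" where cs: "\<And>i. comparability_chart M g (cs i)" "(\<Union>i. fst (cs i)) = UNIV"
    using comparability_atlas by auto
  have csM: "cs i \<in> M" for i using cs(1) comparability_chart_mem by blast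
  have null: "snd (cs i) ` ({p. rep u p \<noteq> 0} \<inter> fst (cs i)) \<in> null_sets lebesgue" for i
  proof -
    let ?c = "cs i"
    let ?\<Omega> = "chart_image ?c"
    define h where "h I y = dens ?c y *\<^sub>R form_inner (metric_in_chart M ?c g y) (axis I 1) (form_in_chart M ?c (rep u) y)" for I y
    obtain D where D: "countable D" "D \<subseteq> Pow (interior ?\<Omega>)" "\<And>X. X \<in> D \<Longrightarrow> \<exists>a b. X = cbox a b" "\<Union>D = interior ?\<Omega>"
      using open_countable_Union_open_cbox[of "interior ?\<Omega>"] by auto
    have hX: "negligible {y \<in> X. h I y \<noteq> 0}" if X: "X \<in> D" for X I
    proof -
      obtain a b where ab: "X = cbox a b" using D(3)[OF X] by blast
      have "negligible {y \<in> box a b. h I y \<noteq> 0}"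
        unfolding h_def using D(2) X ab e Ccc by (intro orthogonal_imp_zero_in_chart[OF cs(1)]) auto
      moreover have "negligible (cbox a b - box a b)" using negligible_frontier_interval .
      ultimately have "negligible ({y \<in> box a b. h I y \<noteq> 0} \<union> (cbox a b - box a b))" by (rule negligible_Un)
      then show ?thesis by (rule negligible_subset) (auto simp: ab)
    qed
    have "negligible (\<Union>X\<in>D. {y \<in> X. h I y \<noteq> 0})" for I
      using D(1) hX by (intro negligible_countable_Union) auto
    then have hI: "negligible {y \<in> interior ?\<Omega>. h I y \<noteq> 0}" for I
      by (rule negligible_subset) (use D(4) in blast)
    have Nh: "negligible (\<Union>I\<in>UNIV. {y \<in> interior ?\<Omega>. h I y \<noteq> 0})" by (intro negligible_Union) (use hI in auto)
    have Ni: "negligible (?\<Omega> - interior ?\<Omega>)" by (rule relatively_open_interior[OF image_relatively_open[OF csM]])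
    have "AE y in lebesgue. y \<notin> snd ?c ` ({p. rep u p \<noteq> 0} \<inter> fst ?c)"
      using AE_not_in[OF Nh[unfolded negligible_iff_null_sets]] AE_not_in[OF Ni[unfolded negligible_iff_null_sets]]
        ae_dens_pos[OF csM[of i]]
    proof eventually_elim
      fix y assume a: "y \<notin> (\<Union>I\<in>UNIV. {y \<in> interior ?\<Omega>. h I y \<noteq> 0})" "y \<notin> ?\<Omega> - interior ?\<Omega>"
        and p: "y \<in> ?\<Omega> \<longrightarrow> posdef (metric_in_chart M ?c g y) \<and> 0 < dens ?c y"
      show "y \<notin> snd ?c ` ({p. rep u p \<noteq> 0} \<inter> fst ?c)"
      proof
        assume "y \<in> snd ?c ` ({p. rep u p \<noteq> 0} \<inter> fst ?c)"
        then obtain q where q: "q \<in> fst ?c" "rep u q \<noteq> 0" "y = snd ?c q" by blast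
        have yO: "y \<in> ?\<Omega>" using q by blast
        have G: "posdef (metric_in_chart M ?c g y)" and d: "0 < dens ?c y" using p yO by auto
        let ?w = "form_in_chart M ?c (rep u) y"
        have z: "form_inner (metric_in_chart M ?c g y) (axis I 1) ?w = 0" for I
          using a yO d unfolding h_def by auto
        have "form_inner (metric_in_chart M ?c g y) ?w ?w = (\<Sum>I\<in>UNIV. ?w $ I * form_inner (metric_in_chart M ?c g y) (axis I 1) ?w)"
        proof -
          have s: "form_inner G (\<Sum>I\<in>S. \<omega> $ I *s axis I 1) \<eta> = (\<Sum>I\<in>S. \<omega> $ I * form_inner G (axis I 1) \<eta>)"
            if "finite S" for G :: "'n rmat" and S and \<omega> \<eta> :: "'n form"
            using that by induction (simp_all add: form_inner_add_left form_inner_scale_left)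
          have "(\<Sum>I\<in>UNIV. ?w $ I *s axis I 1) = ?w"
            by (rule basis_expansion)
          then show ?thesis using s[of UNIV "metric_in_chart M ?c g y" ?w ?w] by simp
        qed
        then have "form_inner (metric_in_chart M ?c g y) ?w ?w = 0" by (simp add: z)
        then have "?w = 0" using form_inner_self[OF G, of ?w] form_norm_eq_0[OF G, of ?w] by simp
        then show False using form_in_chart_eq_0_iff[OF csM q(1), of "rep u"] q by simp
      qed
    qed
    then obtain Z where "Z \<in> null_sets lebesgue" "snd ?c ` ({p. rep u p \<noteq> 0} \<inter> fst ?c) \<subseteq> Z"
      by (auto simp: eventually_ae_filter)
    then show ?thesis using null_sets_completion_subset by blast
  qed
  then have "manifold_null M {p. rep u p \<noteq> 0}" using null_iff_subatlas[of cs, OF csM cs(2)] by blast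
  then have "ae M (\<lambda>p. rep u p = 0)" by (simp add: ae_def)
  then have "form_class M (rep u) = form_class M (\<lambda>p. 0)" by (rule form_class_eqI)
  then show ?thesis using e zero_L2 by simp
qed

end

subsection \<open>The Hodge-Dirac operators of two metrics\<close>

text \<open>That a test form is square integrable is read off from its class lying in the domain of
  \<open>d\<close>, which is contained in the carrier.\<close>

lemma (in rough_mfd) densely_defined_extension:
  assumes lin: "linear_operator L2 d" and ext: "d_cc M \<subseteq> d"
  shows "densely_defined L2 d"
proof -
  interpret hilbert_space L2 by (rule hilbert_L2)
  have "perp (Domain d) \<subseteq> {hzero L2}"
  proof
    fix u assume u: "u \<in> perp (Domain d)"
    have "form_class M \<omega> \<in> hcar L2 \<and> hinner L2 (form_class M \<omega>) u = 0" if "\<omega> \<in> Ccc_forms M" for \<omega>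
    proof -
      have "(form_class M \<omega>, form_class M (exterior_d M \<omega>)) \<in> d" using ext that by (auto simp: d_cc_def)
      then show ?thesis using linear_operator_carrier[OF lin] u by (auto simp: perp_def)
    qed
    then show "u \<in> {hzero L2}" using orthogonal_Ccc_imp_zero u perp_carrier by blast
  qed
  then show ?thesis unfolding densely_defined_def using dense_iff[OF subspace_Domain[OF lin]] by blast
qed

context two_rough
begin

lemma two_hodge_dirac_extension:
  assumes "closed_operator R1.L2 d" "nilpotent_operator R1.L2 d" "d_cc M \<subseteq> d"
  shows "two_hodge_dirac R1.L2 R2.L2 (K\<^sup>2) d"
proof -
  interpret equivalent_hilbert_spaces R1.L2 R2.L2 "K\<^sup>2" by (rule equivalent_L2)
  show ?thesis
    by unfold_locales (use assms R1.densely_defined_extension in \<open>auto simp: closed_operator_def\<close>)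
qed

text \<open>\<open>degree_part\<close> is one map for both metrics and symmetric for both inner
  products; degree raising gives the invariance of \<open>ker d\<close> and of
  \<open>Range d\<close>. Its fixed vectors in the carrier are exactly the
  \<open>k\<close>-forms.\<close>

lemma k_forms_bij:
  assumes d: "closed_operator R1.L2 d" "nilpotent_operator R1.L2 d" "d_cc M \<subseteq> d"
    and r: "raises_degree M d"
  defines "D1 \<equiv> hodge_dirac R1.L2 d" and "D2 \<equiv> hodge_dirac R2.L2 d"
  shows "bij_betw (proj_along R1.L2 (hker R1.L2 D1) (hclosure R1.L2 (Range D1)))
    (hker R2.L2 D2 \<inter> k_forms M k) (hker R1.L2 D1 \<inter> k_forms M k)"
proof -
  interpret T: two_hodge_dirac R1.L2 R2.L2 "K\<^sup>2" d by (rule two_hodge_dirac_extension[OF d])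
  have deg: "R2.degree_proj {k} u = degree_part M k u" "R1.degree_proj {k} u = degree_part M k u" for u
    by (simp_all add: R2.degree_part_eq R1.degree_part_eq)
  have "bij_betw T.\<Phi> {v \<in> hker R2.L2 T.D2. degree_part M k v = v} {u \<in> hker R1.L2 T.D1. degree_part M k u = u}"
  proof (rule T.commuting_projection)
    show "degree_part M k u \<in> hcar R1.L2" if "u \<in> hcar R1.L2" for u
      using R1.degree_proj_car[OF that, of "{k}"] by (simp add: deg)
    show "hinner R1.L2 (degree_part M k u) v = hinner R1.L2 u (degree_part M k v)"
      if "u \<in> hcar R1.L2" "v \<in> hcar R1.L2" for u v
      using R1.degree_proj_inner[OF that, of "{k}"] by (simp add: deg)
    show "hinner R2.L2 (degree_part M k u) v = hinner R2.L2 u (degree_part M k v)"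
      if "u \<in> hcar R1.L2" "v \<in> hcar R1.L2" for u v
      using R2.degree_proj_inner[OF that[folded T.car_eq], of "{k}"] by (simp add: deg)
    show "degree_part M k u \<in> hker R1.L2 d" if "u \<in> hker R1.L2 d" for u
      using R1.raises_degree_ker[OF r that, of k] by (simp add: deg)
    show "degree_part M k y \<in> Range d" if "y \<in> Range d" for y
      using R1.raises_degree_range[OF T.d_linear r that, of k] by (simp add: deg)
  qed
  moreover have "{v \<in> hker R2.L2 T.D2. degree_part M k v = v} = hker R2.L2 T.D2 \<inter> k_forms M k"
    using R1.k_forms_iff[of _ k] T.ker2_carrier by (auto simp: deg)
  moreover have "{v \<in> hker R1.L2 T.D1. degree_part M k v = v} = hker R1.L2 T.D1 \<inter> k_forms M k"
    using R1.k_forms_iff[of _ k] T.ker1_carrier by (auto simp: deg)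
  ultimately show ?thesis unfolding D1_def D2_def by simp
qed

end

theorem theorem5p6:
  fixes M :: "('a::{t2_space,second_countable_topology}, 'n::{finite,linorder}) chart set"
    and g1 g2 :: "'a \<Rightarrow> 'n rmat"
  assumes "smooth_manifold M"
    and "rough_metric M g1" and "rough_metric M g2"
    and "mutually_bounded_metrics M g1 g2"
  shows "mutually_bounded_pairs M (volume_measure M g1, g1) (volume_measure M g2, g2) \<and>
    hcar (L2_forms M g1) = hcar (L2_forms M g2) \<and>
    equivalent_norms (L2_forms M g1) (L2_forms M g2) \<and>
    (\<forall>d. closed_operator (L2_forms M g1) d \<and> nilpotent_operator (L2_forms M g1) d \<and> d_cc M \<subseteq> d \<longrightarrow>
      (let H1 = L2_forms M g1; H2 = L2_forms M g2;
           D1 = hodge_dirac H1 d; D2 = hodge_dirac H2 d;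
           R1 = hclosure H1 (Range D1);
           \<Phi> = proj_along H1 (hker H1 D1) R1
       in
        \<comment> \<open>(i)\<close>
        (\<forall>(H, D) \<in> {(H1, D1), (H2, D2)}.
           self_adjoint H D \<and> densely_defined H D \<and> closed_operator H D \<and>
           bisectorial H1 D \<and> bisectorial H2 D) \<and>
        \<comment> \<open>(ii)\<close>
        (\<forall>k\<ge>1. \<forall>l\<ge>1. \<forall>k'\<ge>1. \<forall>l'\<ge>1.
           (\<forall>(H, D) \<in> {(H1, D1), (H2, D2)}.
              hker H (D ^^ k) = hker H D \<and>
              hclosure H (Range (D ^^ l)) = hclosure H (Range D)) \<and>
           direct_sum H1 (hker H1 (D1 ^^ k)) (hclosure H1 (Range (D1 ^^ l))) \<and>
           direct_sum H1 (hker H2 (D2 ^^ k')) (hclosure H1 (Range (D1 ^^ l')))) \<and>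
        \<comment> \<open>(iii)\<close>
        hilb_iso H2 (hker H2 D2) H1 (hker H1 D1) \<Phi> \<and>
        (\<forall>u \<in> hker H1 D1.
           inv_into (hker H2 D2) \<Phi> u = proj_along H1 (hker H2 D2) R1 u) \<and>
        \<comment> \<open>(iv)\<close>
        (raises_degree M d \<longrightarrow>
          (\<forall>k \<le> CARD('n).
            hilb_iso H2 (hker H2 D2 \<inter> k_forms M k) H1 (hker H1 D1 \<inter> k_forms M k) \<Phi>))))"
proof -
  interpret smooth_mfd M by unfold_locales fact
  from assms(4) obtain C where C: "1 \<le> C" "ae M (\<lambda>x. \<forall>u. metric_norm (g1 x) u / C \<le> metric_norm (g2 x) u \<and>
      metric_norm (g2 x) u \<le> C * metric_norm (g1 x) u)"
    unfolding mutually_bounded_metrics_def by blast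
  have bounded: "ae M (\<lambda>x. \<forall>u. metric_norm (g1 x) u \<le> C * metric_norm (g2 x) u \<and>
      metric_norm (g2 x) u \<le> C * metric_norm (g1 x) u)"
    by (rule ae_mono[OF C(2)]) (use C(1) in \<open>simp add: pos_divide_le_eq mult.commute\<close>)
  interpret G: two_rough M g1 g2 C "comparison_const TYPE('n) C"
    by unfold_locales (use assms C(1) bounded in auto)
  show ?thesis
    unfolding Let_def
  proof (intro conjI allI impI)
    show "mutually_bounded_pairs M (volume_measure M g1, g1) (volume_measure M g2, g2)" by (rule G.pairs_bounded)
    show "hcar (L2_forms M g1) = hcar (L2_forms M g2)" using G.car_eq by simp
    show "equivalent_norms (L2_forms M g1) (L2_forms M g2)" by (rule G.equivalent_norms_L2)
  next
    fix d
    assume d: "closed_operator (L2_forms M g1) d \<and> nilpotent_operator (L2_forms M g1) d \<and> d_cc M \<subseteq> d"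
    interpret T: two_hodge_dirac "L2_forms M g1" "L2_forms M g2" "(comparison_const TYPE('n) C)\<^sup>2" d
      using G.two_hodge_dirac_extension d by blast
    note sa = T.dirac_self_adjoint T.snd.dirac_self_adjoint
    note pow = T.H1.self_adjoint_ker_pow[OF sa(1)] T.H2.self_adjoint_ker_pow[OF sa(2)]
      T.H1.self_adjoint_closure_range_pow[OF sa(1)] T.H2.self_adjoint_closure_range_pow[OF sa(2)]
    show "\<forall>(H, D) \<in> {(L2_forms M g1, T.D1), (L2_forms M g2, T.D2)}.
        self_adjoint H D \<and> densely_defined H D \<and> closed_operator H D \<and>
        bisectorial (L2_forms M g1) D \<and> bisectorial (L2_forms M g2) D"
      using sa T.dirac_dense T.snd.dirac_dense T.H1.self_adjoint_closed T.H2.self_adjoint_closed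
        T.bisectorial_11 T.bisectorial_12 T.bisectorial_21 T.bisectorial_22 by simp
    show "hilb_iso (L2_forms M g2) (hker (L2_forms M g2) T.D2) (L2_forms M g1) (hker (L2_forms M g1) T.D1) T.\<Phi>"
      by (rule T.\<Phi>_iso_on[OF order_refl T.\<Phi>_bij])
    show "\<forall>u \<in> hker (L2_forms M g1) T.D1. inv_into (hker (L2_forms M g2) T.D2) T.\<Phi> u = T.\<Psi> u"
      using T.\<Phi>_inv_into by blast
    { fix k assume "raises_degree M d"
      then show "hilb_iso (L2_forms M g2) (hker (L2_forms M g2) T.D2 \<inter> k_forms M k)
          (L2_forms M g1) (hker (L2_forms M g1) T.D1 \<inter> k_forms M k) T.\<Phi>"
        using d by (intro T.\<Phi>_iso_on G.k_forms_bij) auto }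
    { fix k l k' l' :: nat
      assume n: "1 \<le> k" "1 \<le> l" "1 \<le> k'" "1 \<le> l'"
      show "\<forall>(H, D) \<in> {(L2_forms M g1, T.D1), (L2_forms M g2, T.D2)}.
          hker H (D ^^ k) = hker H D \<and> hclosure H (Range (D ^^ l)) = hclosure H (Range D)"
        using n pow by simp
      show "direct_sum (L2_forms M g1) (hker (L2_forms M g1) (T.D1 ^^ k)) (hclosure (L2_forms M g1) (Range (T.D1 ^^ l)))"
        using n T.direct_sum_ker1 by (simp add: pow)
      show "direct_sum (L2_forms M g1) (hker (L2_forms M g2) (T.D2 ^^ k')) (hclosure (L2_forms M g1) (Range (T.D1 ^^ l')))"
        using n T.direct_sum_ker2 by (simp add: pow) }
  qed
qed

end
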